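(* Let $d\in\{2,3\}$, let $\Omega\subset\mathbb{R}^d$ be a bounded Lipschitz polyhedral domain, and let $\gamma_0>0$. Let $p\in(1,\infty)$ and $q\in(1,\infty)$ satisfy $1-\frac{d}{p}\ge-\frac{d}{q}$ and $q\le p$. Then there exists a constant $C=C(d,\Omega,p,q,\gamma_0)>0$, depending only on $d$, $\Omega$, $p$, $q$ and $\gamma_0$ (in particular independent of $h$ and of the aspect ratios and angles of the simplices), such that for every conforming simplicial mesh $\mathbb{T}_h$ of $\overline{\Omega}$ with $0<h\le 1$ satisfying the semi-regularity condition $$\frac{H_T}{h_T}\le\gamma_0\qquad\forall\, T\in\mathbb{T}_h,$$ and for each choice $V_h\in\{V_h^{DCCR},V_h^{CR},V_{h0}^{CR}\}$, $$\|\varphi_h\|_{L^q(\Omega)}\le C\,|\varphi_h|_{p,V_h}\qquad\forall\,\varphi_h\in V_h .$$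
   Context: **Mesh.** $\mathbb{T}_h$ is a finite set of closed nondegenerate $d$-simplices forming a conforming simplicial mesh (no hanging nodes) of $\overline\Omega$; $h_T:=\operatorname{diam}(T)$ and $h:=\max_{T\in\mathbb{T}_h}h_T$. $|\cdot|_k$ denotes $k$-dimensional Hausdorff measure. $\mathcal{F}_h^i$ is the set of interior faces ($(d-1)$-dimensional faces shared by two elements), $\mathcal{F}_h^\partial$ the set of faces contained in $\partial\Omega$, and $\mathcal{F}_h:=\mathcal{F}_h^i\cup\mathcal{F}_h^\partial$. For a face $F$ of a simplex $T$, $\ell_{T,F}:=\frac{d\,|T|_d}{|F|_{d-1}}$ (the distance from the vertex of $T$ opposite to $F$ to the hyperplane of $F$). **Parameters $h_1,\dots,h_d$ and $H_T$.** For each simplex $T$ label its vertices as follows (ties are broken by any fixed choice). - $d=2$: vertices $\boldsymbol p_1,\boldsymbol p_2,\boldsymbol p_3$ are labelled so that the edge $\boldsymbol p_2\boldsymbol p_3$ is the longest edge and, with $h_1:=|\boldsymbol p_1-\boldsymbol p_2|$ and $h_2:=|\boldsymbol p_1-\boldsymbol p_3|$, one has $h_2\le h_1$. - $d=3$: let $L_{\min}$ be a shortest edge of $T$ and $h_2:=|L_{\min}|$. Among the four edges sharing an endpoint with $L_{\min}$ let $L_{\max}^{(\min)}$ be a longest one; $\boldsymbol p_1,\boldsymbol p_2$ are its endpoints, and $h_1:=|\boldsymbol p_1-\boldsymbol p_2|$. The vertex $\boldsymbol p_3$ is the endpoint of $L_{\min}$ that is not on $L_{\max}^{(\min)}$,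 and $\boldsymbol p_4$ is the remaining vertex. Consider the plane through the midpoint of $L_{\max}^{(\min)}$ perpendicular to $\boldsymbol p_1-\boldsymbol p_2$. If $\boldsymbol p_3,\boldsymbol p_4$ lie in the same half-space (Type i), the names $\boldsymbol p_1,\boldsymbol p_2$ are assigned so that $L_{\min}$ has endpoints $\boldsymbol p_1,\boldsymbol p_3$; if they lie in different half-spaces (Type ii), so that $L_{\min}$ has endpoints $\boldsymbol p_2,\boldsymbol p_3$. (In both cases $\boldsymbol p_1$ and $\boldsymbol p_4$ are in the same half-space.) Finally $h_3:=|\boldsymbol p_1-\boldsymbol p_4|$. Then $H_T:=\frac{\prod_{i=1}^d h_i}{|T|_d}\,h_T$. **Jumps and projections.** For a function $\varphi$ that is piecewise $W^{1,p}$ on $\mathbb{T}_h$ and an interior face $F=\partial T_+\cap\partial T_-$ (with a fixed ordering of the two elements), $[\![\varphi]\!]_F:=\varphi|_{T_+}-\varphi|_{T_-}$ on $F$; for a boundary face $F=\partial T\cap\partial\Omega$, $[\![\varphi]\!]_F:=\varphi|_T$ on $F$. $\Pi_F^0$ is the $L^2(F)$-projection onto constants, i.e. $\Pi_F^0\varphi=\frac{1}{|F|_{d-1}}\int_F\varphi\,ds$. **Spaces.** $V_h^{DCCR}$ is the space of all functions on $\Omega$ whose restriction to each $T\in\mathbb{T}_h$ is a polynomial of degree at most $1$ (no interelement continuity). Further $$V_h^{CR}:=\Big\{\varphi_h\in V_h^{DCCR}:\ \int_F[\![\varphi_h]\!]\,ds=0\ \ \forall F\in\mathcal{F}_h^i\Big\},\qquad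 V_{h0}^{CR}:=\Big\{\varphi_h\in V_h^{CR}:\ \int_F\varphi_h\,ds=0\ \ \forall F\in\mathcal{F}_h^\partial\Big\}.$$ **Norm.** With $$\kappa_{p,F*}:=\begin{cases}\Big(\ell_{T_+,F}^{\frac{p-1}{p}}+\ell_{T_-,F}^{\frac{p-1}{p}}\Big)^{-p} & \text{if }F=\partial T_+\cap\partial T_-\in\mathcal{F}_h^i,\\[1mm] \ell_{T_\partial,F}^{\,1-p} & \text{if }F=\partial T_\partial\cap\partial\Omega\in\mathcal{F}_h^\partial,\end{cases}$$ define $$|\varphi_h|_{p,V_h}:=\Big(|\varphi_h|_{W^{1,p}(\mathbb{T}_h)}^p+|\varphi_h|_{p,J}^p\Big)^{1/p},\qquad |\varphi_h|_{W^{1,p}(\mathbb{T}_h)}:=\Big(\sum_{T\in\mathbb{T}_h}|\varphi_h|_{W^{1,p}(T)}^p\Big)^{1/p},$$ $$|\varphi_h|_{p,J}:=\Big(\sum_{F\in\mathcal{F}_h}\kappa_{p,F*}\,\|\Pi_F^0[\![\varphi_h]\!]\|_{L^p(F)}^p\Big)^{1/p}.$$ *)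

theory Defs
  imports "HOL-Analysis.Analysis"
begin

section \<open>Hausdorff measure and Lebesgue norms\<close>

text \<open>The normalisation is the one for which the \<open>d\<close>-dimensional Hausdorff measure
  on \<open>d\<close>-dimensional Euclidean space is Lebesgue measure. The empty set is singled out
  because \<open>diameter {} = 0\<close> and \<open>0 ^ 0 = 1\<close>; boundedness is required because
  \<open>diameter\<close> is real-valued and meaningless on unbounded sets.\<close>

definition hausdorff_gauge :: "nat \<Rightarrow> 'a::metric_space set \<Rightarrow> ennreal" where
  "hausdorff_gauge k U =
     (if U = {} then 0 else ennreal (unit_ball_vol (real k) * (diameter U / 2) ^ k))"

definition hausdorff_outer :: "nat \<Rightarrow> 'a::metric_space set \<Rightarrow> ennreal" where
  "hausdorff_outer k A =
     (SUP \<delta>\<in>{0<..}. INF U\<in>{U :: nat \<Rightarrow> 'a set.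
        A \<subseteq> (\<Union>i. U i) \<and> (\<forall>i. bounded (U i) \<and> diameter (U i) \<le> \<delta>)}.
        (\<Sum>i. hausdorff_gauge k (U i)))"

definition hausdorff_measure :: "nat \<Rightarrow> 'a::metric_space measure" where
  "hausdorff_measure k = measure_of UNIV (sets borel) (hausdorff_outer k)"

definition vol :: "nat \<Rightarrow> 'a::metric_space set \<Rightarrow> real" where
  "vol k A = measure (hausdorff_measure k) A"

definition Lp_norm :: "'a measure \<Rightarrow> 'a set \<Rightarrow> real \<Rightarrow> ('a \<Rightarrow> real) \<Rightarrow> real" where
  "Lp_norm M A p f = (LINT x:A|M. \<bar>f x\<bar> powr p) powr (1 / p)"

section \<open>Domains\<close>

text \<open>Near each boundary point the domain is the strict epigraph of a Lipschitz function,
  the vertical direction being the unit vector \<open>e\<close>; the function depends only on the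
  component orthogonal to \<open>e\<close>.\<close>

definition lipschitz_boundary :: "'a::euclidean_space set \<Rightarrow> bool" where
  "lipschitz_boundary \<Omega> \<longleftrightarrow>
     (\<forall>x\<in>frontier \<Omega>. \<exists>e U L. \<exists>g :: 'a \<Rightarrow> real.
        norm e = 1 \<and> open U \<and> x \<in> U \<and> L-lipschitz_on UNIV g \<and>
        \<Omega> \<inter> U = {y \<in> U. g (y - (y \<bullet> e) *\<^sub>R e) < y \<bullet> e})"

definition lipschitz_polyhedral_domain :: "'a::euclidean_space set \<Rightarrow> bool" where
  "lipschitz_polyhedral_domain \<Omega> \<longleftrightarrow>
     open \<Omega> \<and> connected \<Omega> \<and> \<Omega> \<noteq> {} \<and> bounded \<Omega> \<and> lipschitz_boundary \<Omega> \<and>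
     (\<exists>\<P>. finite \<P> \<and> (\<forall>P\<in>\<P>. polytope P) \<and> closure \<Omega> = \<Union>\<P>)"

section \<open>Meshes\<close>

text \<open>Conformity is the condition in \<^const>\<open>triangulation\<close> that any two elements
  intersect in a common (possibly empty) face.\<close>

definition conforming_mesh :: "'a::euclidean_space set \<Rightarrow> 'a set set \<Rightarrow> bool" where
  "conforming_mesh \<Omega> \<T> \<longleftrightarrow>
     triangulation \<T> \<and> (\<forall>T\<in>\<T>. int DIM('a) simplex T) \<and> \<Union>\<T> = closure \<Omega>"

definition mesh_size :: "'a::euclidean_space set set \<Rightarrow> real" where
  "mesh_size \<T> = Max (diameter ` \<T>)"

definition interior_faces :: "'a::euclidean_space set set \<Rightarrow> 'a set set" where
  "interior_faces \<T> = {F. \<exists>T\<in>\<T>. \<exists>T'\<in>\<T>. T \<noteq> T' \<and> F facet_of T \<and> F facet_of T'}"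

definition boundary_faces :: "'a::euclidean_space set \<Rightarrow> 'a set set \<Rightarrow> 'a set set" where
  "boundary_faces \<Omega> \<T> = {F. F \<subseteq> frontier \<Omega> \<and> (\<exists>T\<in>\<T>. F facet_of T)}"

definition faces :: "'a::euclidean_space set \<Rightarrow> 'a set set \<Rightarrow> 'a set set" where
  "faces \<Omega> \<T> = interior_faces \<T> \<union> boundary_faces \<Omega> \<T>"

definition face_ordering ::
    "'a::euclidean_space set set \<Rightarrow> ('a set \<Rightarrow> 'a set) \<Rightarrow> ('a set \<Rightarrow> 'a set) \<Rightarrow> bool" where
  "face_ordering \<T> Tp Tm \<longleftrightarrow>
     (\<forall>F\<in>interior_faces \<T>. Tp F \<in> \<T> \<and> Tm F \<in> \<T> \<and> Tp F \<noteq> Tm F \<and>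
        F facet_of Tp F \<and> F facet_of Tm F)"

definition boundary_element :: "'a::euclidean_space set set \<Rightarrow> 'a set \<Rightarrow> 'a set" where
  "boundary_element \<T> F = (THE T. T \<in> \<T> \<and> F facet_of T)"

definition face_height :: "'a::euclidean_space set \<Rightarrow> 'a set \<Rightarrow> real" where
  "face_height T F = real DIM('a) * vol DIM('a) T / vol (DIM('a) - 1) F"

section \<open>Vertex labellings and semi-regularity\<close>

definition vertices :: "'a::euclidean_space set \<Rightarrow> 'a set" where
  "vertices T = {v. v extreme_point_of T}"

definition shortest_edge :: "'a::euclidean_space set \<Rightarrow> 'a \<Rightarrow> 'a \<Rightarrow> bool" where
  "shortest_edge T x y \<longleftrightarrow> x \<in> vertices T \<and> y \<in> vertices T \<and> x \<noteq> y \<and>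
     (\<forall>x'\<in>vertices T. \<forall>y'\<in>vertices T. x' \<noteq> y' \<longrightarrow> dist x y \<le> dist x' y')"

text \<open>Labellings are relations, not functions: whenever several labellings satisfy the
  requirements, each of them is admitted.\<close>

definition labelling_2d :: "'a::euclidean_space set \<Rightarrow> (nat \<Rightarrow> 'a) \<Rightarrow> bool" where
  "labelling_2d T p \<longleftrightarrow>
     bij_betw p {1..3} (vertices T) \<and>
     (\<forall>x\<in>vertices T. \<forall>y\<in>vertices T. dist x y \<le> dist (p 2) (p 3)) \<and>
     dist (p 1) (p 3) \<le> dist (p 1) (p 2)"

text \<open>\<open>p 1\<close>, \<open>p 2\<close> are the endpoints of a longest edge among the four edges sharing
  exactly one endpoint with the shortest edge from \<open>p e\<close> to \<open>p 3\<close>; so \<open>e = 1\<close> in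
  Type i and \<open>e = 2\<close> in Type ii.\<close>

definition long_adjacent_edge :: "'a::euclidean_space set \<Rightarrow> (nat \<Rightarrow> 'a) \<Rightarrow> nat \<Rightarrow> bool" where
  "long_adjacent_edge T p e \<longleftrightarrow>
     (\<forall>x\<in>{p e, p 3}. \<forall>y\<in>vertices T - {p e, p 3}. dist x y \<le> dist (p 1) (p 2))"

text \<open>Signed position of \<open>x\<close> relative to the perpendicular bisector plane of the edge from
  \<open>p 1\<close> to \<open>p 2\<close>, positive on the side of \<open>p 1\<close>. The half-spaces below are closed, so that
  a vertex on that plane counts as a tie.\<close>

definition bisector_side :: "(nat \<Rightarrow> 'a::euclidean_space) \<Rightarrow> 'a \<Rightarrow> real" where
  "bisector_side p x = (x - midpoint (p 1) (p 2)) \<bullet> (p 1 - p 2)"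

definition type_i :: "'a::euclidean_space set \<Rightarrow> (nat \<Rightarrow> 'a) \<Rightarrow> bool" where
  "type_i T p \<longleftrightarrow> shortest_edge T (p 1) (p 3) \<and> long_adjacent_edge T p 1 \<and>
     0 \<le> bisector_side p (p 3) * bisector_side p (p 4)"

definition type_ii :: "'a::euclidean_space set \<Rightarrow> (nat \<Rightarrow> 'a) \<Rightarrow> bool" where
  "type_ii T p \<longleftrightarrow> shortest_edge T (p 2) (p 3) \<and> long_adjacent_edge T p 2 \<and>
     bisector_side p (p 3) * bisector_side p (p 4) \<le> 0"

definition labelling_3d :: "'a::euclidean_space set \<Rightarrow> (nat \<Rightarrow> 'a) \<Rightarrow> bool" where
  "labelling_3d T p \<longleftrightarrow>
     bij_betw p {1..4} (vertices T) \<and> (type_i T p \<or> type_ii T p) \<and>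
     0 \<le> bisector_side p (p 4)"

definition vertex_labelling :: "'a::euclidean_space set \<Rightarrow> (nat \<Rightarrow> 'a) \<Rightarrow> bool" where
  "vertex_labelling T p \<longleftrightarrow>
     (if DIM('a) = 2 then labelling_2d T p else labelling_3d T p)"

definition shortest_edge_length :: "'a::euclidean_space set \<Rightarrow> real" where
  "shortest_edge_length T =
     Min {dist x y |x y. x \<in> vertices T \<and> y \<in> vertices T \<and> x \<noteq> y}"

definition edge_parameter :: "'a::euclidean_space set \<Rightarrow> (nat \<Rightarrow> 'a) \<Rightarrow> nat \<Rightarrow> real" where
  "edge_parameter T p i =
     (if i = 1 then dist (p 1) (p 2)
      else if DIM('a) = 2 then dist (p 1) (p 3)
      else if i = 2 then shortest_edge_length T
      else dist (p 1) (p 4))"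

definition H_param :: "'a::euclidean_space set \<Rightarrow> (nat \<Rightarrow> 'a) \<Rightarrow> real" where
  "H_param T p =
     (\<Prod>i=1..DIM('a). edge_parameter T p i) / vol DIM('a) T * diameter T"

definition semi_regular ::
    "real \<Rightarrow> 'a::euclidean_space set set \<Rightarrow> ('a set \<Rightarrow> nat \<Rightarrow> 'a) \<Rightarrow> bool" where
  "semi_regular \<gamma>0 \<T> P \<longleftrightarrow> (\<forall>T\<in>\<T>. H_param T (P T) / diameter T \<le> \<gamma>0)"

section \<open>Piecewise affine functions\<close>

definition P1 :: "('a::euclidean_space \<Rightarrow> real) set" where
  "P1 = {g. \<exists>a b. g = (\<lambda>x. a \<bullet> x + b)}"

text \<open>Piecewise polynomials are single-valued functions constrained only on the open
  elements: their values on the (null) mesh skeleton are immaterial. The restriction to a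
  closed element \<open>T\<close>, including its trace on the faces of \<open>T\<close>, is given by the unique
  polynomial agreeing with the function inside \<open>T\<close>.\<close>

definition V_DCCR :: "'a::euclidean_space set set \<Rightarrow> ('a \<Rightarrow> real) set" where
  "V_DCCR \<T> = {\<phi>. \<forall>T\<in>\<T>. \<exists>g\<in>P1. \<forall>x\<in>interior T. \<phi> x = g x}"

definition elem_restrict ::
    "('a::euclidean_space \<Rightarrow> real) \<Rightarrow> 'a set \<Rightarrow> 'a \<Rightarrow> real" where
  "elem_restrict \<phi> T = (THE g. g \<in> P1 \<and> (\<forall>x\<in>interior T. \<phi> x = g x))"

definition jump ::
    "'a::euclidean_space set set \<Rightarrow> ('a set \<Rightarrow> 'a set) \<Rightarrow> ('a set \<Rightarrow> 'a set) \<Rightarrow>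
     ('a \<Rightarrow> real) \<Rightarrow> 'a set \<Rightarrow> 'a \<Rightarrow> real" where
  "jump \<T> Tp Tm \<phi> F x =
     (if F \<in> interior_faces \<T> then elem_restrict \<phi> (Tp F) x - elem_restrict \<phi> (Tm F) x
      else elem_restrict \<phi> (boundary_element \<T> F) x)"

definition face_integral :: "'a::euclidean_space set \<Rightarrow> ('a \<Rightarrow> real) \<Rightarrow> real" where
  "face_integral F f = (LINT x:F|hausdorff_measure (DIM('a) - 1). f x)"

definition face_projection :: "'a::euclidean_space set \<Rightarrow> ('a \<Rightarrow> real) \<Rightarrow> 'a \<Rightarrow> real" where
  "face_projection F f = (\<lambda>x. face_integral F f / vol (DIM('a) - 1) F)"

definition V_CR ::
    "'a::euclidean_space set set \<Rightarrow> ('a set \<Rightarrow> 'a set) \<Rightarrow> ('a set \<Rightarrow> 'a set) \<Rightarrow>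
     ('a \<Rightarrow> real) set" where
  "V_CR \<T> Tp Tm =
     {\<phi> \<in> V_DCCR \<T>. \<forall>F\<in>interior_faces \<T>. face_integral F (jump \<T> Tp Tm \<phi> F) = 0}"

definition V_CR0 ::
    "'a::euclidean_space set \<Rightarrow> 'a set set \<Rightarrow> ('a set \<Rightarrow> 'a set) \<Rightarrow>
     ('a set \<Rightarrow> 'a set) \<Rightarrow> ('a \<Rightarrow> real) set" where
  "V_CR0 \<Omega> \<T> Tp Tm =
     {\<phi> \<in> V_CR \<T> Tp Tm. \<forall>F\<in>boundary_faces \<Omega> \<T>.
        face_integral F (elem_restrict \<phi> (boundary_element \<T> F)) = 0}"

section \<open>Mesh-dependent norms\<close>

definition kappa ::
    "real \<Rightarrow> 'a::euclidean_space set set \<Rightarrow> ('a set \<Rightarrow> 'a set) \<Rightarrow>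
     ('a set \<Rightarrow> 'a set) \<Rightarrow> 'a set \<Rightarrow> real" where
  "kappa p \<T> Tp Tm F =
     (if F \<in> interior_faces \<T>
      then (face_height (Tp F) F powr ((p - 1) / p)
            + face_height (Tm F) F powr ((p - 1) / p)) powr (- p)
      else face_height (boundary_element \<T> F) F powr (1 - p))"

text \<open>The restriction to an element is a polynomial, so its weak partial derivatives are
  the classical ones.\<close>

definition W1p_seminorm ::
    "real \<Rightarrow> 'a::euclidean_space set \<Rightarrow> ('a \<Rightarrow> real) \<Rightarrow> real" where
  "W1p_seminorm p T g =
     (\<Sum>b\<in>Basis. Lp_norm lebesgue T p (\<lambda>x. frechet_derivative g (at x) b) powr p)
       powr (1 / p)"

definition broken_W1p_seminorm ::
    "real \<Rightarrow> 'a::euclidean_space set set \<Rightarrow> ('a \<Rightarrow> real) \<Rightarrow> real" where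
  "broken_W1p_seminorm p \<T> \<phi> =
     (\<Sum>T\<in>\<T>. W1p_seminorm p T (elem_restrict \<phi> T) powr p) powr (1 / p)"

definition jump_seminorm ::
    "real \<Rightarrow> 'a::euclidean_space set \<Rightarrow> 'a set set \<Rightarrow> ('a set \<Rightarrow> 'a set) \<Rightarrow>
     ('a set \<Rightarrow> 'a set) \<Rightarrow> ('a \<Rightarrow> real) \<Rightarrow> real" where
  "jump_seminorm p \<Omega> \<T> Tp Tm \<phi> =
     (\<Sum>F\<in>faces \<Omega> \<T>. kappa p \<T> Tp Tm F *
        Lp_norm (hausdorff_measure (DIM('a) - 1)) F p
          (face_projection F (jump \<T> Tp Tm \<phi> F)) powr p) powr (1 / p)"

definition Vh_norm ::
    "real \<Rightarrow> 'a::euclidean_space set \<Rightarrow> 'a set set \<Rightarrow> ('a set \<Rightarrow> 'a set) \<Rightarrow>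
     ('a set \<Rightarrow> 'a set) \<Rightarrow> ('a \<Rightarrow> real) \<Rightarrow> real" where
  "Vh_norm p \<Omega> \<T> Tp Tm \<phi> =
     (broken_W1p_seminorm p \<T> \<phi> powr p + jump_seminorm p \<Omega> \<T> Tp Tm \<phi> powr p)
       powr (1 / p)"

end

(*
By duality it suffices to bound the pairing of phi with a trigonometric polynomial f on a large cube, in
terms of the L^r norm of f, 1/p + 1/r = 1. Write f = div v, where v and Dv are bounded in L^r by f: this is
the L^r boundedness of the second-order Riesz transforms, proved with a Bellman function along the heat flow.
On each element the integral of phi div v is the sum over the faces of the face mean of phi times the flux of
v, up to an error bounded by |grad phi| times the integral of |v| + |Dv|. For this bound v is decomposed along
d edges of the element; by Cramer's rule the coefficients are controlled by the semi-regularity alone. The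
fluxes on the two sides of a face cancel, so that only the jump means remain, and each of them is matched with
the weight of the jump seminorm because the flux through F is at most C |F| / |T| times the integral
of |v| + |Dv| over the adjacent element T. No trace theorem is used: the flux through a face is defined as an
integral over the element.
*)
theory Submission
  imports Defs
begin

section \<open>Hausdorff outer measure\<close>

text \<open>Every face carries a jump penalty, boundary faces included, so the field v needs no
  boundary condition: it may be any right inverse of the divergence on a cube around the closure of
  \<open>\<Omega>\<close>, where Fourier series make it explicit. For trigonometric polynomials
  derivatives, inverse Laplacian and heat flow are operations on finite lists, so the Riesz
  transform bound rests on integrations by parts over a cube; density comes from Stone-Weierstrass.
  The obstacle is anisotropy. Expanding the element error along edges leaves, for each edge, only
  the cone integrals at its two endpoints; what remains is bounded by products of an edge length and
  the norm of its dual vector, and semi-regularity is what bounds these products. Hausdorff measure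
  is accessible only through its invariances. They fix it up to a factor, so \<open>\<kappa>\<close>
  and \<open>cF\<close> stand for normalisations whose values are never determined. The step from
  the exponent p down to q is a pointwise inequality on a bounded set.\<close>

definition hausdorff_covers :: "real \<Rightarrow> 'a::metric_space set \<Rightarrow> (nat \<Rightarrow> 'a set) set" where
  "hausdorff_covers \<delta> A = {U. A \<subseteq> (\<Union>i. U i) \<and> (\<forall>i. bounded (U i) \<and> diameter (U i) \<le> \<delta>)}"

text \<open>The premeasure at scale \<open>\<delta>\<close>. It is subadditive at each fixed scale,
  but additivity on separated sets, and hence Borel measurability, needs \<open>\<delta>\<close> to
  drop below the separation.\<close>

definition hausdorff_pre :: "nat \<Rightarrow> real \<Rightarrow> 'a::metric_space set \<Rightarrow> ennreal" where
  "hausdorff_pre k \<delta> A = (INF U\<in>hausdorff_covers \<delta> A. \<Sum>i. hausdorff_gauge k (U i))"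

lemma hausdorff_outer_eq_SUP: "hausdorff_outer k A = (SUP \<delta>\<in>{0<..}. hausdorff_pre k \<delta> A)"
  by (simp add: hausdorff_outer_def hausdorff_pre_def hausdorff_covers_def)

lemma hausdorff_pre_antimono: "\<delta> \<le> \<delta>' \<Longrightarrow> hausdorff_pre k \<delta>' A \<le> hausdorff_pre k \<delta> A"
  unfolding hausdorff_pre_def hausdorff_covers_def
  by (intro INF_superset_mono) (auto intro: order_trans)

lemma hausdorff_pre_mono: "A \<subseteq> B \<Longrightarrow> hausdorff_pre k \<delta> A \<le> hausdorff_pre k \<delta> B"
  unfolding hausdorff_pre_def hausdorff_covers_def by (intro INF_superset_mono) auto

lemma hausdorff_pre_le_outer: "\<delta> > 0 \<Longrightarrow> hausdorff_pre k \<delta> A \<le> hausdorff_outer k A"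
  unfolding hausdorff_outer_eq_SUP by (intro SUP_upper) auto

lemma hausdorff_outer_eq_SUP_nat:
  "hausdorff_outer k A = (SUP n. hausdorff_pre k (1 / real (Suc n)) A)"
proof (rule antisym)
  show "hausdorff_outer k A \<le> (SUP n. hausdorff_pre k (1 / real (Suc n)) A)"
    unfolding hausdorff_outer_eq_SUP
  proof (rule SUP_least)
    fix \<delta> :: real assume "\<delta> \<in> {0<..}"
    then obtain n where "1 / real (Suc n) < \<delta>"
      by (metis greaterThan_iff nat_approx_posE)
    then show "hausdorff_pre k \<delta> A \<le> (SUP n. hausdorff_pre k (1 / real (Suc n)) A)"
      by (intro SUP_upper2[of n] hausdorff_pre_antimono) auto
  qed
qed (auto intro!: SUP_least hausdorff_pre_le_outer)

lemma hausdorff_pre_empty: "\<delta> > 0 \<Longrightarrow> hausdorff_pre k \<delta> ({} :: 'a::metric_space set) = 0"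
proof -
  assume "\<delta> > 0"
  then have "(\<lambda>_. {}) \<in> hausdorff_covers \<delta> ({} :: 'a set)" by (auto simp: hausdorff_covers_def)
  then have "hausdorff_pre k \<delta> ({} :: 'a set) \<le> (\<Sum>i::nat. hausdorff_gauge k ({} :: 'a set))"
    unfolding hausdorff_pre_def by (rule INF_lower2) simp
  then show ?thesis by (simp add: hausdorff_gauge_def)
qed

lemma hausdorff_pre_UN_le:
  "hausdorff_pre k \<delta> (\<Union>n. A n) \<le> (\<Sum>n::nat. hausdorff_pre k \<delta> (A n))"
proof (cases "(\<Sum>n. hausdorff_pre k \<delta> (A n)) = \<infinity>")
  case False
  show ?thesis
  proof (rule ennreal_le_epsilon)
    fix e :: real assume e: "0 < e"
    have fin: "hausdorff_pre k \<delta> (A n) < \<infinity>" for n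
      using ennreal_suminf_lessD[of "\<lambda>n. hausdorff_pre k \<delta> (A n)" \<infinity> n] False
      by (simp add: less_top)
    have "\<exists>U\<in>hausdorff_covers \<delta> (A n).
        (\<Sum>i. hausdorff_gauge k (U i)) < hausdorff_pre k \<delta> (A n) + e * (1/2)^Suc n" for n
    proof -
      have "hausdorff_pre k \<delta> (A n) < hausdorff_pre k \<delta> (A n) + e * (1/2)^Suc n"
        using fin[of n] e by (auto simp flip: ennreal_power ennreal_mult simp: less_top)
      from this[unfolded hausdorff_pre_def[of k \<delta> "A n"] INF_less_iff]
      show ?thesis by (simp add: hausdorff_pre_def)
    qed
    then obtain U where U: "\<And>n. U n \<in> hausdorff_covers \<delta> (A n)"
      "\<And>n. (\<Sum>i. hausdorff_gauge k (U n i)) < hausdorff_pre k \<delta> (A n) + e * (1/2)^Suc n"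
      by metis
    \<comment> \<open>A pairing function merges the countably many covers into one sequence. The
      n-th cover may exceed the infimum by \<open>e * (1/2)^Suc n\<close>, so the total excess is
      \<open>e\<close>.\<close>
    define W where "W i = (case prod_decode i of (n, m) \<Rightarrow> U n m)" for i
    have Uc: "A n \<subseteq> (\<Union>i. U n i)" "bounded (U n i)" "diameter (U n i) \<le> \<delta>" for n i
      using U(1)[of n] by (auto simp: hausdorff_covers_def)
    have UW: "x \<in> (\<Union>i. W i)" if "x \<in> U n i" for x n i
      using that by (intro UN_I[of "prod_encode (n,i)"]) (auto simp: W_def)
    have "W \<in> hausdorff_covers \<delta> (\<Union>n. A n)"
      unfolding hausdorff_covers_def
    proof (intro CollectI conjI allI subsetI)
      fix x assume "x \<in> (\<Union>n. A n)"
      then obtain n i where "x \<in> U n i" using Uc(1) by blast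
      then show "x \<in> (\<Union>i. W i)" by (rule UW)
    qed (auto simp: W_def Uc split: prod.splits)
    then have "hausdorff_pre k \<delta> (\<Union>n. A n) \<le> (\<Sum>i. hausdorff_gauge k (W i))"
      unfolding hausdorff_pre_def by (rule INF_lower)
    also have "\<dots> = (\<Sum>i. (\<lambda>(n,m). hausdorff_gauge k (U n m)) (prod_decode i))"
      by (simp add: W_def split_def)
    also have "\<dots> = (\<Sum>n. \<Sum>i. hausdorff_gauge k (U n i))"
      by (subst suminf_ennreal_2dimen[where g="\<lambda>n. \<Sum>i. hausdorff_gauge k (U n i)"])
         (auto simp: o_def)
    also have "\<dots> \<le> (\<Sum>n. hausdorff_pre k \<delta> (A n) + e * (1/2)^Suc n)"
      by (intro suminf_le summableI) (auto intro!: less_imp_le U simp del: power_Suc)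
    also have "\<dots> = (\<Sum>n. hausdorff_pre k \<delta> (A n)) + (\<Sum>n. ennreal e * ennreal ((1 / 2) ^ Suc n))"
      using e by (subst suminf_add[symmetric]) (auto simp: ennreal_mult simp del: power_Suc)
    also have "(\<Sum>n. ennreal e * ennreal ((1 / 2) ^ Suc n)) = e"
      unfolding ennreal_suminf_cmult
      by (subst suminf_ennreal_eq[OF zero_le_power power_half_series]) auto
    finally show "hausdorff_pre k \<delta> (\<Union>n. A n) \<le> (\<Sum>n. hausdorff_pre k \<delta> (A n)) + e" .
  qed
qed simp

lemma hausdorff_outer_mono: "A \<subseteq> B \<Longrightarrow> hausdorff_outer k A \<le> hausdorff_outer k B"
  unfolding hausdorff_outer_eq_SUP by (intro SUP_mono) (auto intro: hausdorff_pre_mono)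

lemma hausdorff_outer_empty [simp]: "hausdorff_outer k {} = 0"
  unfolding hausdorff_outer_eq_SUP_nat by (simp add: hausdorff_pre_empty del: of_nat_Suc)

lemma hausdorff_outer_UN_le:
  "hausdorff_outer k (\<Union>n. A n) \<le> (\<Sum>n::nat. hausdorff_outer k (A n))"
  unfolding hausdorff_outer_eq_SUP[of k "\<Union>n. A n"]
proof (rule SUP_least)
  fix \<delta> :: real assume "\<delta> \<in> {0<..}"
  then show "hausdorff_pre k \<delta> (\<Union>n. A n) \<le> (\<Sum>n. hausdorff_outer k (A n))"
    by (intro order_trans[OF hausdorff_pre_UN_le] suminf_le summableI hausdorff_pre_le_outer) auto
qed

lemma hausdorff_outer_Un_le: "hausdorff_outer k (A \<union> B) \<le> hausdorff_outer k A + hausdorff_outer k B"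
proof -
  have "(\<Union>n::nat. if n = 0 then A else if n = 1 then B else {}) = A \<union> B"
    by (auto split: if_splits)
  then have "hausdorff_outer k (A \<union> B)
      \<le> (\<Sum>n::nat. hausdorff_outer k (if n = 0 then A else if n = 1 then B else {}))"
    using hausdorff_outer_UN_le[of k "\<lambda>n::nat. if n = 0 then A else if n = 1 then B else {}"] by simp
  also have "\<dots> = (\<Sum>n\<in>{0,1::nat}. hausdorff_outer k (if n = 0 then A else if n = 1 then B else {}))"
    by (intro suminf_finite) auto
  finally show ?thesis by simp
qed

text \<open>A set of diameter at most \<open>\<delta>\<close> cannot meet both \<open>A\<close> and
  \<open>B\<close>, so every cover of the union splits into two covers without using any member
  twice.\<close>

lemma hausdorff_pre_separated:
  assumes sep: "\<And>x y. x \<in> A \<Longrightarrow> y \<in> B \<Longrightarrow> \<delta> < dist x y"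
  shows "hausdorff_pre k \<delta> A + hausdorff_pre k \<delta> B \<le> hausdorff_pre k \<delta> (A \<union> B)"
  unfolding hausdorff_pre_def[of k \<delta> "A \<union> B"]
proof (rule INF_greatest)
  fix U assume "U \<in> hausdorff_covers \<delta> (A \<union> B)"
  then have U: "A \<union> B \<subseteq> (\<Union>i. U i)" "\<And>i. bounded (U i)" "\<And>i. diameter (U i) \<le> \<delta>"
    by (auto simp: hausdorff_covers_def)
  \<comment> \<open>Members that miss the set are replaced by the empty set, whose gauge is 0, so
    that both covers keep the index set of \<open>U\<close>.\<close>
  define UA where "UA i = (if U i \<inter> A = {} then {} else U i)" for i
  define UB where "UB i = (if U i \<inter> B = {} then {} else U i)" for i
  have pos: "0 \<le> \<delta>" using U(3)[of 0] diameter_ge_0[OF U(2), of 0] by simp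
  have "UA \<in> hausdorff_covers \<delta> A" "UB \<in> hausdorff_covers \<delta> B"
    using U pos unfolding hausdorff_covers_def UA_def UB_def
    by (auto simp: subset_iff) (metis disjoint_iff)+
  then have "hausdorff_pre k \<delta> A + hausdorff_pre k \<delta> B
      \<le> (\<Sum>i. hausdorff_gauge k (UA i)) + (\<Sum>i. hausdorff_gauge k (UB i))"
    unfolding hausdorff_pre_def by (intro add_mono INF_lower)
  also have "\<dots> = (\<Sum>i. hausdorff_gauge k (UA i) + hausdorff_gauge k (UB i))"
    by (rule suminf_add) auto
  also have "\<dots> \<le> (\<Sum>i. hausdorff_gauge k (U i))"
  proof (intro suminf_le summableI)
    fix i
    have "U i \<inter> A = {} \<or> U i \<inter> B = {}"
    proof (rule ccontr)
      assume "\<not> ?thesis"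
      then obtain x y where xy: "x \<in> U i" "x \<in> A" "y \<in> U i" "y \<in> B" by blast
      then have "dist x y \<le> \<delta>"
        using diameter_bounded_bound[OF U(2) xy(1,3)] U(3)[of i] by simp
      with sep[OF xy(2,4)] show False by simp
    qed
    then show "hausdorff_gauge k (UA i) + hausdorff_gauge k (UB i) \<le> hausdorff_gauge k (U i)"
      by (auto simp: UA_def UB_def hausdorff_gauge_def)
  qed
  finally show "hausdorff_pre k \<delta> A + hausdorff_pre k \<delta> B \<le> (\<Sum>i. hausdorff_gauge k (U i))" .
qed

text \<open>Additivity on separated sets survives the supremum over the scales because the
  premeasures increase as the scale shrinks.\<close>

lemma hausdorff_outer_separated:
  assumes "e > 0" and sep: "\<And>x y. x \<in> A \<Longrightarrow> y \<in> B \<Longrightarrow> e \<le> dist x y"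
  shows "hausdorff_outer k A + hausdorff_outer k B \<le> hausdorff_outer k (A \<union> B)"
proof -
  have inc: "incseq (\<lambda>n. hausdorff_pre k (1 / real (Suc n)) X)" for X :: "'a set"
    by (intro incseq_SucI hausdorff_pre_antimono) (auto simp: field_simps)
  have "hausdorff_outer k A + hausdorff_outer k B
      = (SUP n. hausdorff_pre k (1 / real (Suc n)) A + hausdorff_pre k (1 / real (Suc n)) B)"
    unfolding hausdorff_outer_eq_SUP_nat by (rule ennreal_SUP_add[symmetric]) (rule inc)+
  also have "\<dots> \<le> hausdorff_outer k (A \<union> B)"
  proof (rule SUP_least)
    fix n
    define \<delta> where "\<delta> = min (1 / real (Suc n)) (e/2)"
    have \<delta>: "0 < \<delta>" "\<delta> < e" "\<delta> \<le> 1 / real (Suc n)" using \<open>e > 0\<close> by (auto simp: \<delta>_def)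
    have "hausdorff_pre k (1 / real (Suc n)) A + hausdorff_pre k (1 / real (Suc n)) B
       \<le> hausdorff_pre k \<delta> A + hausdorff_pre k \<delta> B"
      by (intro add_mono hausdorff_pre_antimono \<delta>)
    also have "\<dots> \<le> hausdorff_pre k \<delta> (A \<union> B)"
      by (intro hausdorff_pre_separated) (use sep \<delta> in force)
    also have "\<dots> \<le> hausdorff_outer k (A \<union> B)" by (intro hausdorff_pre_le_outer \<delta>)
    finally show "hausdorff_pre k (1 / real (Suc n)) A + hausdorff_pre k (1 / real (Suc n)) B
       \<le> hausdorff_outer k (A \<union> B)" .
  qed
  finally show ?thesis .
qed

lemma hausdorff_outer_sum_separated:
  fixes D :: "nat \<Rightarrow> 'a::metric_space set"
  assumes sep: "\<And>i j. i < j \<Longrightarrow> \<exists>e>0. \<forall>x\<in>D i. \<forall>y\<in>D j. e \<le> dist x y"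
  shows "(\<Sum>i<n. hausdorff_outer k (D i)) \<le> hausdorff_outer k (\<Union>i<n. D i)"
proof (induction n)
  case (Suc n)
  have "\<forall>i. \<exists>e. i < n \<longrightarrow> e > (0::real) \<and> (\<forall>x\<in>D i. \<forall>y\<in>D n. e \<le> dist x y)"
    using sep[of _ n] by blast
  then obtain e where e: "\<And>i. i < n \<Longrightarrow> e i > (0::real) \<and> (\<forall>x\<in>D i. \<forall>y\<in>D n. e i \<le> dist x y)"
    by metis
  define e0 where "e0 = Min (insert 1 (e ` {..<n}))"
  have e0: "e0 > 0" unfolding e0_def using e by (subst Min_gr_iff) auto
  have "e0 \<le> e i" if "i < n" for i unfolding e0_def using that by (intro Min_le) auto
  then have "\<And>x y. x \<in> (\<Union>i<n. D i) \<Longrightarrow> y \<in> D n \<Longrightarrow> e0 \<le> dist x y"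
    using e by fastforce
  from hausdorff_outer_separated[where k=k, OF e0 this]
  have "hausdorff_outer k (\<Union>i<n. D i) + hausdorff_outer k (D n) \<le> hausdorff_outer k ((\<Union>i<n. D i) \<union> D n)"
    by blast
  moreover have "(\<Union>i<n. D i) \<union> D n = (\<Union>i<Suc n. D i)" by (auto simp: less_Suc_eq)
  ultimately show ?case using Suc.IH by (simp add: add_right_mono order_trans[OF add_right_mono[OF Suc.IH]])
qed simp

text \<open>Caratheodory's criterion for metric outer measures. The points of \<open>X\<close> off
  \<open>C\<close> are exhausted by \<open>Y n\<close>, which has positive distance to
  \<open>C\<close>; the remainder is a tail of the shells \<open>D j\<close>, and the tails vanish
  because the sum over all shells is finite.\<close>

lemma hausdorff_outer_closed_split:
  fixes C X :: "'a::metric_space set"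
  assumes "closed C" "C \<noteq> {}"
  shows "hausdorff_outer k (X \<inter> C) + hausdorff_outer k (X - C) \<le> hausdorff_outer k X"
proof (cases "hausdorff_outer k X = \<infinity>")
  case False
  let ?H = "hausdorff_outer k"
  define Y where "Y n = {x\<in>X. 1 / real (Suc n) \<le> infdist x C}" for n
  define D where "D n = {x\<in>X. 1 / real (Suc (Suc n)) \<le> infdist x C \<and> infdist x C < 1 / real (Suc n)}" for n
  have main: "?H (X \<inter> C) + ?H (Y n) \<le> ?H X" for n
  proof -
    have "?H (X \<inter> C) + ?H (Y n) \<le> ?H (X \<inter> C \<union> Y n)"
    proof (rule hausdorff_outer_separated)
      fix x y assume "x \<in> X \<inter> C" "y \<in> Y n"
      then show "1 / real (Suc n) \<le> dist x y"
        using infdist_le[of x C y] by (auto simp: Y_def dist_commute)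
    qed simp
    also have "\<dots> \<le> ?H X" by (intro hausdorff_outer_mono) (auto simp: Y_def)
    finally show ?thesis .
  qed
  \<comment> \<open>Neighbouring shells may touch, so only shells whose indices differ by at least 2
    are separated.\<close>
  have sepD: "\<exists>e>0. \<forall>x\<in>D i. \<forall>y\<in>D j. e \<le> dist x y" if "i + 1 < j" for i j
  proof (intro exI conjI ballI)
    let ?e = "1 / real (i + 2) - 1 / real (i + 3)"
    show "?e > 0" by (simp add: frac_less2)
    fix x y assume "x \<in> D i" "y \<in> D j"
    then have "1 / real (i + 2) \<le> infdist x C" "infdist y C < 1 / real (Suc j)" by (auto simp: D_def)
    moreover have "1 / real (Suc j) \<le> 1 / real (i + 3)" using that by (simp add: field_simps)
    moreover have "infdist x C \<le> infdist y C + dist x y" by (rule infdist_triangle)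
    ultimately show "?e \<le> dist x y" by linarith
  qed
  \<comment> \<open>Shells of even index are pairwise separated, and so are those of odd index. Each
    family contributes at most the outer measure of \<open>X\<close>, whence the factor 2.\<close>
  have sumD: "(\<Sum>j<n. ?H (D j)) \<le> 2 * ?H X" for n
  proof -
    have "(\<Sum>j<n. ?H (D j)) \<le> (\<Sum>j<2*n. ?H (D j))"
      by (intro sum_mono2) auto
    also have "\<dots> = (\<Sum>j<n. ?H (D (2*j))) + (\<Sum>j<n. ?H (D (2*j+1)))"
      by (induction n) (auto simp: algebra_simps)
    also have "\<dots> \<le> ?H (\<Union>j<n. D (2*j)) + ?H (\<Union>j<n. D (2*j+1))"
      by (intro add_mono hausdorff_outer_sum_separated sepD) auto
    also have "\<dots> \<le> ?H X + ?H X"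
      by (intro add_mono hausdorff_outer_mono) (auto simp: D_def)
    finally show ?thesis by (simp add: mult_2)
  qed
  have finX: "2 * ?H X < \<infinity>" using False by (simp add: ennreal_mult_less_top less_top)
  have fin: "(\<Sum>j. ?H (D j)) < \<infinity>"
  proof -
    have "(\<Sum>j. ?H (D j)) \<le> 2 * ?H X" by (rule suminf_le_const[OF summableI sumD])
    then show ?thesis using finX by (rule le_less_trans)
  qed
  have split: "?H (X - C) \<le> ?H (Y n) + (\<Sum>j. ?H (D (j + n)))" for n
  proof -
    have "X - C \<subseteq> Y n \<union> (\<Union>j. D (j + n))"
    proof
      fix x assume x: "x \<in> X - C"
      then have pos: "infdist x C > 0"
        using assms by (simp add: infdist_pos_not_in_closed)
      show "x \<in> Y n \<union> (\<Union>j. D (j + n))"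
      proof (cases "x \<in> Y n")
        case F: False
        obtain m where m: "1 / real (Suc m) < infdist x C" using pos by (metis nat_approx_posE)
        define j where "j = (LEAST j. 1 / real (Suc j) \<le> infdist x C)"
        have j1: "1 / real (Suc j) \<le> infdist x C" unfolding j_def
          by (rule LeastI[of _ m]) (use m in simp)
        have jn: "n < j"
        proof (rule ccontr)
          assume "\<not> n < j"
          then have "1 / real (Suc n) \<le> 1 / real (Suc j)" by (simp add: field_simps)
          then show False using F x j1 by (auto simp: Y_def)
        qed
        then have "infdist x C < 1 / real (Suc (j - 1))"
          using not_less_Least[of "j - 1" "\<lambda>j. 1 / real (Suc j) \<le> infdist x C"] j_def by force
        then have "x \<in> D (j - 1)" using j1 jn x by (auto simp: D_def)
        then show ?thesis using jn by (intro UnI2 UN_I[of "j - 1 - n"]) auto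
      qed simp
    qed
    then have "?H (X - C) \<le> ?H (Y n \<union> (\<Union>j. D (j + n)))" by (rule hausdorff_outer_mono)
    also have "\<dots> \<le> ?H (Y n) + ?H (\<Union>j. D (j + n))" by (rule hausdorff_outer_Un_le)
    also have "\<dots> \<le> ?H (Y n) + (\<Sum>j. ?H (D (j + n)))"
      by (intro add_left_mono hausdorff_outer_UN_le)
    finally show ?thesis .
  qed
  have tail: "(\<lambda>n. \<Sum>j. ?H (D (j + n))) \<longlonglongrightarrow> 0"
  proof -
    define r where "r j = enn2real (?H (D j))" for j
    have r: "?H (D j) = ennreal (r j)" for j
      unfolding r_def using ennreal_suminf_lessD[OF fin, of j] by simp
    have r0: "0 \<le> r j" for j by (simp add: r_def)
    have "summable r" using fin r r0 by (intro summable_suminf_not_top) auto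
    then have "(\<lambda>n. \<Sum>j. r (j + n)) \<longlonglongrightarrow> 0" by (rule suminf_exist_split2)
    then have "(\<lambda>n. ennreal (\<Sum>j. r (j + n))) \<longlonglongrightarrow> 0"
      by (metis ennreal_0 tendsto_ennrealI)
    moreover have "(\<Sum>j. ?H (D (j + n))) = ennreal (\<Sum>j. r (j + n))" for n
      unfolding r by (intro suminf_ennreal2 r0) (use \<open>summable r\<close> in \<open>simp add: summable_iff_shift\<close>)
    ultimately show ?thesis by simp
  qed
  have "?H (X \<inter> C) + ?H (X - C) \<le> ?H X + (\<Sum>j. ?H (D (j + n)))" for n
    using order_trans[OF add_left_mono[OF split[of n]], of "?H (X \<inter> C)"] add_right_mono[OF main[of n]]
    by (metis (no_types, lifting) add.assoc order_trans)
  moreover have "(\<lambda>n. ?H X + (\<Sum>j. ?H (D (j + n)))) \<longlonglongrightarrow> ?H X + 0"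
    by (intro tendsto_add tail tendsto_const)
  ultimately show ?thesis
    by (intro LIMSEQ_le_const[of "\<lambda>n. ?H X + (\<Sum>j. ?H (D (j + n)))"]) auto
qed simp

section \<open>From the outer measure to a Borel measure, and its invariance under
  isometries\<close>

lemma outer_measure_space_hausdorff: "outer_measure_space (Pow UNIV) (hausdorff_outer k)"
  unfolding outer_measure_space_def positive_def increasing_def countably_subadditive_def
  by (auto intro: hausdorff_outer_mono hausdorff_outer_UN_le)

lemma measure_space_hausdorff:
  "measure_space (UNIV :: 'a::metric_space set) (sets borel) (hausdorff_outer k)"
proof -
  interpret sigma_algebra "UNIV :: 'a set" "Pow UNIV" by (rule sigma_algebra_Pow)
  let ?L = "lambda_system (UNIV :: 'a set) (Pow UNIV) (hausdorff_outer k)"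
  have ms: "measure_space UNIV ?L (hausdorff_outer k)"
    by (rule caratheodory_lemma[OF outer_measure_space_hausdorff])
  then have sa: "sigma_algebra UNIV ?L" by (simp add: measure_space_def)
  have "{C::'a set. closed C} \<subseteq> ?L"
  proof clarify
    fix C :: "'a set" assume C: "closed C"
    \<comment> \<open>The empty set is treated apart because the distance to it is 0 by convention,
      so the splitting lemma does not cover it.\<close>
    show "C \<in> ?L"
    proof (cases "C = {}")
      case True then show ?thesis by (auto simp: lambda_system_def)
    next
      case False
      have "hausdorff_outer k (C \<inter> x) + hausdorff_outer k ((UNIV - C) \<inter> x) = hausdorff_outer k x" for x
      proof (rule antisym)
        show "hausdorff_outer k (C \<inter> x) + hausdorff_outer k ((UNIV - C) \<inter> x) \<le> hausdorff_outer k x"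
          using hausdorff_outer_closed_split[OF C False, of k x]
          by (simp add: Int_commute Diff_eq)
        show "hausdorff_outer k x \<le> hausdorff_outer k (C \<inter> x) + hausdorff_outer k ((UNIV - C) \<inter> x)"
          using hausdorff_outer_Un_le[of k "C \<inter> x" "(UNIV - C) \<inter> x"]
          by (metis Compl_eq_Diff_UNIV Int_Un_distrib2 Un_Diff_cancel Un_UNIV_right Int_UNIV_left)
      qed
      then show ?thesis by (auto simp: lambda_system_def)
    qed
  qed
  then have "sigma_sets UNIV {C::'a set. closed C} \<subseteq> ?L"
    using sigma_algebra.sigma_sets_subset[OF sa] by blast
  then have "sets (borel::'a measure) \<subseteq> ?L"
    by (simp add: borel_eq_closed)
  moreover have "sigma_algebra UNIV (sets (borel::'a measure))"
    by (metis sets.sigma_algebra_axioms space_borel)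
  ultimately show ?thesis
    using ms unfolding measure_space_def positive_def countably_additive_def by (auto; blast)
qed

lemma sets_hausdorff_measure [simp, measurable_cong]: "sets (hausdorff_measure k) = sets borel"
  unfolding hausdorff_measure_def
  by (metis sets.sigma_sets_eq sets.space_closed sets_measure_of space_borel)

lemma space_hausdorff_measure [simp]: "space (hausdorff_measure k) = UNIV"
  using sets_eq_imp_space_eq[OF sets_hausdorff_measure] by simp

lemma emeasure_hausdorff_measure:
  "A \<in> sets borel \<Longrightarrow> emeasure (hausdorff_measure k) A = hausdorff_outer k A"
  unfolding hausdorff_measure_def
  by (rule emeasure_measure_of_sigma)
     (use measure_space_hausdorff in \<open>auto simp: measure_space_def\<close>)

lemma hausdorff_outer_isometry_le:
  fixes f :: "'a::metric_space \<Rightarrow> 'b::metric_space"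
  assumes iso: "\<And>x y. dist (f x) (f y) = dist x y"
  shows "hausdorff_outer k (f ` A) \<le> hausdorff_outer k A"
  unfolding hausdorff_outer_eq_SUP
proof (intro SUP_mono')
  fix \<delta>
  show "hausdorff_pre k \<delta> (f ` A) \<le> hausdorff_pre k \<delta> A"
    unfolding hausdorff_pre_def
  proof (rule INF_mono)
    fix U assume U: "U \<in> hausdorff_covers \<delta> A"
    have bd: "bounded (f ` V) = bounded V \<and> diameter (f ` V) = diameter V" for V
    proof -
      have "(\<lambda>x. dist (fst x) (snd x)) ` (f ` V \<times> f ` V) = (\<lambda>x. dist (fst x) (snd x)) ` (V \<times> V)"
        using iso by (force simp: image_iff)
      then have "(SUP x\<in>f ` V \<times> f ` V. dist (fst x) (snd x)) = (SUP x\<in>V \<times> V. dist (fst x) (snd x))"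
        by simp
      then show ?thesis using iso by (auto simp: bounded_any_center diameter_def case_prod_beta bounded_two_points)
    qed
    show "\<exists>V\<in>hausdorff_covers \<delta> (f ` A). (\<Sum>i. hausdorff_gauge k (V i)) \<le> (\<Sum>i. hausdorff_gauge k (U i))"
    proof (intro bexI[of _ "\<lambda>i. f ` U i"] suminf_le summableI)
      show "hausdorff_gauge k (f ` U i) \<le> hausdorff_gauge k (U i)" for i
        by (auto simp: hausdorff_gauge_def bd)
      show "(\<lambda>i. f ` U i) \<in> hausdorff_covers \<delta> (f ` A)"
        using U by (auto simp: hausdorff_covers_def bd) blast
    qed
  qed
qed

lemma hausdorff_outer_isometry:
  fixes f :: "'a::metric_space \<Rightarrow> 'a"
  assumes iso: "\<And>x y. dist (f x) (f y) = dist x y" and "surj f"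
  shows "hausdorff_outer k (f ` A) = hausdorff_outer k A"
proof (rule antisym)
  have inj: "inj f" by (metis dist_eq_0_iff injI iso)
  have "dist (inv f x) (inv f y) = dist x y" for x y
    by (metis assms surj_f_inv_f)
  from hausdorff_outer_isometry_le[OF this, of k "f ` A"]
  show "hausdorff_outer k A \<le> hausdorff_outer k (f ` A)"
    by (simp add: image_comp inj)
qed (rule hausdorff_outer_isometry_le[OF iso])

section \<open>A Bellman function\<close>

lemma DERIV_powr_const:
  fixes g :: "real \<Rightarrow> real"
  assumes "(g has_real_derivative m) (at s)" "g s > 0"
  shows "((\<lambda>x. g x powr r) has_real_derivative r * g s powr (r - 1) * m) (at s)"
  using DERIV_fun_powr[OF assms, of r] by simp

lemma DERIV_sqrt_comp:
  fixes g :: "real \<Rightarrow> real"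
  assumes "(g has_real_derivative m) (at s)" "g s > 0"
  shows "((\<lambda>x. sqrt (g x)) has_real_derivative m / (2 * sqrt (g s))) (at s)"
  using DERIV_chain2[OF DERIV_real_sqrt[OF assms(2)] assms(1)] by (simp add: field_simps)

lemma DERIV_quotient_form:
  fixes f h :: "real \<Rightarrow> real"
  assumes "(f has_real_derivative f') (at s)" "(h has_real_derivative h') (at s)" "h s \<noteq> 0"
  shows "((\<lambda>x. f x / h x) has_real_derivative f' / h s - f s * h' / (h s)\<^sup>2) (at s)"
  using DERIV_divide[OF assms]
  by (rule DERIV_cong) (use assms(3) in \<open>simp add: field_simps power2_eq_square\<close>)

text \<open>The quotient rule, sorted by the two inner derivatives. The coefficient of
  \<open>b'\<close> in the first identity equals that of \<open>a'\<close> in the second: the mixed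
  derivatives of the coupling term agree, so one function \<open>bellman_uv\<close> serves for
  both.\<close>

lemma bellman_alg:
  fixes H :: real
  assumes "H \<noteq> 0"
  shows "(a' * V + a * (2 * b * b')) / H - a * V * ((a * V * a' + N * b * b') / H) / H\<^sup>2
      = (V / H - (a * V)\<^sup>2 / H ^ 3) * a' + (2 * a * b / H - a * V * (N * b) / H ^ 3) * b'"
    and "((2 * a * a' + 2 * q * (q - 1) * P * b * b') * b + N * b') / H
        - N * b * ((a * V * a' + N * b * b') / H) / H\<^sup>2
      = (2 * a * b / H - a * V * (N * b) / H ^ 3) * a'
        + ((N + 2 * q * (q - 1) * P * b\<^sup>2) / H - (N * b)\<^sup>2 / H ^ 3) * b'"
  using assms by (simp_all add: field_simps power2_eq_square power3_eq_cube)

context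
  fixes A p q e :: real
begin

text \<open>With \<open>y = sqrt (v\<^sup>2 + e\<^sup>2)\<close> the Bellman function is
  \<open>A (u\<^sup>2 + e\<^sup>2) powr (p/2) + A y powr q + y sqrt (y powr (2 q - 2) + u\<^sup>2)\<close>, where \<open>q \<le> 2 \<le> p\<close> are
  conjugate and \<open>e > 0\<close> smooths it. The last summand makes the Hessian dominate \<open>2 \<bar>\<alpha>\<bar> \<bar>\<beta>\<bar>\<close>.\<close>

definition bell_S :: "real \<Rightarrow> real \<Rightarrow> real" where
  "bell_S u v = (v\<^sup>2 + e\<^sup>2) powr q + u\<^sup>2 * (v\<^sup>2 + e\<^sup>2)"

definition bellman :: "real \<Rightarrow> real \<Rightarrow> real" where
  "bellman u v = A * (u\<^sup>2 + e\<^sup>2) powr (p/2) + A * (v\<^sup>2 + e\<^sup>2) powr (q/2) + sqrt (bell_S u v)"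

text \<open>Half of the derivative of \<open>bell_S\<close> in \<open>v\<close> is
  \<open>bell_N u v * v\<close>; this is what the chain rule produces from the square root.\<close>

definition bell_N :: "real \<Rightarrow> real \<Rightarrow> real" where
  "bell_N u v = q * (v\<^sup>2 + e\<^sup>2) powr (q - 1) + u\<^sup>2"

definition bellman_u :: "real \<Rightarrow> real \<Rightarrow> real" where
  "bellman_u u v = A * p * u * (u\<^sup>2 + e\<^sup>2) powr (p/2 - 1) + u * (v\<^sup>2 + e\<^sup>2) / sqrt (bell_S u v)"

definition bellman_v :: "real \<Rightarrow> real \<Rightarrow> real" where
  "bellman_v u v = A * q * v * (v\<^sup>2 + e\<^sup>2) powr (q/2 - 1) + bell_N u v * v / sqrt (bell_S u v)"

definition bellman_uu :: "real \<Rightarrow> real \<Rightarrow> real" where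
  "bellman_uu u v = A * p * ((u\<^sup>2 + e\<^sup>2) powr (p/2 - 1) + (p - 2) * u\<^sup>2 * (u\<^sup>2 + e\<^sup>2) powr (p/2 - 2))
    + ((v\<^sup>2 + e\<^sup>2) / sqrt (bell_S u v) - (u * (v\<^sup>2 + e\<^sup>2))\<^sup>2 / sqrt (bell_S u v) ^ 3)"

definition bellman_uv :: "real \<Rightarrow> real \<Rightarrow> real" where
  "bellman_uv u v = 2 * u * v / sqrt (bell_S u v)
    - u * (v\<^sup>2 + e\<^sup>2) * (bell_N u v * v) / sqrt (bell_S u v) ^ 3"

definition bellman_vv :: "real \<Rightarrow> real \<Rightarrow> real" where
  "bellman_vv u v = A * q * ((v\<^sup>2 + e\<^sup>2) powr (q/2 - 1) + (q - 2) * v\<^sup>2 * (v\<^sup>2 + e\<^sup>2) powr (q/2 - 2))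
    + ((bell_N u v + 2 * q * (q - 1) * (v\<^sup>2 + e\<^sup>2) powr (q - 2) * v\<^sup>2) / sqrt (bell_S u v)
       - (bell_N u v * v)\<^sup>2 / sqrt (bell_S u v) ^ 3)"

context
  assumes e: "e > 0"
begin

lemma bell_y_pos: "v\<^sup>2 + e\<^sup>2 > 0"
  using e by (simp add: add_nonneg_pos)

lemma bell_S_pos: "bell_S u v > 0"
  unfolding bell_S_def using bell_y_pos[of v] by (intro add_pos_nonneg) auto

lemma continuous_on_bell [continuous_intros]:
  assumes "continuous_on X f" "continuous_on X g"
  shows "continuous_on X (\<lambda>x. bellman (f x) (g x))" (is ?b)
    and "continuous_on X (\<lambda>x. bellman_u (f x) (g x))" (is ?bu)
    and "continuous_on X (\<lambda>x. bellman_v (f x) (g x))" (is ?bv)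
    and "continuous_on X (\<lambda>x. bellman_uu (f x) (g x))" (is ?buu)
    and "continuous_on X (\<lambda>x. bellman_uv (f x) (g x))" (is ?buv)
    and "continuous_on X (\<lambda>x. bellman_vv (f x) (g x))" (is ?bvv)
proof -
  have y: "(g x)\<^sup>2 + e\<^sup>2 \<noteq> 0" "(f x)\<^sup>2 + e\<^sup>2 \<noteq> 0" for x
    using bell_y_pos[of "g x"] bell_y_pos[of "f x"] by auto
  have S: "continuous_on X (\<lambda>x. bell_S (f x) (g x))"
    unfolding bell_S_def by (intro continuous_intros assms) (use y in auto)
  have N: "continuous_on X (\<lambda>x. bell_N (f x) (g x))"
    unfolding bell_N_def by (intro continuous_intros assms) (use y in auto)
  have S0: "sqrt (bell_S (f x) (g x)) \<noteq> 0" for x using bell_S_pos[of "f x" "g x"] by simp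
  note [simp] = S0
  show ?b ?bu ?bv ?buu ?buv ?bvv
    unfolding bellman_def bellman_u_def bellman_v_def bellman_uu_def bellman_uv_def bellman_vv_def
    by (intro continuous_intros assms S N ballI; use y S0 in force)+
qed

context
  fixes \<alpha> \<beta> :: "real \<Rightarrow> real" and \<alpha>' \<beta>' s :: real
  assumes \<alpha>: "(\<alpha> has_real_derivative \<alpha>') (at s)" and \<beta>: "(\<beta> has_real_derivative \<beta>') (at s)"
begin

private lemma DU: "((\<lambda>s. (\<alpha> s)\<^sup>2 + e\<^sup>2) has_real_derivative 2 * \<alpha> s * \<alpha>') (at s)"
  by (auto intro!: derivative_eq_intros \<alpha>)

private lemma DV: "((\<lambda>s. (\<beta> s)\<^sup>2 + e\<^sup>2) has_real_derivative 2 * \<beta> s * \<beta>') (at s)"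
  by (auto intro!: derivative_eq_intros \<beta>)

private lemma DN: "((\<lambda>s. bell_N (\<alpha> s) (\<beta> s)) has_real_derivative
    2 * \<alpha> s * \<alpha>' + 2 * q * (q - 1) * ((\<beta> s)\<^sup>2 + e\<^sup>2) powr (q - 2) * \<beta> s * \<beta>') (at s)"
  unfolding bell_N_def
  by (rule derivative_eq_intros DERIV_powr_const DV bell_y_pos \<alpha> refl)+ (simp add: algebra_simps)

private lemma DH: "((\<lambda>s. sqrt (bell_S (\<alpha> s) (\<beta> s))) has_real_derivative
    (\<alpha> s * ((\<beta> s)\<^sup>2 + e\<^sup>2) * \<alpha>' + bell_N (\<alpha> s) (\<beta> s) * \<beta> s * \<beta>') / sqrt (bell_S (\<alpha> s) (\<beta> s))) (at s)"
proof -
  have "((\<lambda>s. bell_S (\<alpha> s) (\<beta> s)) has_real_derivative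
    2 * (\<alpha> s * ((\<beta> s)\<^sup>2 + e\<^sup>2) * \<alpha>' + bell_N (\<alpha> s) (\<beta> s) * \<beta> s * \<beta>')) (at s)"
    unfolding bell_S_def bell_N_def
    by (rule derivative_eq_intros DERIV_powr_const DV bell_y_pos \<alpha> \<beta> refl)+ (simp add: algebra_simps)
  from DERIV_sqrt_comp[OF this bell_S_pos] show ?thesis
    by (rule DERIV_cong) (simp only: mult_divide_mult_cancel_left_if; simp)
qed

text \<open>The derivatives are taken along arbitrary curves, since they are needed both along the
  heat flow, in time, and along coordinate lines, in space.\<close>

lemma bellman_DERIV: "((\<lambda>s. bellman (\<alpha> s) (\<beta> s)) has_real_derivative
    bellman_u (\<alpha> s) (\<beta> s) * \<alpha>' + bellman_v (\<alpha> s) (\<beta> s) * \<beta>') (at s)"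
  unfolding bellman_def bellman_u_def bellman_v_def
  by (rule derivative_eq_intros DERIV_powr_const DV DU DH bell_y_pos refl)+
     (simp add: algebra_simps add_divide_distrib)

lemma bellman_u_DERIV: "((\<lambda>s. bellman_u (\<alpha> s) (\<beta> s)) has_real_derivative
    bellman_uu (\<alpha> s) (\<beta> s) * \<alpha>' + bellman_uv (\<alpha> s) (\<beta> s) * \<beta>') (at s)"
proof -
  let ?H = "sqrt (bell_S (\<alpha> s) (\<beta> s))"
  have H: "?H > 0" using bell_S_pos by simp
  have "((\<lambda>s. \<alpha> s * ((\<beta> s)\<^sup>2 + e\<^sup>2) / sqrt (bell_S (\<alpha> s) (\<beta> s))) has_real_derivative
      (((\<beta> s)\<^sup>2 + e\<^sup>2) / ?H - (\<alpha> s * ((\<beta> s)\<^sup>2 + e\<^sup>2))\<^sup>2 / ?H ^ 3) * \<alpha>'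
      + bellman_uv (\<alpha> s) (\<beta> s) * \<beta>') (at s)"
    unfolding bellman_uv_def
    by (rule DERIV_cong[OF DERIV_quotient_form[OF DERIV_mult[OF \<alpha> DV] DH]])
       (use H bellman_alg(1)[of ?H \<alpha>' "(\<beta> s)\<^sup>2 + e\<^sup>2" "\<alpha> s" "\<beta> s" \<beta>' "bell_N (\<alpha> s) (\<beta> s)"] in \<open>simp_all add: algebra_simps\<close>)
  note d1 = this
  have "((\<lambda>s. A * p * \<alpha> s * ((\<alpha> s)\<^sup>2 + e\<^sup>2) powr (p/2 - 1)) has_real_derivative
      A * p * (((\<alpha> s)\<^sup>2 + e\<^sup>2) powr (p/2 - 1) + (p - 2) * (\<alpha> s)\<^sup>2 * ((\<alpha> s)\<^sup>2 + e\<^sup>2) powr (p/2 - 2)) * \<alpha>') (at s)"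
    by (rule derivative_eq_intros DERIV_powr_const DU bell_y_pos \<alpha> refl)+
       (simp add: algebra_simps power2_eq_square)
  from DERIV_add[OF this d1] show ?thesis
    unfolding bellman_u_def bellman_uu_def by (rule DERIV_cong) (simp add: algebra_simps)
qed

lemma bellman_v_DERIV: "((\<lambda>s. bellman_v (\<alpha> s) (\<beta> s)) has_real_derivative
    bellman_uv (\<alpha> s) (\<beta> s) * \<alpha>' + bellman_vv (\<alpha> s) (\<beta> s) * \<beta>') (at s)"
proof -
  let ?H = "sqrt (bell_S (\<alpha> s) (\<beta> s))"
  have H: "?H > 0" using bell_S_pos by simp
  have "((\<lambda>s. bell_N (\<alpha> s) (\<beta> s) * \<beta> s / sqrt (bell_S (\<alpha> s) (\<beta> s))) has_real_derivative
      bellman_uv (\<alpha> s) (\<beta> s) * \<alpha>' +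
      ((bell_N (\<alpha> s) (\<beta> s) + 2 * q * (q - 1) * ((\<beta> s)\<^sup>2 + e\<^sup>2) powr (q - 2) * (\<beta> s)\<^sup>2) / ?H
       - (bell_N (\<alpha> s) (\<beta> s) * \<beta> s)\<^sup>2 / ?H ^ 3) * \<beta>') (at s)"
    unfolding bellman_uv_def
    by (rule DERIV_cong[OF DERIV_quotient_form[OF DERIV_mult[OF DN \<beta>] DH]])
       (use H bellman_alg(2)[of ?H "\<alpha> s" \<alpha>' q "((\<beta> s)\<^sup>2 + e\<^sup>2) powr (q - 2)" "\<beta> s" \<beta>' "bell_N (\<alpha> s) (\<beta> s)" "(\<beta> s)\<^sup>2 + e\<^sup>2"] in \<open>simp_all add: algebra_simps\<close>)
  note d1 = this
  have "((\<lambda>s. A * q * \<beta> s * ((\<beta> s)\<^sup>2 + e\<^sup>2) powr (q/2 - 1)) has_real_derivative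
      A * q * (((\<beta> s)\<^sup>2 + e\<^sup>2) powr (q/2 - 1) + (q - 2) * (\<beta> s)\<^sup>2 * ((\<beta> s)\<^sup>2 + e\<^sup>2) powr (q/2 - 2)) * \<beta>') (at s)"
    by (rule derivative_eq_intros DERIV_powr_const DV bell_y_pos \<beta> refl)+
       (simp add: algebra_simps power2_eq_square)
  from DERIV_add[OF this d1] show ?thesis
    unfolding bellman_v_def bellman_vv_def by (rule DERIV_cong) (simp add: algebra_simps)
qed

end

section \<open>Size condition and Hessian bounds of the Bellman function\<close>

context
  assumes q: "1 < q" "q \<le> 2" and p: "p = q / (q - 1)" and A: "A = 12 / (q * (q - 1))"
begin

lemma bell_p_ge_2: "p \<ge> 2" using q by (simp add: p field_simps)

lemma bell_A_pos: "A > 0" using q by (simp add: A)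

lemma bellman_nonneg: "bellman u v \<ge> 0"
  using bell_A_pos bell_S_pos[of u v] unfolding bellman_def by (intro add_nonneg_nonneg mult_nonneg_nonneg) auto

text \<open>The size condition of the Bellman method. The coupling term is split by subadditivity of
  the square root, and its mixed part \<open>\<bar>u\<bar> * y\<close> is separated by Young's
  inequality for the conjugate exponents \<open>p\<close> and \<open>q\<close>.\<close>

lemma bellman_le: "bellman u v \<le> (A + 1) * (u\<^sup>2 + e\<^sup>2) powr (p/2) + (A + 2) * (v\<^sup>2 + e\<^sup>2) powr (q/2)"
proof -
  define V where "V = v\<^sup>2 + e\<^sup>2"
  define y where "y = sqrt V"
  define w where "w = sqrt (u\<^sup>2 + e\<^sup>2)"
  have V: "V > 0" using bell_y_pos unfolding V_def by simp
  have y: "y > 0" using V by (simp add: y_def)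
  have w: "w > 0" using bell_y_pos[of u] by (simp add: w_def)
  have uw: "\<bar>u\<bar> \<le> w" unfolding w_def by (rule real_le_rsqrt) simp
  have Vq: "sqrt (V powr q) = y powr q" "V powr (q/2) = y powr q" "(u\<^sup>2 + e\<^sup>2) powr (p/2) = w powr p"
    using V bell_y_pos[of u] by (simp_all add: y_def w_def powr_half_sqrt[symmetric] powr_powr less_imp_le)
  have "sqrt (bell_S u v) \<le> sqrt (V powr q) + sqrt (u\<^sup>2 * V)"
    unfolding bell_S_def V_def[symmetric] using V by (intro sqrt_add_le_add_sqrt) auto
  also have "sqrt (u\<^sup>2 * V) = \<bar>u\<bar> * y" by (simp add: real_sqrt_mult y_def)
  also have "\<bar>u\<bar> * y \<le> w * y" using uw y by (intro mult_right_mono) auto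
  also have "w * y \<le> w powr p / p + y powr q / q"
    by (rule Youngs_inequality) (use w y q in \<open>auto simp: p field_simps\<close>)
  also have "\<dots> \<le> w powr p + y powr q"
    using bell_p_ge_2 q by (intro add_mono) (auto simp: divide_le_eq mult_le_cancel_left1)
  finally show ?thesis
    unfolding bellman_def using Vq unfolding V_def by (simp add: algebra_simps)
qed

text \<open>\<open>bellman_vv\<close> is bounded below by a multiple of
  \<open>V powr (q/2 - 1)\<close>, so \<open>bellman_uu\<close> has to reach the reciprocal power
  \<open>V powr (1 - q/2)\<close>. Where \<open>u\<close> is small compared with \<open>v\<close>
  the pure power in \<open>u\<close> may be too weak for this, and the coupling term provides it;
  that is the purpose of the coupling term.\<close>

lemma bellman_hessian_bounds:
  shows bellman_uu_pos: "bellman_uu u v > 0" and bellman_vv_pos: "bellman_vv u v > 0"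
    and bellman_uv_bound: "\<bar>bellman_uv u v\<bar> \<le> 1"
    and bellman_det_bound: "bellman_uu u v * bellman_vv u v \<ge> 4"
proof -
  define V where "V = v\<^sup>2 + e\<^sup>2"
  define W where "W = V powr q"
  define S where "S = bell_S u v"
  define H where "H = sqrt S"
  define N where "N = bell_N u v"
  define U where "U = u\<^sup>2 + e\<^sup>2"
  have V: "V > 0" and U: "U > 0" unfolding V_def U_def by (rule bell_y_pos)+
  have W: "W > 0" using V by (simp add: W_def)
  have S: "S = W + u\<^sup>2 * V" by (simp add: S_def bell_S_def W_def V_def)
  have Sp: "S > 0" using bell_S_pos by (simp add: S_def)
  have H: "H > 0" "H\<^sup>2 = S" using Sp by (auto simp: H_def)
  have H3: "H ^ 3 = H * S" using H by (simp add: power3_eq_cube power2_eq_square)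
  have Wq: "V powr (q - 1) = W / V" "V powr (q - 2) = W / V\<^sup>2"
    using V by (auto simp: W_def powr_diff)
  have N: "N = q * (W / V) + u\<^sup>2" by (simp add: N_def bell_N_def V_def[symmetric] Wq)
  have NV: "N * V = q * W + u\<^sup>2 * V" using V by (simp add: N field_simps)
  have vV: "v\<^sup>2 \<le> V" by (simp add: V_def)
  \<comment> \<open>The coupling term is convex in \<open>u\<close>; its second derivative collapses
    because \<open>S = W + u\<^sup>2 * V\<close>.\<close>
  have Huu: "V / H - (u * V)\<^sup>2 / H ^ 3 = V * W / H ^ 3"
  proof -
    have "V / H = V * S / (H * S)" using Sp by simp
    then have "V / H - (u * V)\<^sup>2 / (H * S) = (V * S - (u * V)\<^sup>2) / (H * S)"
      by (simp add: diff_divide_distrib)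
    then show ?thesis unfolding H3 by (simp add: S power2_eq_square algebra_simps)
  qed
  have Huv: "\<bar>bellman_uv u v\<bar> \<le> 1"
  proof -
    have "bellman_uv u v = 2 * u * v / H - u * V * (N * v) / H ^ 3"
      by (simp add: bellman_uv_def V_def N_def H_def S_def)
    also have "\<dots> = u * v * (2 * S - N * V) / H ^ 3"
      using H Sp unfolding H3 by (simp add: field_simps)
    also have "2 * S - N * V = (2 - q) * W + u\<^sup>2 * V" unfolding S NV by (simp add: algebra_simps)
    finally have eq: "bellman_uv u v = u * v * ((2 - q) * W + u\<^sup>2 * V) / H ^ 3" .
    have 1: "\<bar>u * v\<bar> \<le> H"
    proof -
      have "(u * v)\<^sup>2 \<le> u\<^sup>2 * V" using vV by (simp add: power_mult_distrib mult_left_mono)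
      also have "\<dots> \<le> S" using W by (simp add: S)
      finally show ?thesis using H by (metis abs_le_square_iff abs_of_pos)
    qed
    have 2: "0 \<le> (2 - q) * W + u\<^sup>2 * V" using q W V by (intro add_nonneg_nonneg mult_nonneg_nonneg) auto
    have 3: "(2 - q) * W + u\<^sup>2 * V \<le> S" using q W by (simp add: S)
    have "\<bar>u * v * ((2 - q) * W + u\<^sup>2 * V)\<bar> \<le> H * S"
      unfolding abs_mult[of "u * v"] using 1 2 3 H by (intro mult_mono) auto
    then show ?thesis unfolding eq H3 using H Sp by (simp add: abs_divide divide_le_eq)
  qed
  have Hvv: "(N + 2 * q * (q - 1) * V powr (q - 2) * v\<^sup>2) / H - (N * v)\<^sup>2 / H ^ 3 \<ge> 0"
  proof -
    \<comment> \<open>\<open>\<tau>\<close> is the share of \<open>v\<^sup>2\<close> in the smoothed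
      square \<open>V\<close>. The difference \<open>S - N * v\<^sup>2\<close> can be negative, by
      at most \<open>\<tau> * (q - 1) * W\<close>; the term coming from the derivative of
      \<open>bell_N\<close> makes up for it.\<close>
    define \<tau> where "\<tau> = v\<^sup>2 / V"
    have \<tau>: "0 \<le> \<tau>" "\<tau> \<le> 1" "v\<^sup>2 = \<tau> * V" using V vV by (auto simp: \<tau>_def)
    have N0: "N > 0" unfolding N using q W V by (intro add_pos_nonneg mult_pos_pos) auto
    have a: "S - N * v\<^sup>2 \<ge> - \<tau> * (q - 1) * W"
    proof -
      have "N * v\<^sup>2 = \<tau> * (q * W + u\<^sup>2 * V)" using \<tau>(3) unfolding NV[symmetric] by simp
      also have "\<dots> = \<tau> * (S + (q - 1) * W)" by (simp add: S algebra_simps)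
      finally have "N * v\<^sup>2 = \<tau> * S + \<tau> * (q - 1) * W" by (simp add: algebra_simps)
      moreover have "\<tau> * S \<le> 1 * S" using \<tau> Sp by (intro mult_right_mono) auto
      ultimately show ?thesis by simp
    qed
    have "N * S + 2 * q * (q - 1) * (W / V\<^sup>2) * v\<^sup>2 * S - N\<^sup>2 * v\<^sup>2
        = N * (S - N * v\<^sup>2) + 2 * q * (q - 1) * (W / V\<^sup>2) * v\<^sup>2 * S"
      by (simp add: algebra_simps power2_eq_square)
    also have "\<dots> \<ge> N * (- \<tau> * (q - 1) * W) + 2 * q * (q - 1) * (W / V\<^sup>2) * v\<^sup>2 * S"
      using a N0 by (intro add_right_mono mult_left_mono) auto
    also have "N * (- \<tau> * (q - 1) * W) + 2 * q * (q - 1) * (W / V\<^sup>2) * v\<^sup>2 * S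
        = \<tau> * (q - 1) * (W / V) * (2 * q * S - N * V)"
      using V \<tau>(3) by (simp add: field_simps power2_eq_square)
    finally have b: "N * S + 2 * q * (q - 1) * (W / V\<^sup>2) * v\<^sup>2 * S - N\<^sup>2 * v\<^sup>2
        \<ge> \<tau> * (q - 1) * (W / V) * (2 * q * S - N * V)" .
    have "2 * q * S - N * V \<ge> 0"
    proof -
      have "N * V \<le> q * S" unfolding NV S using q V by (simp add: algebra_simps mult_le_cancel_right1)
      also have "\<dots> \<le> 2 * q * S" using q Sp by simp
      finally show ?thesis by simp
    qed
    then have "0 \<le> \<tau> * (q - 1) * (W / V) * (2 * q * S - N * V)"
      using q \<tau> W V by (intro mult_nonneg_nonneg) auto
    with b have c: "0 \<le> N * S + 2 * q * (q - 1) * (W / V\<^sup>2) * v\<^sup>2 * S - N\<^sup>2 * v\<^sup>2" by linarith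
    have "(N + 2 * q * (q - 1) * V powr (q - 2) * v\<^sup>2) / H - (N * v)\<^sup>2 / H ^ 3
      = (N * S + 2 * q * (q - 1) * (W / V\<^sup>2) * v\<^sup>2 * S - N\<^sup>2 * v\<^sup>2) / (H * S)"
      unfolding H3 Wq using H Sp by (simp add: field_simps power2_eq_square)
    then show ?thesis using c H Sp by simp
  qed
  \<comment> \<open>Since \<open>q \<le> 2\<close>, the second summand of the pure power is
    nonpositive. As \<open>v\<^sup>2 \<le> V\<close>, it costs at most the factor
    \<open>2 - q\<close>, which leaves \<open>q - 1\<close>.\<close>
  have Bvv: "bellman_vv u v \<ge> A * q * (q - 1) * V powr (q/2 - 1)"
  proof -
    have "V powr (q/2 - 2) = V powr (q/2 - 1) / V"
      using V powr_diff[of V "q/2 - 1" 1] by (simp add: algebra_simps)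
    then have "v\<^sup>2 * V powr (q/2 - 2) \<le> V powr (q/2 - 1)"
      using V vV by (simp add: divide_le_eq mult.commute mult_right_mono)
    then have "(q - 2) * (v\<^sup>2 * V powr (q/2 - 2)) \<ge> (q - 2) * V powr (q/2 - 1)"
      using q by (intro mult_left_mono_neg) auto
    then have "V powr (q/2 - 1) + (q - 2) * v\<^sup>2 * V powr (q/2 - 2) \<ge> (q - 1) * V powr (q/2 - 1)"
      by (simp add: algebra_simps)
    then have "A * q * (V powr (q/2 - 1) + (q - 2) * v\<^sup>2 * V powr (q/2 - 2)) \<ge> A * q * ((q - 1) * V powr (q/2 - 1))"
      using q bell_A_pos by (intro mult_left_mono) auto
    then show ?thesis
      using Hvv unfolding bellman_vv_def V_def[symmetric] N_def[symmetric] S_def[symmetric] H_def[symmetric]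
      by (simp add: mult.assoc)
  qed
  have Buu1: "bellman_uu u v \<ge> A * p * U powr (p/2 - 1) + V * W / H ^ 3"
  proof -
    have "A * p * (U powr (p/2 - 1) + (p - 2) * u\<^sup>2 * U powr (p/2 - 2)) \<ge> A * p * U powr (p/2 - 1)"
      using bell_p_ge_2 bell_A_pos by (intro mult_left_mono) auto
    then show ?thesis
      unfolding bellman_uu_def V_def[symmetric] S_def[symmetric] H_def[symmetric] U_def[symmetric] Huu by simp
  qed
  have pos1: "A * p * U powr (p/2 - 1) > 0" "V * W / H ^ 3 > 0"
    using bell_A_pos bell_p_ge_2 U V W H by auto
  \<comment> \<open>This is where \<open>A\<close> comes from: 12, together with the factor 1/3
    obtained below for \<open>bellman_uu\<close>, makes the product 4.\<close>
  have "A * (q * (q - 1)) = 12" using q by (simp add: A)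
  then have Aq: "A * q * (q - 1) = 12" by (simp add: mult.assoc)
  have Bvv12: "bellman_vv u v \<ge> 12 * V powr (q/2 - 1)" using Bvv Aq by simp
  have Vp: "V powr (q/2 - 1) > 0" using V by simp
  show uu: "bellman_uu u v > 0" using Buu1 pos1 by linarith
  show vv: "bellman_vv u v > 0" using Bvv12 Vp by linarith
  show "\<bar>bellman_uv u v\<bar> \<le> 1" by (rule Huv)
  have inv: "V powr (1 - q/2) * V powr (q/2 - 1) = 1"
    using V by (simp add: powr_add[symmetric])
  \<comment> \<open>For \<open>u\<^sup>2 \<le> V powr (q - 1)\<close> one has
    \<open>S \<le> 2 * W\<close> and the coupling term gives the bound; the 3 is an upper bound for
    \<open>2 * sqrt 2\<close>. Otherwise the pure power in \<open>u\<close> suffices, because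
    \<open>(q - 1) * (p/2 - 1) = 1 - q/2\<close>.\<close>
  have key: "bellman_uu u v \<ge> V powr (1 - q/2) / 3"
  proof (cases "u\<^sup>2 \<le> V powr (q - 1)")
    case True
    then have "u\<^sup>2 * V \<le> W" using V by (simp add: Wq pos_le_divide_eq)
    then have "S \<le> 2 * W" by (simp add: S)
    then have "H \<le> sqrt 2 * sqrt W" unfolding H_def by (metis real_sqrt_le_mono real_sqrt_mult)
    then have "H ^ 3 \<le> (sqrt 2 * sqrt W) ^ 3" using H by (intro power_mono) auto
    also have "\<dots> = 2 * sqrt 2 * (W * sqrt W)"
      using W by (simp add: power3_eq_cube algebra_simps)
    also have "\<dots> \<le> 3 * (W * sqrt W)"
    proof -
      have "sqrt 2 \<le> 3/2" by (rule real_le_lsqrt) (auto simp: power2_eq_square)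
      then show ?thesis using W by (intro mult_right_mono) auto
    qed
    finally have h: "H ^ 3 \<le> 3 * (W * sqrt W)" .
    have "V powr (1 - q/2) = V / sqrt W"
      using V by (simp add: W_def powr_half_sqrt[symmetric] powr_powr powr_diff)
    then have "V powr (1 - q/2) / 3 = V * W / (3 * (W * sqrt W))" using W by simp
    also have "\<dots> \<le> V * W / H ^ 3" using h H V W by (intro divide_left_mono) auto
    finally show ?thesis using Buu1 pos1 by linarith
  next
    case False
    have "V powr (1 - q/2) = (V powr (q - 1)) powr (p/2 - 1)"
    proof -
      have "(q - 1) * (p/2 - 1) = 1 - q/2" using q by (simp add: p field_simps)
      then show ?thesis by (simp add: powr_powr)
    qed
    also have "\<dots> \<le> U powr (p/2 - 1)"
    proof (rule powr_mono2)
      show "V powr (q - 1) \<le> U" using False zero_le_power2[of e] unfolding U_def by linarith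
    qed (use bell_p_ge_2 in auto)
    also have "\<dots> \<le> A * p * U powr (p/2 - 1)"
    proof -
      have "A \<ge> 6" using q by (simp add: A field_simps) (sos)
      then have "1 * 1 \<le> A * p" using bell_p_ge_2 by (intro mult_mono) auto
      then show ?thesis using U by (simp add: mult_le_cancel_right1)
    qed
    finally have "V powr (1 - q/2) \<le> A * p * U powr (p/2 - 1)" .
    moreover have "V powr (1 - q/2) / 3 \<le> V powr (1 - q/2)" by simp
    ultimately show ?thesis using Buu1 pos1 by linarith
  qed
  have "4 = (V powr (1 - q/2) / 3) * (12 * V powr (q/2 - 1))" using inv by simp
  also have "\<dots> \<le> bellman_uu u v * bellman_vv u v"
    using key Bvv12 uu Vp by (intro mult_mono) auto
  finally show "bellman_uu u v * bellman_vv u v \<ge> 4" .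
qed

end
end
end

lemma quadratic_form_absorb:
  fixes X Y c a b :: real
  assumes "X > 0" "Y > 0" "X * Y \<ge> 4" "\<bar>c\<bar> \<le> 1"
  shows "X * a\<^sup>2 + Y * b\<^sup>2 \<ge> 4 * \<bar>a\<bar> * \<bar>b\<bar>"
    and "X * a\<^sup>2 + 2 * c * a * b + Y * b\<^sup>2 \<ge> (X * a\<^sup>2 + Y * b\<^sup>2) / 2"
proof -
  have "0 \<le> (X * \<bar>a\<bar> - 2 * \<bar>b\<bar>)\<^sup>2 + (X * Y - 4) * b\<^sup>2" using assms by simp
  also have "\<dots> = X * (X * a\<^sup>2 + Y * b\<^sup>2 - 4 * \<bar>a\<bar> * \<bar>b\<bar>)"
    by (simp add: power2_eq_square algebra_simps)
  finally show 1: "X * a\<^sup>2 + Y * b\<^sup>2 \<ge> 4 * \<bar>a\<bar> * \<bar>b\<bar>"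
    using assms by (simp add: zero_le_mult_iff)
  have "\<bar>c * (a * b)\<bar> \<le> \<bar>a\<bar> * \<bar>b\<bar>"
    using assms(4) by (simp add: abs_mult mult_left_le_one_le)
  then have "- (c * (a * b)) \<le> \<bar>a\<bar> * \<bar>b\<bar>" by linarith
  moreover have "2 * c * a * b = 2 * (c * (a * b))" by simp
  ultimately have 2: "2 * c * a * b \<ge> - 2 * (\<bar>a\<bar> * \<bar>b\<bar>)" by linarith
  define t where "t = \<bar>a\<bar> * \<bar>b\<bar>"
  have "4 * t \<le> X * a\<^sup>2 + Y * b\<^sup>2" "- 2 * t \<le> 2 * c * a * b"
    using 1 2 by (simp_all add: t_def mult.assoc)
  then show "X * a\<^sup>2 + 2 * c * a * b + Y * b\<^sup>2 \<ge> (X * a\<^sup>2 + Y * b\<^sup>2) / 2" by argo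
qed

text \<open>The indices \<open>i\<close> and \<open>j\<close> may differ although the form is
  diagonal in the index: half of each diagonal entry survives the mixed terms, and single entries
  are bounded by the sums. This makes products of derivatives in two different directions
  accessible.\<close>

lemma quadratic_form_sum_lower:
  fixes X Y c :: real and a b :: "'i \<Rightarrow> real"
  assumes "X > 0" "Y > 0" "X * Y \<ge> 4" "\<bar>c\<bar> \<le> 1" "finite I" "i \<in> I" "j \<in> I"
  shows "(\<Sum>m\<in>I. X * (a m)\<^sup>2 + 2 * c * a m * b m + Y * (b m)\<^sup>2) \<ge> 2 * \<bar>a i\<bar> * \<bar>b j\<bar>"
proof -
  note Q = quadratic_form_absorb[OF assms(1-4)]
  have "2 * \<bar>a i\<bar> * \<bar>b j\<bar> \<le> (X * (a i)\<^sup>2 + Y * (b j)\<^sup>2) / 2"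
    using Q(1)[of "a i" "b j"] by simp
  also have "\<dots> \<le> ((\<Sum>m\<in>I. X * (a m)\<^sup>2) + (\<Sum>m\<in>I. Y * (b m)\<^sup>2)) / 2"
    using assms by (intro divide_right_mono add_mono member_le_sum) auto
  also have "\<dots> = (\<Sum>m\<in>I. (X * (a m)\<^sup>2 + Y * (b m)\<^sup>2) / 2)"
    by (simp add: sum.distrib sum_divide_distrib add_divide_distrib)
  also have "\<dots> \<le> (\<Sum>m\<in>I. X * (a m)\<^sup>2 + 2 * c * a m * b m + Y * (b m)\<^sup>2)"
    by (intro sum_mono Q(2))
  finally show ?thesis .
qed

section \<open>Trigonometric polynomials and the heat flow\<close>

text \<open>A triple \<open>(a, k, \<theta>)\<close> stands for the wave \<open>a cos (k \<bullet> x + \<theta>)\<close>.\<close>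

type_synonym 'a trig = "(real \<times> 'a \<times> real) list"

definition tev :: "'a::euclidean_space trig \<Rightarrow> 'a \<Rightarrow> real" where
  "tev xs x = (\<Sum>(a,k,\<theta>)\<leftarrow>xs. a * cos (k \<bullet> x + \<theta>))"

text \<open>As \<open>cos (t + pi/2) = - sin t\<close>, differentiating a wave multiplies its
  amplitude and shifts its phase, and the result is again a list of waves.\<close>

definition trig_deriv :: "'a::euclidean_space \<Rightarrow> 'a trig \<Rightarrow> 'a trig" where
  "trig_deriv w = map (\<lambda>(a,k,\<theta>). (a * (k \<bullet> w), k, \<theta> + pi/2))"

definition trig_heat :: "real \<Rightarrow> 'a::euclidean_space trig \<Rightarrow> 'a trig" where
  "trig_heat t = map (\<lambda>(a,k,\<theta>). (a * exp (- (k \<bullet> k) * t), k, \<theta>))"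

definition trig_lap :: "'a::euclidean_space trig \<Rightarrow> 'a trig" where
  "trig_lap = map (\<lambda>(a,k,\<theta>). (- a * (k \<bullet> k), k, \<theta>))"

text \<open>Waves with \<open>k = 0\<close> are sent to zero, since \<open>a / 0 = 0\<close>.\<close>

definition trig_invlap :: "'a::euclidean_space trig \<Rightarrow> 'a trig" where
  "trig_invlap = map (\<lambda>(a,k,\<theta>). (- a / (k \<bullet> k), k, \<theta>))"

definition trig_scale :: "real \<Rightarrow> 'a::euclidean_space trig \<Rightarrow> 'a trig" where
  "trig_scale c = map (\<lambda>(a,k,\<theta>). (c * a, k, \<theta>))"

text \<open>The frequencies lie in the dual lattice of the cube of side \<open>L\<close>: all waves
  have period \<open>L\<close> in each coordinate.\<close>

definition trig_freq :: "real \<Rightarrow> 'a::euclidean_space trig \<Rightarrow> bool" where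
  "trig_freq L xs \<longleftrightarrow> (\<forall>(a,k,\<theta>)\<in>set xs. \<forall>i\<in>Basis. \<exists>m::int. L * (k \<bullet> i) = 2 * pi * m)"

definition trig_nonzero :: "'a::euclidean_space trig \<Rightarrow> bool" where
  "trig_nonzero xs \<longleftrightarrow> (\<forall>(a,k,\<theta>)\<in>set xs. k \<noteq> 0)"

lemmas trig_defs = trig_deriv_def trig_heat_def trig_lap_def trig_invlap_def trig_scale_def

lemma tev_simps [simp]: "tev [] x = 0" "tev ((a,k,\<theta>) # xs) x = a * cos (k \<bullet> x + \<theta>) + tev xs x"
  by (simp_all add: tev_def)

lemma trig_simps [simp]:
  "trig_deriv w [] = []" "trig_deriv w ((a,k,\<theta>) # xs) = (a * (k \<bullet> w), k, \<theta> + pi/2) # trig_deriv w xs"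
  "trig_heat t [] = []" "trig_heat t ((a,k,\<theta>) # xs) = (a * exp (- (k \<bullet> k) * t), k, \<theta>) # trig_heat t xs"
  "trig_lap [] = []" "trig_lap ((a,k,\<theta>) # xs) = (- a * (k \<bullet> k), k, \<theta>) # trig_lap xs"
  "trig_invlap [] = []" "trig_invlap ((a,k,\<theta>) # xs) = (- a / (k \<bullet> k), k, \<theta>) # trig_invlap xs"
  "trig_scale c [] = []" "trig_scale c ((a,k,\<theta>) # xs) = (c * a, k, \<theta>) # trig_scale c xs"
  "trig_freq L []" "trig_freq L ((a,k,\<theta>) # xs) \<longleftrightarrow> (\<forall>i\<in>Basis. \<exists>m::int. L * (k \<bullet> i) = 2 * pi * m) \<and> trig_freq L xs"
  "trig_nonzero []" "trig_nonzero ((a,k,\<theta>) # xs) \<longleftrightarrow> k \<noteq> 0 \<and> trig_nonzero xs"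
  by (simp_all add: trig_defs trig_freq_def trig_nonzero_def)

lemma tev_append: "tev (xs @ ys) x = tev xs x + tev ys x"
  by (simp add: tev_def)

lemma tev_scale: "tev (trig_scale c xs) x = c * tev xs x"
  by (induction xs) (auto simp: algebra_simps)

lemma trig_freq_append: "trig_freq L (xs @ ys) \<longleftrightarrow> trig_freq L xs \<and> trig_freq L ys"
  unfolding trig_freq_def set_append ball_Un ..

lemma trig_freq_preserved [simp]:
  "trig_freq L xs \<Longrightarrow> trig_freq L (trig_deriv w xs)" "trig_freq L xs \<Longrightarrow> trig_freq L (trig_heat t xs)"
  "trig_freq L xs \<Longrightarrow> trig_freq L (trig_lap xs)" "trig_freq L xs \<Longrightarrow> trig_freq L (trig_invlap xs)"
  "trig_freq L xs \<Longrightarrow> trig_freq L (trig_scale c xs)"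
  by (induction xs; force)+

lemma trig_nonzero_preserved [simp]:
  "trig_nonzero xs \<Longrightarrow> trig_nonzero (trig_scale c xs)"
  "trig_nonzero xs \<Longrightarrow> trig_nonzero (trig_invlap xs)"
  "trig_nonzero xs \<Longrightarrow> trig_nonzero (trig_deriv w xs)"
  by (induction xs; force)+

text \<open>These are equalities of lists and not merely of functions, since all the operators act
  wave by wave; hence they can be used for rewriting under \<open>tev\<close>.\<close>

lemma trig_commute:
  "trig_deriv w (trig_heat t xs) = trig_heat t (trig_deriv w xs)"
  "trig_deriv w (trig_lap xs) = trig_lap (trig_deriv w xs)"
  "trig_deriv w (trig_invlap xs) = trig_invlap (trig_deriv w xs)"
  "trig_deriv w (trig_scale c xs) = trig_scale c (trig_deriv w xs)"
  "trig_lap (trig_heat t xs) = trig_heat t (trig_lap xs)"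
  "trig_invlap (trig_scale c xs) = trig_scale c (trig_invlap xs)"
  by (induction xs; force)+

lemma trig_heat_0 [simp]: "trig_heat 0 xs = xs"
  by (induction xs) auto

lemma tev_lap_invlap: "trig_nonzero xs \<Longrightarrow> trig_lap (trig_invlap xs) = xs"
  by (induction xs) auto

lemma tev_lap: "tev (trig_lap xs) x = (\<Sum>i\<in>Basis. tev (trig_deriv i (trig_deriv i xs)) x)"
proof (induction xs)
  case (Cons c xs)
  obtain a k \<theta> where c: "c = (a,k,\<theta>)" by (metis prod_cases3)
  have cp: "cos (k \<bullet> x + (\<theta> + pi / 2 + pi / 2)) = - cos (k \<bullet> x + \<theta>)"
    using cos_periodic_pi[of "k \<bullet> x + \<theta>"] by (simp add: algebra_simps)
  have "(\<Sum>i\<in>Basis. a * (k \<bullet> i) * (k \<bullet> i) * cos (k \<bullet> x + (\<theta> + pi / 2 + pi / 2)))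
     = - a * (k \<bullet> k) * cos (k \<bullet> x + \<theta>)"
    unfolding cp euclidean_inner[of k k]
    by (simp add: sum_distrib_left sum_distrib_right sum_negf algebra_simps)
  then show ?case by (simp add: c Cons sum.distrib)
qed simp

lemma tev_DERIV: "((\<lambda>s. tev xs (x + s *\<^sub>R w)) has_real_derivative tev (trig_deriv w xs) (x + s *\<^sub>R w)) (at s)"
proof (induction xs)
  case (Cons c xs)
  obtain a k \<theta> where c: "c = (a,k,\<theta>)" by (metis prod_cases3)
  have "cos (k \<bullet> (x + s *\<^sub>R w) + (\<theta> + pi / 2)) = - sin (k \<bullet> (x + s *\<^sub>R w) + \<theta>)"
    using minus_sin_cos_eq[of "k \<bullet> (x + s *\<^sub>R w) + \<theta>"] by (simp add: add.assoc)
  then show ?case unfolding c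
    by (auto intro!: derivative_eq_intros Cons simp: inner_add_right algebra_simps)
qed simp

lemma tev_has_derivative: "(tev xs has_derivative (\<lambda>w. tev (trig_deriv w xs) x)) (at x)"
proof (induction xs)
  case Nil
  have "tev [] = (\<lambda>_::'a. 0)" by auto
  then show ?case by simp
next
  case (Cons c xs)
  obtain a k \<theta> where c: "c = (a,k,\<theta>)" by (metis prod_cases3)
  have 1: "cos (k \<bullet> x + (\<theta> + pi / 2)) = - sin (k \<bullet> x + \<theta>)"
    using minus_sin_cos_eq[of "k \<bullet> x + \<theta>"] by (simp add: add.assoc)
  have 2: "tev (c # xs) = (\<lambda>x. a * cos (k \<bullet> x + \<theta>) + tev xs x)" by (auto simp: c)
  have 3: "cos (\<theta> + (k \<bullet> x + pi / 2)) = - sin (\<theta> + k \<bullet> x)"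
    using 1 by (simp add: ac_simps)
  show ?case unfolding 2
    by (auto intro!: derivative_eq_intros Cons simp: c 3 algebra_simps)
qed

lemma tev_heat_DERIV: "((\<lambda>t. tev (trig_heat t xs) x) has_real_derivative tev (trig_lap (trig_heat t xs)) x) (at t)"
  by (induction xs) (auto intro!: derivative_eq_intros simp: algebra_simps)

lemma continuous_on_tev_heat [continuous_intros]:
  fixes f :: "'b::t2_space \<Rightarrow> 'a::euclidean_space"
  assumes "continuous_on X f" "continuous_on X g"
  shows "continuous_on X (\<lambda>y. tev (trig_heat (g y) xs) (f y))"
proof (induction xs)
  case (Cons c xs)
  obtain a k \<theta> where c: "c = (a,k,\<theta>)" by (metis prod_cases3)
  show ?case unfolding c trig_simps tev_simps
    by (intro continuous_on_add continuous_on_mult continuous_on_cos continuous_on_exp continuous_on_const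
          continuous_on_inner assms Cons)
qed simp

lemma continuous_on_tev [continuous_intros]:
  fixes f :: "'b::t2_space \<Rightarrow> 'a::euclidean_space"
  assumes "continuous_on X f"
  shows "continuous_on X (\<lambda>y. tev xs (f y))"
  using continuous_on_tev_heat[OF assms continuous_on_const, of 0 xs] by simp

lemma continuous_on_tev_id [simp]: "continuous_on X (tev xs)"
  using continuous_on_tev[OF continuous_on_id, of X xs] by simp

lemma tev_periodic:
  assumes "trig_freq L xs" "i \<in> Basis"
  shows "tev xs (x + L *\<^sub>R i) = tev xs x"
  using assms(1)
proof (induction xs)
  case (Cons c xs)
  obtain a k \<theta> where c: "c = (a,k,\<theta>)" by (metis prod_cases3)
  obtain m :: int where m: "L * (k \<bullet> i) = 2 * pi * m" using Cons.prems assms(2) by (auto simp: c)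
  have "cos (k \<bullet> (x + L *\<^sub>R i) + \<theta>) = cos ((k \<bullet> x + \<theta>) + 2 * pi * m)"
    using m by (simp add: inner_add_right algebra_simps)
  also have "\<dots> = cos (k \<bullet> x + \<theta>)"
    by (metis cos_int_2pin sin_int_2pin cos_add mult.right_neutral mult_zero_right diff_zero)
  finally show ?case using Cons by (simp add: c)
qed simp

lemma tev_bound: "\<bar>tev xs x\<bar> \<le> (\<Sum>c\<leftarrow>xs. \<bar>fst c\<bar>)"
proof (induction xs)
  case (Cons c xs)
  obtain a k \<theta> where c: "c = (a,k,\<theta>)" by (metis prod_cases3)
  have "\<bar>a * cos (k \<bullet> x + \<theta>)\<bar> \<le> \<bar>a\<bar> * 1" unfolding abs_mult by (intro mult_left_mono) auto
  then show ?case using Cons abs_triangle_ineq[of "a * cos (k \<bullet> x + \<theta>)" "tev xs x"] by (simp add: c)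
qed simp

section \<open>Integration of periodic functions over a cube\<close>

definition pbox :: "real \<Rightarrow> 'a::euclidean_space set" where
  "pbox L = cbox 0 (L *\<^sub>R One)"

text \<open>The box lengthened by \<open>s\<close> in direction \<open>i\<close> is cut once at
  \<open>s\<close> and once at \<open>L\<close>. The two short pieces are translates of each other
  by a period, so the two long ones, the cube and its shift, have equal integrals.\<close>

lemma integral_periodic_shift:
  fixes f :: "'a::euclidean_space \<Rightarrow> real"
  assumes cont: "continuous_on UNIV f" and i: "i \<in> Basis" and per: "\<And>x. f (x + L *\<^sub>R i) = f x"
    and s: "0 \<le> s" "s \<le> L"
  shows "integral (pbox L) (\<lambda>x. f (x + s *\<^sub>R i)) = integral (pbox L) f"
proof -
  have int: "f integrable_on cbox a b" for a b
    by (intro integrable_continuous continuous_on_subset[OF cont]) auto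
  define R :: "'a set" where "R = cbox 0 (L *\<^sub>R One + s *\<^sub>R i)"
  define A :: "'a set" where "A = cbox 0 (L *\<^sub>R One + (s - L) *\<^sub>R i)"
  have mb: "x \<in> cbox a b \<longleftrightarrow> (a \<bullet> i \<le> x \<bullet> i \<and> x \<bullet> i \<le> b \<bullet> i) \<and> (\<forall>j\<in>Basis-{i}. a \<bullet> j \<le> x \<bullet> j \<and> x \<bullet> j \<le> b \<bullet> j)"
    for a b x :: 'a
    using i by (auto simp: mem_box)
  have ii: "i \<bullet> i = 1" "One \<bullet> i = 1" using i by auto
  have ij: "i \<bullet> j = 0" "One \<bullet> j = 1" if "j \<in> Basis - {i}" for j using that i by (auto simp: inner_Basis)
  note box = R_def A_def pbox_def set_eq_iff mb inner_add_left ii ij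
  have i0: "i \<bullet> j = 0" if "j \<in> Basis" "j \<noteq> i" for j using that ij by auto
  have R1: "R \<inter> {x. x \<bullet> i \<ge> s} = cbox (0 + s *\<^sub>R i) (L *\<^sub>R One + s *\<^sub>R i)"
    using s by (simp add: box cong: ball_cong) (auto simp: i0)
  have R2: "R \<inter> {x. x \<bullet> i \<le> s} = A"
    using s by (simp add: box cong: ball_cong) (auto simp: i0)
  have R3: "R \<inter> {x. x \<bullet> i \<le> L} = pbox L"
    using s by (simp add: box cong: ball_cong) (auto simp: i0)
  have R4: "R \<inter> {x. x \<bullet> i \<ge> L} = cbox (0 + L *\<^sub>R i) (L *\<^sub>R One + (s - L) *\<^sub>R i + L *\<^sub>R i)"
    using s by (simp add: box cong: ball_cong) (auto simp: i0)
  have "integral R f = integral A f + integral (cbox (0 + s *\<^sub>R i) (L *\<^sub>R One + s *\<^sub>R i)) f"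
    using integral_split[OF int i, of 0 "L *\<^sub>R One + s *\<^sub>R i" s] unfolding R_def[symmetric] R1 R2 .
  moreover have "integral R f = integral (pbox L) f + integral (cbox (0 + L *\<^sub>R i) (L *\<^sub>R One + (s - L) *\<^sub>R i + L *\<^sub>R i)) f"
    using integral_split[OF int i, of 0 "L *\<^sub>R One + s *\<^sub>R i" L] unfolding R_def[symmetric] R3 R4 .
  moreover have "integral (cbox (0 + L *\<^sub>R i) (L *\<^sub>R One + (s - L) *\<^sub>R i + L *\<^sub>R i)) f = integral A f"
    unfolding integral_shift_cbox_plus[symmetric] A_def using per by (simp add: o_def add.commute)
  moreover have "integral (cbox (0 + s *\<^sub>R i) (L *\<^sub>R One + s *\<^sub>R i)) f = integral (pbox L) (\<lambda>x. f (x + s *\<^sub>R i))"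
    unfolding integral_shift_cbox_plus[symmetric] pbox_def by (simp add: o_def add.commute)
  ultimately show ?thesis by linarith
qed

text \<open>By periodicity the integral of a translate does not depend on the translation;
  differentiating under the integral at 0 gives the claim without iterated integrals.\<close>

lemma integral_periodic_deriv_0:
  fixes f g :: "'a::euclidean_space \<Rightarrow> real"
  assumes L: "L > 0" and cont: "continuous_on UNIV f" "continuous_on UNIV g"
    and i: "i \<in> Basis" and per: "\<And>x. f (x + L *\<^sub>R i) = f x"
    and der: "\<And>x s. ((\<lambda>s. f (x + s *\<^sub>R i)) has_real_derivative g (x + s *\<^sub>R i)) (at s)"
  shows "integral (pbox L) g = 0"
proof -
  define J where "J s = integral (pbox L) (\<lambda>x. f (x + s *\<^sub>R i))" for s
  have "(J has_real_derivative integral (pbox L) (\<lambda>x. g (x + 0 *\<^sub>R i))) (at 0 within UNIV)"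
    unfolding J_def pbox_def
  proof (rule leibniz_rule_field_derivative)
    show "(\<lambda>x. f (x + s *\<^sub>R i)) integrable_on cbox 0 (L *\<^sub>R One)" for s
      by (intro integrable_continuous continuous_on_compose2[OF cont(1)] continuous_intros) auto
    show "continuous_on (UNIV \<times> cbox 0 (L *\<^sub>R One)) (\<lambda>(s, x). g (x + s *\<^sub>R i))"
      unfolding split_def by (intro continuous_on_compose2[OF cont(2)] continuous_intros) auto
  qed (use der in auto)
  then have D: "(J has_real_derivative integral (pbox L) g) (at 0)" by simp
  have pos: "J s = J 0" if "0 \<le> s" "s \<le> L" for s
    using integral_periodic_shift[OF cont(1) i per that] by (simp add: J_def)
  \<comment> \<open>Negative shifts are positive shifts of a translated function; the derivative at
    0 is two-sided.\<close>
  have neg: "J (- s) = J 0" if "0 \<le> s" "s \<le> L" for s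
  proof -
    have "integral (pbox L) (\<lambda>x. (\<lambda>x. f (x - s *\<^sub>R i)) (x + s *\<^sub>R i)) = integral (pbox L) (\<lambda>x. f (x - s *\<^sub>R i))"
    proof (rule integral_periodic_shift[OF _ i _ that])
      show "continuous_on UNIV (\<lambda>x. f (x - s *\<^sub>R i))"
        by (intro continuous_on_compose2[OF cont(1)] continuous_intros) auto
      show "f (x + L *\<^sub>R i - s *\<^sub>R i) = f (x - s *\<^sub>R i)" for x
        using per[of "x - s *\<^sub>R i"] by (simp add: algebra_simps)
    qed
    then show ?thesis by (simp add: J_def)
  qed
  have "J 0 = J y" if "\<bar>0 - y\<bar> < L" for y
    using pos[of y] neg[of "-y"] that by (cases "y \<ge> 0") auto
  then have "\<forall>y. \<bar>0 - y\<bar> < L \<longrightarrow> J 0 = J y" by blast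
  from DERIV_local_const[OF D L this] show ?thesis .
qed

lemma integral_pbox_mono:
  fixes f g :: "'a::euclidean_space \<Rightarrow> real"
  assumes "continuous_on UNIV f" "continuous_on UNIV g" "\<And>x. f x \<le> g x"
  shows "integral (pbox L) f \<le> integral (pbox L) g"
  unfolding pbox_def
  by (intro integral_le integrable_continuous continuous_on_subset[OF assms(1)] continuous_on_subset[OF assms(2)] assms(3)) auto

lemma integrable_pbox:
  fixes f :: "'a::euclidean_space \<Rightarrow> real"
  assumes "continuous_on UNIV f"
  shows "f integrable_on pbox L"
  unfolding pbox_def by (intro integrable_continuous continuous_on_subset[OF assms]) auto

abbreviation trig_inner :: "real \<Rightarrow> 'a::euclidean_space trig \<Rightarrow> 'a trig \<Rightarrow> real" where
  "trig_inner L us vs \<equiv> integral (pbox L) (\<lambda>x. tev us x * tev vs x)"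

abbreviation lpow :: "real \<Rightarrow> real \<Rightarrow> ('a::euclidean_space \<Rightarrow> real) \<Rightarrow> real" where
  "lpow L r f \<equiv> integral (pbox L) (\<lambda>x. \<bar>f x\<bar> powr r)"

lemma tev_green:
  fixes xs ys :: "'a::euclidean_space trig"
  assumes L: "L > 0" and fr: "trig_freq L xs" "trig_freq L ys"
  shows "trig_inner L xs (trig_lap ys) = trig_inner L (trig_lap xs) ys"
proof -
  define \<psi> where "\<psi> m x = tev xs x * tev (trig_deriv m (trig_deriv m ys)) x - tev (trig_deriv m (trig_deriv m xs)) x * tev ys x" for m x
  have "integral (pbox L) (\<psi> m) = 0" if m: "m \<in> Basis" for m
  proof (rule integral_periodic_deriv_0[OF L _ _ m, where f = "\<lambda>x. tev xs x * tev (trig_deriv m ys) x - tev (trig_deriv m xs) x * tev ys x"])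
    fix x s
    show "((\<lambda>s. tev xs (x + s *\<^sub>R m) * tev (trig_deriv m ys) (x + s *\<^sub>R m) - tev (trig_deriv m xs) (x + s *\<^sub>R m) * tev ys (x + s *\<^sub>R m))
       has_real_derivative \<psi> m (x + s *\<^sub>R m)) (at s)"
      unfolding \<psi>_def by (rule DERIV_cong[OF DERIV_diff[OF DERIV_mult[OF tev_DERIV tev_DERIV] DERIV_mult[OF tev_DERIV tev_DERIV]]]) (simp add: algebra_simps)
  qed (auto simp: \<psi>_def fr tev_periodic[OF _ m] intro!: continuous_intros)
  then have "0 = (\<Sum>m\<in>Basis. integral (pbox L) (\<psi> m))" by simp
  also have "\<dots> = integral (pbox L) (\<lambda>x. \<Sum>m\<in>Basis. \<psi> m x)"
    by (rule integral_sum[symmetric]) (auto intro!: integrable_pbox continuous_intros simp: \<psi>_def)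
  also have "\<dots> = integral (pbox L) (\<lambda>x. tev xs x * tev (trig_lap ys) x - tev (trig_lap xs) x * tev ys x)"
    by (simp add: \<psi>_def tev_lap sum_subtractf sum_distrib_left sum_distrib_right)
  also have "\<dots> = trig_inner L xs (trig_lap ys) - trig_inner L (trig_lap xs) ys"
    by (intro integral_diff integrable_pbox continuous_intros)
  finally show ?thesis by simp
qed

lemma tev_parts:
  fixes xs ys :: "'a::euclidean_space trig"
  assumes L: "L > 0" and fr: "trig_freq L xs" "trig_freq L ys" and j: "j \<in> Basis"
  shows "trig_inner L (trig_deriv j xs) ys = - trig_inner L xs (trig_deriv j ys)"
proof -
  have "integral (pbox L) (\<lambda>x. tev (trig_deriv j xs) x * tev ys x + tev xs x * tev (trig_deriv j ys) x) = 0"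
  proof (rule integral_periodic_deriv_0[OF L _ _ j, where f = "\<lambda>x. tev xs x * tev ys x"])
    fix x s
    show "((\<lambda>s. tev xs (x + s *\<^sub>R j) * tev ys (x + s *\<^sub>R j)) has_real_derivative
       tev (trig_deriv j xs) (x + s *\<^sub>R j) * tev ys (x + s *\<^sub>R j) + tev xs (x + s *\<^sub>R j) * tev (trig_deriv j ys) (x + s *\<^sub>R j)) (at s)"
      by (rule DERIV_cong[OF DERIV_mult[OF tev_DERIV tev_DERIV]]) (simp add: algebra_simps)
  qed (auto simp: fr tev_periodic[OF _ j] intro!: continuous_intros)
  then show ?thesis
    by (subst (asm) integral_add) (auto intro!: integrable_pbox continuous_intros)
qed

text \<open>Heat-flow form of the Bellman argument: any dissipated quantity controls the pairing
  of the second derivatives of the inverse Laplacian.\<close>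

lemma heat_pairing_bound:
  fixes xs ys :: "'a::euclidean_space trig"
  assumes L: "L > 0" and fr: "trig_freq L xs" "trig_freq L ys" and nz: "trig_nonzero xs"
    and ij: "i \<in> Basis" "j \<in> Basis"
    and h: "\<And>t. t \<ge> 0 \<Longrightarrow> (h has_real_derivative h' t) (at t)" "\<And>t. h t \<ge> 0"
    and h': "\<And>t. t \<ge> 0 \<Longrightarrow> 2 * \<bar>trig_inner L (trig_deriv i (trig_heat t xs)) (trig_deriv j (trig_heat t ys))\<bar> \<le> - h' t"
  shows "\<bar>trig_inner L (trig_deriv i (trig_invlap xs)) (trig_deriv j ys)\<bar> \<le> h 0"
proof -
  define us where "us = trig_deriv i (trig_invlap xs)"
  define vs where "vs = trig_deriv j ys"
  \<comment> \<open>\<open>k\<close> interpolates by the heat flow between the pairing in question,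
    at time 0, and 0, at infinity.\<close>
  define k where "k t = trig_inner L (trig_heat t us) (trig_heat t vs)" for t
  define D where "D t = trig_inner L (trig_deriv i (trig_heat t xs)) (trig_deriv j (trig_heat t ys))" for t
  have fru: "trig_freq L us" "trig_freq L vs" using fr by (auto simp: us_def vs_def)
  have lapu: "trig_lap us = trig_deriv i xs"
    unfolding us_def by (simp add: trig_commute(2)[symmetric] tev_lap_invlap[OF nz])
  \<comment> \<open>One Laplacian, moved by Green's formula, falls on \<open>us\<close>, where it
    cancels the inverse Laplacian; what is left is twice the pairing that \<open>h'\<close>
    controls.\<close>
  have Dk: "(k has_real_derivative 2 * D t) (at t)" for t
  proof -
    have "(k has_real_derivative integral (pbox L) (\<lambda>x. tev (trig_heat t us) x * tev (trig_lap (trig_heat t vs)) x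
         + tev (trig_lap (trig_heat t us)) x * tev (trig_heat t vs) x)) (at t within UNIV)"
      unfolding k_def pbox_def
    proof (rule leibniz_rule_field_derivative)
      show "(\<lambda>x. tev (trig_heat t us) x * tev (trig_heat t vs) x) integrable_on cbox 0 (L *\<^sub>R One)" for t
        by (intro integrable_continuous continuous_intros)
      show "continuous_on (UNIV \<times> cbox 0 (L *\<^sub>R One)) (\<lambda>(t, x). tev (trig_heat t us) x * tev (trig_lap (trig_heat t vs)) x
         + tev (trig_lap (trig_heat t us)) x * tev (trig_heat t vs) x)"
        unfolding split_def trig_commute(5) by (intro continuous_intros)
      show "((\<lambda>t. tev (trig_heat t us) x * tev (trig_heat t vs) x) has_real_derivative
         tev (trig_heat t us) x * tev (trig_lap (trig_heat t vs)) x + tev (trig_lap (trig_heat t us)) x * tev (trig_heat t vs) x) (at t within UNIV)" for x t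
        by (rule DERIV_cong[OF DERIV_mult[OF tev_heat_DERIV tev_heat_DERIV]]) (simp add: algebra_simps)
    qed auto
    also have "integral (pbox L) (\<lambda>x. tev (trig_heat t us) x * tev (trig_lap (trig_heat t vs)) x
         + tev (trig_lap (trig_heat t us)) x * tev (trig_heat t vs) x)
       = trig_inner L (trig_heat t us) (trig_lap (trig_heat t vs))
         + trig_inner L (trig_lap (trig_heat t us)) (trig_heat t vs)"
      by (intro integral_add integrable_pbox continuous_intros)
    also have "trig_inner L (trig_heat t us) (trig_lap (trig_heat t vs))
       = trig_inner L (trig_lap (trig_heat t us)) (trig_heat t vs)"
      by (rule tev_green[OF L]) (use fru in auto)
    also have "trig_inner L (trig_lap (trig_heat t us)) (trig_heat t vs) = D t"
      unfolding D_def trig_commute(5) lapu by (simp add: trig_commute(1) vs_def)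
    finally show ?thesis by simp
  qed
  \<comment> \<open>\<open>h + k\<close> and \<open>h - k\<close> are both nonincreasing, and
    \<open>h\<close> is nonnegative at the later time.\<close>
  have kh: "\<bar>k 0 - k T\<bar> \<le> h 0" if T: "T \<ge> 0" for T
  proof -
    have "h T + \<sigma> * k T \<le> h 0 + \<sigma> * k 0" if \<sigma>: "\<bar>\<sigma>\<bar> = 1" for \<sigma>
    proof (rule DERIV_nonpos_imp_nonincreasing[OF T])
      fix t assume t: "0 \<le> t" "t \<le> T"
      have "((\<lambda>t. h t + \<sigma> * k t) has_real_derivative h' t + \<sigma> * (2 * D t)) (at t)"
        by (intro DERIV_add h DERIV_cmult Dk t)
      moreover have "\<bar>\<sigma> * (2 * D t)\<bar> = 2 * \<bar>D t\<bar>" using \<sigma> by (simp add: abs_mult)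
      then have "h' t + \<sigma> * (2 * D t) \<le> 0" using h'[OF t(1)] unfolding D_def[symmetric] by linarith
      ultimately show "\<exists>y. ((\<lambda>t. h t + \<sigma> * k t) has_real_derivative y) (at t) \<and> y \<le> 0" by blast
    qed
    from this[of 1] this[of "-1"]
    show ?thesis using h(2)[of T] by simp
  qed
  have nzu: "trig_nonzero us" using nz by (simp add: us_def)
  \<comment> \<open>All frequencies in \<open>us\<close> are nonzero, so its amplitudes decay; those
    of \<open>vs\<close> need only stay bounded.\<close>
  have amp0: "((\<lambda>t. \<Sum>c\<leftarrow>trig_heat t us. \<bar>fst c\<bar>) \<longlongrightarrow> 0) at_top"
    using nzu
  proof (induction us)
    case (Cons c us)
    obtain a k \<theta> where c: "c = (a,k,\<theta>)" by (metis prod_cases3)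
    have kk: "k \<bullet> k > 0" using Cons.prems by (simp add: c)
    have "((\<lambda>t. exp (- (k \<bullet> k) * t)) \<longlongrightarrow> 0) at_top"
      using filterlim_compose[OF exp_at_bot, of "\<lambda>t. - (k \<bullet> k) * t" at_top]
        filterlim_tendsto_neg_mult_at_bot[OF tendsto_const[of "- (k \<bullet> k)"] _ filterlim_ident[of at_top]] kk by simp
    then have "((\<lambda>t. \<bar>a\<bar> * exp (- (k \<bullet> k) * t) + (\<Sum>c\<leftarrow>trig_heat t us. \<bar>fst c\<bar>)) \<longlongrightarrow> \<bar>a\<bar> * 0 + 0) at_top"
      using Cons by (intro tendsto_intros) (auto simp: c)
    then show ?case by (simp add: c abs_mult)
  qed simp
  have ampv: "(\<Sum>c\<leftarrow>trig_heat t vs. \<bar>fst c\<bar>) \<le> (\<Sum>c\<leftarrow>vs. \<bar>fst c\<bar>)" if "t \<ge> 0" for t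
  proof (induction vs)
    case (Cons c vs)
    obtain a k \<theta> where c: "c = (a,k,\<theta>)" by (metis prod_cases3)
    have "\<bar>a\<bar> * exp (- (k \<bullet> k) * t) \<le> \<bar>a\<bar> * 1" using that by (intro mult_left_mono) auto
    then show ?case using Cons by (simp add: c abs_mult)
  qed simp
  define M where "M = (\<Sum>c\<leftarrow>vs. \<bar>fst c\<bar>)"
  have kb: "\<bar>k t\<bar> \<le> (\<Sum>c\<leftarrow>trig_heat t us. \<bar>fst c\<bar>) * M * measure lborel (pbox L :: 'a set)" if t: "t \<ge> 0" for t
  proof -
    have "norm (trig_inner L (trig_heat t us) (trig_heat t vs))
       \<le> ((\<Sum>c\<leftarrow>trig_heat t us. \<bar>fst c\<bar>) * M) * measure lborel (pbox L :: 'a set)"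
      unfolding pbox_def
    proof (rule integrable_bound)
      have s0: "0 \<le> (\<Sum>c\<leftarrow>ws. \<bar>fst c\<bar>)" for ws :: "'a trig" by (induction ws) auto
      then show "0 \<le> (\<Sum>c\<leftarrow>trig_heat t us. \<bar>fst c\<bar>) * M" by (auto simp: M_def)
      show "norm (tev (trig_heat t us) x * tev (trig_heat t vs) x) \<le> (\<Sum>c\<leftarrow>trig_heat t us. \<bar>fst c\<bar>) * M" for x
        unfolding real_norm_def abs_mult
        by (intro mult_mono tev_bound order_trans[OF tev_bound ampv[OF t, folded M_def]] s0) auto
    qed (intro integrable_continuous continuous_intros)
    then show ?thesis by (simp add: k_def)
  qed
  have "((\<lambda>t. (\<Sum>c\<leftarrow>trig_heat t us. \<bar>fst c\<bar>) * M * measure lborel (pbox L :: 'a set)) \<longlongrightarrow> 0 * M * measure lborel (pbox L :: 'a set)) at_top"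
    by (intro tendsto_intros amp0)
  then have lim0: "((\<lambda>t. (\<Sum>c\<leftarrow>trig_heat t us. \<bar>fst c\<bar>) * M * measure lborel (pbox L :: 'a set)) \<longlongrightarrow> 0) at_top"
    by simp
  have "\<forall>\<^sub>F t in at_top. norm (k t) \<le> (\<Sum>c\<leftarrow>trig_heat t us. \<bar>fst c\<bar>) * M * measure lborel (pbox L :: 'a set)"
    unfolding eventually_at_top_linorder real_norm_def using kb by blast
  from Lim_null_comparison[OF this lim0] have "(k \<longlongrightarrow> 0) at_top" .
  then have klim: "((\<lambda>T. \<bar>k 0 - k T\<bar>) \<longlongrightarrow> \<bar>k 0 - 0\<bar>) at_top" by (intro tendsto_intros)
  have "\<forall>\<^sub>F T in at_top. \<bar>k 0 - k T\<bar> \<le> h 0"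
    unfolding eventually_at_top_linorder using kh by blast
  with klim have "\<bar>k 0 - 0\<bar> \<le> h 0"
    by (rule tendsto_upperbound) simp
  then show ?thesis by (simp add: k_def us_def vs_def)
qed

text \<open>Along two solutions of the heat equation, \<open>h'\<close> is the integral of
  \<open>B_u \<Delta>f + B_v \<Delta>g\<close>. The divergence of
  \<open>B_u \<nabla>f + B_v \<nabla>g\<close> has integral 0 and equals that integrand plus the
  Hessian form in the gradients; so \<open>- h'\<close> is the integral of a form bounded below by
  twice the product of any two partial derivatives of \<open>f\<close> and \<open>g\<close>.\<close>

lemma bellman_dissipation:
  fixes xs ys :: "'a::euclidean_space trig"
  assumes L: "L > 0" and e: "e > 0" and q: "1 < q" "q \<le> 2" and p: "p = q / (q - 1)" and A: "A = 12 / (q * (q - 1))"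
    and fr: "trig_freq L xs" "trig_freq L ys" and ij: "i \<in> Basis" "j \<in> Basis"
  defines "h \<equiv> \<lambda>t. integral (pbox L) (\<lambda>x. bellman A p q e (tev (trig_heat t xs) x) (tev (trig_heat t ys) x))"
  obtains h' where "\<And>t. (h has_real_derivative h' t) (at t)"
    "\<And>t. 2 * \<bar>trig_inner L (trig_deriv i (trig_heat t xs)) (trig_deriv j (trig_heat t ys))\<bar> \<le> - h' t"
proof -
  let ?F = "\<lambda>t. tev (trig_heat t xs)" and ?G = "\<lambda>t. tev (trig_heat t ys)"
  let ?F' = "\<lambda>m t. tev (trig_deriv m (trig_heat t xs))" and ?G' = "\<lambda>m t. tev (trig_deriv m (trig_heat t ys))"
  let ?F2 = "\<lambda>m t. tev (trig_deriv m (trig_deriv m (trig_heat t xs)))"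
  let ?G2 = "\<lambda>m t. tev (trig_deriv m (trig_deriv m (trig_heat t ys)))"
  let ?Bu = "bellman_u A p q e" and ?Bv = "bellman_v A q e"
  let ?Buu = "bellman_uu A p q e" and ?Buv = "bellman_uv q e" and ?Bvv = "bellman_vv A q e"
  define d where "d t x = ?Bu (?F t x) (?G t x) * tev (trig_lap (trig_heat t xs)) x
      + ?Bv (?F t x) (?G t x) * tev (trig_lap (trig_heat t ys)) x" for t x
  define hess where "hess t x = (\<Sum>m\<in>Basis. ?Buu (?F t x) (?G t x) * (?F' m t x)\<^sup>2
      + 2 * ?Buv (?F t x) (?G t x) * ?F' m t x * ?G' m t x + ?Bvv (?F t x) (?G t x) * (?G' m t x)\<^sup>2)" for t x
  note cont = continuous_intros e
  have D: "(h has_real_derivative integral (pbox L) (d t)) (at t)" for t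
  proof -
    have "(h has_real_derivative integral (pbox L) (d t)) (at t within UNIV)"
      unfolding h_def pbox_def
    proof (rule leibniz_rule_field_derivative)
      show "(\<lambda>x. bellman A p q e (?F t x) (?G t x)) integrable_on cbox 0 (L *\<^sub>R One)" for t
        by (intro integrable_continuous cont)
      show "continuous_on (UNIV \<times> cbox 0 (L *\<^sub>R One)) (\<lambda>(t, x). d t x)"
        unfolding split_def d_def trig_commute(5) by (intro cont)
      show "((\<lambda>t. bellman A p q e (?F t x) (?G t x)) has_real_derivative d t x) (at t within UNIV)" for x t
        unfolding d_def by (intro bellman_DERIV[OF e] tev_heat_DERIV)
    qed auto
    then show ?thesis by simp
  qed
  have H: "integral (pbox L) (d t) = - integral (pbox L) (hess t)" for t
  proof -
    \<comment> \<open>\<open>g m\<close> is the derivative in direction \<open>m\<close> of the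
      \<open>m\<close>-th component of that vector field; summed over \<open>m\<close> it is
      \<open>d t + hess t\<close>.\<close>
    define g where "g m x = (?Buu (?F t x) (?G t x) * ?F' m t x + ?Buv (?F t x) (?G t x) * ?G' m t x) * ?F' m t x
        + ?Bu (?F t x) (?G t x) * ?F2 m t x
        + ((?Buv (?F t x) (?G t x) * ?F' m t x + ?Bvv (?F t x) (?G t x) * ?G' m t x) * ?G' m t x
        + ?Bv (?F t x) (?G t x) * ?G2 m t x)" for m x
    have gc: "continuous_on UNIV (g m)" for m unfolding g_def by (intro cont)
    have "integral (pbox L) (g m) = 0" if m: "m \<in> Basis" for m
    proof (rule integral_periodic_deriv_0[OF L _ gc m, where f = "\<lambda>x. ?Bu (?F t x) (?G t x) * ?F' m t x + ?Bv (?F t x) (?G t x) * ?G' m t x"])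
      show "continuous_on UNIV (\<lambda>x. ?Bu (?F t x) (?G t x) * ?F' m t x + ?Bv (?F t x) (?G t x) * ?G' m t x)"
        by (intro cont)
      show "((\<lambda>s. ?Bu (?F t (x + s *\<^sub>R m)) (?G t (x + s *\<^sub>R m)) * ?F' m t (x + s *\<^sub>R m)
          + ?Bv (?F t (x + s *\<^sub>R m)) (?G t (x + s *\<^sub>R m)) * ?G' m t (x + s *\<^sub>R m)) has_real_derivative g m (x + s *\<^sub>R m)) (at s)" for x s
        unfolding g_def
        by (rule DERIV_cong[OF DERIV_add[OF DERIV_mult[OF bellman_u_DERIV[OF e tev_DERIV tev_DERIV] tev_DERIV]
             DERIV_mult[OF bellman_v_DERIV[OF e tev_DERIV tev_DERIV] tev_DERIV]]]) (simp add: algebra_simps)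
      show "?Bu (?F t (x + L *\<^sub>R m)) (?G t (x + L *\<^sub>R m)) * ?F' m t (x + L *\<^sub>R m)
          + ?Bv (?F t (x + L *\<^sub>R m)) (?G t (x + L *\<^sub>R m)) * ?G' m t (x + L *\<^sub>R m)
        = ?Bu (?F t x) (?G t x) * ?F' m t x + ?Bv (?F t x) (?G t x) * ?G' m t x" for x
        using fr m by (simp add: tev_periodic)
    qed
    then have "0 = (\<Sum>m\<in>Basis. integral (pbox L) (g m))" by simp
    also have "\<dots> = integral (pbox L) (\<lambda>x. \<Sum>m\<in>Basis. g m x)"
      by (rule integral_sum[symmetric]) (auto intro!: integrable_pbox gc)
    also have "(\<lambda>x. \<Sum>m\<in>Basis. g m x) = (\<lambda>x. d t x + hess t x)"
      by (rule ext) (simp add: g_def d_def hess_def tev_lap sum.distrib sum_distrib_left sum_distrib_right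
           power2_eq_square algebra_simps)
    also have "integral (pbox L) (\<lambda>x. d t x + hess t x) = integral (pbox L) (d t) + integral (pbox L) (hess t)"
      unfolding d_def hess_def by (intro integral_add integrable_pbox cont)
    finally show ?thesis by linarith
  qed
  have lower: "2 * \<bar>integral (pbox L) (\<lambda>x. ?F' i t x * ?G' j t x)\<bar> \<le> integral (pbox L) (hess t)" for t
  proof -
    have "\<bar>integral (pbox L) (\<lambda>x. ?F' i t x * ?G' j t x)\<bar> \<le> integral (pbox L) (\<lambda>x. hess t x / 2)"
    proof -
      have "norm (integral (pbox L) (\<lambda>x. ?F' i t x * ?G' j t x)) \<le> integral (pbox L) (\<lambda>x. hess t x / 2)"
      proof (rule integral_norm_bound_integral)
        fix x
        have "2 * \<bar>?F' i t x\<bar> * \<bar>?G' j t x\<bar> \<le> hess t x"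
          unfolding hess_def
          by (rule quadratic_form_sum_lower)
             (use bellman_hessian_bounds[OF e q p A] ij in auto)
        then show "norm (?F' i t x * ?G' j t x) \<le> hess t x / 2" by (simp add: abs_mult)
      next
        show "(\<lambda>x. hess t x / 2) integrable_on pbox L"
          unfolding hess_def by (intro integrable_pbox cont) auto
      qed (intro integrable_pbox cont)
      then show ?thesis by simp
    qed
    then show ?thesis by simp
  qed
  show thesis by (rule that[of "\<lambda>t. integral (pbox L) (d t)"]) (use D H lower in auto)
qed

section \<open>From the Bellman estimate to a bilinear bound in Lebesgue norms\<close>

lemma integral_regularised_tendsto:
  fixes f :: "'a::euclidean_space \<Rightarrow> real"
  assumes c: "continuous_on UNIV f" and r: "r > 0"
  shows "(\<lambda>n. integral (pbox L) (\<lambda>x. ((f x)\<^sup>2 + (1 / Suc n)\<^sup>2) powr (r/2))) \<longlonglongrightarrow> lpow L r f"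
proof (rule dominated_convergence(2)[where h="\<lambda>x. ((f x)\<^sup>2 + 1) powr (r/2)"])
  have pos: "(f x)\<^sup>2 + (1 / real (Suc n))\<^sup>2 > 0" "(f x)\<^sup>2 + 1 > 0" for x n
    by (auto intro!: add_nonneg_pos simp del: of_nat_Suc)
  show "(\<lambda>x. ((f x)\<^sup>2 + (1 / real (Suc n))\<^sup>2) powr (r/2)) integrable_on pbox L" for n
    by (intro integrable_pbox continuous_intros c) (use pos in \<open>auto simp: less_imp_neq[symmetric] simp del: of_nat_Suc\<close>)
  show "(\<lambda>x. ((f x)\<^sup>2 + 1) powr (r/2)) integrable_on pbox L"
    by (intro integrable_pbox continuous_intros c) (use pos in \<open>auto simp: less_imp_neq[symmetric]\<close>)
  show "norm (((f x)\<^sup>2 + (1 / real (Suc n))\<^sup>2) powr (r/2)) \<le> ((f x)\<^sup>2 + 1) powr (r/2)" for n x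
  proof -
    have "(1 / real (Suc n))\<^sup>2 \<le> 1" by (intro power_le_one) auto
    then show ?thesis using r by (auto intro!: powr_mono2 simp del: of_nat_Suc)
  qed
  show "(\<lambda>n. ((f x)\<^sup>2 + (1 / real (Suc n))\<^sup>2) powr (r/2)) \<longlonglongrightarrow> \<bar>f x\<bar> powr r" if "x \<in> pbox L" for x
  proof -
    have "(\<lambda>n. (1 / real (Suc n))) \<longlonglongrightarrow> 0" by (rule LIMSEQ_Suc[OF lim_1_over_n])
    then have "(\<lambda>n. ((f x)\<^sup>2 + (1 / real (Suc n))\<^sup>2)) \<longlonglongrightarrow> (f x)\<^sup>2 + 0\<^sup>2"
      by (intro tendsto_intros)
    then have "(\<lambda>n. ((f x)\<^sup>2 + (1 / real (Suc n))\<^sup>2) powr (r/2)) \<longlonglongrightarrow> ((f x)\<^sup>2 + 0\<^sup>2) powr (r/2)"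
      using r by (intro tendsto_powr2 tendsto_const) (auto intro!: always_eventually)
    also have "((f x)\<^sup>2 + 0\<^sup>2) powr (r/2) = \<bar>f x\<bar> powr r"
    proof -
      have "(f x)\<^sup>2 = \<bar>f x\<bar> powr 2" by (cases "f x = 0") (auto simp: powr_numeral)
      then have "((f x)\<^sup>2 + 0\<^sup>2) powr (r/2) = (\<bar>f x\<bar> powr 2) powr (r/2)" by simp
      also have "\<dots> = \<bar>f x\<bar> powr (2 * (r/2))" by (rule powr_powr)
      finally show ?thesis by simp
    qed
    finally show ?thesis .
  qed
qed

definition pnorm :: "real \<Rightarrow> real \<Rightarrow> ('a::euclidean_space \<Rightarrow> real) \<Rightarrow> real" where
  "pnorm L r f = (lpow L r f) powr (1 / r)"

lemma integral_powr_nonneg: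
  fixes f :: "'a::euclidean_space \<Rightarrow> real"
  shows "0 \<le> lpow L r f"
  by (cases "(\<lambda>x. \<bar>f x\<bar> powr r) integrable_on pbox L")
     (auto intro: integral_nonneg simp: not_integrable_integral)

abbreviation riesz_pairing :: "real \<Rightarrow> 'a::euclidean_space \<Rightarrow> 'a trig \<Rightarrow> 'a \<Rightarrow> 'a trig \<Rightarrow> real" where
  "riesz_pairing L i xs j ys \<equiv> trig_inner L (trig_deriv i (trig_invlap xs)) (trig_deriv j ys)"

text \<open>The Bellman function treats its arguments differently, the first with the exponent
  \<open>p \<ge> 2\<close>, the second with \<open>q \<le> 2\<close>. The inverse Laplacian may sit
  on either of them, and the two cases together cover all exponents above 1.\<close>

lemma bilinear_sum_bound:
  assumes q: "1 < q" "q \<le> 2" and p: "p = q / (q - 1)"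
  shows "\<exists>C>0. \<forall>L xs (ys :: 'a::euclidean_space trig). \<forall>i\<in>Basis. \<forall>j\<in>Basis. L > 0 \<longrightarrow> trig_freq L xs \<longrightarrow> trig_freq L ys \<longrightarrow>
    (trig_nonzero xs \<longrightarrow> \<bar>riesz_pairing L i xs j ys\<bar>
      \<le> C * (lpow L p (tev xs) + lpow L q (tev ys))) \<and>
    (trig_nonzero ys \<longrightarrow> \<bar>riesz_pairing L j ys i xs\<bar>
      \<le> C * (lpow L p (tev xs) + lpow L q (tev ys)))"
proof -
  define A where "A = 12 / (q * (q - 1))"
  have A: "A > 0" using q by (simp add: A_def)
  have p0: "p > 0" using q by (simp add: p)
  show ?thesis
  proof (intro exI[of _ "A + 2"] conjI allI ballI impI)
    fix L and xs ys :: "'a trig" and i j :: 'a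
    assume L: "L > 0" and ij: "i \<in> Basis" "j \<in> Basis" and fr: "trig_freq L xs" "trig_freq L ys"
    let ?h = "\<lambda>e t. integral (pbox L) (\<lambda>x. bellman A p q e (tev (trig_heat t xs) x) (tev (trig_heat t ys) x))"
    let ?If = "lpow L p (tev xs)" and ?Ig = "lpow L q (tev ys)"
    have hpos: "?h e t \<ge> 0" if "e > 0" for e t
      by (intro integral_nonneg integrable_pbox continuous_intros continuous_on_bell that bellman_nonneg[OF that q p A_def])
    \<comment> \<open>The Bellman functional at time 0 is estimated by the size condition, and the
      smoothing parameter is then sent to 0; \<open>A + 2\<close> is the larger of the two
      coefficients in \<open>bellman_le\<close>.\<close>
    have lim: "X \<le> (A + 2) * (?If + ?Ig)" if X: "\<And>e. e > 0 \<Longrightarrow> X \<le> ?h e 0" for X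
    proof -
      let ?u = "\<lambda>n. (A + 1) * integral (pbox L) (\<lambda>x. ((tev xs x)\<^sup>2 + (1 / Suc n)\<^sup>2) powr (p/2))
            + (A + 2) * integral (pbox L) (\<lambda>x. ((tev ys x)\<^sup>2 + (1 / Suc n)\<^sup>2) powr (q/2))"
      have le: "X \<le> ?u n" for n
      proof -
        have e: "1 / real (Suc n) > 0" by simp
        have pos: "(f x)\<^sup>2 + (1 / real (Suc n))\<^sup>2 \<noteq> 0" for x and f :: "'a \<Rightarrow> real"
          using e by (metis add_nonneg_eq_0_iff less_irrefl zero_eq_power2 zero_le_power2)
        have "X \<le> ?h (1 / Suc n) 0" using X e by blast
        also have "\<dots> \<le> integral (pbox L) (\<lambda>x. (A + 1) * ((tev xs x)\<^sup>2 + (1 / Suc n)\<^sup>2) powr (p/2)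
            + (A + 2) * ((tev ys x)\<^sup>2 + (1 / Suc n)\<^sup>2) powr (q/2))"
          unfolding trig_heat_0
          by (intro integral_pbox_mono continuous_intros continuous_on_bell e bellman_le[OF e q p A_def] ballI pos)
        also have "\<dots> = ?u n"
          by (subst integral_add) (auto intro!: integrable_pbox continuous_intros simp: pos simp del: of_nat_Suc)
        finally show ?thesis .
      qed
      have "?u \<longlonglongrightarrow> (A + 1) * ?If + (A + 2) * ?Ig"
        using p0 q by (intro tendsto_intros integral_regularised_tendsto) auto
      then have "X \<le> (A + 1) * ?If + (A + 2) * ?Ig"
        by (rule LIMSEQ_le_const) (use le in auto)
      also have "\<dots> \<le> (A + 2) * ?If + (A + 2) * ?Ig"
        by (intro add_right_mono mult_right_mono integral_powr_nonneg) auto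
      finally show ?thesis by (simp add: algebra_simps)
    qed
    have hd: thesis if "\<And>h'. (\<And>t. (?h e has_real_derivative h' t) (at t)) \<Longrightarrow>
        (\<And>t. 2 * \<bar>trig_inner L (trig_deriv i (trig_heat t xs)) (trig_deriv j (trig_heat t ys))\<bar> \<le> - h' t) \<Longrightarrow> thesis"
      "e > 0" for e thesis
      using bellman_dissipation[OF L \<open>e > 0\<close> q p A_def fr ij] that(1) by blast
    show "\<bar>riesz_pairing L i xs j ys\<bar> \<le> (A + 2) * (?If + ?Ig)" if nz: "trig_nonzero xs"
    proof (rule lim)
      fix e :: real assume e: "e > 0"
      show "\<bar>riesz_pairing L i xs j ys\<bar> \<le> ?h e 0"
        by (rule hd[OF _ e], rule heat_pairing_bound[OF L fr nz ij]) (use hpos[OF e] in auto)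
    qed
    show "\<bar>riesz_pairing L j ys i xs\<bar> \<le> (A + 2) * (?If + ?Ig)" if nz: "trig_nonzero ys"
    proof (rule lim)
      fix e :: real assume e: "e > 0"
      show "\<bar>riesz_pairing L j ys i xs\<bar> \<le> ?h e 0"
        by (rule hd[OF _ e], rule heat_pairing_bound[OF L fr(2,1) nz ij(2,1)]) (use hpos[OF e] in \<open>auto simp: mult.commute\<close>)
    qed
  qed (use A in auto)
qed

lemma bilinear_sum_bound':
  assumes r: "1 < r" and s: "1 / r + 1 / s = 1"
  shows "\<exists>C>0. \<forall>L xs (ys :: 'a::euclidean_space trig). \<forall>i\<in>Basis. \<forall>j\<in>Basis. L > 0 \<longrightarrow> trig_freq L xs \<longrightarrow> trig_freq L ys \<longrightarrow> trig_nonzero xs \<longrightarrow>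
    \<bar>riesz_pairing L i xs j ys\<bar>
      \<le> C * (lpow L r (tev xs) + lpow L s (tev ys))"
proof (cases "r \<le> 2")
  case True
  have "s = r / (r - 1)" using r s by (cases "s = 0") (auto simp: field_simps)
  from bilinear_sum_bound[OF r True this, where 'a='a] obtain C where "C > 0" and
    C: "\<And>L i j xs ys :: 'a trig. i \<in> Basis \<Longrightarrow> j \<in> Basis \<Longrightarrow> L > 0 \<Longrightarrow> trig_freq L xs \<Longrightarrow> trig_freq L ys \<Longrightarrow> trig_nonzero ys \<Longrightarrow>
      \<bar>riesz_pairing L j ys i xs\<bar>
      \<le> C * (lpow L s (tev xs) + lpow L r (tev ys))" by blast
  show ?thesis
    by (intro exI[of _ C] conjI allI ballI impI \<open>C > 0\<close>, subst add.commute) (rule C)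
next
  case False
  have s0: "s \<noteq> 0" using r s by auto
  have rs: "r = s / (s - 1)" "1 < s" "s \<le> 2"
  proof -
    have "1 / s = 1 - 1 / r" using s by simp
    moreover have "1 / r < 1" "1 / r \<le> 1 / 2" "1 / r > 0" using r False by auto
    ultimately have s1: "1 / s < 1" "1 / s \<ge> 1/2" by linarith+
    then have "s > 0" by (metis less_le_trans half_gt_zero zero_less_divide_1_iff zero_less_one)
    with s1 show "1 < s" "s \<le> 2" by (simp_all add: field_simps)
    then show "r = s / (s - 1)" using r s by (auto simp: field_simps)
  qed
  from bilinear_sum_bound[OF rs(2,3,1), where 'a='a] show ?thesis by blast
qed

lemma bilinear_norm_bound:
  assumes r: "1 < r" and s: "1 / r + 1 / s = 1"
  shows "\<exists>C>0. \<forall>L xs (ys :: 'a::euclidean_space trig). \<forall>i\<in>Basis. \<forall>j\<in>Basis. L > 0 \<longrightarrow> trig_freq L xs \<longrightarrow> trig_freq L ys \<longrightarrow> trig_nonzero xs \<longrightarrow>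
    \<bar>riesz_pairing L i xs j ys\<bar>
      \<le> C * pnorm L r (tev xs) * pnorm L s (tev ys)"
proof -
  from bilinear_sum_bound'[OF assms, where 'a='a] obtain C where C0: "C > 0" and
    C: "\<And>L i j xs ys :: 'a trig. i \<in> Basis \<Longrightarrow> j \<in> Basis \<Longrightarrow> L > 0 \<Longrightarrow> trig_freq L xs \<Longrightarrow> trig_freq L ys \<Longrightarrow> trig_nonzero xs \<Longrightarrow>
    \<bar>riesz_pairing L i xs j ys\<bar>
      \<le> C * (lpow L r (tev xs) + lpow L s (tev ys))" by blast
  have s1: "s > 1"
  proof -
    have "1 / s = 1 - 1 / r" using s by simp
    moreover have "1 / r < 1" "1 / r > 0" using r by auto
    ultimately have "0 < 1 / s" "1 / s < 1" by linarith+
    then show ?thesis by (simp add: field_simps)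
  qed
  show ?thesis
  proof (intro exI[of _ "2 * C"] conjI allI ballI impI)
    fix L and xs ys :: "'a trig" and i j :: 'a
    assume a: "L > 0" "i \<in> Basis" "j \<in> Basis" "trig_freq L xs" "trig_freq L ys" "trig_nonzero xs"
    let ?I = "\<lambda>xs ys. riesz_pairing L i xs j ys"
    \<comment> \<open>Both functions are scaled to norm at most 1, where the sum of the powers is at
      most 2. The shift \<open>\<delta>\<close> keeps the scaling defined when a norm vanishes; it
      is removed by a limit.\<close>
    have scaled: "\<bar>?I xs ys\<bar> \<le> 2 * C * (pnorm L r (tev xs) + \<delta>) * (pnorm L s (tev ys) + \<delta>)" if d: "\<delta> > 0" for \<delta>
    proof -
      have np: "pnorm L t f \<ge> 0" for t and f :: "'a \<Rightarrow> real" by (simp add: pnorm_def)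
      define la where "la = 1 / (pnorm L r (tev xs) + \<delta>)"
      define mu where "mu = 1 / (pnorm L s (tev ys) + \<delta>)"
      have lm: "la > 0" "mu > 0" using d np[of r "tev xs"] np[of s "tev ys"] by (auto simp: la_def mu_def intro!: add_nonneg_pos)
      have le1: "lpow L t (tev (trig_scale c zs)) \<le> 1"
        if "c = 1 / (pnorm L t (tev zs) + \<delta>)" "t > 1" for c t and zs :: "'a trig"
      proof -
        have c: "c > 0" using that d np[of t "tev zs"] by (auto intro!: add_nonneg_pos)
        have "lpow L t (tev (trig_scale c zs)) = c powr t * lpow L t (tev zs)"
          using c by (simp add: tev_scale abs_mult powr_mult)
        also have "lpow L t (tev zs) = pnorm L t (tev zs) powr t"
          using that integral_powr_nonneg[of L "tev zs" t] by (simp add: pnorm_def powr_powr)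
        also have "c powr t * pnorm L t (tev zs) powr t = (c * pnorm L t (tev zs)) powr t"
          using c np by (simp add: powr_mult)
        also have "\<dots> \<le> 1 powr t"
        proof (rule powr_mono2)
          show "c * pnorm L t (tev zs) \<le> 1" using np[of t "tev zs"] d unfolding that(1) by simp
        qed (use that c np[of t "tev zs"] in auto)
        finally show ?thesis by simp
      qed
      have "\<bar>?I (trig_scale la xs) (trig_scale mu ys)\<bar> \<le> C * (lpow L r (tev (trig_scale la xs)) + lpow L s (tev (trig_scale mu ys)))"
        by (rule C) (use a in auto)
      also have "\<dots> \<le> C * (1 + 1)"
        using C0 r s1 by (intro mult_left_mono add_mono le1) (auto simp: la_def mu_def)
      also have "?I (trig_scale la xs) (trig_scale mu ys) = la * mu * ?I xs ys"
        by (simp add: trig_commute tev_scale integral_mult_right[symmetric] algebra_simps del: integral_mult_right)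
      finally have "la * mu * \<bar>?I xs ys\<bar> \<le> 2 * C" using lm by (simp add: abs_mult)
      then have "\<bar>?I xs ys\<bar> \<le> 2 * C / (la * mu)" using lm by (simp add: pos_le_divide_eq mult.commute)
      then show ?thesis using lm by (simp add: la_def mu_def)
    qed
    have "((\<lambda>\<delta>. 2 * C * (pnorm L r (tev xs) + \<delta>) * (pnorm L s (tev ys) + \<delta>)) \<longlongrightarrow>
       2 * C * (pnorm L r (tev xs) + 0) * (pnorm L s (tev ys) + 0)) (at_right 0)"
      by (intro tendsto_intros)
    then have "\<bar>?I xs ys\<bar> \<le> 2 * C * (pnorm L r (tev xs) + 0) * (pnorm L s (tev ys) + 0)"
      by (rule tendsto_lowerbound) (auto intro!: eventually_mono[OF eventually_at_right_less scaled])
    then show "\<bar>?I xs ys\<bar> \<le> 2 * C * pnorm L r (tev xs) * pnorm L s (tev ys)" by simp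
  qed (use C0 in auto)
qed

section \<open>Density of trigonometric polynomials among continuous periodic functions\<close>

lemma tev_product:
  assumes "trig_freq L xs" "trig_freq L ys"
  shows "\<exists>zs. trig_freq L zs \<and> (\<forall>x. tev zs x = tev xs x * tev ys x)"
  using assms(1)
proof (induction xs)
  case Nil
  show ?case by (intro exI[of _ "[]"]) auto
next
  case (Cons c xs)
  obtain a k \<theta> where c: "c = (a,k,\<theta>)" by (metis prod_cases3)
  obtain zs where zs: "trig_freq L zs" "\<And>x. tev zs x = tev xs x * tev ys x" using Cons by (auto simp: c)
  have "\<exists>ws. trig_freq L ws \<and> (\<forall>x. tev ws x = a * cos (k \<bullet> x + \<theta>) * tev ys x)"
    using assms(2)
  proof (induction ys)
    case Nil
    show ?case by (intro exI[of _ "[]"]) auto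
  next
    case (Cons d ys)
    obtain b l \<eta> where d: "d = (b,l,\<eta>)" by (metis prod_cases3)
    obtain ws where ws: "trig_freq L ws" "\<And>x. tev ws x = a * cos (k \<bullet> x + \<theta>) * tev ys x" using Cons by (auto simp: d)
    have k: "\<forall>i\<in>Basis. \<exists>m::int. L * (k \<bullet> i) = 2 * pi * m" using \<open>trig_freq L (c # xs)\<close> by (simp add: c)
    have l: "\<forall>i\<in>Basis. \<exists>m::int. L * (l \<bullet> i) = 2 * pi * m" using Cons.prems by (simp add: d)
    have kl: "\<exists>m::int. L * ((k + l) \<bullet> i) = 2 * pi * m" "\<exists>m::int. L * ((k - l) \<bullet> i) = 2 * pi * m" if "i \<in> Basis" for i
    proof -
      obtain m n :: int where mn: "L * (k \<bullet> i) = 2 * pi * m" "L * (l \<bullet> i) = 2 * pi * n" using k l \<open>i \<in> Basis\<close> by blast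
      show "\<exists>m::int. L * ((k + l) \<bullet> i) = 2 * pi * m"
        by (rule exI[of _ "m + n"]) (simp add: inner_add_left distrib_left mn)
      show "\<exists>m::int. L * ((k - l) \<bullet> i) = 2 * pi * m"
        by (rule exI[of _ "m - n"]) (simp add: inner_diff_left right_diff_distrib mn)
    qed
    have "tev ((a*b/2, k + l, \<theta> + \<eta>) # (a*b/2, k - l, \<theta> - \<eta>) # ws) x = a * cos (k \<bullet> x + \<theta>) * tev (d # ys) x" for x
    proof -
      have 1: "(k + l) \<bullet> x + (\<theta> + \<eta>) = (k \<bullet> x + \<theta>) + (l \<bullet> x + \<eta>)" "(k - l) \<bullet> x + (\<theta> - \<eta>) = (k \<bullet> x + \<theta>) - (l \<bullet> x + \<eta>)"
        by (simp_all add: inner_add_left inner_diff_left)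
      have "a*b/2 * cos (u + v) + a*b/2 * cos (u - v) = a * cos u * (b * cos v)" for u v
        by (simp add: cos_add cos_diff field_simps)
      from this[of "k \<bullet> x + \<theta>" "l \<bullet> x + \<eta>"] show ?thesis
        unfolding d tev_simps 1 ws distrib_left by linarith
    qed
    then show ?case using ws kl by (intro exI[of _ "(a*b/2, k + l, \<theta> + \<eta>) # (a*b/2, k - l, \<theta> - \<eta>) # ws"]) auto
  qed
  then obtain ws where "trig_freq L ws" "\<And>x. tev ws x = a * cos (k \<bullet> x + \<theta>) * tev ys x" by blast
  then show ?case using zs
    by (intro exI[of _ "ws @ zs"]) (auto simp: trig_freq_append tev_append c algebra_simps)
qed

lemma periodic_lattice:
  fixes f :: "'a::euclidean_space \<Rightarrow> 'b"
  assumes per: "\<And>x i. i \<in> Basis \<Longrightarrow> f (x + L *\<^sub>R i) = f x"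
  shows "f (x + (\<Sum>i\<in>Basis. (L * of_int (m i)) *\<^sub>R i)) = f x"
proof -
  have one: "f (x + (L * of_int k) *\<^sub>R i) = f x" if i: "i \<in> Basis" for i x and k :: int
  proof -
    have pos: "f (x + (L * real n) *\<^sub>R i) = f x" for n x
    proof (induction n)
      case (Suc n)
      have "f (x + (L * real (Suc n)) *\<^sub>R i) = f ((x + (L * real n) *\<^sub>R i) + L *\<^sub>R i)"
        by (simp add: algebra_simps)
      then show ?case using per[OF i] Suc by simp
    qed simp
    show ?thesis
    proof (cases "k \<ge> 0")
      case True
      then show ?thesis using pos[of x "nat k"] by simp
    next
      case False
      then show ?thesis using pos[of "x + (L * of_int k) *\<^sub>R i" "nat (- k)"] by (simp add: algebra_simps)
    qed
  qed
  have "f (x + (\<Sum>i\<in>S. (L * of_int (m i)) *\<^sub>R i)) = f x" if "finite S" "S \<subseteq> Basis" for S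
    using that
  proof (induction S rule: finite_induct)
    case (insert j S)
    have "f (x + (\<Sum>i\<in>insert j S. (L * of_int (m i)) *\<^sub>R i)) = f ((x + (\<Sum>i\<in>S. (L * of_int (m i)) *\<^sub>R i)) + (L * of_int (m j)) *\<^sub>R j)"
      using insert by (simp add: algebra_simps)
    then show ?case using insert one by auto
  qed simp
  from this[of Basis] show ?thesis by simp
qed

text \<open>Periodic functions are functions on a torus, which \<open>\<pi>\<close> embeds in a
  Euclidean space by the cosines and sines of the coordinates. On the compact image the coordinate
  functions are waves and separate points, so Stone-Weierstrass applies.\<close>

lemma trig_dense:
  fixes f :: "'a::euclidean_space \<Rightarrow> real"
  assumes L: "L > 0" and cont: "continuous_on UNIV f" and per: "\<And>x i. i \<in> Basis \<Longrightarrow> f (x + L *\<^sub>R i) = f x" and e: "e > 0"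
  shows "\<exists>xs. trig_freq L xs \<and> (\<forall>x. \<bar>f x - tev xs x\<bar> < e)"
proof -
  define w where "w = 2 * pi / L"
  have w: "w > 0" "w * L = 2 * pi" using L by (auto simp: w_def)
  define \<pi> :: "'a \<Rightarrow> 'a \<times> 'a" where
    "\<pi> x = (\<Sum>i\<in>Basis. cos (w * (x \<bullet> i)) *\<^sub>R i, \<Sum>i\<in>Basis. sin (w * (x \<bullet> i)) *\<^sub>R i)" for x
  have pi_comp: "fst (\<pi> x) \<bullet> i = cos (w * (x \<bullet> i))" "snd (\<pi> x) \<bullet> i = sin (w * (x \<bullet> i))" if "i \<in> Basis" for x i
    using that by (simp_all add: \<pi>_def)
  have contpi: "continuous_on X \<pi>" for X unfolding \<pi>_def by (intro continuous_intros)
  have same: "\<exists>m. y = x + (\<Sum>i\<in>Basis. (L * of_int (m i)) *\<^sub>R i)" if "\<pi> x = \<pi> y" for x y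
  proof -
    have "\<exists>m::int. y \<bullet> i = x \<bullet> i + L * m" if i: "i \<in> Basis" for i
    proof -
      have "sin (w * (y \<bullet> i)) = sin (w * (x \<bullet> i)) \<and> cos (w * (y \<bullet> i)) = cos (w * (x \<bullet> i))"
        using pi_comp[OF i, of x] pi_comp[OF i, of y] \<open>\<pi> x = \<pi> y\<close> by simp
      then obtain n :: int where "w * (y \<bullet> i) = w * (x \<bullet> i) + 2 * pi * n"
        unfolding sin_cos_eq_iff by blast
      then have "w * (y \<bullet> i) = w * (x \<bullet> i + L * n)" using w by (simp add: algebra_simps)
      then show ?thesis using w by auto
    qed
    then obtain m :: "'a \<Rightarrow> int" where m: "\<And>i. i \<in> Basis \<Longrightarrow> y \<bullet> i = x \<bullet> i + L * m i" by metis
    show ?thesis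
      by (intro exI[of _ m], rule euclidean_eqI) (simp add: m inner_add_left)
  qed
  have fac: "f x = f y" if "\<pi> x = \<pi> y" for x y
    using same[OF that] periodic_lattice[OF per] by metis
  define S where "S = \<pi> ` pbox L"
  have inS: "\<pi> x \<in> S" for x
  proof -
    define m where "m i = \<lfloor>(x \<bullet> i) / L\<rfloor>" for i
    define y where "y = x + (\<Sum>i\<in>Basis. (L * of_int (- m i)) *\<^sub>R i)"
    have "cos (w * (x \<bullet> i + L * of_int k)) = cos (w * (x \<bullet> i))" "sin (w * (x \<bullet> i + L * of_int k)) = sin (w * (x \<bullet> i))" for i and k :: int
    proof -
      have "w * (x \<bullet> i + L * of_int k) = w * (x \<bullet> i) + 2 * pi * k" using w(2) by (simp add: algebra_simps)
      then show "cos (w * (x \<bullet> i + L * of_int k)) = cos (w * (x \<bullet> i))" "sin (w * (x \<bullet> i + L * of_int k)) = sin (w * (x \<bullet> i))"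
        using sin_cos_eq_iff[of "w * (x \<bullet> i) + 2 * pi * k" "w * (x \<bullet> i)"] by auto
    qed
    note cs = this
    have "\<pi> y = \<pi> x"
      unfolding \<pi>_def y_def using cs[of _ "- m _"]
      by (simp add: inner_add_left del: of_int_minus)
    moreover have "y \<in> pbox L"
    proof -
      have "0 \<le> y \<bullet> i \<and> y \<bullet> i \<le> L" if "i \<in> Basis" for i
      proof -
        have "y \<bullet> i = x \<bullet> i + L * of_int (- m i)" using that by (simp add: y_def inner_add_left del: of_int_minus)
        then have "y \<bullet> i = x \<bullet> i - L * m i" by simp
        moreover have "of_int (m i) \<le> (x \<bullet> i) / L" "(x \<bullet> i) / L < of_int (m i) + 1" unfolding m_def by linarith+
        ultimately show ?thesis using L by (simp add: field_simps)
      qed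
      then show ?thesis by (simp add: pbox_def mem_box)
    qed
    ultimately show ?thesis unfolding S_def by (metis imageI)
  qed
  have compS: "compact S" unfolding S_def pbox_def by (intro compact_continuous_image contpi compact_cbox)
  define g where "g p = f (SOME x. \<pi> x = p)" for p
  have g: "g (\<pi> x) = f x" for x
    unfolding g_def by (rule fac) (rule someI[of "\<lambda>y. \<pi> y = \<pi> x"], rule refl)
  \<comment> \<open>Restricted to the compact cube, \<open>\<pi>\<close> is a closed map: the
    preimage of a closed set under \<open>g\<close> is the image of a compact set.\<close>
  have contg: "continuous_on S g"
  proof -
    have "closed (g -` B \<inter> S)" if "closed B" for B
    proof -
      have "g -` B \<inter> S = \<pi> ` (pbox L \<inter> f -` B)" unfolding S_def by (auto simp: g)
      moreover have "compact (pbox L \<inter> f -` B)"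
        unfolding pbox_def
        by (intro compact_Int_closed compact_cbox continuous_closed_vimage that)
           (use cont in \<open>auto simp: continuous_on_eq_continuous_at\<close>)
      ultimately show ?thesis by (simp add: compact_imp_closed compact_continuous_image contpi)
    qed
    then show ?thesis using continuous_on_closed_vimage[OF compact_imp_closed[OF compS]] by blast
  qed
  define R where "R = {h. continuous_on S h \<and> (\<exists>xs. trig_freq L xs \<and> (\<forall>x. h (\<pi> x) = tev xs x))}"
  interpret function_ring_on R S
  proof
    show "compact S" by (rule compS)
    show "continuous_on S h" if "h \<in> R" for h using that by (simp add: R_def)
    show "(\<lambda>x. h x + k x) \<in> R" if hk: "h \<in> R" "k \<in> R" for h k
    proof -
      obtain xs ys where "trig_freq L xs" "\<And>x. h (\<pi> x) = tev xs x" "trig_freq L ys" "\<And>x. k (\<pi> x) = tev ys x"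
        using hk by (auto simp: R_def)
      then show ?thesis using hk
        by (auto simp: R_def trig_freq_append tev_append intro!: continuous_intros exI[of _ "xs @ ys"])
    qed
    show "(\<lambda>x. h x * k x) \<in> R" if hk: "h \<in> R" "k \<in> R" for h k
    proof -
      obtain xs ys where xy: "trig_freq L xs" "\<And>x. h (\<pi> x) = tev xs x" "trig_freq L ys" "\<And>x. k (\<pi> x) = tev ys x"
        using hk by (auto simp: R_def)
      from tev_product[OF xy(1,3)] obtain zs where "trig_freq L zs" "\<And>x. tev zs x = tev xs x * tev ys x" by blast
      then show ?thesis using hk xy
        by (auto simp: R_def intro!: continuous_intros exI[of _ zs])
    qed
    show "(\<lambda>_. c) \<in> R" for c
      unfolding R_def by (auto intro!: exI[of _ "[(c, 0, 0)]"])
    show "\<exists>h\<in>R. h p \<noteq> h r" if pr: "p \<in> S" "r \<in> S" "p \<noteq> r" for p r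
    proof -
      have freqi: "\<exists>m::int. L * (w *\<^sub>R i \<bullet> j) = 2 * pi * m" if "i \<in> Basis" "j \<in> Basis" for i j :: 'a
      proof (rule exI[of _ "if i = j then 1 else 0"])
        show "L * (w *\<^sub>R i \<bullet> j) = 2 * pi * real_of_int (if i = j then 1 else 0)"
          using that w by (simp add: inner_Basis mult.commute)
      qed
      have c: "(\<lambda>p. fst p \<bullet> i) \<in> R" if i: "i \<in> Basis" for i
        unfolding R_def using freqi i
        by (auto simp: pi_comp inner_commute[of i] intro!: continuous_intros exI[of _ "[(1, w *\<^sub>R i, 0)]"])
      have s: "(\<lambda>p. snd p \<bullet> i) \<in> R" if i: "i \<in> Basis" for i
      proof -
        have "sin t = cos (t + - pi / 2)" for t :: real by (simp add: cos_diff)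
        then show ?thesis
          unfolding R_def using freqi i
          by (auto simp: pi_comp inner_commute[of i] intro!: continuous_intros exI[of _ "[(1, w *\<^sub>R i, - pi/2)]"])
      qed
      have "fst p \<noteq> fst r \<or> snd p \<noteq> snd r" using pr(3) by (simp add: prod_eq_iff)
      then obtain i where "i \<in> Basis" "fst p \<bullet> i \<noteq> fst r \<bullet> i \<or> snd p \<bullet> i \<noteq> snd r \<bullet> i"
        by (metis euclidean_eqI)
      then show ?thesis
        using bexI[of "\<lambda>h. h p \<noteq> h r" "\<lambda>p. fst p \<bullet> i" R] bexI[of "\<lambda>h. h p \<noteq> h r" "\<lambda>p. snd p \<bullet> i" R]
          c[of i] s[of i] by blast
    qed
  qed
  from Stone_Weierstrass_basic[OF contg e] obtain h where h: "h \<in> R" "\<forall>p\<in>S. \<bar>g p - h p\<bar> < e" by blast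
  then obtain xs where xs: "trig_freq L xs" "\<And>x. h (\<pi> x) = tev xs x" by (auto simp: R_def)
  have "\<bar>f x - tev xs x\<bar> < e" for x using h(2) inS[of x] by (auto simp: g xs(2)[symmetric])
  then show ?thesis using xs(1) by blast
qed

section \<open>Power inequalities, Riesz transforms and a Poincare inequality\<close>

lemma powr_tangent:
  fixes t m r :: real
  assumes "t \<ge> 0" "m > 0" "r > 1"
  shows "m powr r + r * m powr (r - 1) * (t - m) \<le> t powr r"
proof -
  have "t * m powr (r - 1) \<le> t powr r / r + (m powr (r - 1)) powr (r / (r - 1)) / (r / (r - 1))"
    by (rule Youngs_inequality) (use assms in \<open>auto simp: field_simps\<close>)
  also have "(m powr (r - 1)) powr (r / (r - 1)) = m powr r"
    using assms by (simp add: powr_powr)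
  finally have "r * (t * m powr (r - 1)) \<le> r * (t powr r / r + m powr r / (r / (r - 1)))"
    using assms by (intro mult_left_mono) auto
  also have "\<dots> = t powr r + (r - 1) * m powr r" using assms by (simp add: field_simps)
  finally have a: "r * (t * m powr (r - 1)) \<le> t powr r + (r - 1) * m powr r" .
  have "m powr (r - 1) * m = m powr r" using assms by (simp add: powr_diff)
  then have "r * m powr (r - 1) * (t - m) = r * (t * m powr (r - 1)) - r * m powr r"
    by (simp add: algebra_simps)
  moreover have "(r - 1) * m powr r = r * m powr r - m powr r" by (simp add: algebra_simps)
  ultimately show ?thesis using a by linarith
qed

text \<open>The tangent to the power at the mean value of \<open>f\<close> is integrated over a set
  of measure \<open>V\<close>; its linear term drops out.\<close>

lemma integral_powr_jensen:
  fixes f :: "'a::euclidean_space \<Rightarrow> real"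
  assumes f: "f integrable_on S" "(\<lambda>x. f x powr r) integrable_on S" and nn: "\<And>x. x \<in> S \<Longrightarrow> f x \<ge> 0"
    and V: "((\<lambda>_. 1) has_integral V) S" "V > 0" and r: "r > 1"
  shows "(integral S f) powr r \<le> V powr (r - 1) * integral S (\<lambda>x. f x powr r)"
proof (cases "integral S f = 0")
  case True
  then show ?thesis using V by (auto intro!: mult_nonneg_nonneg integral_nonneg f)
next
  case False
  then have I: "integral S f > 0" using integral_nonneg[OF f(1) nn] by simp
  define m where "m = integral S f / V"
  have m: "m > 0" "integral S f = m * V" using I V by (auto simp: m_def)
  have c: "((\<lambda>_. a) has_integral a * V) S" for a using has_integral_mult_right[OF V(1), of a] by simp
  have "((\<lambda>x. m powr r + r * m powr (r - 1) * (f x - m)) has_integral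
      m powr r * V + r * m powr (r - 1) * (integral S f - m * V)) S"
    by (intro has_integral_add has_integral_mult_right has_integral_diff c integrable_integral f)
  then have "((\<lambda>x. m powr r + r * m powr (r - 1) * (f x - m)) has_integral m powr r * V) S" using m by simp
  then have "m powr r * V \<le> integral S (\<lambda>x. f x powr r)"
    by (rule has_integral_le[OF _ integrable_integral[OF f(2)]]) (intro powr_tangent nn m r)
  then have "V powr (r - 1) * (m powr r * V) \<le> V powr (r - 1) * integral S (\<lambda>x. f x powr r)"
    by (intro mult_left_mono) auto
  moreover have "V powr (r - 1) * (m powr r * V) = (m * V) powr r"
    using m V by (simp add: powr_mult powr_diff)
  ultimately show ?thesis using m by simp
qed

lemma powr_sum_le:
  fixes a :: "'i \<Rightarrow> real"
  assumes "finite I" "\<And>i. i \<in> I \<Longrightarrow> a i \<ge> 0" "r > 0"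
  shows "(\<Sum>i\<in>I. a i) powr r \<le> real (card I) powr r * (\<Sum>i\<in>I. a i powr r)"
proof (cases "I = {}")
  case False
  define M where "M = Max (a ` I)"
  have "M \<in> a ` I" unfolding M_def using False assms by (intro Max_in) auto
  then obtain k where k: "k \<in> I" "M = a k" by blast
  have "(\<Sum>i\<in>I. a i) \<le> real (card I) * M"
    using assms by (intro sum_bounded_above) (auto simp: M_def)
  then have "(\<Sum>i\<in>I. a i) powr r \<le> (real (card I) * M) powr r"
    using assms by (intro powr_mono2 sum_nonneg) auto
  also have "\<dots> = real (card I) powr r * a k powr r" using k assms by (simp add: powr_mult)
  also have "a k powr r \<le> (\<Sum>i\<in>I. a i powr r)"
    using k assms by (intro member_le_sum) auto
  finally show ?thesis by (simp add: mult_left_mono)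
qed simp

text \<open>The odd power \<open>sgn t * \<bar>t\<bar> powr r\<close>, written so that continuity at
  0 is visible. With exponent \<open>r - 1\<close> it turns a function into the one that realises
  its L^r norm by duality.\<close>

definition spow :: "real \<Rightarrow> real \<Rightarrow> real" where
  "spow r t = (max t 0) powr r - (max (- t) 0) powr r"

lemma continuous_on_spow: "r > 0 \<Longrightarrow> continuous_on X f \<Longrightarrow> continuous_on X (\<lambda>x. spow r (f x))"
  unfolding spow_def by (intro continuous_intros continuous_on_powr') auto

lemma abs_spow: "\<bar>spow r t\<bar> = \<bar>t\<bar> powr r"
  by (cases "t \<ge> 0") (auto simp: spow_def max_def)

lemma mult_spow: "t * spow (r - 1) t = \<bar>t\<bar> powr r"
proof (cases "t = 0")
  case False
  have "t * spow (r - 1) t = \<bar>t\<bar> * \<bar>t\<bar> powr (r - 1)" by (cases "t \<ge> 0") (auto simp: spow_def max_def)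
  then show ?thesis using False by (simp add: powr_diff)
qed (simp add: spow_def)

lemma continuous_on_abs_powr [continuous_intros]:
  fixes f :: "'b::t2_space \<Rightarrow> real"
  shows "r > 0 \<Longrightarrow> continuous_on X f \<Longrightarrow> continuous_on X (\<lambda>x. \<bar>f x\<bar> powr r)"
  by (intro continuous_on_powr' continuous_intros) auto

text \<open>Duality: \<open>w\<close> is tested with \<open>W = spow (r - 1) w\<close>, for which
  the pairing is the \<open>r\<close>-th power of the norm of \<open>w\<close>, and one derivative
  is moved onto the test function. As \<open>W\<close> need not be a trigonometric polynomial, it is
  approximated uniformly, with error \<open>1 / Suc n\<close>.\<close>

lemma riesz_bound:
  assumes r: "1 < r"
  shows "\<exists>C>0. \<forall>L (xs :: 'a::euclidean_space trig). \<forall>i\<in>Basis. \<forall>j\<in>Basis. L > 0 \<longrightarrow> trig_freq L xs \<longrightarrow> trig_nonzero xs \<longrightarrow>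
    pnorm L r (tev (trig_deriv j (trig_deriv i (trig_invlap xs)))) \<le> C * pnorm L r (tev xs)"
proof -
  define s where "s = r / (r - 1)"
  have s: "1 / r + 1 / s = 1" "s > 1" "(r - 1) * s = r" using r by (auto simp: s_def field_simps)
  from bilinear_norm_bound[OF r s(1), where 'a='a] obtain C where C0: "C > 0" and
    C: "\<And>L i j xs ys :: 'a trig. i \<in> Basis \<Longrightarrow> j \<in> Basis \<Longrightarrow> L > 0 \<Longrightarrow> trig_freq L xs \<Longrightarrow> trig_freq L ys \<Longrightarrow> trig_nonzero xs \<Longrightarrow>
      \<bar>riesz_pairing L i xs j ys\<bar>
      \<le> C * pnorm L r (tev xs) * pnorm L s (tev ys)" by blast
  show ?thesis
  proof (intro exI[of _ C] conjI allI ballI impI C0)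
    fix L and xs :: "'a trig" and i j :: 'a
    assume a: "L > 0" "i \<in> Basis" "j \<in> Basis" "trig_freq L xs" "trig_nonzero xs"
    define ws where "ws = trig_deriv j (trig_deriv i (trig_invlap xs))"
    define w where "w = tev ws"
    have frw: "trig_freq L ws" using a by (simp add: ws_def)
    define W where "W x = spow (r - 1) (w x)" for x
    have Wc: "continuous_on X W" for X unfolding W_def w_def using r by (intro continuous_on_spow continuous_intros) auto
    have wc: "continuous_on X w" for X unfolding w_def by (intro continuous_intros)
    have Wper: "W (x + L *\<^sub>R k) = W x" if "k \<in> Basis" for k x
      unfolding W_def w_def using tev_periodic[OF frw that] by simp
    define I where "I = lpow L r w"
    have I0: "I \<ge> 0" unfolding I_def by (rule integral_powr_nonneg)
    let ?K = "\<lambda>n. integral (pbox L) (\<lambda>x. (\<bar>W x\<bar> + 1 / real (Suc n)) powr s)"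
    have le: "I \<le> C * pnorm L r (tev xs) * (?K n) powr (1 / s) + (1 / real (Suc n)) * integral (pbox L) (\<lambda>x. \<bar>w x\<bar>)" for n
    proof -
      have e: "1 / real (Suc n) > 0" by simp
      from trig_dense[OF a(1) Wc Wper e] obtain ys where
        ys: "trig_freq L ys" "\<And>x. \<bar>W x - tev ys x\<bar> < 1 / real (Suc n)" by blast
      have "I = integral (pbox L) (\<lambda>x. w x * W x)"
        unfolding I_def W_def mult_spow ..
      also have "\<dots> \<le> integral (pbox L) (\<lambda>x. w x * tev ys x + (1 / real (Suc n)) * \<bar>w x\<bar>)"
      proof (intro integral_pbox_mono continuous_intros wc Wc)
        fix x
        have "w x * W x - w x * tev ys x \<le> \<bar>w x\<bar> * \<bar>W x - tev ys x\<bar>"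
          by (metis abs_ge_self abs_mult right_diff_distrib)
        also have "\<dots> \<le> \<bar>w x\<bar> * (1 / real (Suc n))" using ys(2)[of x] by (intro mult_left_mono) auto
        finally show "w x * W x \<le> w x * tev ys x + (1 / real (Suc n)) * \<bar>w x\<bar>" by (simp add: mult.commute)
      qed
      also have "\<dots> = integral (pbox L) (\<lambda>x. w x * tev ys x) + (1 / real (Suc n)) * integral (pbox L) (\<lambda>x. \<bar>w x\<bar>)"
        by (subst integral_add) (auto intro!: integrable_pbox continuous_intros wc)
      also have "integral (pbox L) (\<lambda>x. w x * tev ys x) = - riesz_pairing L i xs j ys"
        unfolding w_def ws_def by (rule tev_parts) (use a ys in auto)
      also have "\<dots> \<le> C * pnorm L r (tev xs) * pnorm L s (tev ys)"
        using C[of i j L xs ys] a ys(1) by linarith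
      also have "pnorm L s (tev ys) \<le> (?K n) powr (1 / s)"
      proof -
        have "lpow L s (tev ys) \<le> ?K n"
        proof (rule integral_pbox_mono)
          show "continuous_on UNIV (\<lambda>x. \<bar>tev ys x\<bar> powr s)" using s by (intro continuous_intros) auto
          show "continuous_on UNIV (\<lambda>x. (\<bar>W x\<bar> + 1 / real (Suc n)) powr s)"
            by (intro continuous_on_powr' continuous_intros Wc) (use s in \<open>auto simp del: of_nat_Suc\<close>)
          show "\<bar>tev ys x\<bar> powr s \<le> (\<bar>W x\<bar> + 1 / real (Suc n)) powr s" for x
            using ys(2)[of x] s by (intro powr_mono2) auto
        qed
        then show ?thesis unfolding pnorm_def
          using s by (intro powr_mono2 integral_powr_nonneg) auto
      qed
      finally show ?thesis using C0 by (simp add: pnorm_def mult_left_mono del: of_nat_Suc)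
    qed
    have K: "?K \<longlonglongrightarrow> I"
    proof -
      have eq: "I = lpow L s W"
        unfolding I_def W_def abs_spow powr_powr s(3) ..
      show ?thesis unfolding eq
      proof (rule dominated_convergence(2)[where h="\<lambda>x. (\<bar>W x\<bar> + 1) powr s"])
        show "(\<lambda>x. (\<bar>W x\<bar> + 1 / real (Suc n)) powr s) integrable_on pbox L" for n
          by (intro integrable_pbox continuous_on_powr' continuous_intros Wc) (use s in \<open>auto simp del: of_nat_Suc\<close>)
        show "(\<lambda>x. (\<bar>W x\<bar> + 1) powr s) integrable_on pbox L"
          by (intro integrable_pbox continuous_on_powr' continuous_intros Wc) (use s in auto)
        show "norm ((\<bar>W x\<bar> + 1 / real (Suc n)) powr s) \<le> (\<bar>W x\<bar> + 1) powr s" for n x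
          using s by (auto intro!: powr_mono2)
        have "(\<lambda>n. (1 / real (Suc n))) \<longlonglongrightarrow> 0" by (rule LIMSEQ_Suc[OF lim_1_over_n])
        then have "(\<lambda>n. \<bar>W x\<bar> + 1 / real (Suc n)) \<longlonglongrightarrow> \<bar>W x\<bar> + 0" for x by (intro tendsto_intros)
        then have "(\<lambda>n. (\<bar>W x\<bar> + 1 / real (Suc n)) powr s) \<longlonglongrightarrow> (\<bar>W x\<bar> + 0) powr s" for x
          using s by (intro tendsto_powr2 tendsto_const) (auto intro!: always_eventually)
        then show "(\<lambda>n. (\<bar>W x\<bar> + 1 / real (Suc n)) powr s) \<longlonglongrightarrow> \<bar>W x\<bar> powr s" for x by simp
      qed
    qed
    have "(\<lambda>n. C * pnorm L r (tev xs) * (?K n) powr (1 / s) + (1 / real (Suc n)) * integral (pbox L) (\<lambda>x. \<bar>w x\<bar>))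
       \<longlonglongrightarrow> C * pnorm L r (tev xs) * I powr (1 / s) + 0 * integral (pbox L) (\<lambda>x. \<bar>w x\<bar>)"
    proof -
      have "(\<lambda>n. (?K n) powr (1 / s)) \<longlonglongrightarrow> I powr (1 / s)"
      proof (rule tendsto_powr2[OF K tendsto_const])
        show "\<forall>\<^sub>F n in sequentially. 0 \<le> ?K n"
          by (intro always_eventually allI integral_nonneg integrable_pbox continuous_on_powr' continuous_intros Wc)
             (use s in \<open>auto simp del: of_nat_Suc\<close>)
      qed (use s in auto)
      then show ?thesis by (intro tendsto_add tendsto_mult tendsto_const LIMSEQ_Suc[OF lim_1_over_n])
    qed
    then have fin: "I \<le> C * pnorm L r (tev xs) * I powr (1 / s) + 0 * integral (pbox L) (\<lambda>x. \<bar>w x\<bar>)"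
      by (rule LIMSEQ_le_const) (use le in blast)
    have "pnorm L r (tev ws) \<le> C * pnorm L r (tev xs)"
    proof (cases "I = 0")
      case True
      then show ?thesis using C0 by (simp add: pnorm_def I_def w_def)
    next
      case False
      then have Ip: "I > 0" using I0 by simp
      have "I = I powr (1 / r) * I powr (1 / s)" using s(1) Ip by (simp add: powr_add[symmetric])
      then have "I powr (1 / r) * I powr (1 / s) \<le> C * pnorm L r (tev xs) * I powr (1 / s)" using fin by simp
      then have "I powr (1 / r) \<le> C * pnorm L r (tev xs)" using Ip by (simp add: mult_le_cancel_right)
      then show ?thesis by (simp add: pnorm_def I_def w_def)
    qed
    then show "pnorm L r (tev (trig_deriv j (trig_deriv i (trig_invlap xs)))) \<le> C * pnorm L r (tev xs)"
      by (simp add: ws_def)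
  qed
qed

text \<open>On every line in direction \<open>i\<close> the periodic function \<open>tev zs\<close>
  has a critical point, so the first derivative is an integral of the second starting there.
  Jensen's inequality, an interchange of integrals and the shift invariance over the cube turn this
  into a bound of powers.\<close>

lemma poincare_line:
  fixes zs :: "'a::euclidean_space trig"
  assumes L: "L > 0" and fr: "trig_freq L zs" and i: "i \<in> Basis" and r: "r > 1"
  shows "lpow L r (tev (trig_deriv i zs))
    \<le> L powr r * lpow L r (tev (trig_deriv i (trig_deriv i zs)))"
proof -
  let ?w = "tev (trig_deriv i zs)" and ?g = "tev (trig_deriv i (trig_deriv i zs))"
  define G where "G s x = \<bar>?g (x + s *\<^sub>R i)\<bar>" for s x
  have Gc: "continuous_on X (\<lambda>s. G s x)" for X x unfolding G_def by (intro continuous_intros)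
  have pt: "\<bar>?w x\<bar> powr r \<le> L powr (r - 1) * integral {0..L} (\<lambda>s. G s x powr r)" for x
  proof -
    have "\<exists>\<xi>>0. \<xi> < L \<and> ?w (x + \<xi> *\<^sub>R i) = 0"
    proof -
      have "\<exists>z>0. z < L \<and> (\<lambda>s. tev zs (x + s *\<^sub>R i)) L - tev zs (x + 0 *\<^sub>R i) = (L - 0) * ?w (x + z *\<^sub>R i)"
        by (rule MVT2[OF L]) (rule tev_DERIV)
      then show ?thesis using tev_periodic[OF fr i, of x] L by auto
    qed
    then obtain \<xi> where \<xi>: "\<xi> > 0" "\<xi> < L" "?w (x + \<xi> *\<^sub>R i) = 0" by blast
    have "((\<lambda>s. ?g (x + s *\<^sub>R i)) has_integral (?w (x + \<xi> *\<^sub>R i) - ?w (x + 0 *\<^sub>R i))) {0..\<xi>}"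
      using \<xi> by (intro fundamental_theorem_of_calculus)
        (auto simp: has_real_derivative_iff_has_vector_derivative[symmetric] intro!: DERIV_subset[OF tev_DERIV])
    then have "?w x = - integral {0..\<xi>} (\<lambda>s. ?g (x + s *\<^sub>R i))" using \<xi> by (simp add: integral_unique)
    then have "\<bar>?w x\<bar> = norm (integral {0..\<xi>} (\<lambda>s. ?g (x + s *\<^sub>R i)))" by simp
    also have "\<dots> \<le> integral {0..\<xi>} (\<lambda>s. G s x)"
      by (intro integral_norm_bound_integral integrable_continuous_interval continuous_intros Gc) (auto simp: G_def)
    also have "\<dots> \<le> integral {0..L} (\<lambda>s. G s x)"
      using \<xi> by (intro integral_subset_le integrable_continuous_interval Gc) (auto simp: G_def)
    finally have "\<bar>?w x\<bar> powr r \<le> (integral {0..L} (\<lambda>s. G s x)) powr r" using r by (intro powr_mono2) auto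
    also have "\<dots> \<le> L powr (r - 1) * integral {0..L} (\<lambda>s. G s x powr r)"
    proof (rule integral_powr_jensen)
      show "((\<lambda>_. 1) has_integral L) {0..L}" using has_integral_const_real[of "1::real" 0 L] L by simp
      show "(\<lambda>s. G s x powr r) integrable_on {0..L}"
        using r by (intro integrable_continuous_interval) (auto simp: G_def intro!: continuous_intros)
      show "(\<lambda>s. G s x) integrable_on {0..L}" by (intro integrable_continuous_interval Gc)
    qed (use L r in \<open>auto simp: G_def\<close>)
    finally show ?thesis .
  qed
  have joint: "continuous_on (X \<times> Y) (\<lambda>(x, s). G s x powr r)" for X and Y :: "real set"
    unfolding G_def split_def using r by (intro continuous_intros) auto
  have inner: "continuous_on UNIV (\<lambda>x. integral (cbox 0 L) (\<lambda>s. G s x powr r))"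
    by (rule integral_continuous_on_param[OF joint])
  have "lpow L r ?w \<le> integral (pbox L) (\<lambda>x. L powr (r - 1) * integral (cbox 0 L) (\<lambda>s. G s x powr r))"
    using r pt by (intro integral_pbox_mono continuous_intros inner) (auto simp: cbox_interval)
  also have "\<dots> = L powr (r - 1) * integral (pbox L) (\<lambda>x. integral (cbox 0 L) (\<lambda>s. G s x powr r))" by simp
  also have "integral (pbox L) (\<lambda>x. integral (cbox 0 L) (\<lambda>s. G s x powr r))
      = integral (cbox 0 L) (\<lambda>s. integral (pbox L) (\<lambda>x. G s x powr r))"
    unfolding pbox_def
    using integral_swap_continuous[of 0 0 "L *\<^sub>R One :: 'a" L "\<lambda>x s. G s x powr r"] joint
    by (simp add: cbox_Pair_eq split_def)
  also have "\<dots> = integral (cbox 0 L) (\<lambda>s. lpow L r ?g)"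
  proof (rule integral_cong)
    fix s assume s: "s \<in> cbox 0 L"
    show "integral (pbox L) (\<lambda>x. G s x powr r) = lpow L r ?g"
      unfolding G_def
      by (rule integral_periodic_shift[OF _ i, where f="\<lambda>x. \<bar>?g x\<bar> powr r"])
         (use s r fr in \<open>auto intro!: continuous_intros simp: cbox_interval tev_periodic[OF _ i]\<close>)
  qed
  also have "\<dots> = L * lpow L r ?g" using L by simp
  finally show ?thesis using L by (simp add: powr_diff)
qed

lemma sum_sum_card: "finite A \<Longrightarrow> (\<Sum>i\<in>A. \<Sum>j\<in>A. (f i j :: real)) = (\<Sum>k\<in>A \<times> A. f (fst k) (snd k))"
  by (simp add: sum.cartesian_product split_def)

section \<open>A bounded right inverse of the divergence\<close>

text \<open>Continuity of the derivative is asked for each fixed direction; as the derivative is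
  linear, continuity with a varying direction follows in \<open>C1_continuous_dir\<close>.\<close>

definition C1 :: "('a::euclidean_space \<Rightarrow> 'b::real_normed_vector) \<Rightarrow> ('a \<Rightarrow> 'a \<Rightarrow> 'b) \<Rightarrow> bool" where
  "C1 f Df \<longleftrightarrow> (\<forall>x. (f has_derivative Df x) (at x)) \<and> (\<forall>w. continuous_on UNIV (\<lambda>x. Df x w))"

definition vsize :: "('a::euclidean_space \<Rightarrow> 'a) \<Rightarrow> ('a \<Rightarrow> 'a \<Rightarrow> 'a) \<Rightarrow> 'a \<Rightarrow> real" where
  "vsize v Dv x = norm (v x) + (\<Sum>b\<in>Basis. norm (Dv x b))"

abbreviation vpow :: "('a::euclidean_space \<Rightarrow> 'a) \<Rightarrow> ('a \<Rightarrow> 'a \<Rightarrow> 'a) \<Rightarrow> real \<Rightarrow> 'a set \<Rightarrow> real" where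
  "vpow v Dv r T \<equiv> integral T (\<lambda>x. vsize v Dv x powr r)"

definition divg :: "('a::euclidean_space \<Rightarrow> 'a \<Rightarrow> 'a) \<Rightarrow> 'a \<Rightarrow> real" where
  "divg Dv x = (\<Sum>b\<in>Basis. Dv x b \<bullet> b)"

text \<open>\<open>v\<close> is the gradient of the inverse Laplacian of the part of mean zero, plus
  a linear field that carries the constant part \<open>c\<close>. The second derivatives are Riesz
  transforms, and \<open>poincare_line\<close> handles \<open>v\<close> itself. The linear field is
  not periodic, which is harmless as only its size on the cube matters.\<close>

lemma divergence_right_inverse:
  assumes r: "r > 1" and L: "L > 0"
  shows "\<exists>C>0. \<forall>xs :: 'a::euclidean_space trig. trig_freq L xs \<longrightarrow> (\<exists>v Dv.
     C1 v Dv \<and> (\<forall>x. divg Dv x = tev xs x) \<and> vpow v Dv r (pbox L) \<le> C * lpow L r (tev xs))"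
proof -
  from riesz_bound[OF r, where 'a='a] obtain K0 where K0: "K0 > 0" and
    K: "\<And>(xs::'a trig) i j. i \<in> Basis \<Longrightarrow> j \<in> Basis \<Longrightarrow> trig_freq L xs \<Longrightarrow> trig_nonzero xs \<Longrightarrow>
       pnorm L r (tev (trig_deriv j (trig_deriv i (trig_invlap xs)))) \<le> K0 * pnorm L r (tev xs)" using L by blast
  define n where "n = DIM('a)"
  have n: "n > 0" by (simp add: n_def)
  define V where "V = L ^ n"
  have V: "V > 0" using L by (simp add: V_def)
  have V1: "((\<lambda>_. 1::real) has_integral V) (pbox L :: 'a set)"
  proof -
    have "measure lborel (cbox 0 (L *\<^sub>R One) :: 'a set) = V"
      using L by (simp add: content_cbox_cases V_def n_def inner_sum_left inner_Basis if_distrib sum.delta cong: if_cong)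
    then show ?thesis using has_integral_const[of "1::real" 0 "L *\<^sub>R One :: 'a"] by (simp add: pbox_def)
  qed
  define N where "N = real (n + n * n + 1) powr r"
  \<comment> \<open>\<open>N\<close> is the price for distributing the power over \<open>n\<close>
    components of \<open>v\<close>, \<open>n * n\<close> of its derivative and one term for the
    linear field. \<open>2 powr r * 2\<close> comes from removing the mean, \<open>L + 1\<close>
    from the size of the linear field and of its derivative; the final 1 secures positivity.\<close>
  define C where "C = N * (real n * (L powr r * (K0 powr r * (2 powr r * 2))) + real (n * n) * (K0 powr r * (2 powr r * 2)) + (L + 1) powr r) + 1"
  obtain b0 :: 'a where b0: "b0 \<in> Basis" using nonempty_Basis by blast
  show ?thesis
  proof (intro exI[of _ C] conjI allI impI)
    show "C > 0" unfolding C_def N_def using K0 L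
      by (intro add_nonneg_pos mult_nonneg_nonneg add_nonneg_nonneg) auto
    fix xs :: "'a trig" assume fr: "trig_freq L xs"
    define zs where "zs = filter (\<lambda>(a,k,\<theta>). k \<noteq> 0) xs"
    define c where "c = (\<Sum>(a,k,\<theta>)\<leftarrow>filter (\<lambda>(a,k,\<theta>). k = 0) xs. a * cos \<theta>)"
    have frz: "trig_freq L zs" using fr by (auto simp: zs_def trig_freq_def)
    have nz: "trig_nonzero zs" by (auto simp: zs_def trig_nonzero_def)
    have split: "tev xs x = tev zs x + c" for x
      unfolding zs_def c_def by (induction xs) auto
    define I where "I = lpow L r (tev xs)"
    have I0: "I \<ge> 0" unfolding I_def by (rule integral_powr_nonneg)
    have mean0: "integral (pbox L) (tev zs) = 0"
    proof -
      have "integral (pbox L) (tev zs) = integral (pbox L) (\<lambda>x. \<Sum>i\<in>Basis. tev (trig_deriv i (trig_deriv i (trig_invlap zs))) x)"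
        by (simp add: tev_lap[symmetric] tev_lap_invlap[OF nz])
      also have "\<dots> = (\<Sum>i\<in>Basis. integral (pbox L) (tev (trig_deriv i (trig_deriv i (trig_invlap zs)))))"
        by (rule integral_sum) (auto intro!: integrable_pbox)
      also have "\<dots> = 0"
      proof (rule sum.neutral, rule ballI)
        fix i :: 'a assume i: "i \<in> Basis"
        show "integral (pbox L) (tev (trig_deriv i (trig_deriv i (trig_invlap zs)))) = 0"
          by (rule integral_periodic_deriv_0[OF L _ _ i, where f="tev (trig_deriv i (trig_invlap zs))"])
             (use frz in \<open>auto intro!: tev_DERIV tev_periodic i\<close>)
      qed
      finally show ?thesis .
    qed
    \<comment> \<open>\<open>c\<close> is the mean value of \<open>tev xs\<close>, as all other
      waves integrate to 0; Jensen's inequality bounds it.\<close>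
    have cb: "\<bar>c\<bar> powr r * V \<le> I"
    proof -
      have "integral (pbox L) (tev xs) = integral (pbox L) (\<lambda>x. tev zs x + c)" using split by presburger
      also have "\<dots> = integral (pbox L) (tev zs) + integral (pbox L) (\<lambda>x::'a. c)"
        by (intro integral_add integrable_pbox) auto
      also have "\<dots> = c * V" using mean0 has_integral_mult_right[OF V1, of c] by (simp add: integral_unique)
      finally have "\<bar>c * V\<bar> = norm (integral (pbox L) (tev xs))" by simp
      also have "\<dots> \<le> integral (pbox L) (\<lambda>x. \<bar>tev xs x\<bar>)"
        by (intro integral_norm_bound_integral integrable_pbox continuous_intros) auto
      finally have "\<bar>c * V\<bar> powr r \<le> (integral (pbox L) (\<lambda>x. \<bar>tev xs x\<bar>)) powr r"
        using r by (intro powr_mono2) auto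
      also have "\<dots> \<le> V powr (r - 1) * I" unfolding I_def
        by (rule integral_powr_jensen) (use V V1 r in \<open>auto intro!: integrable_pbox continuous_intros\<close>)
      finally have "\<bar>c\<bar> powr r * V powr r \<le> V powr (r - 1) * I" using V by (simp add: abs_mult powr_mult)
      moreover have "V powr r = V powr (r - 1) * V" using V by (simp add: powr_diff)
      ultimately have "V powr (r - 1) * (\<bar>c\<bar> powr r * V) \<le> V powr (r - 1) * I" by (simp add: ac_simps)
      then show ?thesis using V by simp
    qed
    have zI: "lpow L r (tev zs) \<le> 2 powr r * 2 * I"
    proof -
      have "lpow L r (tev zs) \<le> integral (pbox L) (\<lambda>x. 2 powr r * (\<bar>tev xs x\<bar> powr r + \<bar>c\<bar> powr r))"
      proof (rule integral_pbox_mono)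
        fix x
        have "\<bar>tev zs x\<bar> \<le> (\<Sum>b\<in>UNIV. if b then \<bar>tev xs x\<bar> else \<bar>c\<bar>)" by (simp add: UNIV_bool split)
        then have "\<bar>tev zs x\<bar> powr r \<le> (\<Sum>b\<in>UNIV. if b then \<bar>tev xs x\<bar> else \<bar>c\<bar>) powr r" using r by (intro powr_mono2) auto
        also have "\<dots> \<le> real (card (UNIV::bool set)) powr r * (\<Sum>b\<in>UNIV. (if b then \<bar>tev xs x\<bar> else \<bar>c\<bar>) powr r)"
          using r by (intro powr_sum_le) auto
        finally show "\<bar>tev zs x\<bar> powr r \<le> 2 powr r * (\<bar>tev xs x\<bar> powr r + \<bar>c\<bar> powr r)" by (simp add: UNIV_bool add.commute)
      qed (use r in \<open>auto intro!: continuous_intros\<close>)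
      also have "\<dots> = 2 powr r * (I + \<bar>c\<bar> powr r * V)"
      proof -
        have "integral (pbox L) (\<lambda>x::'a. \<bar>tev xs x\<bar> powr r + \<bar>c\<bar> powr r) = I + \<bar>c\<bar> powr r * V"
          unfolding I_def using has_integral_mult_right[OF V1, of "\<bar>c\<bar> powr r"] r
          by (subst integral_add) (auto intro!: integrable_pbox continuous_intros simp: integral_unique)
        then show ?thesis by simp
      qed
      also have "\<dots> \<le> 2 powr r * (I + I)" using cb by simp
      finally show ?thesis by simp
    qed
    define us where "us = trig_invlap zs"
    have fru: "trig_freq L us" using frz by (simp add: us_def)
    define M where "M = K0 powr r * (2 powr r * 2) * I"
    have M0: "M \<ge> 0" using I0 K0 by (simp add: M_def)
    have second: "lpow L r (tev (trig_deriv j (trig_deriv i us))) \<le> M"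
      if ij: "i \<in> Basis" "j \<in> Basis" for i j
    proof -
      have "lpow L r (tev (trig_deriv j (trig_deriv i us))) = pnorm L r (tev (trig_deriv j (trig_deriv i us))) powr r"
        using r integral_powr_nonneg[of L "tev (trig_deriv j (trig_deriv i us))" r] by (simp add: pnorm_def powr_powr)
      also have "\<dots> \<le> (K0 * pnorm L r (tev zs)) powr r"
        unfolding us_def using r by (intro powr_mono2 K ij frz nz) (auto simp: pnorm_def)
      also have "\<dots> = K0 powr r * lpow L r (tev zs)"
        using r K0 integral_powr_nonneg[of L "tev zs" r] by (simp add: pnorm_def powr_powr powr_mult)
      also have "\<dots> \<le> K0 powr r * (2 powr r * 2 * I)" by (intro mult_left_mono zI) auto
      finally show ?thesis by (simp add: M_def mult.assoc)
    qed
    have first: "lpow L r (tev (trig_deriv i us)) \<le> L powr r * M" if i: "i \<in> Basis" for i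
      using poincare_line[OF L fru i r] second[OF i i] by (meson mult_left_mono order_trans powr_ge_zero)
    define v where "v x = (\<Sum>i\<in>Basis. tev (trig_deriv i us) x *\<^sub>R i) + (c * (x \<bullet> b0)) *\<^sub>R b0" for x
    define Dv where "Dv x w = (\<Sum>i\<in>Basis. tev (trig_deriv w (trig_deriv i us)) x *\<^sub>R i) + (c * (w \<bullet> b0)) *\<^sub>R b0" for x w
    have der: "(v has_derivative Dv x) (at x)" for x
      unfolding v_def Dv_def
      by (intro has_derivative_add has_derivative_sum has_derivative_scaleR_left tev_has_derivative
           has_derivative_mult_right has_derivative_inner_left has_derivative_ident)
    have DvB: "norm (Dv x j) \<le> (\<Sum>i\<in>Basis. \<bar>tev (trig_deriv j (trig_deriv i us)) x\<bar>) + (if j = b0 then \<bar>c\<bar> else 0)" if j: "j \<in> Basis" for x j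
    proof -
      have "norm (Dv x j) \<le> (\<Sum>i\<in>Basis. norm (tev (trig_deriv j (trig_deriv i us)) x *\<^sub>R i)) + norm ((c * (j \<bullet> b0)) *\<^sub>R b0)"
        unfolding Dv_def by (intro order_trans[OF norm_triangle_ineq] add_mono norm_sum order_refl)
      also have "\<dots> = (\<Sum>i\<in>Basis. \<bar>tev (trig_deriv j (trig_deriv i us)) x\<bar>) + (if j = b0 then \<bar>c\<bar> else 0)"
        using j b0 by (simp add: inner_Basis)
      finally show ?thesis .
    qed
    have vB: "norm (v x) \<le> (\<Sum>i\<in>Basis. \<bar>tev (trig_deriv i us) x\<bar>) + \<bar>c\<bar> * L" if x: "x \<in> pbox L" for x
    proof -
      have "norm (v x) \<le> (\<Sum>i\<in>Basis. norm (tev (trig_deriv i us) x *\<^sub>R i)) + norm ((c * (x \<bullet> b0)) *\<^sub>R b0)"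
        unfolding v_def by (intro order_trans[OF norm_triangle_ineq] add_mono norm_sum order_refl)
      also have "\<dots> = (\<Sum>i\<in>Basis. \<bar>tev (trig_deriv i us) x\<bar>) + \<bar>c\<bar> * \<bar>x \<bullet> b0\<bar>"
        using b0 by (simp add: abs_mult)
      also have "\<bar>x \<bullet> b0\<bar> \<le> L" using x b0 by (auto simp: pbox_def mem_box)
      finally show ?thesis by (simp add: mult_left_mono)
    qed
    let ?D = "Basis :: 'a set"
    have big: "(norm (v x) + (\<Sum>b\<in>Basis. norm (Dv x b))) powr r
        \<le> N * ((\<Sum>i\<in>?D. \<bar>tev (trig_deriv i us) x\<bar> powr r) + (\<Sum>k\<in>?D\<times>?D. \<bar>tev (trig_deriv (fst k) (trig_deriv (snd k) us)) x\<bar> powr r)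
           + (\<bar>c\<bar> * (L + 1)) powr r)" if x: "x \<in> pbox L" for x
    proof -
      \<comment> \<open>A sum type serves as index set, so that all summands are handled by one
        application of \<open>powr_sum_le\<close>.\<close>
      define A where "A = (Inl ` Inl ` ?D \<union> Inl ` Inr ` (?D \<times> ?D)) \<union> {Inr ()}"
      define a where "a = case_sum (case_sum (\<lambda>i. \<bar>tev (trig_deriv i us) x\<bar>) (\<lambda>k. \<bar>tev (trig_deriv (fst k) (trig_deriv (snd k) us)) x\<bar>)) (\<lambda>_::unit. \<bar>c\<bar> * (L + 1))"
      have sumA: "(\<Sum>z\<in>A. f z) = (\<Sum>i\<in>?D. f (Inl (Inl i))) + (\<Sum>k\<in>?D\<times>?D. f (Inl (Inr k))) + f (Inr ())" for f :: "_ \<Rightarrow> real"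
        unfolding A_def by (subst sum.union_disjoint; (subst sum.union_disjoint)?) (auto simp: sum.reindex inj_on_def o_def)
      have cardA: "card A = n + n * n + 1"
        unfolding A_def n_def
        by (subst card_Un_disjoint; (subst card_Un_disjoint)?) (auto simp: card_image inj_on_def card_cartesian_product)
      have "norm (v x) + (\<Sum>b\<in>Basis. norm (Dv x b)) \<le> ((\<Sum>i\<in>?D. \<bar>tev (trig_deriv i us) x\<bar>) + \<bar>c\<bar> * L)
         + (\<Sum>j\<in>?D. (\<Sum>i\<in>Basis. \<bar>tev (trig_deriv j (trig_deriv i us)) x\<bar>) + (if j = b0 then \<bar>c\<bar> else 0))"
        by (intro add_mono vB[OF x] sum_mono DvB)
      also have "\<dots> = (\<Sum>z\<in>A. a z)"
        using b0 unfolding sumA a_def by (simp add: sum.distrib sum_sum_card algebra_simps)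
      finally have "norm (v x) + (\<Sum>b\<in>Basis. norm (Dv x b)) \<le> (\<Sum>z\<in>A. a z)" .
      then have "(norm (v x) + (\<Sum>b\<in>Basis. norm (Dv x b))) powr r \<le> (\<Sum>z\<in>A. a z) powr r"
        using r by (intro powr_mono2) (auto intro!: add_nonneg_nonneg sum_nonneg)
      also have "\<dots> \<le> real (card A) powr r * (\<Sum>z\<in>A. a z powr r)"
        using r L by (intro powr_sum_le) (auto simp: A_def a_def)
      finally show ?thesis unfolding cardA sumA by (simp add: a_def N_def)
    qed
    have int1: "(\<lambda>x. \<bar>tev ys x\<bar> powr r) integrable_on pbox L" for ys :: "'a trig"
      using r by (intro integrable_pbox continuous_intros) auto
    have Dvc: "continuous_on X (\<lambda>x. Dv x w)" for X w unfolding Dv_def by (intro continuous_intros)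
    have vc: "continuous_on X v" for X unfolding v_def by (intro continuous_intros)
    have "integral (pbox L) (\<lambda>x. (norm (v x) + (\<Sum>b\<in>Basis. norm (Dv x b))) powr r)
       \<le> integral (pbox L) (\<lambda>x. N * ((\<Sum>i\<in>?D. \<bar>tev (trig_deriv i us) x\<bar> powr r) + (\<Sum>k\<in>?D\<times>?D. \<bar>tev (trig_deriv (fst k) (trig_deriv (snd k) us)) x\<bar> powr r)
           + (\<bar>c\<bar> * (L + 1)) powr r))"
    proof (intro integral_le integrable_pbox)
      show "continuous_on UNIV (\<lambda>x. (norm (v x) + (\<Sum>b\<in>Basis. norm (Dv x b))) powr r)"
        by (intro continuous_on_powr' continuous_intros vc Dvc) (use r in \<open>auto intro!: add_nonneg_nonneg sum_nonneg\<close>)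
    qed (use r big in \<open>auto intro!: continuous_intros\<close>)
    also have "\<dots> = N * ((\<Sum>i\<in>?D. lpow L r (tev (trig_deriv i us)))
        + (\<Sum>k\<in>?D\<times>?D. lpow L r (tev (trig_deriv (fst k) (trig_deriv (snd k) us))))
        + (\<bar>c\<bar> * (L + 1)) powr r * V)"
    proof (intro integral_unique has_integral_mult_right has_integral_add has_integral_sum integrable_integral int1)
      show "((\<lambda>x. (\<bar>c\<bar> * (L + 1)) powr r) has_integral (\<bar>c\<bar> * (L + 1)) powr r * V) (pbox L :: 'a set)"
        using has_integral_mult_right[OF V1, of "(\<bar>c\<bar> * (L + 1)) powr r"] by simp
    qed auto
    also have "\<dots> \<le> N * ((\<Sum>i\<in>?D. L powr r * M) + (\<Sum>k\<in>?D\<times>?D. M) + (L + 1) powr r * I)"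
    proof (intro mult_left_mono add_mono sum_mono first second)
      have "(\<bar>c\<bar> * (L + 1)) powr r * V = (L + 1) powr r * (\<bar>c\<bar> powr r * V)" using L by (simp add: powr_mult)
      also have "\<dots> \<le> (L + 1) powr r * I" by (intro mult_left_mono cb) auto
      finally show "(\<bar>c\<bar> * (L + 1)) powr r * V \<le> (L + 1) powr r * I" .
    qed (auto simp: N_def)
    also have "\<dots> = (C - 1) * I"
      by (simp add: C_def M_def n_def algebra_simps card_cartesian_product)
    also have "\<dots> \<le> C * I" using I0 by (simp add: algebra_simps)
    finally have fin: "integral (pbox L) (\<lambda>x. (norm (v x) + (\<Sum>b\<in>Basis. norm (Dv x b))) powr r) \<le> C * I" .
    have div: "(\<Sum>b\<in>Basis. Dv x b \<bullet> b) = tev xs x" for x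
    proof -
      have "(\<Sum>b\<in>Basis. Dv x b \<bullet> b) = (\<Sum>b\<in>Basis. tev (trig_deriv b (trig_deriv b us)) x + (if b = b0 then c else 0))"
        using b0 by (intro sum.cong refl) (simp add: Dv_def inner_add_left inner_Basis)
      also have "\<dots> = tev (trig_lap us) x + c" using b0 by (simp add: sum.distrib tev_lap)
      finally show ?thesis by (simp add: us_def tev_lap_invlap[OF nz] split)
    qed
    show "\<exists>v Dv. C1 v Dv \<and> (\<forall>x. divg Dv x = tev xs x) \<and> vpow v Dv r (pbox L) \<le> C * lpow L r (tev xs)"
      using der Dvc div fin unfolding C1_def divg_def vsize_def by (intro exI[of _ v] exI[of _ Dv]) (auto simp: I_def)
  qed
qed

section \<open>Hausdorff measure on hyperplanes\<close>

lemma borel_shift_vimage: "C \<in> sets borel \<Longrightarrow> (\<lambda>x. x + g) -` C \<in> sets (borel :: 'a::euclidean_space measure)"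
  using measurable_sets[of "\<lambda>x. x + g" borel borel C] by simp

text \<open>The uniqueness argument for Haar measure: the double integral of
  \<open>indicator A x * indicator B (x + y)\<close> is evaluated in both orders. Both measures live
  on \<open>G\<close> and are invariant under translations from \<open>G\<close>, so that measures
  on a subspace are covered; the product form of the conclusion avoids a division.\<close>

lemma translation_invariant_unique:
  fixes M N :: "'a::euclidean_space measure"
  assumes sM: "sets M = sets borel" and sN: "sets N = sets borel"
    and sf: "sigma_finite_measure M" "sigma_finite_measure N"
    and GM: "AE x in M. x \<in> G" and GN: "AE x in N. x \<in> G"
    and invM: "\<And>g A. g \<in> G \<Longrightarrow> A \<in> sets borel \<Longrightarrow> emeasure M ((\<lambda>x. x + g) -` A) = emeasure M A"
    and invN: "\<And>g A. g \<in> G \<Longrightarrow> A \<in> sets borel \<Longrightarrow> emeasure N ((\<lambda>x. x + g) -` A) = emeasure N A"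
    and reflN: "\<And>A. A \<in> sets borel \<Longrightarrow> emeasure N (uminus -` A) = emeasure N A"
    and A [measurable]: "A \<in> sets borel" and B [measurable]: "B \<in> sets borel"
  shows "emeasure M A * emeasure N B = emeasure M B * emeasure N A"
proof -
  have sp: "space M = UNIV" "space N = UNIV" using sets_eq_imp_space_eq[OF sM] sets_eq_imp_space_eq[OF sN] by auto
  have mM: "h \<in> borel_measurable M \<longleftrightarrow> h \<in> borel_measurable borel" for h :: "'a \<Rightarrow> ennreal"
    by (simp only: measurable_cong_sets[OF sM refl])
  have mN: "h \<in> borel_measurable N \<longleftrightarrow> h \<in> borel_measurable borel" for h :: "'a \<Rightarrow> ennreal"
    by (simp only: measurable_cong_sets[OF sN refl])
  have mMN: "h \<in> borel_measurable (M \<Otimes>\<^sub>M N) \<longleftrightarrow> h \<in> borel_measurable (borel \<Otimes>\<^sub>M borel)" for h :: "'a \<times> 'a \<Rightarrow> ennreal"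
    by (simp only: measurable_cong_sets[OF sets_pair_measure_cong[OF sM sN] refl])
  have shiftM: "(\<integral>\<^sup>+x. h (x + y) \<partial>M) = (\<integral>\<^sup>+x. h x \<partial>M)" if "y \<in> G" and h: "h \<in> borel_measurable borel" for h and y
  proof -
    have m: "(\<lambda>x. x + y) \<in> borel_measurable M" unfolding measurable_cong_sets[OF sM refl] by measurable
    have "distr M borel (\<lambda>x. x + y) = M"
    proof (rule measure_eqI)
      fix C assume "C \<in> sets (distr M borel (\<lambda>x. x + y))"
      then have C: "C \<in> sets borel" by simp
      show "emeasure (distr M borel (\<lambda>x. x + y)) C = emeasure M C"
        unfolding emeasure_distr[OF m C] sp Int_UNIV_right by (rule invM[OF \<open>y \<in> G\<close> C])
    qed (simp add: sM)
    moreover have "(\<integral>\<^sup>+x. h x \<partial>distr M borel (\<lambda>x. x + y)) = (\<integral>\<^sup>+x. h (x + y) \<partial>M)"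
      by (rule nn_integral_distr[OF m]) (use h in simp)
    ultimately show ?thesis by simp
  qed
  have AM: "A \<in> sets M" "B \<in> sets M" "A \<in> sets N" "B \<in> sets N" using A B by (simp_all only: sM sN)
  have "emeasure M A * emeasure N B = (\<integral>\<^sup>+x. indicator A x * emeasure N B \<partial>M)"
    by (simp add: nn_integral_multc AM mM)
  also have "\<dots> = (\<integral>\<^sup>+x. (\<integral>\<^sup>+y. indicator A x * indicator B (x + y) \<partial>N) \<partial>M)"
  proof (rule nn_integral_cong_AE, use GM in eventually_elim)
    fix x assume x: "x \<in> G"
    have "(\<integral>\<^sup>+y. indicator A x * indicator B (x + y) \<partial>N) = indicator A x * (\<integral>\<^sup>+y. indicator B (x + y) \<partial>N)"
      by (rule nn_integral_cmult) (unfold mN, measurable)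
    also have "(\<integral>\<^sup>+y. indicator B (x + y) \<partial>N) = (\<integral>\<^sup>+y. indicator ((\<lambda>y. y + x) -` B) y \<partial>N)"
      by (intro nn_integral_cong) (auto simp: indicator_def add.commute)
    also have "\<dots> = emeasure N ((\<lambda>y. y + x) -` B)"
      by (rule nn_integral_indicator) (simp add: sN borel_shift_vimage[OF B])
    also have "\<dots> = emeasure N B" by (rule invN[OF x B])
    finally show "indicator A x * emeasure N B = (\<integral>\<^sup>+y. indicator A x * indicator B (x + y) \<partial>N)" by simp
  qed
  also have "\<dots> = (\<integral>\<^sup>+y. (\<integral>\<^sup>+x. indicator A x * indicator B (x + y) \<partial>M) \<partial>N)"
    by (rule pair_sigma_finite.Fubini'[symmetric])
       (simp add: pair_sigma_finite_def sf, unfold mMN, measurable)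
  also have "\<dots> = (\<integral>\<^sup>+y. (\<integral>\<^sup>+x. indicator A (x - y) * indicator B x \<partial>M) \<partial>N)"
  proof (rule nn_integral_cong_AE, use GN in eventually_elim)
    fix y assume y: "y \<in> G"
    have "(\<lambda>x. indicator A (x - y) * indicator B x :: ennreal) \<in> borel_measurable borel" by measurable
    from shiftM[OF y this]
    show "(\<integral>\<^sup>+x. indicator A x * indicator B (x + y) \<partial>M) = (\<integral>\<^sup>+x. indicator A (x - y) * indicator B x \<partial>M)"
      by simp
  qed
  also have "\<dots> = (\<integral>\<^sup>+x. (\<integral>\<^sup>+y. indicator A (x - y) * indicator B x \<partial>N) \<partial>M)"
    by (rule pair_sigma_finite.Fubini')
       (simp add: pair_sigma_finite_def sf, unfold mMN, measurable)
  also have "\<dots> = (\<integral>\<^sup>+x. indicator B x * emeasure N A \<partial>M)"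
  proof (rule nn_integral_cong_AE, use GM in eventually_elim)
    fix x assume x: "x \<in> G"
    have C: "(\<lambda>y. y + x) -` A \<in> sets borel" by (rule borel_shift_vimage[OF A])
    have D: "uminus -` ((\<lambda>y. y + x) -` A) \<in> sets borel"
      using measurable_sets[of "uminus :: 'a \<Rightarrow> 'a" borel borel "(\<lambda>y. y + x) -` A"] C by simp
    have "(\<integral>\<^sup>+y. indicator A (x - y) * indicator B x \<partial>N) = (\<integral>\<^sup>+y. indicator A (x - y) \<partial>N) * indicator B x"
      by (rule nn_integral_multc) (unfold mN, measurable)
    also have "(\<integral>\<^sup>+y. indicator A (x - y) \<partial>N) = (\<integral>\<^sup>+y. indicator (uminus -` ((\<lambda>y. y + x) -` A)) y \<partial>N)"
      by (intro nn_integral_cong) (auto simp: indicator_def)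
    also have "\<dots> = emeasure N (uminus -` ((\<lambda>y. y + x) -` A))"
      by (rule nn_integral_indicator) (simp add: sN D)
    also have "\<dots> = emeasure N A" using reflN[OF C] invN[OF x A] by simp
    finally show "(\<integral>\<^sup>+y. indicator A (x - y) * indicator B x \<partial>N) = indicator B x * emeasure N A"
      by (simp add: mult.commute)
  qed
  also have "\<dots> = emeasure M B * emeasure N A"
    by (simp add: nn_integral_multc AM mM)
  finally show ?thesis .
qed

lemma sigma_finite_cballs:
  fixes M :: "'a::euclidean_space measure"
  assumes "sets M = sets borel" "\<And>n::nat. emeasure M (cball 0 n) < \<infinity>"
  shows "sigma_finite_measure M"
proof
  show "\<exists>A. countable A \<and> A \<subseteq> sets M \<and> \<Union>A = space M \<and> (\<forall>a\<in>A. emeasure M a \<noteq> \<infinity>)"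
  proof (intro exI conjI ballI)
    show "\<Union>(range (\<lambda>n::nat. cball (0::'a) n)) = space M"
    proof -
      have "x \<in> (\<Union>n::nat. cball 0 n)" for x :: 'a
        using real_arch_simple[of "norm x"] by auto
      then show ?thesis using sets_eq_imp_space_eq[OF assms(1)] by auto
    qed
  qed (use assms in \<open>auto simp: less_top[symmetric]\<close>)
qed

section \<open>Lebesgue measure of linear images\<close>

lemma lborel_translation_vimage:
  fixes A :: "'a::euclidean_space set"
  assumes "A \<in> sets borel"
  shows "emeasure lborel ((\<lambda>x. x + g) -` A) = emeasure lborel A"
proof -
  have "emeasure lborel A = emeasure (distr lborel borel ((+) g)) A" by (simp add: lborel_distr_plus)
  also have "\<dots> = emeasure lborel ((+) g -` A)" using assms by (simp add: emeasure_distr)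
  finally show ?thesis by (simp add: vimage_def add.commute)
qed

lemma lborel_reflect_vimage:
  fixes A :: "'a::euclidean_space set"
  assumes "A \<in> sets borel"
  shows "emeasure lborel ((\<lambda>x. c - x) -` A) = emeasure lborel A"
proof -
  have "emeasure lborel A = emeasure (distr lborel borel (\<lambda>x. c + (-1) *\<^sub>R x)) A"
    using lborel_affine[of "-1" c] by (simp add: density_1)
  also have "\<dots> = emeasure lborel ((\<lambda>x. c - x) -` A)" using assms by (simp add: emeasure_distr)
  finally show ?thesis by simp
qed

text \<open>The factor by which an injective linear \<open>f\<close> changes volumes, defined
  without coordinates; \<open>lscale_eq_det\<close> identifies it as the modulus of the
  determinant.\<close>

definition lscale :: "('a::euclidean_space \<Rightarrow> 'a) \<Rightarrow> real" where
  "lscale f = measure lborel (f ` cbox 0 One)"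

lemma linear_bij_image_eq_vimage:
  fixes f :: "'a::euclidean_space \<Rightarrow> 'a"
  assumes "linear f" "inj f"
  shows "f ` A = inv f -` A" "linear (inv f)" "inv f \<circ> f = id" "f \<circ> inv f = id" "surj f"
proof -
  show s: "surj f" using linear_injective_imp_surjective assms by blast
  show "f ` A = inv f -` A"
    using bij_vimage_eq_inv_image[of "inv f" A] bij_imp_bij_inv[of f] inv_inv_eq[of f] assms s by (simp add: bij_def)
  show "linear (inv f)" using assms(1) assms(2) inj_linear_imp_inv_linear by blast
  show "inv f \<circ> f = id" "f \<circ> inv f = id" using assms s by (auto simp: fun_eq_iff surj_f_inv_f)
qed

lemma borel_linear_image:
  fixes f :: "'a::euclidean_space \<Rightarrow> 'a"
  assumes "linear f" "inj f" "A \<in> sets borel"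
  shows "f ` A \<in> sets borel"
proof -
  have "inv f \<in> borel_measurable borel"
    using linear_bij_image_eq_vimage(2)[OF assms(1,2)] by (intro borel_measurable_continuous_onI linear_continuous_on) (simp add: linear_conv_bounded_linear)
  from measurable_sets[OF this assms(3)] show ?thesis using linear_bij_image_eq_vimage(1)[OF assms(1,2)] by simp
qed

text \<open>The volume of the image is a translation invariant measure of the original set, hence a
  multiple of Lebesgue measure; the factor is read off at the unit cube.\<close>

lemma emeasure_lborel_linear_image:
  fixes f :: "'a::euclidean_space \<Rightarrow> 'a"
  assumes f: "linear f" "inj f" and A: "A \<in> sets borel"
  shows "emeasure lborel (f ` A) = ennreal (lscale f) * emeasure lborel A"
proof -
  note fi = linear_bij_image_eq_vimage[OF f]
  have m: "inv f \<in> borel_measurable borel"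
    using fi(2) by (intro borel_measurable_continuous_onI linear_continuous_on) (simp add: linear_conv_bounded_linear)
  define M where "M = distr lborel borel (inv f)"
  have M: "emeasure M C = emeasure lborel (f ` C)" if "C \<in> sets borel" for C
    using m that by (simp add: M_def emeasure_distr fi(1))
  have fin: "emeasure lborel (f ` K) < \<infinity>" if "compact K" for K
    using compact_continuous_image[OF linear_continuous_on that, of f] f
    by (intro emeasure_bounded_finite compact_imp_bounded) (auto simp: linear_conv_bounded_linear)
  have eq: "emeasure M A * emeasure lborel (cbox 0 One :: 'a set) = emeasure M (cbox 0 One) * emeasure lborel A"
  proof (rule translation_invariant_unique[where G=UNIV])
    show "sets M = sets borel" by (simp add: M_def)
    show "sigma_finite_measure M"
      by (rule sigma_finite_cballs) (use M fin[OF compact_cball] in \<open>simp_all add: M_def\<close>)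
    show "sigma_finite_measure (lborel :: 'a measure)" by (rule sigma_finite_lborel)
    show "emeasure M ((\<lambda>x. x + g) -` C) = emeasure M C" if C: "C \<in> sets borel" for g C
    proof -
      have "(\<lambda>x. x + g) -` C \<in> sets borel" using measurable_sets[of "\<lambda>x. x + g" borel borel C] C by simp
      moreover have "f ` ((\<lambda>x. x + g) -` C) = (\<lambda>x. x + f g) -` (f ` C)"
      proof (intro set_eqI iffI)
        fix y assume "y \<in> f ` ((\<lambda>x. x + g) -` C)"
        then show "y \<in> (\<lambda>x. x + f g) -` (f ` C)" by (auto simp flip: linear_add[OF f(1)])
      next
        fix y assume "y \<in> (\<lambda>x. x + f g) -` (f ` C)"
        then obtain c where c: "c \<in> C" "y + f g = f c" by auto
        then have "y = f (c - g)" using linear_diff[OF f(1)] by (metis add_diff_cancel_right')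
        then show "y \<in> f ` ((\<lambda>x. x + g) -` C)" using c by auto
      qed
      ultimately show ?thesis using C by (simp add: M lborel_translation_vimage borel_linear_image[OF f])
    qed
    show "emeasure lborel (uminus -` C) = emeasure lborel C" if "C \<in> sets borel" for C :: "'a set"
      using lborel_reflect_vimage[OF that, of 0] by simp
  qed (auto simp: A lborel_translation_vimage)
  have "emeasure lborel (f ` cbox 0 One) = ennreal (lscale f)"
    unfolding lscale_def using fin[OF compact_cbox, of 0 One] by (intro emeasure_eq_ennreal_measure) simp
  moreover have one: "emeasure lborel (cbox 0 One :: 'a set) = 1"
    by (subst emeasure_eq_ennreal_measure) (auto simp: content_unit emeasure_lborel_cbox_eq)
  ultimately show ?thesis using eq A unfolding one by (simp add: M)
qed

lemma measure_lborel_linear_image: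
  fixes f :: "'a::euclidean_space \<Rightarrow> 'a"
  assumes f: "linear f" "inj f" and A: "A \<in> sets borel"
  shows "measure lborel (f ` A) = lscale f * measure lborel A"
  using emeasure_lborel_linear_image[OF assms] by (simp add: measure_def enn2real_mult lscale_def)

lemma lscale_comp:
  assumes "linear f" "inj f" "linear g" "inj g"
  shows "lscale (f \<circ> g) = lscale f * lscale (g :: 'a::euclidean_space \<Rightarrow> 'a)"
  unfolding lscale_def[of "f \<circ> g"] lscale_def[of g] image_comp[symmetric]
  by (intro measure_lborel_linear_image borel_linear_image assms) auto

lemma lscale_id [simp]: "lscale id = 1"
  by (simp add: lscale_def content_unit)

lemma lscale_nonneg: "lscale f \<ge> 0" by (simp add: lscale_def)

lemma involution_inj: "f \<circ> f = id \<Longrightarrow> inj f"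
  by (metis inj_on_id inj_on_imageI2)

lemma lscale_involution:
  fixes f :: "'a::euclidean_space \<Rightarrow> 'a"
  assumes "linear f" "f \<circ> f = id"
  shows "lscale f = 1"
proof -
  have "inj f" by (rule involution_inj[OF assms(2)])
  then have "lscale f * lscale f = 1" using lscale_comp[of f f] assms by simp
  then show ?thesis using lscale_nonneg[of f] by (metis abs_of_nonneg real_sqrt_mult_self real_sqrt_one real_sqrt_abs2)
qed

text \<open>The corresponding library results require a well-ordered index type.\<close>

lemma lscale_eq_det:
  fixes f :: "real^'n \<Rightarrow> real^'n"
  assumes "linear f" "inj f"
  shows "lscale f = \<bar>det (matrix f)\<bar>"
proof -
  have "linear f \<and> (inj f \<longrightarrow> lscale f = \<bar>det (matrix f)\<bar>)"
    using assms(1)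
  proof (rule induct_linear_elementary)
    fix f g :: "real^'n \<Rightarrow> real^'n"
    assume f: "linear f" and g: "linear g"
      and f': "linear f \<and> (inj f \<longrightarrow> lscale f = \<bar>det (matrix f)\<bar>)" and g': "linear g \<and> (inj g \<longrightarrow> lscale g = \<bar>det (matrix g)\<bar>)"
    show "linear (f \<circ> g) \<and> (inj (f \<circ> g) \<longrightarrow> lscale (f \<circ> g) = \<bar>det (matrix (f \<circ> g))\<bar>)"
    proof (intro conjI impI linear_compose g f)
      assume fg: "inj (f \<circ> g)"
      then have ig: "inj g" using inj_on_imageI2 by blast
      have "surj g" using ig g linear_injective_imp_surjective by blast
      then have "inj f" using fg by (metis inj_on_imageI)
      then show "lscale (f \<circ> g) = \<bar>det (matrix (f \<circ> g))\<bar>"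
        using f' g' ig f g by (simp add: lscale_comp matrix_compose det_mul abs_mult)
    qed
  next
    fix f :: "real^'n \<Rightarrow> real^'n" and i assume lf: "linear f" and f: "\<And>x. f x $ i = 0"
    then have "\<not> inj f"
      by (metis (full_types) linear_injective_imp_surjective one_neq_zero surjE vec_component)
    then show "linear f \<and> (inj f \<longrightarrow> lscale f = \<bar>det (matrix f)\<bar>)" using lf by simp
  next
    fix c :: "'n \<Rightarrow> real"
    let ?f = "\<lambda>x::real^'n. \<chi> i. c i * x$i"
    have lin: "linear ?f" by (rule linearI) (simp_all add: vec_eq_iff algebra_simps)
    have s: "(SOME j. axis i (1::real) = axis j 1) = i" for i :: 'n by (rule some_equality) (auto simp: axis_eq_axis)
    have B: "(Basis::(real^'n) set) = range (\<lambda>i. axis i 1)" by (auto simp: Basis_vec_def)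
    have injB: "inj (\<lambda>i. axis i (1::real) :: real^'n)" by (simp add: inj_on_def axis_eq_axis)
    have eq: "?f x = (\<Sum>k\<in>Basis. (c (SOME i. k = axis i 1) * (x \<bullet> k)) *\<^sub>R k)" for x
      using basis_expansion[of "?f x"] unfolding B
      by (simp add: sum.reindex[OF injB] s inner_axis scalar_mult_eq_scaleR)
    have "lscale ?f = \<bar>det (matrix ?f)\<bar>"
    proof -
      have "lscale ?f = \<bar>\<Prod>k\<in>(Basis::(real^'n) set). c (SOME i. k = axis i 1)\<bar> * measure lborel (cbox 0 One :: (real^'n) set)"
        unfolding lscale_def eq by (rule content_image_stretch_interval)
      also have "(\<Prod>k\<in>(Basis::(real^'n) set). c (SOME i. k = axis i 1)) = (\<Prod>i\<in>UNIV. c i)"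
        unfolding B by (simp add: prod.reindex[OF injB] s)
      also have "\<dots> = det (matrix ?f)" by (simp add: axis_def matrix_def det_diagonal)
      finally show ?thesis by (simp add: content_unit)
    qed
    then show "linear ?f \<and> (inj ?f \<longrightarrow> lscale ?f = \<bar>det (matrix ?f)\<bar>)" using lin by blast
  next
    fix m n :: 'n assume "m \<noteq> n"
    let ?h = "\<lambda>v::real^'n. \<chi> i. v $ Transposition.transpose m n i"
    have lin: "linear ?h" by (rule linearI) (simp_all add: vec_eq_iff)
    have inv: "?h \<circ> ?h = id" by (simp add: fun_eq_iff vec_eq_iff)
    have "det (matrix ?h) * det (matrix ?h) = 1"
      using matrix_compose[OF lin lin] inv by (metis det_I det_mul matrix_id_mat_1)
    then have "\<bar>det (matrix ?h)\<bar> = 1" by (metis abs_mult_self_eq abs_1 real_sqrt_abs2 real_sqrt_one)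
    then show "linear ?h \<and> (inj ?h \<longrightarrow> lscale ?h = \<bar>det (matrix ?h)\<bar>)"
      using lin lscale_involution[OF lin inv] by simp
  next
    fix m n :: 'n assume mn: "m \<noteq> n"
    let ?h = "\<lambda>v::real^'n. \<chi> i. if i = m then v $ m + v $ n else v $ i"
    \<comment> \<open>The shear is composed with the reflection of the \<open>m\<close>-th
      coordinate. The composition and the reflection are involutions and preserve volume, hence so
      does the shear.\<close>
    let ?D = "\<lambda>v::real^'n. \<chi> i. if i = m then - v $ m else v $ i"
    have lin: "linear ?h" by (rule linearI) (auto simp: vec_eq_iff algebra_simps)
    have linD: "linear ?D" by (rule linearI) (auto simp: vec_eq_iff)
    have invD: "?D \<circ> ?D = id" by (auto simp: fun_eq_iff vec_eq_iff)
    have hD: "(?h \<circ> ?D) \<circ> (?h \<circ> ?D) = id" using mn by (auto simp: fun_eq_iff vec_eq_iff)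
    have injh: "inj ?h"
    proof (rule injI)
      fix x y assume "?h x = ?h y"
      then have "(if i = m then x $ m + x $ n else x $ i) = (if i = m then y $ m + y $ n else y $ i)" for i
        by (simp add: vec_eq_iff)
      from this[of n] this show "x = y" using mn unfolding vec_eq_iff by (metis add_right_cancel)
    qed
    have "inj ?D" by (rule involution_inj[OF invD])
    then have "lscale (?h \<circ> ?D) = lscale ?h * lscale ?D" by (intro lscale_comp lin linD injh)
    then have 1: "lscale ?h = 1"
      unfolding lscale_involution[OF linear_compose[OF linD lin] hD] lscale_involution[OF linD invD] mult_1_right
      by (rule sym)
    have "matrix ?h = (\<chi> k. if k = m then row m (mat 1) + 1 *s row n (mat 1) else row k (mat 1))"
      by (auto simp: vec_eq_iff matrix_def row_def mat_def axis_def)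
    then have "det (matrix ?h) = 1" using det_row_operation[OF mn, where A="mat 1 :: real^'n^'n" and c=1] by simp
    then show "linear ?h \<and> (inj ?h \<longrightarrow> lscale ?h = \<bar>det (matrix ?h)\<bar>)" using lin 1 by simp
  qed
  then show ?thesis using assms by blast
qed

lemma lborel_affine_image:
  fixes f :: "'a::euclidean_space \<Rightarrow> 'a"
  assumes f: "linear f" "inj f" and A: "A \<in> sets borel"
  shows "(\<lambda>x. p + f x) ` A \<in> sets borel" "emeasure lborel ((\<lambda>x. p + f x) ` A) = ennreal (lscale f) * emeasure lborel A"
proof -
  have eq: "(\<lambda>x. p + f x) ` A = (\<lambda>x. x + (- p)) -` (f ` A)"
    by (auto simp: image_iff algebra_simps intro!: bexI)
  have b: "f ` A \<in> sets borel" by (rule borel_linear_image[OF f A])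
  show "(\<lambda>x. p + f x) ` A \<in> sets borel"
    unfolding eq using measurable_sets[of "\<lambda>x. x + (- p)" borel borel "f ` A"] b by simp
  show "emeasure lborel ((\<lambda>x. p + f x) ` A) = ennreal (lscale f) * emeasure lborel A"
    unfolding eq lborel_translation_vimage[OF b] by (rule emeasure_lborel_linear_image[OF f A])
qed

text \<open>The coordinate subspace of \<open>I\<close>, its unit thickening in the other coordinates, and the projection:
  the volume \<open>hvol I\<close> they define is translation invariant on the subspace, hence a multiple of Hausdorff measure.\<close>

definition hspace :: "'n set \<Rightarrow> (real^'n) set" where "hspace I = {x. \<forall>j\<in>-I. x $ j = 0}"
definition hslab :: "'n set \<Rightarrow> (real^'n) set" where "hslab I = {x. \<forall>j\<in>-I. 0 \<le> x $ j \<and> x $ j \<le> 1}"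
definition hproj :: "'n set \<Rightarrow> real^'n \<Rightarrow> real^'n" where "hproj I x = (\<chi> j. if j \<in> I then x $ j else 0)"
definition hcube :: "'n set \<Rightarrow> real^'n \<Rightarrow> real \<Rightarrow> (real^'n) set" where
  "hcube I c R = {x\<in>hspace I. \<forall>j\<in>I. \<bar>x $ j - c $ j\<bar> \<le> R}"

lemma closed_hspace: "closed (hspace I)"
proof -
  have "hspace I = (\<Inter>j\<in>-I. {x. x $ j = 0})" by (auto simp: hspace_def)
  then show ?thesis by (auto intro!: closed_INT closed_Collect_eq continuous_intros)
qed

lemma closed_hslab: "closed (hslab I)"
proof -
  have "hslab I = (\<Inter>j\<in>-I. {x. 0 \<le> x $ j} \<inter> {x. x $ j \<le> 1})" by (auto simp: hslab_def)
  then show ?thesis by (auto intro!: closed_INT closed_Int closed_Collect_le continuous_intros)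
qed

lemma closed_hcube: "closed (hcube I c R)"
proof -
  have "hcube I c R = hspace I \<inter> (\<Inter>j\<in>I. {x. \<bar>x $ j - c $ j\<bar> \<le> R})" by (auto simp: hcube_def)
  then show ?thesis by (auto intro!: closed_INT closed_Int closed_hspace closed_Collect_le continuous_intros)
qed

lemma hproj_measurable [measurable]:
  fixes I :: "'n::finite set"
  shows "hproj I \<in> borel_measurable borel"
proof (rule borel_measurable_continuous_onI)
  show "continuous_on UNIV (hproj I)"
    unfolding hproj_def
  proof (intro continuous_on_vec_lambda)
    show "continuous_on UNIV (\<lambda>x. if j \<in> I then x $ j else 0)" for j
      by (cases "j \<in> I") (auto intro!: continuous_intros)
  qed
qed

lemma hproj_in [simp]: "hproj I x \<in> hspace I" by (simp add: hproj_def hspace_def)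

definition hvol :: "'n set \<Rightarrow> (real^'n) set \<Rightarrow> ennreal" where
  "hvol I A = emeasure lborel (hslab I \<inter> hproj I -` A)"

lemma hvol_sets: "A \<in> sets borel \<Longrightarrow> hslab I \<inter> hproj I -` A \<in> sets borel"
  using measurable_sets[OF hproj_measurable, of A I] closed_hslab[of I] by auto

lemma hvol_hcube:
  assumes "R \<ge> 0"
  shows "hvol I (hcube I c R) = ennreal ((2 * R) ^ card I)"
proof -
  have eq: "hslab I \<inter> hproj I -` hcube I c R = cbox (\<chi> j. if j \<in> I then c $ j - R else 0) (\<chi> j. if j \<in> I then c $ j + R else 1)"
    by (auto simp: hslab_def hproj_def hcube_def hspace_def mem_box_cart abs_le_iff algebra_simps split: if_splits)
  have "measure lborel (cbox (\<chi> j. if j \<in> I then c $ j - R else 0) (\<chi> j. if j \<in> I then c $ j + R else (1::real)))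
     = (\<Prod>j\<in>UNIV. if j \<in> I then 2 * R else 1)"
    using assms by (subst content_cbox_cart) (auto simp: interval_eq_empty_cart if_distrib intro!: prod.cong split: if_splits)
  also have "\<dots> = (2 * R) ^ card I" by (simp add: prod.If_cases)
  finally show ?thesis unfolding hvol_def eq
    using emeasure_lborel_cbox_finite by (subst emeasure_eq_ennreal_measure) (auto simp: less_top)
qed

section \<open>Hausdorff measure on coordinate subspaces\<close>

lemma hausdorff_pre_finite_cover:
  assumes "finite X" "A \<subseteq> (\<Union>f\<in>X. U f)" "\<And>f. f \<in> X \<Longrightarrow> bounded (U f) \<and> diameter (U f) \<le> \<delta>" "\<delta> > 0"
  shows "hausdorff_pre k \<delta> A \<le> (\<Sum>f\<in>X. hausdorff_gauge k (U f))"
proof -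
  obtain e where e: "bij_betw e {..<card X} X" using ex_bij_betw_nat_finite[OF assms(1)] by (auto simp: atLeast0LessThan)
  define W where "W i = (if i < card X then U (e i) else {})" for i
  have "W \<in> hausdorff_covers \<delta> A"
    unfolding hausdorff_covers_def
  proof (intro CollectI conjI allI subsetI)
    fix x assume "x \<in> A"
    then obtain f where "f \<in> X" "x \<in> U f" using assms(2) by blast
    then obtain i where "i < card X" "e i = f"
      using bij_betw_imp_surj_on[OF e] by (metis imageE lessThan_iff)
    then show "x \<in> (\<Union>i. W i)" using \<open>x \<in> U f\<close> by (intro UN_I[of i]) (auto simp: W_def)
  next
    fix i show "bounded (W i)" "diameter (W i) \<le> \<delta>"
      using assms(3)[of "e i"] assms(4) bij_betwE[OF e] by (auto simp: W_def)
  qed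
  then have "hausdorff_pre k \<delta> A \<le> (\<Sum>i. hausdorff_gauge k (W i))"
    unfolding hausdorff_pre_def by (rule INF_lower)
  also have "\<dots> = (\<Sum>i<card X. hausdorff_gauge k (W i))"
    by (rule suminf_finite) (auto simp: W_def hausdorff_gauge_def)
  also have "\<dots> = (\<Sum>f\<in>X. hausdorff_gauge k (U f))"
    using sum.reindex_bij_betw[OF e, of "\<lambda>f. hausdorff_gauge k (U f)"] by (simp add: W_def)
  finally show ?thesis .
qed

text \<open>The cube is cut into \<open>m ^ card I\<close> cells of diameter at most
  \<open>n * (2 * R) / m\<close>; the resulting bound for the sum of the gauges does not depend on
  \<open>m\<close>. Bounding diameters by the sum norm is crude, but only finiteness
  matters.\<close>

lemma hausdorff_hcube_finite:
  assumes R: "R > 0"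
  shows "hausdorff_outer (card I) (hcube I (0::real^'n) R) < \<infinity>"
proof -
  let ?k = "card I"
  define n where "n = real CARD('n)"
  have n: "n \<ge> 1" by (simp add: n_def Suc_leI)
  have "hausdorff_pre ?k \<delta> (hcube I 0 R) \<le> ennreal (unit_ball_vol ?k * (n * R) ^ ?k)" if \<delta>: "\<delta> > 0" for \<delta>
  proof -
    define m where "m = Suc (nat \<lceil>n * (2 * R) / \<delta>\<rceil>)"
    have m: "m > 0" "n * (2 * R) / m \<le> \<delta>"
    proof -
      have "n * (2 * R) / \<delta> \<le> m" unfolding m_def by linarith
      then show "n * (2 * R) / m \<le> \<delta>" using \<delta> by (simp add: m_def field_simps)
    qed (simp add: m_def)
    define X where "X = PiE I (\<lambda>_. {..<m})"
    define U where "U f = {x\<in>hspace I. \<forall>j\<in>I. - R + 2 * R * real (f j) / m \<le> x $ j \<and> x $ j \<le> - R + 2 * R * (real (f j) + 1) / m}" for f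
    have fX: "finite X" unfolding X_def by (intro finite_PiE) auto
    have cX: "card X = m ^ ?k" unfolding X_def by (subst card_PiE) auto
    have close: "norm (x - y) \<le> n * (2 * R) / m" if "x \<in> U f" "y \<in> U f" for x y f
    proof -
      have "norm (x - y) \<le> (\<Sum>j\<in>UNIV. \<bar>(x - y) $ j\<bar>)" by (rule norm_le_l1_cart)
      also have "\<dots> \<le> (\<Sum>j\<in>(UNIV::'n set). 2 * R / m)"
      proof (rule sum_mono)
        fix j
        show "\<bar>(x - y) $ j\<bar> \<le> 2 * R / m"
        proof (cases "j \<in> I")
          case True
          have "- R + 2 * R * (real (f j) + 1) / m - (- R + 2 * R * real (f j) / m) = 2 * R / m"
            by (simp add: field_simps add_divide_distrib[symmetric])
          moreover have "- R + 2 * R * real (f j) / m \<le> x $ j" "x $ j \<le> - R + 2 * R * (real (f j) + 1) / m"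
            "- R + 2 * R * real (f j) / m \<le> y $ j" "y $ j \<le> - R + 2 * R * (real (f j) + 1) / m"
            using that True by (auto simp: U_def)
          ultimately show ?thesis by (simp add: abs_le_iff)
        next
          case False
          then show ?thesis using that R by (auto simp: U_def hspace_def)
        qed
      qed
      finally show ?thesis by (simp add: n_def)
    qed
    have bd: "bounded (U f)" for f
    proof (cases "U f = {}")
      case False
      then obtain y where "y \<in> U f" by blast
      then have "U f \<subseteq> cball y (n * (2 * R) / m)"
        using close[of y f] by (auto simp: dist_norm)
      then show ?thesis by (rule bounded_subset[OF bounded_cball])
    qed simp
    have diam: "diameter (U f) \<le> n * (2 * R) / m" for f
      using close n R by (intro diameter_le) (auto intro!: divide_nonneg_nonneg mult_nonneg_nonneg)
    have cov: "hcube I 0 R \<subseteq> (\<Union>f\<in>X. U f)"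
    proof
      fix x :: "real^'n" assume x: "x \<in> hcube I 0 R"
      define t where "t j = (x $ j + R) * m / (2 * R)" for j
      have t: "0 \<le> t j" "t j \<le> m" if "j \<in> I" for j
      proof -
        have xj: "0 \<le> x $ j + R" "x $ j + R \<le> 2 * R" using x that by (auto simp: hcube_def abs_le_iff)
        then show "0 \<le> t j" using R m by (auto simp: t_def intro!: divide_nonneg_nonneg mult_nonneg_nonneg)
        have "t j \<le> (2 * R) * m / (2 * R)" unfolding t_def using xj R by (intro divide_right_mono mult_right_mono) auto
        then show "t j \<le> m" using R by simp
      qed
      \<comment> \<open>The cell index is capped at \<open>m - 1\<close>, so that points on the far
        side of the cube belong to the last cell.\<close>
      define f where "f = restrict (\<lambda>j. min (m - 1) (nat \<lfloor>t j\<rfloor>)) I"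
      have f: "real (f j) \<le> t j" "t j \<le> real (f j) + 1" if "j \<in> I" for j
        using t[OF that] m that by (auto simp: f_def min_def of_nat_diff) linarith+
      have xt: "x $ j = - R + 2 * R * t j / m" for j using R m by (simp add: t_def field_simps)
      have "x \<in> U f" unfolding U_def
      proof (intro CollectI conjI ballI)
        show "x \<in> hspace I" using x by (simp add: hcube_def)
        fix j assume j: "j \<in> I"
        show "- R + 2 * R * real (f j) / m \<le> x $ j" "x $ j \<le> - R + 2 * R * (real (f j) + 1) / m"
          unfolding xt using f[OF j] R m by (auto intro!: divide_right_mono mult_left_mono)
      qed
      moreover have "f \<in> X" unfolding X_def f_def using m by auto
      ultimately show "x \<in> (\<Union>f\<in>X. U f)" by blast
    qed
    have "hausdorff_pre ?k \<delta> (hcube I 0 R) \<le> (\<Sum>f\<in>X. hausdorff_gauge ?k (U f))"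
      by (rule hausdorff_pre_finite_cover[OF fX cov _ \<delta>]) (use bd diam m order_trans in blast)
    also have "\<dots> \<le> (\<Sum>f\<in>X. ennreal (unit_ball_vol ?k * (n * R / m) ^ ?k))"
    proof (rule sum_mono)
      fix f
      have "n * (2 * R) / m = 2 * (n * R / m)" by simp
      with diam[of f] have "diameter (U f) \<le> 2 * (n * R / m)" by metis
      then have "diameter (U f) / 2 \<le> (2 * (n * R / m)) / 2" by (rule divide_right_mono) simp
      also have "\<dots> = n * R / m" by simp
      finally have "diameter (U f) / 2 \<le> n * R / m" .
      then have "(diameter (U f) / 2) ^ ?k \<le> (n * R / m) ^ ?k"
        using diameter_ge_0[OF bd] by (intro power_mono) auto
      then show "hausdorff_gauge ?k (U f) \<le> ennreal (unit_ball_vol ?k * (n * R / m) ^ ?k)"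
        by (auto simp: hausdorff_gauge_def intro!: ennreal_leI mult_left_mono)
    qed
    also have "\<dots> = ennreal (real (m ^ ?k) * (unit_ball_vol ?k * (n * R / m) ^ ?k))"
      using n R by (simp add: cX ennreal_mult' ennreal_of_nat_eq_real_of_nat)
    also have "real (m ^ ?k) * (unit_ball_vol ?k * (n * R / m) ^ ?k) = unit_ball_vol ?k * (n * R) ^ ?k"
      using m by (simp add: power_divide)
    finally show ?thesis .
  qed
  then have "hausdorff_outer ?k (hcube I 0 R) \<le> ennreal (unit_ball_vol ?k * (n * R) ^ ?k)"
    unfolding hausdorff_outer_eq_SUP by (intro SUP_least) auto
  then show ?thesis by (rule le_less_trans) simp
qed

text \<open>Within the subspace, a set of diameter \<open>d\<close> lies in a cube of half side
  \<open>d\<close> around any of its points, so its volume is at most \<open>c\<close> times its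
  gauge. A cover with too small a sum of gauges would contradict the volume of the cube.\<close>

lemma hausdorff_hcube_pos: "hausdorff_outer (card I) (hcube I (0::real^'n) 1) > 0"
proof (rule ccontr)
  let ?k = "card I"
  assume "\<not> ?thesis"
  then have z: "hausdorff_pre ?k 1 (hcube I 0 1) = 0"
    using hausdorff_pre_le_outer[of 1 ?k "hcube I 0 1"] by simp
  \<comment> \<open>The quotient of the volume \<open>(2 * d) ^ k\<close> and the gauge
    \<open>unit_ball_vol k * (d / 2) ^ k\<close>.\<close>
  define c where "c = 4 ^ ?k / unit_ball_vol (real ?k)"
  have c: "c > 0" by (simp add: c_def)
  have "hausdorff_pre ?k 1 (hcube I 0 1) < ennreal (1 / c)" using c z by simp
  then obtain U where U: "U \<in> hausdorff_covers 1 (hcube I 0 1)" "(\<Sum>i. hausdorff_gauge ?k (U i)) < ennreal (1 / c)"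
    unfolding hausdorff_pre_def INF_less_iff by blast
  define x where "x i = (SOME y. y \<in> U i)" for i
  define B where "B i = (if U i = {} then {} else hcube I (x i) (diameter (U i)))" for i
  have UB: "hcube I 0 1 \<subseteq> (\<Union>i. B i)"
  proof
    fix y assume y: "y \<in> hcube I 0 1"
    then obtain i where i: "y \<in> U i" using U(1) by (auto simp: hausdorff_covers_def)
    then have xi: "x i \<in> U i" unfolding x_def by (metis someI)
    have "dist y (x i) \<le> diameter (U i)"
      using U(1) i xi by (intro diameter_bounded_bound) (auto simp: hausdorff_covers_def)
    then have "\<bar>y $ j - x i $ j\<bar> \<le> diameter (U i)" for j
      using component_le_norm_cart[of "y - x i" j] by (simp add: dist_norm)
    then have "y \<in> B i" using y i by (auto simp: B_def hcube_def)
    then show "y \<in> (\<Union>i. B i)" by blast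
  qed
  have Bb: "B i \<in> sets borel" for i by (auto simp: B_def intro!: borel_closed[OF closed_hcube])
  have "ennreal (2 ^ ?k) = hvol I (hcube I 0 1)" by (simp add: hvol_hcube)
  also have "\<dots> \<le> emeasure lborel (\<Union>i. hslab I \<inter> hproj I -` B i)"
    unfolding hvol_def
  proof (rule emeasure_mono)
    show "hslab I \<inter> hproj I -` hcube I 0 1 \<subseteq> (\<Union>i. hslab I \<inter> hproj I -` B i)" using UB by blast
    show "(\<Union>i. hslab I \<inter> hproj I -` B i) \<in> sets lborel"
      unfolding sets_lborel by (intro sets.countable_UN image_subsetI hvol_sets[OF Bb])
  qed
  also have "\<dots> \<le> (\<Sum>i. hvol I (B i))"
    unfolding hvol_def
    by (rule emeasure_subadditive_countably) (auto simp del: vimage_UN Int_UN_distrib intro!: hvol_sets[OF Bb])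
  also have "\<dots> \<le> (\<Sum>i. ennreal c * hausdorff_gauge ?k (U i))"
  proof (intro suminf_le summableI)
    fix i
    show "hvol I (B i) \<le> ennreal c * hausdorff_gauge ?k (U i)"
    proof (cases "U i = {}")
      case False
      have d: "diameter (U i) \<ge> 0" using U(1) by (auto simp: hausdorff_covers_def diameter_ge_0)
      have "c * (unit_ball_vol ?k * (diameter (U i) / 2) ^ ?k) = (2 * diameter (U i)) ^ ?k"
      proof -
        have "unit_ball_vol (real ?k) \<noteq> 0" using unit_ball_vol_pos[of "real ?k"] by linarith
        then have "c * unit_ball_vol ?k = 4 ^ ?k" by (simp add: c_def)
        then have "c * (unit_ball_vol ?k * (diameter (U i) / 2) ^ ?k) = (4 * (diameter (U i) / 2)) ^ ?k"
          by (simp only: mult.assoc[symmetric] power_mult_distrib)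
        then show ?thesis by simp
      qed
      then have "ennreal c * hausdorff_gauge ?k (U i) = ennreal ((2 * diameter (U i)) ^ ?k)"
        using False c d by (simp add: hausdorff_gauge_def ennreal_mult[symmetric])
      then show ?thesis using False d by (simp add: B_def hvol_hcube)
    qed (simp add: B_def hvol_def)
  qed
  also have "\<dots> = ennreal c * (\<Sum>i. hausdorff_gauge ?k (U i))" by (rule ennreal_suminf_cmult)
  also have "\<dots> < ennreal c * ennreal (1 / c)" using U(2) c by (intro ennreal_mult_strict_left_mono) auto
  also have "\<dots> = 1" using c by (simp add: ennreal_mult[symmetric])
  finally have "(2::real) ^ ?k < 1" by (simp add: ennreal_less_one_iff)
  then show False using one_le_power[of "2::real" ?k] by linarith
qed

lemma hausdorff_outer_translate: "hausdorff_outer k ((\<lambda>x. x + g) -` A) = hausdorff_outer k (A :: 'a::real_normed_vector set)"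
proof -
  have "(\<lambda>x. x + g) -` A = (\<lambda>x. x - g) ` A" by (auto simp: image_iff intro!: bexI[of _ "_ + g"])
  moreover have "surj (\<lambda>x. x - g)" by (metis add_diff_cancel surjI)
  ultimately show ?thesis using hausdorff_outer_isometry[of "\<lambda>x. x - g" k A] by (simp add: dist_norm)
qed

text \<open>Hausdorff measure restricted to the subspace and the projected volume of the slab are
  both invariant under translations in the subspace, hence proportional. The factor is the quotient
  of their values on a cube; it is not evaluated further and goes into later constants.\<close>

lemma hausdorff_coordinate:
  "\<exists>\<kappa>>0. \<forall>A. A \<in> sets borel \<longrightarrow> A \<subseteq> hspace I \<longrightarrow>
     emeasure (hausdorff_measure (card I)) A = ennreal \<kappa> * hvol I (A :: (real^'n) set)"
proof -
  let ?k = "card I"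
  let ?H = "hausdorff_measure ?k :: (real^'n) measure"
  have hs: "hspace I \<in> sets borel" by (rule borel_closed[OF closed_hspace])
  define M where "M = density ?H (indicator (hspace I))"
  define N where "N = distr (density lborel (indicator (hslab I))) borel (hproj I)"
  have M: "emeasure M A = hausdorff_outer ?k (hspace I \<inter> A)" if "A \<in> sets borel" for A
  proof -
    have "emeasure M A = emeasure ?H (hspace I \<inter> A)"
      unfolding M_def using that hs by (subst emeasure_density) (auto simp: indicator_inter_arith[symmetric])
    then show ?thesis using that hs by (simp add: emeasure_hausdorff_measure)
  qed
  have sl: "hslab I \<in> sets borel" by (rule borel_closed[OF closed_hslab])
  have N: "emeasure N A = hvol I A" if "A \<in> sets borel" for A
  proof -
    have "emeasure N A = emeasure (density lborel (indicator (hslab I))) (hproj I -` A)"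
      unfolding N_def using that by (subst emeasure_distr) auto
    also have "\<dots> = emeasure lborel (hslab I \<inter> hproj I -` A)"
      using that sl measurable_sets[OF hproj_measurable that, of I]
      by (subst emeasure_density) (auto simp: indicator_inter_arith[symmetric])
    finally show ?thesis by (simp add: hvol_def)
  qed
  have cube: "hspace I \<inter> cball 0 (real n) \<subseteq> hcube I 0 (real n + 1)" for n
  proof
    fix x :: "real^'n" assume x: "x \<in> hspace I \<inter> cball 0 (real n)"
    then have "\<bar>x $ j\<bar> \<le> real n + 1" for j using component_le_norm_cart[of x j] by simp
    then show "x \<in> hcube I 0 (real n + 1)" using x by (simp add: hcube_def)
  qed
  have eq: "emeasure M A * emeasure N B = emeasure M B * emeasure N A" if "A \<in> sets borel" "B \<in> sets borel" for A B
  proof (rule translation_invariant_unique[where G="hspace I"])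
    show "sets M = sets borel" "sets N = sets borel" by (simp_all add: M_def N_def)
    show "sigma_finite_measure M"
    proof (rule sigma_finite_cballs)
      show "emeasure M (cball 0 (real n)) < \<infinity>" for n
        using M[of "cball 0 (real n)"] hausdorff_outer_mono[OF cube, of ?k n]
          hausdorff_hcube_finite[of "real n + 1" I] by (auto intro: le_less_trans)
    qed (simp add: M_def)
    show "sigma_finite_measure N"
    proof (rule sigma_finite_cballs)
      fix n :: nat
      have "hvol I (cball 0 (real n)) \<le> hvol I (hcube I 0 (real n + 1))"
        unfolding hvol_def
      proof (rule emeasure_mono)
        show "hslab I \<inter> hproj I -` cball 0 (real n) \<subseteq> hslab I \<inter> hproj I -` hcube I 0 (real n + 1)"
          using cube[of n] hproj_in by blast
        show "hslab I \<inter> hproj I -` hcube I 0 (real n + 1) \<in> sets lborel"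
          unfolding sets_lborel by (rule hvol_sets[OF borel_closed[OF closed_hcube]])
      qed
      moreover have "hvol I (hcube I (0::real^'n) (real n + 1)) < \<infinity>" by (subst hvol_hcube) auto
      ultimately have "hvol I (cball (0::real^'n) (real n)) < \<infinity>" by (rule le_less_trans)
      then show "emeasure N (cball 0 (real n)) < \<infinity>" by (simp only: N[OF borel_closed[OF closed_cball]])
    qed (simp add: N_def)
    have "indicator (hspace I) \<in> borel_measurable ?H" using hs by (intro borel_measurable_indicator) simp
    from AE_density[OF this] show "AE x in M. x \<in> hspace I"
      unfolding M_def by (simp add: indicator_def)
    have "{x \<in> space borel. x \<in> hspace I} \<in> sets borel" using hs by simp
    from AE_distr_iff[of "hproj I" "density lborel (indicator (hslab I))" borel, OF _ this]
    show "AE x in N. x \<in> hspace I" unfolding N_def by simp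
    fix g :: "real^'n" and A :: "(real^'n) set" assume g: "g \<in> hspace I" and A: "A \<in> sets borel"
    have gA: "(\<lambda>x. x + g) -` A \<in> sets borel" by (rule borel_shift_vimage[OF A])
    have eq1: "hspace I \<inter> (\<lambda>x. x + g) -` A = (\<lambda>x. x + g) -` (hspace I \<inter> A)" using g by (auto simp: hspace_def)
    show "emeasure M ((\<lambda>x. x + g) -` A) = emeasure M A"
      unfolding M[OF gA] M[OF A] eq1 by (rule hausdorff_outer_translate)
    have "hproj I (x + g) = hproj I x + g" for x using g by (auto simp: hproj_def hspace_def vec_eq_iff)
    then have "hslab I \<inter> hproj I -` ((\<lambda>x. x + g) -` A) = (\<lambda>x. x + g) -` (hslab I \<inter> hproj I -` A)"
      using g by (auto simp: hslab_def hspace_def)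
    then show "emeasure N ((\<lambda>x. x + g) -` A) = emeasure N A"
      using N[OF gA] N[OF A] lborel_translation_vimage[OF hvol_sets[OF A]] by (simp add: hvol_def)
  next
    fix A :: "(real^'n) set" assume A: "A \<in> sets borel"
    \<comment> \<open>The reflection has to map the slab onto itself, so it is centred at 0 in the
      coordinates from \<open>I\<close> and at 1/2 in the others.\<close>
    define c :: "real^'n" where "c = (\<chi> j. if j \<in> I then 0 else 1)"
    have uA: "uminus -` A \<in> sets borel"
      using measurable_sets[of "uminus :: real^'n \<Rightarrow> real^'n" borel borel A] A by simp
    have "hproj I (c - x) = - hproj I x" for x by (auto simp: hproj_def c_def vec_eq_iff)
    then have "hslab I \<inter> hproj I -` (uminus -` A) = (\<lambda>x. c - x) -` (hslab I \<inter> hproj I -` A)"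
      by (auto simp: hslab_def c_def)
    then show "emeasure N (uminus -` A) = emeasure N A"
      using N[OF uA] N[OF A] lborel_reflect_vimage[OF hvol_sets[OF A]] by (simp add: hvol_def)
  qed (use that in auto)
  let ?B = "hcube I (0::real^'n) 1"
  have B: "?B \<in> sets borel" by (rule borel_closed[OF closed_hcube])
  define h where "h = enn2real (hausdorff_outer ?k ?B)"
  have MB: "emeasure M ?B = ennreal h"
  proof -
    have "hspace I \<inter> ?B = ?B" by (auto simp: hcube_def)
    then show ?thesis using M[OF B] hausdorff_hcube_finite[of 1 I] by (simp add: h_def)
  qed
  have h: "h > 0" using hausdorff_hcube_pos[of I] hausdorff_hcube_finite[of 1 I]
    by (auto simp: h_def enn2real_positive_iff)
  show ?thesis
  proof (intro exI[of _ "h / 2 ^ ?k"] conjI allI impI)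
    show "h / 2 ^ ?k > 0" using h by simp
    fix A :: "(real^'n) set" assume A: "A \<in> sets borel" "A \<subseteq> hspace I"
    have "emeasure M A = emeasure ?H A"
      using M[OF A(1)] A by (simp add: emeasure_hausdorff_measure inf.absorb2)
    then have "emeasure ?H A * ennreal (2 ^ ?k) = ennreal h * hvol I A"
      using eq[OF A(1) B] MB by (simp add: N[OF A(1)] N[OF B] hvol_hcube)
    then have "emeasure ?H A * ennreal (2 ^ ?k) * ennreal (1 / 2 ^ ?k) = ennreal h * hvol I A * ennreal (1 / 2 ^ ?k)" by simp
    moreover have "ennreal (2 ^ ?k) * ennreal (1 / 2 ^ ?k) = 1" by (simp add: ennreal_mult[symmetric])
    moreover have "ennreal h * hvol I A * ennreal (1 / 2 ^ ?k) = ennreal (h / 2 ^ ?k) * hvol I A"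
    proof -
      have "ennreal (h / 2 ^ ?k) = ennreal h * ennreal (1 / 2 ^ ?k)" using h by (simp add: ennreal_mult[symmetric])
      then show ?thesis by (simp add: ac_simps)
    qed
    ultimately show "emeasure ?H A = ennreal (h / 2 ^ ?k) * hvol I A" by (simp add: mult.assoc)
  qed
qed

lemma hausdorff_full_dim:
  "\<exists>\<kappa>>0. \<forall>A. A \<in> sets borel \<longrightarrow> emeasure (hausdorff_measure CARD('n)) A = ennreal \<kappa> * emeasure lborel (A :: (real^'n) set)"
proof -
  have "hspace UNIV = (UNIV :: (real^'n) set)" "hslab UNIV = (UNIV :: (real^'n) set)" "hproj UNIV = (id :: real^'n \<Rightarrow> _)"
    by (auto simp: hspace_def hslab_def hproj_def vec_eq_iff fun_eq_iff)
  then show ?thesis using hausdorff_coordinate[of "UNIV :: 'n set"] by (simp add: hvol_def)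
qed

text \<open>The prism over \<open>A\<close> with side vector \<open>n\<close>, which trades an area
  in a hyperplane for a volume.\<close>

definition cyl :: "'a::real_vector \<Rightarrow> 'a set \<Rightarrow> 'a set" where
  "cyl n A = {y + s *\<^sub>R n | y s. y \<in> A \<and> 0 \<le> s \<and> s \<le> 1}"

lemma cyl_affine:
  assumes "linear f" "f n = m"
  shows "cyl m ((\<lambda>x. p + f x) ` A) = (\<lambda>x. p + f x) ` cyl n A"
  using assms unfolding cyl_def
  by (auto simp: linear_add linear_scale image_iff add.assoc) (metis add.assoc linear_add linear_scale)+

text \<open>A rigid motion takes the hyperplane to a coordinate hyperplane, where the prism of
  height 1 is the slab over the set. The same \<open>\<kappa>\<close> serves all hyperplanes,
  because a rigid motion changes neither side.\<close>

lemma hausdorff_cylinder: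
  "\<exists>\<kappa>>0. \<forall>n p (A :: (real^'n) set). norm n = 1 \<longrightarrow> A \<in> sets borel \<longrightarrow> (\<forall>x\<in>A. n \<bullet> (x - p) = 0) \<longrightarrow>
     emeasure (hausdorff_measure (CARD('n) - 1)) A = ennreal \<kappa> * emeasure lborel (cyl n A)"
proof -
  fix i0 :: 'n
  define I where "I = UNIV - {i0}"
  define e :: "real^'n" where "e = axis i0 1"
  have cI: "card I = CARD('n) - 1" by (simp add: I_def card_Diff_singleton)
  from hausdorff_coordinate[of I] obtain \<kappa> where \<kappa>: "\<kappa> > 0"
    "\<And>A. A \<in> sets borel \<Longrightarrow> A \<subseteq> hspace I \<Longrightarrow> emeasure (hausdorff_measure (CARD('n) - 1)) A = ennreal \<kappa> * hvol I (A :: (real^'n) set)"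
    unfolding cI by blast
  show ?thesis
  proof (intro exI[of _ \<kappa>] conjI allI impI \<kappa>(1))
    fix n p :: "real^'n" and A assume n: "norm n = 1" and A: "A \<in> sets borel" and An: "\<forall>x\<in>A. n \<bullet> (x - p) = 0"
    have "norm e = norm n" using n by (simp add: e_def norm_axis_1)
    then obtain R where R: "orthogonal_transformation R" "R e = n" using orthogonal_transformation_exists by blast
    have lin: "linear R" and injR: "inj R" and surjR: "surj R"
      using R(1) by (auto simp: orthogonal_transformation_linear orthogonal_transformation_inj orthogonal_transformation_surj)
    define \<Phi> where "\<Phi> x = p + R x" for x
    define A' where "A' = \<Phi> -` A"
    have "\<Phi> \<in> borel_measurable borel"
      unfolding \<Phi>_def using lin by (intro borel_measurable_continuous_onI continuous_intros linear_continuous_on) (simp add: linear_conv_bounded_linear)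
    from measurable_sets[OF this A] have A'b: "A' \<in> sets borel" by (simp add: A'_def)
    have surjP: "surj \<Phi>"
      unfolding surj_def \<Phi>_def using surjR by (metis add_diff_cancel_left' add_diff_eq surjD)
    have AA': "A = \<Phi> ` A'" using surjP by (auto simp: A'_def)
    have A'h: "A' \<subseteq> hspace I"
    proof
      fix x assume "x \<in> A'"
      then have "n \<bullet> R x = 0" using An by (auto simp: A'_def \<Phi>_def)
      then have "e \<bullet> x = 0" using R by (metis orthogonal_transformation_def)
      then show "x \<in> hspace I" by (auto simp: hspace_def I_def e_def inner_axis')
    qed
    have iso: "dist (\<Phi> x) (\<Phi> y) = dist x y" for x y
      using R(1) by (simp add: \<Phi>_def orthogonal_transformation_isometry)
    have H: "emeasure (hausdorff_measure (CARD('n) - 1)) A = emeasure (hausdorff_measure (CARD('n) - 1)) A'"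
      using hausdorff_outer_isometry[OF iso surjP, of "CARD('n) - 1" A'] A A'b
      by (simp add: emeasure_hausdorff_measure AA'[symmetric])
    have cylA': "hslab I \<inter> hproj I -` A' = cyl e A'"
    proof (intro set_eqI iffI)
      fix x assume x: "x \<in> hslab I \<inter> hproj I -` A'"
      have "x = hproj I x + (x $ i0) *\<^sub>R e" by (auto simp: vec_eq_iff hproj_def I_def e_def axis_def)
      moreover have "0 \<le> x $ i0" "x $ i0 \<le> 1" using x by (auto simp: hslab_def I_def)
      ultimately show "x \<in> cyl e A'" unfolding cyl_def using x by blast
    next
      fix x assume "x \<in> cyl e A'"
      then obtain y s where ys: "x = y + s *\<^sub>R e" "y \<in> A'" "0 \<le> s" "s \<le> 1" by (auto simp: cyl_def)
      then have "y $ i0 = 0" using A'h by (auto simp: hspace_def I_def)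
      then have "hproj I x = y" "x $ i0 = s" using ys by (auto simp: vec_eq_iff hproj_def I_def e_def axis_def)
      then show "x \<in> hslab I \<inter> hproj I -` A'" using ys by (auto simp: hslab_def I_def)
    qed
    have "lscale R = 1" using lscale_eq_det[OF lin injR] R(1) by (simp add: orthogonal_transformation_det)
    then have "emeasure lborel (\<Phi> ` cyl e A') = emeasure lborel (cyl e A')"
      unfolding \<Phi>_def using lborel_affine_image(2)[OF lin injR, of "cyl e A'" p] hvol_sets[OF A'b, of I] cylA' by simp
    moreover have "\<Phi> ` cyl e A' = cyl n A"
      unfolding AA' \<Phi>_def by (rule cyl_affine[OF lin R(2), symmetric])
    ultimately show "emeasure (hausdorff_measure (CARD('n) - 1)) A = ennreal \<kappa> * emeasure lborel (cyl n A)"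
      unfolding H \<kappa>(2)[OF A'b A'h] hvol_def cylA' by simp
  qed
qed

section \<open>Simplices and their faces\<close>

definition full_simplex :: "'a::euclidean_space set \<Rightarrow> bool" where
  "full_simplex S \<longleftrightarrow> finite S \<and> \<not> affine_dependent S \<and> card S = Suc DIM('a)"

text \<open>\<open>g v \<bullet> x + \<beta> v\<close> is the barycentric coordinate of
  \<open>x\<close> at the vertex \<open>v\<close>. For a full simplex \<open>g v\<close> is
  therefore normal to the facet opposite to \<open>v\<close>, points towards \<open>v\<close> and
  has the reciprocal of the height as norm.\<close>

definition barycentric :: "'a::euclidean_space set \<Rightarrow> ('a \<Rightarrow> 'a) \<Rightarrow> ('a \<Rightarrow> real) \<Rightarrow> bool" where
  "barycentric S g \<beta> \<longleftrightarrow> (\<forall>v\<in>S. \<forall>w\<in>S. g v \<bullet> w + \<beta> v = (if v = w then 1 else 0))"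

lemma barycentric_exists:
  fixes S :: "'a::euclidean_space set"
  assumes "\<not> affine_dependent S"
  shows "\<exists>g \<beta>. barycentric S g \<beta>"
proof (cases "S = {}")
  case False
  then obtain p where p: "p \<in> S" by blast
  have ind: "independent ((\<lambda>x. - p + x) ` (S - {p}))"
    using assms affine_dependent_iff_dependent2[OF p] by blast
  have "\<exists>g b. \<forall>w\<in>S. g \<bullet> w + b = (if v = w then 1 else (0::real))" for v
  proof -
    \<comment> \<open>The values are prescribed on the edges from \<open>p\<close>, which are
      independent; the constant term then corrects the value at \<open>p\<close>.\<close>
    define f where "f y = (if p + y = v then 1 else 0) - (if p = v then 1 else (0::real))" for y
    obtain G where G: "linear G" "\<forall>x\<in>(\<lambda>x. - p + x) ` (S - {p}). G x = f x"
      using linear_independent_extend[OF ind, of f] by blast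
    have adj: "G x = adjoint G (1::real) \<bullet> x" for x
      using adjoint_works[OF G(1), of x 1] by (simp add: inner_commute)
    have "adjoint G (1::real) \<bullet> w + ((if p = v then 1 else 0) - adjoint G (1::real) \<bullet> p) = (if v = w then 1 else 0)" if w: "w \<in> S" for w
    proof (cases "w = p")
      case False
      then have "G (- p + w) = f (- p + w)" using G(2) w by blast
      moreover have "G (- p + w) = adjoint G (1::real) \<bullet> w - adjoint G (1::real) \<bullet> p" by (simp add: adj inner_diff_right)
      ultimately show ?thesis by (auto simp: f_def)
    qed auto
    then show ?thesis by blast
  qed
  then show ?thesis unfolding barycentric_def by metis
qed (simp add: barycentric_def)

context
  fixes S :: "'a::euclidean_space set" and g \<beta>
  assumes fs: "full_simplex S" and ba: "barycentric S g \<beta>"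
begin

lemma bary_coord:
  assumes "sum u S = 1" "v \<in> S"
  shows "g v \<bullet> (\<Sum>w\<in>S. u w *\<^sub>R w) + \<beta> v = u v"
proof -
  have "g v \<bullet> (\<Sum>w\<in>S. u w *\<^sub>R w) + \<beta> v = (\<Sum>w\<in>S. u w * (g v \<bullet> w)) + (\<Sum>w\<in>S. u w * \<beta> v)"
    using assms by (simp add: inner_sum_right sum_distrib_right[symmetric])
  also have "\<dots> = (\<Sum>w\<in>S. u w * (g v \<bullet> w + \<beta> v))" by (simp add: sum.distrib distrib_left)
  also have "\<dots> = (\<Sum>w\<in>S. if v = w then u w else 0)"
    using ba assms(2) by (intro sum.cong) (auto simp: barycentric_def)
  finally show ?thesis using fs assms(2) by (simp add: full_simplex_def)
qed

lemma bary_repr: "(\<Sum>v\<in>S. g v \<bullet> x + \<beta> v) = 1" "(\<Sum>v\<in>S. (g v \<bullet> x + \<beta> v) *\<^sub>R v) = x"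
proof -
  have "x \<in> affine hull S" using fs affine_independent_span_eq[of S] by (auto simp: full_simplex_def)
  then obtain u where u: "sum u S = 1" "(\<Sum>w\<in>S. u w *\<^sub>R w) = x"
    using fs by (auto simp: affine_hull_finite full_simplex_def)
  have c: "g v \<bullet> x + \<beta> v = u v" if "v \<in> S" for v using bary_coord[OF u(1) that] u(2) by simp
  show "(\<Sum>v\<in>S. g v \<bullet> x + \<beta> v) = 1" using u c by simp
  show "(\<Sum>v\<in>S. (g v \<bullet> x + \<beta> v) *\<^sub>R v) = x" using u c by simp
qed

lemma bary_grad: "(\<Sum>v\<in>S. g v \<bullet> w) = 0" "(\<Sum>v\<in>S. (g v \<bullet> w) *\<^sub>R v) = w"
proof -
  have "(\<Sum>v\<in>S. (g v \<bullet> w + \<beta> v) - (g v \<bullet> 0 + \<beta> v)) = 0"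
    unfolding sum_subtractf bary_repr by simp
  then show "(\<Sum>v\<in>S. g v \<bullet> w) = 0" by simp
  have "(\<Sum>v\<in>S. (g v \<bullet> w + \<beta> v) *\<^sub>R v - (g v \<bullet> 0 + \<beta> v) *\<^sub>R v) = w"
    unfolding sum_subtractf bary_repr by simp
  then show "(\<Sum>v\<in>S. (g v \<bullet> w) *\<^sub>R v) = w" by (simp add: scaleR_diff_left[symmetric])
qed

lemma bary_edge: "v \<in> S \<Longrightarrow> a \<in> S \<Longrightarrow> b \<in> S \<Longrightarrow> g v \<bullet> (b - a) = (if v = b then 1 else 0) - (if v = a then 1 else 0)"
proof -
  assume v: "v \<in> S" "a \<in> S" "b \<in> S"
  have "g v \<bullet> b + \<beta> v = (if v = b then 1 else 0)" "g v \<bullet> a + \<beta> v = (if v = a then 1 else 0)"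
    using ba v by (auto simp: barycentric_def)
  then show ?thesis unfolding inner_diff_right by linarith
qed

lemma bary_hull: "x \<in> convex hull S \<longleftrightarrow> (\<forall>v\<in>S. 0 \<le> g v \<bullet> x + \<beta> v)"
proof
  assume "x \<in> convex hull S"
  then obtain u where "\<forall>v\<in>S. 0 \<le> u v" "sum u S = 1" "(\<Sum>w\<in>S. u w *\<^sub>R w) = x"
    using fs by (auto simp: convex_hull_finite full_simplex_def)
  then show "\<forall>v\<in>S. 0 \<le> g v \<bullet> x + \<beta> v" using bary_coord[of u] by auto
next
  assume "\<forall>v\<in>S. 0 \<le> g v \<bullet> x + \<beta> v"
  then show "x \<in> convex hull S"
    using fs bary_repr[of x] by (auto simp: convex_hull_finite full_simplex_def intro!: exI[of _ "\<lambda>v. g v \<bullet> x + \<beta> v"])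
qed

lemma bary_le_1: "x \<in> convex hull S \<Longrightarrow> v \<in> S \<Longrightarrow> g v \<bullet> x + \<beta> v \<le> 1"
  using bary_repr(1)[of x] bary_hull[of x] member_le_sum[of v S "\<lambda>v. g v \<bullet> x + \<beta> v"] fs
  by (auto simp: full_simplex_def)

lemma bary_face_0: "k \<in> S \<Longrightarrow> x \<in> convex hull (S - {k}) \<Longrightarrow> g k \<bullet> x + \<beta> k = 0"
proof -
  assume k: "k \<in> S" and x: "x \<in> convex hull (S - {k})"
  have "convex {x. g k \<bullet> x + \<beta> k = 0}"
    using convex_hyperplane[of "g k" "- \<beta> k"] by (simp add: eq_neg_iff_add_eq_0)
  moreover have "S - {k} \<subseteq> {x. g k \<bullet> x + \<beta> k = 0}" using ba k by (auto simp: barycentric_def)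
  ultimately have "convex hull (S - {k}) \<subseteq> {x. g k \<bullet> x + \<beta> k = 0}" by (intro hull_minimal)
  then show ?thesis using x by blast
qed

lemma bary_grad_nonzero: "k \<in> S \<Longrightarrow> g k \<noteq> 0"
proof
  assume k: "k \<in> S" and 0: "g k = 0"
  have "card (S - {k}) > 0" using fs k DIM_positive by (simp add: full_simplex_def)
  then have "S - {k} \<noteq> {}" by force
  then obtain w where "w \<in> S" "w \<noteq> k" by blast
  then have "g k \<bullet> k + \<beta> k = 1" "g k \<bullet> w + \<beta> k = 0" using ba k by (auto simp: barycentric_def)
  then show False unfolding 0 by simp
qed

end

section \<open>Volumes of simplices and measures of their faces\<close>

lemma convex_hull_affine_image:
  assumes "linear f"
  shows "convex hull ((\<lambda>x. p + f x) ` X) = (\<lambda>x. p + f x) ` (convex hull X)"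
proof -
  have "(\<lambda>x. p + f x) ` Y = (+) p ` (f ` Y)" for Y by (simp add: image_image)
  then show ?thesis by (simp add: convex_hull_translation convex_hull_linear_image[OF assms])
qed

lemma compact_cyl: "compact A \<Longrightarrow> compact (cyl n (A :: 'a::real_normed_vector set))"
proof -
  assume A: "compact A"
  have "cyl n A = (\<lambda>(y, s). y + s *\<^sub>R n) ` (A \<times> {0..1::real})" by (auto simp: cyl_def image_iff) blast
  then show ?thesis
    using A by (auto simp: split_def intro!: compact_continuous_image continuous_intros compact_Times)
qed

text \<open>The simplex is an affine image of the standard simplex: \<open>\<Theta>\<close> sends
  the unit vectors to the edges from \<open>p0\<close>, and the gradients of the barycentric
  coordinates become coordinate functionals.\<close>

lemma simplex_chart:
  fixes S :: "(real^'n) set"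
  assumes fs: "full_simplex S" and ba: "barycentric S g \<beta>" and p0: "p0 \<in> S" and b: "bij_betw b UNIV (S - {p0})"
  obtains \<Theta> where "linear \<Theta>" "inj \<Theta>" "\<And>j. \<Theta> (axis j 1) = b j - p0" "\<And>j x. g (b j) \<bullet> \<Theta> x = x $ j"
    "measure lborel (convex hull S) = lscale \<Theta> / fact CARD('n)" "lscale \<Theta> > 0"
proof
  have bS: "b j \<in> S" "b j \<noteq> p0" for j using b by (auto simp: bij_betw_def)
  have inj: "inj b" using b by (simp add: bij_betw_def)
  define \<Theta> where "\<Theta> x = (\<Sum>j\<in>UNIV. (x $ j) *\<^sub>R (b j - p0))" for x :: "real^'n"
  show linT: "linear \<Theta>"
    unfolding \<Theta>_def by (auto intro!: linearI simp: sum.distrib scaleR_sum_right scaleR_left_distrib)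
  show Tax: "\<Theta> (axis j 1) = b j - p0" for j
    unfolding \<Theta>_def by (subst sum.remove[of UNIV j]) (auto simp: axis_def intro!: sum.neutral)
  show gT: "g (b j) \<bullet> \<Theta> x = x $ j" for j x
  proof -
    have "g (b j) \<bullet> \<Theta> x = (\<Sum>i\<in>UNIV. x $ i * (g (b j) \<bullet> (b i - p0)))" by (simp add: \<Theta>_def inner_sum_right)
    also have "\<dots> = (\<Sum>i\<in>UNIV. if i = j then x $ i else 0)"
      using bary_edge[OF fs ba bS(1) p0 bS(1)] bS(2) inj by (intro sum.cong) (auto simp: inj_eq)
    finally show ?thesis by simp
  qed
  show injT: "inj \<Theta>"
    unfolding linear_injective_0[OF linT] using gT by (metis inner_zero_right vec_eq_iff zero_index)
  show pos: "lscale \<Theta> > 0" using lscale_eq_det[OF linT injT] det_nz_iff_inj[OF linT] injT by simp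
  have "(\<lambda>x. p0 + \<Theta> x) ` insert 0 Basis = insert p0 (b ` UNIV)"
  proof -
    have B: "(Basis :: (real^'n) set) = range (\<lambda>j. axis j 1)" by (auto simp: Basis_vec_def)
    show ?thesis unfolding B by (auto simp: image_image Tax linear_0[OF linT])
  qed
  then have bim: "(\<lambda>x. p0 + \<Theta> x) ` insert 0 Basis = S" using b p0 by (auto simp: bij_betw_def)
  have T: "convex hull S = (\<lambda>x. p0 + \<Theta> x) ` (convex hull (insert 0 Basis))"
    unfolding bim[symmetric] by (rule convex_hull_affine_image[OF linT])
  have "emeasure lborel (convex hull S) = ennreal (lscale \<Theta>) * emeasure lborel (convex hull (insert 0 Basis) :: (real^'n) set)"
    unfolding T by (rule lborel_affine_image(2)[OF linT injT]) (auto intro!: borel_compact finite_imp_compact_convex_hull)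
  then show "measure lborel (convex hull S) = lscale \<Theta> / fact CARD('n)"
    using pos by (simp add: emeasure_std_simplex measure_def ennreal_mult[symmetric])
qed

text \<open>The formula \<open>|T| = |F| * height / d\<close> with the height expressed by
  \<open>norm (g k)\<close>. The constant \<open>c\<close> stands in place of \<open>d\<close>,
  since Hausdorff measure is known here only up to a factor.\<close>

abbreviation face_volume_law :: "real \<Rightarrow> (real^'n) set \<Rightarrow> (real^'n \<Rightarrow> real^'n) \<Rightarrow> real^'n \<Rightarrow> bool" where
  "face_volume_law c S g k \<equiv> measure lborel (convex hull S) > 0 \<and>
     measure (hausdorff_measure (CARD('n) - 1)) (convex hull (S - {k})) = c * norm (g k) * measure lborel (convex hull S) \<and>
     emeasure (hausdorff_measure (CARD('n) - 1)) (convex hull (S - {k})) < \<infinity>"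

text \<open>The prism of height 1 over the facet is an affine image of the prism over a facet of the
  standard simplex, by a map that differs from the chart of the simplex in one column; Cramer's rule
  compares the determinants.\<close>

lemma simplex_face_volume:
  assumes d2: "CARD('n) \<ge> 2"
  shows "\<exists>c>0. \<forall>S g \<beta> k. full_simplex (S :: (real^'n) set) \<longrightarrow> barycentric S g \<beta> \<longrightarrow> k \<in> S \<longrightarrow>
     face_volume_law c S g k"
proof -
  fix i0 :: 'n
  define e :: "real^'n" where "e = axis i0 1"
  define B0 :: "(real^'n) set" where "B0 = insert 0 (Basis - {e})"
  define F0 where "F0 = convex hull B0"
  define m0 where "m0 = measure lborel (cyl e F0)"
  have fB0: "finite B0" by (simp add: B0_def)
  have compF0: "compact F0" unfolding F0_def by (rule finite_imp_compact_convex_hull[OF fB0])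
  have compcyl: "compact (cyl e F0)" by (rule compact_cyl[OF compF0])
  have em0: "emeasure lborel (cyl e F0) = ennreal m0"
    unfolding m0_def using emeasure_bounded_finite[OF compact_imp_bounded[OF compcyl]]
    by (intro emeasure_eq_ennreal_measure) (simp add: less_top)
  have eB: "e \<in> Basis" by (simp add: e_def)
  \<comment> \<open>The inclusion shows that the volume \<open>m0\<close> of the standard prism is
    positive.\<close>
  have std: "convex hull (insert 0 Basis) \<subseteq> cyl e F0"
  proof (rule hull_minimal)
    have cF0: "convex F0" by (simp add: F0_def)
    show "convex (cyl e F0)"
    proof (rule convexI)
      fix x y and u v :: real assume xy: "x \<in> cyl e F0" "y \<in> cyl e F0" and uv: "u \<ge> 0" "v \<ge> 0" "u + v = 1"
      then obtain a s b t where st: "x = a + s *\<^sub>R e" "a \<in> F0" "0 \<le> s" "s \<le> 1" "y = b + t *\<^sub>R e" "b \<in> F0" "0 \<le> t" "t \<le> 1"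
        by (auto simp: cyl_def)
      have "u *\<^sub>R x + v *\<^sub>R y = (u *\<^sub>R a + v *\<^sub>R b) + (u * s + v * t) *\<^sub>R e" by (simp add: st algebra_simps)
      moreover have "u *\<^sub>R a + v *\<^sub>R b \<in> F0" using convexD[OF cF0] st uv by blast
      moreover have "u * s + v * t \<le> 1" using convex_bound_le[of s 1 t u v] st uv by simp
      moreover have "0 \<le> u * s + v * t" using st uv by simp
      ultimately show "u *\<^sub>R x + v *\<^sub>R y \<in> cyl e F0" unfolding cyl_def by blast
    qed
    have sub: "y + s *\<^sub>R e \<in> cyl e F0" if "y \<in> B0" "0 \<le> s" "s \<le> 1" for y s
      using that hull_inc[of y B0] unfolding cyl_def F0_def by blast
    show "insert 0 Basis \<subseteq> cyl e F0"
    proof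
      fix x assume x: "x \<in> insert (0::real^'n) Basis"
      show "x \<in> cyl e F0"
        using sub[of x 0] sub[of 0 1] x by (cases "x = e") (auto simp: B0_def)
    qed
  qed
  have m0: "m0 > 0"
  proof -
    have "1 / fact CARD('n) = measure lborel (convex hull (insert 0 Basis) :: (real^'n) set)"
      by (simp add: content_std_simplex)
    also have "\<dots> \<le> m0" unfolding m0_def
      using compcyl std by (intro measure_mono_fmeasurable)
        (auto intro!: borel_compact finite_imp_compact_convex_hull fmeasurable_compact)
    finally show ?thesis by (smt (verit) divide_pos_pos fact_gt_zero)
  qed
  from hausdorff_cylinder obtain \<kappa> where \<kappa>: "\<kappa> > 0"
    "\<And>n p (A :: (real^'n) set). norm n = 1 \<Longrightarrow> A \<in> sets borel \<Longrightarrow> (\<forall>x\<in>A. n \<bullet> (x - p) = 0) \<Longrightarrow>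
     emeasure (hausdorff_measure (CARD('n) - 1)) A = ennreal \<kappa> * emeasure lborel (cyl n A)" by blast
  \<comment> \<open>\<open>\<kappa>\<close> converts the volume of a prism into an area,
    \<open>m0\<close> is the volume of the standard prism, and \<open>fact CARD('n)\<close> turns
    the volume of the simplex into a determinant.\<close>
  show ?thesis
  proof (intro exI[of _ "\<kappa> * m0 * fact CARD('n)"] conjI allI impI)
    show "\<kappa> * m0 * fact CARD('n) > 0" using \<kappa> m0 by simp
    fix S :: "(real^'n) set" and g \<beta> k
    assume fs: "full_simplex S" and ba: "barycentric S g \<beta>" and k: "k \<in> S"
    have fin: "finite S" and card: "card S = Suc CARD('n)" using fs by (auto simp: full_simplex_def)
    have "card (S - {k}) = CARD('n)" using card k fin by simp
    then have "S - {k} \<noteq> {}" using d2 by (metis card.empty not_numeral_le_zero)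
    then obtain p0 where p0: "p0 \<in> S" "p0 \<noteq> k" by blast
    have "card (UNIV - {i0}) = card (S - {p0, k})"
      using card p0 k fin by (simp add: card_Diff_subset card_Diff_singleton)
    then obtain b' where b': "bij_betw b' (UNIV - {i0}) (S - {p0, k})"
      using finite_same_card_bij[of "UNIV - {i0}" "S - {p0, k}"] fin by auto
    define b where "b j = (if j = i0 then k else b' j)" for j
    have b: "b ` UNIV = S - {p0}" "b ` (UNIV - {i0}) = S - {p0, k}" "b i0 = k" "inj b"
    proof -
      show 2: "b ` (UNIV - {i0}) = S - {p0, k}" using b' by (auto simp: b_def bij_betw_def image_iff)
      show "b i0 = k" by (simp add: b_def)
      then show "b ` UNIV = S - {p0}" using 2 p0 k by (metis Diff_insert2 insert_Diff insert_Diff_single image_insert insert_iff DiffI UNIV_I Diff_insert singletonD)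
      show "inj b"
      proof (rule injI)
        fix x y assume xy: "b x = b y"
        have ran: "b' j \<in> S - {p0, k}" if "j \<noteq> i0" for j using b' that by (auto simp: bij_betw_def)
        show "x = y"
          using xy ran[of x] ran[of y] b' by (auto simp: b_def bij_betw_def inj_on_def split: if_splits)
      qed
    qed
    have bS: "b j \<in> S" "b j \<noteq> p0" for j using b(1) by auto
    have bij: "bij_betw b UNIV (S - {p0})" using b by (auto simp: bij_betw_def)
    obtain \<Theta> where linT: "linear \<Theta>" and injT: "inj \<Theta>" and Tax: "\<And>j. \<Theta> (axis j 1) = b j - p0"
      and gT: "\<And>j x. g (b j) \<bullet> \<Theta> x = x $ j" and mT: "measure lborel (convex hull S) = lscale \<Theta> / fact CARD('n)"
      and lsT: "lscale \<Theta> > 0"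
      by (rule simplex_chart[OF fs ba p0(1) bij]) (rule that; simp)
    define n where "n = g k /\<^sub>R norm (g k)"
    have gk: "norm (g k) > 0" using bary_grad_nonzero[OF fs ba k] by simp
    have n1: "norm n = 1" using gk by (simp add: n_def)
    \<comment> \<open>The edge that ends in \<open>k\<close> is replaced by the unit normal
      \<open>n\<close>. In the chart \<open>n\<close> is the image of \<open>x0\<close>, whose
      coordinate at \<open>i0\<close> is \<open>norm (g k)\<close>; by Cramer's rule this is the
      quotient of the determinants.\<close>
    define \<Psi> where "\<Psi> x = (\<Sum>j\<in>UNIV. (x $ j) *\<^sub>R (if j = i0 then n else b j - p0))" for x :: "real^'n"
    have linP: "linear \<Psi>"
      unfolding \<Psi>_def by (auto intro!: linearI simp: sum.distrib scaleR_sum_right scaleR_left_distrib)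
    have Pax: "\<Psi> (axis j 1) = (if j = i0 then n else b j - p0)" for j
      unfolding \<Psi>_def by (subst sum.remove[of UNIV j]) (auto simp: axis_def intro!: sum.neutral)
    obtain x0 where x0: "\<Theta> x0 = n" using linear_injective_imp_surjective[OF linT injT] by (metis surjD)
    have x00: "x0 $ i0 = norm (g k)"
      using gT[of i0 x0] gk unfolding x0 b(3) n_def by (simp add: power2_norm_eq_inner[symmetric] power2_eq_square field_simps)
    have detP: "det (matrix \<Psi>) = norm (g k) * det (matrix \<Theta>)"
    proof -
      have "matrix \<Psi> = (\<chi> i j. if j = i0 then (matrix \<Theta> *v x0) $ i else matrix \<Theta> $ i $ j)"
        using matrix_works[of \<Theta> x0] linear_matrix_vector_mul_eq[of \<Theta>] linT x0 by (auto simp: vec_eq_iff matrix_def Pax Tax)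
      then show ?thesis using cramer_lemma[of i0 "matrix \<Theta>" x0] x00 by simp
    qed
    have detT: "det (matrix \<Theta>) \<noteq> 0" using det_nz_iff_inj[OF linT] injT by blast
    have injP: "inj \<Psi>" using det_nz_iff_inj[OF linP] detP detT gk by auto
    have lsP: "lscale \<Psi> = norm (g k) * lscale \<Theta>" using lscale_eq_det[OF linP injP] lscale_eq_det[OF linT injT] detP by (simp add: abs_mult)
    have Basis_ax: "(Basis :: (real^'n) set) = range (\<lambda>j. axis j 1)" by (auto simp: Basis_vec_def)
    have B0ax: "Basis - {e} = (\<lambda>j. axis j 1) ` (UNIV - {i0})"
      unfolding Basis_ax e_def by (auto simp: axis_eq_axis)
    have F0im: "(\<lambda>x. p0 + \<Psi> x) ` B0 = S - {k}"
    proof -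
      have "(\<lambda>x. p0 + \<Psi> x) ` B0 = insert p0 (b ` (UNIV - {i0}))"
        unfolding B0_def B0ax by (auto simp: image_image Pax linear_0[OF linP])
      then show ?thesis using b(2) p0 by auto
    qed
    have F: "convex hull (S - {k}) = (\<lambda>x. p0 + \<Psi> x) ` F0"
      unfolding F0im[symmetric] F0_def by (rule convex_hull_affine_image[OF linP])
    show "measure lborel (convex hull S) > 0" using mT lsT by simp
    have Fb: "convex hull (S - {k}) \<in> sets borel"
      using fin by (intro borel_compact finite_imp_compact_convex_hull) auto
    have Fn: "\<forall>x\<in>convex hull (S - {k}). n \<bullet> (x - p0) = 0"
    proof
      fix x assume "x \<in> convex hull (S - {k})"
      then have "g k \<bullet> x + \<beta> k = 0" by (rule bary_face_0[OF fs ba k])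
      moreover have "g k \<bullet> p0 + \<beta> k = 0" using ba k p0 by (auto simp: barycentric_def)
      ultimately show "n \<bullet> (x - p0) = 0" by (simp add: n_def inner_diff_right)
    qed
    have "\<Psi> e = n" by (simp add: e_def Pax)
    then have "cyl n (convex hull (S - {k})) = (\<lambda>x. p0 + \<Psi> x) ` cyl e F0"
      unfolding F by (rule cyl_affine[OF linP])
    then have "emeasure lborel (cyl n (convex hull (S - {k}))) = ennreal (lscale \<Psi>) * ennreal m0"
      using lborel_affine_image(2)[OF linP injP borel_compact[OF compcyl]] em0 by simp
    then have "emeasure (hausdorff_measure (CARD('n) - 1)) (convex hull (S - {k})) = ennreal \<kappa> * (ennreal (lscale \<Psi>) * ennreal m0)"
      using \<kappa>(2)[OF n1 Fb Fn] by simp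
    also have "\<dots> = ennreal (\<kappa> * (lscale \<Psi> * m0))"
      using \<kappa>(1) m0 lscale_nonneg[of \<Psi>] by (simp add: ennreal_mult[symmetric])
    finally have EF: "emeasure (hausdorff_measure (CARD('n) - 1)) (convex hull (S - {k})) = ennreal (\<kappa> * (lscale \<Psi> * m0))" .
    then show "emeasure (hausdorff_measure (CARD('n) - 1)) (convex hull (S - {k})) < \<infinity>" by simp
    have "measure (hausdorff_measure (CARD('n) - 1)) (convex hull (S - {k})) = \<kappa> * (lscale \<Psi> * m0)"
      using EF \<kappa>(1) m0 lscale_nonneg[of \<Psi>] by (simp add: measure_def)
    then show "measure (hausdorff_measure (CARD('n) - 1)) (convex hull (S - {k})) = \<kappa> * m0 * fact CARD('n) * norm (g k) * measure lborel (convex hull S)"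
      unfolding mT lsP by simp
  qed
qed

text \<open>The affine map exchanging two vertices of a face preserves its Hausdorff measure, so all
  barycentric coordinates have the same mean over the face.\<close>

lemma hausdorff_face_swap:
  fixes S :: "(real^'n) set"
  assumes fs: "full_simplex S" and ba: "barycentric S g \<beta>" and k: "k \<in> S" and st: "s \<in> S - {k}" "t \<in> S - {k}" "s \<noteq> t"
    and \<sigma>_def: "\<sigma> = (\<lambda>x. x + ((g s \<bullet> x + \<beta> s) - (g t \<bullet> x + \<beta> t)) *\<^sub>R (t - s))"
  shows "\<sigma> (\<sigma> x) = x" "\<sigma> ` (convex hull (S - {k})) = convex hull (S - {k})"
    "g s \<bullet> \<sigma> x + \<beta> s = g t \<bullet> x + \<beta> t"
    "A \<in> sets borel \<Longrightarrow> A \<subseteq> convex hull (S - {k}) \<Longrightarrow>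
      emeasure (hausdorff_measure (CARD('n) - 1)) (\<sigma> -` A) = emeasure (hausdorff_measure (CARD('n) - 1)) A"
proof -
  have S: "s \<in> S" "t \<in> S" using st by auto
  have gs: "g s \<bullet> (t - s) = - 1" "g t \<bullet> (t - s) = 1" "g k \<bullet> (t - s) = 0"
    using bary_edge[OF fs ba S(1) S] bary_edge[OF fs ba S(2) S] bary_edge[OF fs ba k S] st by auto
  show swap: "g s \<bullet> \<sigma> x + \<beta> s = g t \<bullet> x + \<beta> t" for x
    unfolding \<sigma>_def by (simp add: inner_add_right gs)
  have swap': "g t \<bullet> \<sigma> x + \<beta> t = g s \<bullet> x + \<beta> s" for x
    unfolding \<sigma>_def by (simp add: inner_add_right gs)
  show inv: "\<sigma> (\<sigma> x) = x" for x
  proof -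
    have "\<sigma> y = y + ((g s \<bullet> y + \<beta> s) - (g t \<bullet> y + \<beta> t)) *\<^sub>R (t - s)" for y
      by (simp add: \<sigma>_def)
    from this[of "\<sigma> x"] have "\<sigma> (\<sigma> x) = \<sigma> x + ((g t \<bullet> x + \<beta> t) - (g s \<bullet> x + \<beta> s)) *\<^sub>R (t - s)"
      unfolding swap swap' .
    then show ?thesis by (simp add: \<sigma>_def algebra_simps)
  qed
  define L where "L x = x + ((g s - g t) \<bullet> x) *\<^sub>R (t - s)" for x
  have linL: "linear L" unfolding L_def by (intro linearI) (auto simp: algebra_simps inner_add_right)
  have \<sigma>L: "\<sigma> x = (\<beta> s - \<beta> t) *\<^sub>R (t - s) + L x" for x
    unfolding \<sigma>_def L_def by (simp add: algebra_simps inner_diff_left)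
  have val: "\<sigma> v = (if v = s then t else if v = t then s else v)" if "v \<in> S" for v
    using ba that S st(3) unfolding \<sigma>_def barycentric_def by auto
  have "\<sigma> ` (S - {k}) = S - {k}"
  proof
    show sub: "\<sigma> ` (S - {k}) \<subseteq> S - {k}" using st by (auto simp: val)
    then show "S - {k} \<subseteq> \<sigma> ` (S - {k})" using inv by (metis image_subset_iff subsetI imageI)
  qed
  then show face: "\<sigma> ` (convex hull (S - {k})) = convex hull (S - {k})"
    using convex_hull_affine_image[OF linL, of "(\<beta> s - \<beta> t) *\<^sub>R (t - s)" "S - {k}"] by (simp add: \<sigma>L[abs_def])
  assume A: "A \<in> sets borel" "A \<subseteq> convex hull (S - {k})"
  define n where "n = g k /\<^sub>R norm (g k)"
  have gk: "norm (g k) > 0" using bary_grad_nonzero[OF fs ba k] by simp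
  have n1: "norm n = 1" using gk by (simp add: n_def)
  have nu: "n \<bullet> (t - s) = 0" using gs by (simp add: n_def)
  have nn: "n \<bullet> n = 1" using n1 by (simp add: norm_eq_1)
  have nF: "n \<bullet> (x - s) = 0" if "x \<in> convex hull (S - {k})" for x
    using bary_face_0[OF fs ba k that] bary_face_0[OF fs ba k hull_inc[OF st(1)]] by (simp add: n_def inner_diff_right)
  \<comment> \<open>\<open>\<sigma>\<close> maps the face to itself but may tilt the normal.
    \<open>\<tau>\<close> has the same effect on the directions of the face and fixes
    \<open>n\<close>, so it maps prisms to prisms; being an involution, it preserves volume.\<close>
  define w where "w = (g s - g t) - ((g s - g t) \<bullet> n) *\<^sub>R n"
  have wn: "w \<bullet> n = 0" by (simp add: w_def inner_diff_left nn)
  have wu: "w \<bullet> (t - s) = - 2" using gs nu by (simp add: w_def inner_diff_left)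
  define \<tau> where "\<tau> x = x + (w \<bullet> x) *\<^sub>R (t - s)" for x
  have linT: "linear \<tau>" unfolding \<tau>_def by (intro linearI) (auto simp: algebra_simps inner_add_right)
  have invT: "\<tau> \<circ> \<tau> = id"
  proof
    fix x
    have "\<tau> (\<tau> x) = (x + (w \<bullet> x) *\<^sub>R (t - s)) + ((w \<bullet> x) + (w \<bullet> x) * (w \<bullet> (t - s))) *\<^sub>R (t - s)"
      unfolding \<tau>_def inner_add_right inner_scaleR_right ..
    also have "\<dots> = x" unfolding wu by (simp add: scaleR_left_distrib scaleR_left_diff_distrib)
    finally show "(\<tau> \<circ> \<tau>) x = id x" by simp
  qed
  have injT: "inj \<tau>" by (rule involution_inj[OF invT])
  have Tn: "\<tau> n = n" by (simp add: \<tau>_def wn)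
  define q where "q = \<sigma> s - \<tau> s"
  have onF: "\<sigma> x = q + \<tau> x" if "x \<in> convex hull (S - {k})" for x
  proof -
    have "(g s - g t) \<bullet> (x - s) = w \<bullet> (x - s)" using nF[OF that] by (simp add: w_def inner_diff_left)
    then have "L (x - s) = \<tau> (x - s)" by (simp add: L_def \<tau>_def)
    moreover have "\<sigma> x = \<sigma> s + L (x - s)" unfolding \<sigma>L linear_diff[OF linL] by simp
    ultimately show ?thesis unfolding q_def by (simp add: linear_diff[OF linT])
  qed
  obtain \<kappa> where \<kappa>: "\<kappa> > 0"
    "\<And>n p (A :: (real^'n) set). norm n = 1 \<Longrightarrow> A \<in> sets borel \<Longrightarrow> (\<forall>x\<in>A. n \<bullet> (x - p) = 0) \<Longrightarrow>
     emeasure (hausdorff_measure (CARD('n) - 1)) A = ennreal \<kappa> * emeasure lborel (cyl n A)" using hausdorff_cylinder by blast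
  have im: "\<sigma> -` A = \<sigma> ` A"
    using inv by (auto simp: image_iff) metis
  have im2: "\<sigma> ` A = (\<lambda>x. q + \<tau> x) ` A"
    using onF A(2) by (intro image_cong) auto
  have lT: "lscale \<tau> = 1" by (rule lscale_involution[OF linT invT])
  have subF: "\<sigma> ` A \<subseteq> convex hull (S - {k})" using A(2) face by blast
  have sA: "\<sigma> ` A \<in> sets borel" unfolding im2 by (rule lborel_affine_image(1)[OF linT injT A(1)])
  have cylA: "cyl n A \<in> sets borel"
  proof -
    \<comment> \<open>A prism is Borel because it is the part between two parallel hyperplanes of
      the preimage of \<open>A\<close> under the orthogonal projection.\<close>
    let ?P = "\<lambda>y. y - (n \<bullet> (y - s)) *\<^sub>R n"
    have "cyl n A = {y. 0 \<le> n \<bullet> (y - s)} \<inter> {y. n \<bullet> (y - s) \<le> 1} \<inter> ?P -` A"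
    proof (intro set_eqI iffI)
      fix y assume "y \<in> cyl n A"
      then obtain x c where y: "y = x + c *\<^sub>R n" "x \<in> A" "0 \<le> c" "c \<le> 1" by (auto simp: cyl_def)
      then have "n \<bullet> (x - s) = 0" using nF A(2) by blast
      then have "n \<bullet> (y - s) = c" by (simp add: y(1) inner_diff_right inner_add_right nn)
      then show "y \<in> {y. 0 \<le> n \<bullet> (y - s)} \<inter> {y. n \<bullet> (y - s) \<le> 1} \<inter> ?P -` A"
        using y by simp
    next
      fix y assume "y \<in> {y. 0 \<le> n \<bullet> (y - s)} \<inter> {y. n \<bullet> (y - s) \<le> 1} \<inter> ?P -` A"
      then show "y \<in> cyl n A"
        unfolding cyl_def by (auto intro!: exI[of _ "?P y"] exI[of _ "n \<bullet> (y - s)"])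
    qed
    moreover have "?P \<in> borel_measurable borel" by (intro borel_measurable_continuous_onI continuous_intros)
    from measurable_sets[OF this A(1)] have "?P -` A \<in> sets borel" by simp
    ultimately show ?thesis by (auto intro!: borel_closed closed_Collect_le continuous_intros)
  qed
  have "emeasure (hausdorff_measure (CARD('n) - 1)) (\<sigma> ` A) = ennreal \<kappa> * emeasure lborel (cyl n (\<sigma> ` A))"
    using nF subF by (intro \<kappa>(2)[OF n1 sA, of s]) blast
  also have "cyl n (\<sigma> ` A) = (\<lambda>x. q + \<tau> x) ` cyl n A" unfolding im2 by (rule cyl_affine[OF linT Tn])
  also have "emeasure lborel \<dots> = emeasure lborel (cyl n A)"
    using lborel_affine_image(2)[OF linT injT cylA] lT by simp
  also have "ennreal \<kappa> * \<dots> = emeasure (hausdorff_measure (CARD('n) - 1)) A"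
    using nF A by (intro \<kappa>(2)[OF n1 A(1), of s, symmetric]) blast
  finally show "emeasure (hausdorff_measure (CARD('n) - 1)) (\<sigma> -` A) = emeasure (hausdorff_measure (CARD('n) - 1)) A"
    unfolding im .
qed

text \<open>All barycentric coordinates belonging to vertices of the face have the same mean over
  it, since they are exchanged by maps preserving its measure. On the face an affine function is a
  combination of them, and the constant function 1 gives the common value.\<close>

lemma simplex_face_centroid:
  fixes S :: "(real^'n) set"
  assumes d2: "CARD('n) \<ge> 2" and fs: "full_simplex S" and k: "k \<in> S"
  shows "(LINT x:convex hull (S - {k})|hausdorff_measure (CARD('n) - 1). a \<bullet> x + b)
    = measure (hausdorff_measure (CARD('n) - 1)) (convex hull (S - {k})) * (a \<bullet> ((\<Sum>v\<in>S - {k}. v) /\<^sub>R CARD('n)) + b)"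
proof -
  let ?H = "hausdorff_measure (CARD('n) - 1) :: (real^'n) measure"
  let ?F = "convex hull (S - {k})"
  obtain g \<beta> where ba: "barycentric S g \<beta>" using barycentric_exists fs unfolding full_simplex_def by blast
  have fin: "finite S" and card: "card S = Suc CARD('n)" using fs by (auto simp: full_simplex_def)
  have cardk: "card (S - {k}) = CARD('n)" using card k fin by simp
  have Fb: "?F \<in> sets borel" using fin by (intro borel_compact finite_imp_compact_convex_hull) auto
  have Fc: "compact ?F" using fin by (intro finite_imp_compact_convex_hull) auto
  have Ffin: "emeasure ?H ?F < \<infinity>" using simplex_face_volume[OF d2] fs ba k by blast
  have int: "set_integrable ?H ?F (\<lambda>x. a \<bullet> x + b)" for a b
  proof -
    have "continuous_on ?F (\<lambda>x. a \<bullet> x + b)" by (intro continuous_intros)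
    from compact_imp_bounded[OF compact_continuous_image[OF this Fc]]
    obtain B where B: "\<And>x. x \<in> ?F \<Longrightarrow> norm (a \<bullet> x + b) \<le> B" by (auto simp: bounded_iff)
    have m: "(\<lambda>x. a \<bullet> x + b) \<in> borel_measurable ?H"
      unfolding measurable_cong_sets[OF sets_hausdorff_measure refl] by measurable
    show ?thesis unfolding set_integrable_def
      using B by (intro integrableI_bounded_set_indicator[where B=B] m) (use Ffin Fb in auto)
  qed
  define I where "I v = (LINT x:?F|?H. g v \<bullet> x + \<beta> v)" for v
  have Ieq: "I s = I t" if st: "s \<in> S - {k}" "t \<in> S - {k}" "s \<noteq> t" for s t
  proof -
    define \<sigma> where "\<sigma> = (\<lambda>x. x + ((g s \<bullet> x + \<beta> s) - (g t \<bullet> x + \<beta> t)) *\<^sub>R (t - s))"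
    note sw = hausdorff_face_swap[OF fs ba k st \<sigma>_def]
    have c\<sigma>: "continuous_on UNIV \<sigma>" unfolding \<sigma>_def by (intro continuous_intros)
    have m\<sigma>: "\<sigma> \<in> borel_measurable borel" by (rule borel_measurable_continuous_onI[OF c\<sigma>])
    \<comment> \<open>The restricted measure is its own image under \<open>\<sigma>\<close>, so the
      integral of one coordinate becomes that of the other.\<close>
    define N where "N = density ?H (\<lambda>x. ennreal (indicator ?F x))"
    have indm: "(\<lambda>x. ennreal (indicator ?F x)) \<in> borel_measurable ?H"
      unfolding measurable_cong_sets[OF sets_hausdorff_measure refl] using Fb by measurable
    have eN: "emeasure N A = emeasure ?H (?F \<inter> A)" if "A \<in> sets borel" for A
      unfolding N_def using that Fb indm
      by (subst emeasure_density) (auto simp: ennreal_indicator indicator_inter_arith[symmetric] nn_integral_indicator)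
    have sN: "sets N = sets borel" by (simp add: N_def)
    have mN: "\<sigma> \<in> measurable N borel" using m\<sigma> unfolding measurable_cong_sets[OF sN refl] .
    have pre: "\<sigma> x \<in> ?F \<longleftrightarrow> x \<in> ?F" for x using sw(1,2) by (metis imageI)
    have "distr N borel \<sigma> = N"
    proof (rule measure_eqI)
      fix A assume "A \<in> sets (distr N borel \<sigma>)"
      then have A: "A \<in> sets borel" by simp
      have vA: "\<sigma> -` A \<in> sets borel" using measurable_sets[OF m\<sigma> A] by simp
      have "emeasure (distr N borel \<sigma>) A = emeasure N (\<sigma> -` A)"
        using emeasure_distr[OF mN A] by (simp add: N_def)
      also have "\<dots> = emeasure ?H (\<sigma> -` (?F \<inter> A))" using pre unfolding eN[OF vA] by (intro arg_cong2[where f=emeasure]) auto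
      also have "\<dots> = emeasure N A" unfolding eN[OF A] using A Fb by (intro sw(4)) auto
      finally show "emeasure (distr N borel \<sigma>) A = emeasure N A" .
    qed (simp add: sN)
    have toN: "(LINT x:?F|?H. f x) = integral\<^sup>L N f" if "f \<in> borel_measurable borel" for f :: "_ \<Rightarrow> real"
      unfolding N_def set_lebesgue_integral_def
      using that Fb by (subst integral_density) (auto simp: measurable_cong_sets[OF sets_hausdorff_measure refl])
    have "I t = integral\<^sup>L N (\<lambda>x. g s \<bullet> \<sigma> x + \<beta> s)" unfolding I_def sw(3) by (intro toN) measurable
    also have "\<dots> = integral\<^sup>L (distr N borel \<sigma>) (\<lambda>x. g s \<bullet> x + \<beta> s)"
      by (subst integral_distr[OF mN]) auto
    also have "\<dots> = I s" unfolding \<open>distr N borel \<sigma> = N\<close> I_def by (intro toN[symmetric]) measurable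
    finally show ?thesis ..
  qed
  have dec: "(LINT x:?F|?H. a \<bullet> x + b) = (\<Sum>v\<in>S-{k}. (a \<bullet> v + b) * I v)" for a b
  proof -
    have "a \<bullet> x + b = (\<Sum>v\<in>S-{k}. (a \<bullet> v + b) * (g v \<bullet> x + \<beta> v))" if "x \<in> ?F" for x
    proof -
      have "a \<bullet> x + b = (\<Sum>v\<in>S. (a \<bullet> v + b) * (g v \<bullet> x + \<beta> v))"
        using arg_cong[OF bary_repr(2)[OF fs ba, of x], of "\<lambda>y. a \<bullet> y"] arg_cong[OF bary_repr(1)[OF fs ba, of x], of "\<lambda>y. b * y"]
        by (simp add: inner_sum_right sum_distrib_left sum.distrib algebra_simps)
      also have "\<dots> = (\<Sum>v\<in>S-{k}. (a \<bullet> v + b) * (g v \<bullet> x + \<beta> v))"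
        using bary_face_0[OF fs ba k that] fin k by (subst sum.remove[of S k]) auto
      finally show ?thesis .
    qed
    then have "(LINT x:?F|?H. a \<bullet> x + b) = (LINT x:?F|?H. (\<Sum>v\<in>S-{k}. (a \<bullet> v + b) * (g v \<bullet> x + \<beta> v)))"
      by (intro set_lebesgue_integral_cong) (auto simp: Fb)
    also have "\<dots> = (\<Sum>v\<in>S-{k}. (LINT x:?F|?H. (a \<bullet> v + b) * (g v \<bullet> x + \<beta> v)))"
      unfolding set_lebesgue_integral_def scaleR_sum_right
      using int by (intro Bochner_Integration.integral_sum) (simp add: set_integrable_def mult.left_commute)
    finally show ?thesis by (simp add: I_def)
  qed
  obtain v0 where v0: "v0 \<in> S - {k}" using cardk d2 by (metis all_not_in_conv card.empty not_numeral_le_zero)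
  have Iv: "I v = I v0" if "v \<in> S - {k}" for v using Ieq[OF that v0] by blast
  have "(LINT x:?F|?H. (0::real^'n) \<bullet> x + 1) = measure ?H ?F"
    using Fb Ffin by (simp add: set_lebesgue_integral_def less_top)
  then have "measure ?H ?F = CARD('n) * I v0" using dec[of 0 1] Iv by (simp add: cardk)
  moreover have "(\<Sum>v\<in>S-{k}. (a \<bullet> v + b) * I v) = (a \<bullet> (\<Sum>v\<in>S-{k}. v) + CARD('n) * b) * I v0"
    using Iv by (simp add: cardk sum_distrib_right[symmetric] sum.distrib inner_sum_right)
  ultimately show ?thesis unfolding dec by (simp add: field_simps)
qed

section \<open>Face fluxes without traces\<close>

lemma integrable_on_compact:
  fixes f :: "'a::euclidean_space \<Rightarrow> 'b::euclidean_space"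
  assumes "compact T" "continuous_on T f"
  shows "f integrable_on T" "set_integrable lborel T f"
proof -
  show "set_integrable lborel T f"
    unfolding set_integrable_def by (rule borel_integrable_compact[OF assms])
  then show "f integrable_on T" by (rule set_borel_integral_eq_integral(1))
qed

lemma C1_continuous: "C1 f Df \<Longrightarrow> continuous_on A f"
  unfolding C1_def by (meson continuous_at_imp_continuous_on has_derivative_continuous)

lemma C1_linear: "C1 f Df \<Longrightarrow> linear (Df x)"
  unfolding C1_def by (metis has_derivative_linear)

lemma C1_expand: "C1 f Df \<Longrightarrow> Df x w = (\<Sum>b\<in>Basis. (w \<bullet> b) *\<^sub>R Df x b)"
proof -
  assume c: "C1 f Df"
  have "Df x w = Df x (\<Sum>b\<in>Basis. (w \<bullet> b) *\<^sub>R b)" by (simp add: euclidean_representation)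
  then show ?thesis by (simp add: linear_sum[OF C1_linear[OF c]] linear_scale[OF C1_linear[OF c]])
qed

lemma C1_norm_le: "C1 f Df \<Longrightarrow> norm (Df x w) \<le> (\<Sum>b\<in>Basis. norm (Df x b)) * norm w"
proof -
  assume c: "C1 f Df"
  have "norm (Df x w) \<le> (\<Sum>b\<in>Basis. norm ((w \<bullet> b) *\<^sub>R Df x b))"
    unfolding C1_expand[OF c, of x w] by (rule norm_sum)
  also have "\<dots> \<le> (\<Sum>b\<in>Basis. norm (Df x b) * norm w)"
    using Basis_le_norm[of _ w] by (intro sum_mono) (simp add: mult.commute[of "norm (Df x _)"] mult_right_mono)
  finally show ?thesis by (simp add: sum_distrib_right)
qed

lemma C1_continuous_dir:
  assumes "C1 f Df" "continuous_on A u"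
  shows "continuous_on A (\<lambda>x. Df x (u x))"
proof -
  have "continuous_on A (\<lambda>x. Df x b)" for b
    using assms(1) unfolding C1_def by (meson continuous_on_subset subset_UNIV)
  then have c: "continuous_on A (\<lambda>x. \<Sum>b\<in>Basis. (u x \<bullet> b) *\<^sub>R Df x b)"
    using assms(2) by (intro continuous_intros)
  show ?thesis
    by (rule continuous_on_cong[THEN iffD1, OF refl _ c]) (rule C1_expand[OF assms(1), symmetric])
qed

lemma C1_inner: "C1 v Dv \<Longrightarrow> C1 (\<lambda>x. v x \<bullet> c) (\<lambda>x w. Dv x w \<bullet> c)"
  unfolding C1_def by (auto intro!: derivative_eq_intros continuous_intros)

lemma C1_diff: "C1 f Df \<Longrightarrow> C1 h Dh \<Longrightarrow> C1 (\<lambda>x. f x - h x) (\<lambda>x w. Df x w - Dh x w)"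
  unfolding C1_def by (auto intro!: derivative_eq_intros continuous_intros)

lemma C1_affine:
  assumes "C1 f Df" "linear A"
  shows "C1 (\<lambda>x. f (p + A x)) (\<lambda>x w. Df (p + A x) (A w))"
  unfolding C1_def
proof (intro conjI allI)
  have bA: "bounded_linear A" using assms(2) by (simp add: linear_conv_bounded_linear)
  show "((\<lambda>x. f (p + A x)) has_derivative (\<lambda>w. Df (p + A x) (A w))) (at x)" for x
  proof -
    have "((\<lambda>x. p + A x) has_derivative A) (at x)"
      using bA by (auto intro!: derivative_eq_intros bounded_linear_imp_has_derivative)
    moreover have "(f has_derivative Df (p + A x)) (at (p + A x))" using assms(1) by (simp add: C1_def)
    ultimately show ?thesis by (rule has_derivative_compose)
  qed
  show "continuous_on UNIV (\<lambda>x. Df (p + A x) (A w))" for w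
  proof (rule continuous_on_compose2[of UNIV "\<lambda>y. Df y (A w)"])
    show "continuous_on UNIV (\<lambda>x. p + A x)"
      using bA by (intro continuous_on_add continuous_on_const linear_continuous_on)
  qed (use assms(1) in \<open>auto simp: C1_def\<close>)
qed

text \<open>Change of variables: by the scaling of volumes, Lebesgue measure is a constant multiple
  of its own image under the affine map.\<close>

lemma integral_affine_image:
  fixes L :: "'a::euclidean_space \<Rightarrow> 'a" and f :: "'a \<Rightarrow> real"
  assumes L: "linear L" "inj L" and T: "compact T" and f: "continuous_on UNIV f"
  shows "integral ((\<lambda>x. p + L x) ` T) f = lscale L * integral T (\<lambda>x. f (p + L x))"
proof -
  define \<phi> where "\<phi> x = p + L x" for x
  have cphi: "continuous_on A \<phi>" for A
    unfolding \<phi>_def using L(1) by (intro continuous_on_add continuous_on_const linear_continuous_on) (simp add: linear_conv_bounded_linear)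
  have m\<phi>: "\<phi> \<in> borel_measurable borel" by (rule borel_measurable_continuous_onI[OF cphi])
  have inj\<phi>: "inj \<phi>" using L(2) by (auto simp: inj_def \<phi>_def)
  have surj\<phi>: "\<exists>x. \<phi> x = y" for y
    using linear_injective_imp_surjective[OF L] unfolding \<phi>_def surj_def
    by (metis add.commute diff_add_cancel)
  have fm: "f \<in> borel_measurable borel" by (rule borel_measurable_continuous_onI[OF f])
  have eq: "lborel = density (distr lborel borel \<phi>) (\<lambda>_. ennreal (lscale L))"
  proof (rule measure_eqI)
    fix A :: "'a set" assume "A \<in> sets lborel"
    then have A: "A \<in> sets borel" by simp
    have B: "\<phi> -` A \<in> sets borel" using measurable_sets[OF m\<phi> A] by simp
    have im: "\<phi> ` (\<phi> -` A) = A" using surj\<phi> by (metis surj_def surj_image_vimage_eq)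
    have "emeasure lborel A = ennreal (lscale L) * emeasure lborel (\<phi> -` A)"
      using lborel_affine_image(2)[OF L B, of p] im unfolding \<phi>_def by simp
    also have "\<dots> = emeasure (density (distr lborel borel \<phi>) (\<lambda>_. ennreal (lscale L))) A"
      using A by (simp add: emeasure_density nn_integral_cmult_indicator emeasure_distr m\<phi>)
    finally show "emeasure lborel A = emeasure (density (distr lborel borel \<phi>) (\<lambda>_. ennreal (lscale L))) A" .
  qed simp
  have cT: "compact (\<phi> ` T)" by (rule compact_continuous_image[OF cphi T])
  have f': "continuous_on A f" for A using f by (meson continuous_on_subset subset_UNIV)
  have "integral (\<phi> ` T) f = (LINT x|lborel. indicator (\<phi> ` T) x *\<^sub>R f x)"
    using set_borel_integral_eq_integral(2)[OF integrable_on_compact(2)[OF cT f']]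
    by (simp add: set_lebesgue_integral_def)
  also have "\<dots> = (LINT x|density (distr lborel borel \<phi>) (\<lambda>_. ennreal (lscale L)). indicator (\<phi> ` T) x *\<^sub>R f x)"
    using eq by simp
  also have "\<dots> = (LINT x|distr lborel borel \<phi>. lscale L *\<^sub>R (indicator (\<phi> ` T) x *\<^sub>R f x))"
    using fm borel_compact[OF cT] by (subst integral_density) (auto simp: lscale_nonneg)
  also have "\<dots> = (LINT x|lborel. lscale L *\<^sub>R (indicator (\<phi> ` T) (\<phi> x) *\<^sub>R f (\<phi> x)))"
    using fm borel_compact[OF cT] by (intro integral_distr) (auto simp: m\<phi>)
  also have "\<dots> = lscale L * (LINT x|lborel. indicator T x *\<^sub>R f (\<phi> x))"
    using inj\<phi> by (simp add: indicator_def inj_image_mem_iff)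
  also have "(LINT x|lborel. indicator T x *\<^sub>R f (\<phi> x)) = integral T (\<lambda>x. f (\<phi> x))"
    using set_borel_integral_eq_integral(2)[OF integrable_on_compact(2)[OF T continuous_on_compose2[OF f' cphi]], of UNIV]
    by (simp add: set_lebesgue_integral_def)
  finally show ?thesis by (simp add: \<phi>_def)
qed

lemma lscale_scaleR:
  assumes "r > 0"
  shows "lscale (\<lambda>x::'a::euclidean_space. r *\<^sub>R x) = r ^ DIM('a)"
proof -
  have "(\<lambda>x::'a. r *\<^sub>R x) ` cbox 0 One = cbox 0 (r *\<^sub>R One)"
    using assms image_smult_cbox[of r "0::'a" One] by simp
  then show ?thesis using assms unfolding lscale_def
    by (simp add: content_cbox_if box_eq_empty inner_sum_left inner_Basis if_distrib cong: if_cong)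
qed

text \<open>By the divergence theorem on the cone with apex \<open>k\<close> this is \<open>d |T| / |F|\<close> times the
  integral of \<open>f\<close> over the face \<open>F\<close> opposite to \<open>k\<close>. Using it instead of the surface
  integral avoids traces altogether.\<close>

definition cone_int :: "'a::euclidean_space set \<Rightarrow> 'a \<Rightarrow> ('a \<Rightarrow> real) \<Rightarrow> ('a \<Rightarrow> 'a \<Rightarrow> real) \<Rightarrow> real" where
  "cone_int T k f Df = integral T (\<lambda>x. real DIM('a) * f x + Df x (x - k))"

lemma cone_integrable:
  assumes "compact T" "C1 f Df"
  shows "(\<lambda>x. real DIM('a) * f x + Df x (x - k)) integrable_on (T :: 'a::euclidean_space set)"
proof -
  have "continuous_on T (\<lambda>x. Df x (x - k))"
    by (rule C1_continuous_dir[OF assms(2)]) (intro continuous_intros)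
  then show ?thesis using C1_continuous[OF assms(2), of T]
    by (intro integrable_on_compact(1)[OF assms(1)] continuous_intros)
qed

lemma bary_face:
  assumes fs: "full_simplex S" and ba: "barycentric S g \<beta>" and a: "a \<in> S"
    and y: "y \<in> convex hull S" "g a \<bullet> y + \<beta> a = 0"
  shows "y \<in> convex hull (S - {a})"
proof -
  have fin: "finite S" using fs by (simp add: full_simplex_def)
  have "(\<Sum>v\<in>S-{a}. g v \<bullet> y + \<beta> v) = 1" "(\<Sum>v\<in>S-{a}. (g v \<bullet> y + \<beta> v) *\<^sub>R v) = y"
    using bary_repr[OF fs ba, of y] y(2) sum.remove[OF fin a, of "\<lambda>v. g v \<bullet> y + \<beta> v"]
      sum.remove[OF fin a, of "\<lambda>v. (g v \<bullet> y + \<beta> v) *\<^sub>R v"] by simp_all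
  moreover have "\<forall>v\<in>S-{a}. 0 \<le> g v \<bullet> y + \<beta> v" using y(1) bary_hull[OF fs ba] by blast
  ultimately show ?thesis using fin
    by (auto simp: convex_hull_finite intro!: exI[of _ "\<lambda>v. g v \<bullet> y + \<beta> v"])
qed

lemma C1_lipschitz:
  fixes h :: "'a::euclidean_space \<Rightarrow> 'b::real_normed_vector"
  assumes "C1 h Dh" "compact T" "convex T"
  shows "\<exists>B\<ge>0. \<forall>x\<in>T. \<forall>y\<in>T. norm (h x - h y) \<le> B * norm (x - y)"
proof -
  have "continuous_on T (\<lambda>x. Dh x b)" for b
    using assms(1) unfolding C1_def by (meson continuous_on_subset subset_UNIV)
  then have "continuous_on T (\<lambda>x. \<Sum>b\<in>Basis. norm (Dh x b))" by (intro continuous_intros)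
  from compact_imp_bounded[OF compact_continuous_image[OF this assms(2)]]
  obtain B where B: "\<And>x. x \<in> T \<Longrightarrow> \<bar>\<Sum>b\<in>Basis. norm (Dh x b)\<bar> \<le> B" by (auto simp: bounded_iff)
  have on: "onorm (Dh x) \<le> \<bar>B\<bar>" if "x \<in> T" for x
  proof (rule onorm_le)
    fix w
    have "norm (Dh x w) \<le> (\<Sum>b\<in>Basis. norm (Dh x b)) * norm w" by (rule C1_norm_le[OF assms(1)])
    also have "\<dots> \<le> \<bar>B\<bar> * norm w" using B[OF that] by (intro mult_right_mono) auto
    finally show "norm (Dh x w) \<le> \<bar>B\<bar> * norm w" .
  qed
  have "(h has_derivative Dh x) (at x within T)" for x
    using assms(1) unfolding C1_def by (meson has_derivative_at_withinI)
  then have "norm (h x - h y) \<le> \<bar>B\<bar> * norm (x - y)" if "x \<in> T" "y \<in> T" for x y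
    using on that by (intro differentiable_bound[OF assms(3)]) auto
  then show ?thesis by (intro exI[of _ "\<bar>B\<bar>"]) auto
qed

text \<open>The function \<open>r \<mapsto> r\<^sup>d \<integral>\<^sub>T h (a + r (x - a)) dx\<close> is the integral of \<open>h\<close> over the shrunk
  simplex; its derivative at \<open>1\<close> is the cone integral, and it vanishes because the part of \<open>T\<close>
  cut off has volume \<open>O(1 - r)\<close> while \<open>h = O(1 - r)\<close> there.\<close>

lemma cone_int_vanish:
  assumes fs: "full_simplex S" and ba: "barycentric S g \<beta>" and a: "a \<in> S"
    and h: "C1 h Dh" and h0: "\<And>x. x \<in> convex hull (S - {a}) \<Longrightarrow> h x = 0"
  shows "cone_int (convex hull S) a h Dh = 0"
proof -
  let ?T = "convex hull S" and ?d = "DIM('a)"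
  have fin: "finite S" using fs by (simp add: full_simplex_def)
  have cT: "compact ?T" by (rule finite_imp_compact_convex_hull[OF fin])
  have aT: "a \<in> ?T" by (rule hull_inc[OF a])
  obtain B where B: "B \<ge> 0" "\<And>x y. x \<in> ?T \<Longrightarrow> y \<in> ?T \<Longrightarrow> \<bar>h x - h y\<bar> \<le> B * norm (x - y)"
    using C1_lipschitz[OF h cT convex_convex_hull] by (auto simp: real_norm_def)
  obtain D where D: "D > 0" "\<And>x. x \<in> ?T \<Longrightarrow> norm x \<le> D"
    using compact_imp_bounded[OF cT] bounded_pos by blast
  have D2: "norm (x - y) \<le> 2 * D" if "x \<in> ?T" "y \<in> ?T" for x y
    using D(2)[OF that(1)] D(2)[OF that(2)] norm_triangle_ineq4[of x y] by linarith
  obtain B1 where B1: "\<And>x. x \<in> ?T \<Longrightarrow> \<bar>h x\<bar> \<le> B1"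
    using compact_imp_bounded[OF compact_continuous_image[OF C1_continuous[OF h] cT]] by (auto simp: bounded_iff)
  define V where "V = measure lborel ?T"
  have hc: "continuous_on A h" for A by (rule C1_continuous[OF h])
  define \<phi> where "\<phi> r x = (1 - r) *\<^sub>R a + r *\<^sub>R x" for r x
  have \<phi>T: "\<phi> r x \<in> ?T" if "0 \<le> r" "r \<le> 1" "x \<in> ?T" for r x
    unfolding \<phi>_def using that aT by (intro convexD[OF convex_convex_hull]) auto
  have bern: "1 - r ^ ?d \<le> real ?d * (1 - r)" if "0 \<le> r" for r :: real
    using Bernoulli_inequality[of "r - 1" ?d] that by (simp add: algebra_simps)
  define G where "G r = r ^ ?d * integral ?T (\<lambda>x. h (\<phi> r x))" for r
  have c\<phi>: "continuous_on A (\<lambda>x. h (\<phi> r x))" for r A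
    unfolding \<phi>_def by (intro continuous_on_compose2[OF hc[of UNIV]] continuous_intros) auto
  have one: "integral A (\<lambda>x. 1) = measure lborel A" if "compact A" for A :: "'a set"
    using lmeasure_integral[OF lmeasurable_compact[OF that]] borel_compact[OF that] by simp
  have cst: "integral A (\<lambda>x. c) = c * measure lborel A" if "compact A" for A :: "'a set" and c :: real
    using integral_mult_right[of A c "\<lambda>x. 1"] one[OF that] by simp
  have cut: "\<bar>integral ?T h - G r\<bar> \<le> (B * (2 * D) * (1 - r)) * (real ?d * (1 - r) * V)" if r: "0 < r" "r < 1" for r :: real
  proof -
    let ?Tr = "(\<lambda>x. (1 - r) *\<^sub>R a + r *\<^sub>R x) ` ?T"
    have lin: "linear (\<lambda>x::'a. r *\<^sub>R x)" "inj (\<lambda>x::'a. r *\<^sub>R x)"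
      using r by (auto intro!: linearI simp: algebra_simps inj_def)
    have cTr: "compact ?Tr" by (intro compact_continuous_image continuous_intros cT)
    have sub: "?Tr \<subseteq> ?T" using \<phi>T r by (auto simp: \<phi>_def)
    then have neg: "negligible (?Tr - ?T)" by (simp add: Diff_eq_empty_iff[THEN iffD2])
    have GTr: "integral ?Tr h = G r"
      using integral_affine_image[OF lin cT hc, of "(1 - r) *\<^sub>R a"] lscale_scaleR[OF r(1), where 'a='a]
      by (simp add: G_def \<phi>_def)
    have mTr: "measure lborel ?Tr = r ^ ?d * V"
      using integral_affine_image[OF lin cT, of "\<lambda>x. 1" "(1 - r) *\<^sub>R a"] lscale_scaleR[OF r(1), where 'a='a]
        one[OF cTr] one[OF cT] by (simp add: V_def)
    \<comment> \<open>A point \<open>x\<close> of \<open>?T\<close> missed by the contraction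
      towards \<open>a\<close> has \<open>1 - l a > r\<close>. Its projection \<open>y\<close> from
      \<open>a\<close> onto the opposite face is at distance at most
      \<open>(1 - r) * (2 * D)\<close>, and \<open>h y = 0\<close>.\<close>
    have le: "\<bar>h x\<bar> \<le> B * (2 * D) * (1 - r)" if x: "x \<in> ?T - ?Tr" for x
    proof -
      define l where "l v = g v \<bullet> x + \<beta> v" for v
      have l0: "l v \<ge> 0" if "v \<in> S" for v using bary_hull[OF fs ba] x that by (auto simp: l_def)
      have l1: "l a \<le> 1" using bary_le_1[OF fs ba _ a] x by (auto simp: l_def)
      have pt: "g v \<bullet> (a + (1 / s) *\<^sub>R (x - a)) + \<beta> v = (if v = a then 1 - (1 - l a) / s else l v / s)"
        if "v \<in> S" "s > 0" for v s
      proof -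
        have ga: "g v \<bullet> a + \<beta> v = (if v = a then 1 else 0)" using ba that a by (auto simp: barycentric_def)
        have "g v \<bullet> (a + (1 / s) *\<^sub>R (x - a)) + \<beta> v = (g v \<bullet> a + \<beta> v) + (1 / s) * (l v - (g v \<bullet> a + \<beta> v))"
          by (simp add: l_def inner_add_right inner_diff_right)
        then show ?thesis unfolding ga using that(2) by (auto simp: field_simps)
      qed
      have la: "1 - l a > r"
      proof (rule ccontr)
        assume n: "\<not> 1 - l a > r"
        have "a + (1 / r) *\<^sub>R (x - a) \<in> ?T"
          unfolding bary_hull[OF fs ba] using pt r l0 n by (auto simp: field_simps)
        moreover have "x = (1 - r) *\<^sub>R a + r *\<^sub>R (a + (1 / r) *\<^sub>R (x - a))" using r by (simp add: algebra_simps)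
        ultimately have "x \<in> ?Tr" by blast
        then show False using x by blast
      qed
      define s where "s = 1 - l a"
      have s: "s > 0" "s > r" "s \<le> 1" using la r l0[OF a] by (auto simp: s_def)
      define y where "y = a + (1 / s) *\<^sub>R (x - a)"
      have yT: "y \<in> ?T" unfolding bary_hull[OF fs ba] y_def using pt s l0 by (auto simp: s_def)
      have "g a \<bullet> y + \<beta> a = 0" unfolding y_def using pt[OF a, of s] s by (simp add: s_def)
      then have "h y = 0" using bary_face[OF fs ba a yT] h0 by blast
      have "x - y = (s - 1) *\<^sub>R (y - a)"
      proof -
        have "x - a = s *\<^sub>R (y - a)" using s by (simp add: y_def)
        then have "x - y = s *\<^sub>R (y - a) - (y - a)" by (simp add: algebra_simps)
        then show ?thesis by (simp add: scaleR_diff_left)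
      qed
      then have "norm (x - y) = (1 - s) * norm (y - a)" using s by simp
      also have "\<dots> \<le> (1 - r) * (2 * D)" using s r D2[OF yT aT] by (intro mult_mono) auto
      finally have "B * norm (x - y) \<le> B * ((1 - r) * (2 * D))" by (rule mult_left_mono[OF _ B(1)])
      moreover have "\<bar>h x - h y\<bar> \<le> B * norm (x - y)" using B(2)[OF _ yT] x by blast
      ultimately show ?thesis using \<open>h y = 0\<close> by (simp add: algebra_simps)
    qed
    have iT: "h integrable_on ?T" "h integrable_on ?Tr" using cT cTr hc by (auto intro: integrable_on_compact(1))
    have i1: "(\<lambda>x. c::real) integrable_on ?T" "(\<lambda>x. c) integrable_on ?Tr" for c
      using cT cTr by (auto intro: integrable_on_compact(1))
    let ?M = "B * (2 * D) * (1 - r)"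
    have "\<bar>integral ?T h - G r\<bar> = norm (integral (?T - ?Tr) h)"
      using integral_setdiff[OF iT neg] GTr by simp
    also have "\<dots> \<le> integral (?T - ?Tr) (\<lambda>x. ?M)"
      using le integrable_setdiff[OF iT[THEN integrable_integral] neg] integrable_setdiff[OF i1[THEN integrable_integral] neg]
      by (intro Henstock_Kurzweil_Integration.integral_norm_bound_integral) auto
    also have "\<dots> = integral ?T (\<lambda>x. ?M) - integral ?Tr (\<lambda>x. ?M)"
      by (rule integral_setdiff[OF i1 neg])
    also have "\<dots> = ?M * ((1 - r ^ ?d) * V)"
      unfolding cst[OF cT] cst[OF cTr] mTr by (simp add: V_def algebra_simps)
    also have "\<dots> \<le> ?M * (real ?d * (1 - r) * V)"
      using B(1) D(1) r bern[of r] by (intro mult_left_mono mult_right_mono) (auto simp: V_def)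
    finally show ?thesis .
  qed
  \<comment> \<open>A sequence below 1 with limit 1; the offset 2 keeps it positive at
    \<open>n = 0\<close>.\<close>
  define r :: "nat \<Rightarrow> real" where "r n = 1 - 1 / (real n + 2)" for n
  have r: "0 < r n" "r n < 1" for n by (auto simp: r_def field_simps)
  have rlim: "r \<longlonglongrightarrow> 1" unfolding r_def by real_asymp
  \<comment> \<open>The integrals of these difference quotients tend to the cone integral by
    dominated convergence, and to 0 by \<open>cut\<close>, whose bound is quadratic in
    \<open>1 - r n\<close>.\<close>
  define q where "q n x = (h x - r n ^ ?d * h (\<phi> (r n) x)) / (1 - r n)" for n x
  have "(\<lambda>n. integral ?T (q n)) \<longlonglongrightarrow> integral ?T (\<lambda>x. real ?d * h x + Dh x (x - a))"
  proof (rule dominated_convergence(2)[where h="\<lambda>x. B * (2 * D) + real ?d * B1"])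
    show "q n integrable_on ?T" for n
      unfolding q_def using r[of n] hc c\<phi> by (intro integrable_on_compact(1)[OF cT] continuous_intros) auto
    show "(\<lambda>x. B * (2 * D) + real ?d * B1) integrable_on ?T" by (intro integrable_on_compact(1)[OF cT] continuous_intros)
    fix x assume x: "x \<in> ?T"
    show "norm (q n x) \<le> B * (2 * D) + real ?d * B1" for n
    proof -
      have p: "\<phi> (r n) x \<in> ?T" using \<phi>T r[of n] x by (simp add: less_imp_le)
      have "x - \<phi> (r n) x = (1 - r n) *\<^sub>R (x - a)" by (simp add: \<phi>_def algebra_simps)
      then have nx: "norm (x - \<phi> (r n) x) \<le> (1 - r n) * (2 * D)"
        using r[of n] D2[OF x aT] by simp
      have "\<bar>h x - h (\<phi> (r n) x)\<bar> \<le> B * ((1 - r n) * (2 * D))"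
        using B(2)[OF x p] mult_left_mono[OF nx B(1)] by linarith
      moreover have "\<bar>(1 - r n ^ ?d) * h (\<phi> (r n) x)\<bar> \<le> (?d * (1 - r n)) * B1"
        unfolding abs_mult using bern[of "r n"] r[of n] B1[OF p] power_le_one[of "r n" ?d]
        by (intro mult_mono) auto
      moreover have "h x - r n ^ ?d * h (\<phi> (r n) x) = (h x - h (\<phi> (r n) x)) + (1 - r n ^ ?d) * h (\<phi> (r n) x)"
        by (simp add: algebra_simps)
      ultimately have "\<bar>h x - r n ^ ?d * h (\<phi> (r n) x)\<bar> \<le> B * ((1 - r n) * (2 * D)) + (?d * (1 - r n)) * B1"
        by linarith
      also have "\<dots> = (B * (2 * D) + real ?d * B1) * (1 - r n)" by (simp add: algebra_simps)
      finally show ?thesis using r[of n] by (simp add: q_def divide_le_eq)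
    qed
    show "(\<lambda>n. q n x) \<longlonglongrightarrow> real ?d * h x + Dh x (x - a)"
    proof -
      define Fx where "Fx s = s ^ ?d * h (\<phi> s x)" for s
      have p1: "\<phi> 1 x = x" by (simp add: \<phi>_def)
      have "((\<lambda>s. \<phi> s x) has_derivative (\<lambda>t. t *\<^sub>R (x - a))) (at 1)"
        unfolding \<phi>_def by (auto intro!: derivative_eq_intros simp: algebra_simps)
      moreover have "(h has_derivative Dh x) (at (\<phi> 1 x))" using h by (simp add: C1_def p1)
      ultimately have "((\<lambda>s. h (\<phi> s x)) has_derivative (\<lambda>t. Dh x (t *\<^sub>R (x - a)))) (at 1)"
        by (rule has_derivative_compose)
      moreover have "(\<lambda>t. Dh x (t *\<^sub>R (x - a))) = (*) (Dh x (x - a))"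
        by (rule ext) (simp add: linear_scale[OF C1_linear[OF h]] mult.commute)
      ultimately have "((\<lambda>s. h (\<phi> s x)) has_real_derivative Dh x (x - a)) (at 1)"
        unfolding has_field_derivative_def by (rule subst[rotated])
      then have "(Fx has_real_derivative real ?d * h x + Dh x (x - a)) (at 1)"
        unfolding Fx_def by (auto intro!: derivative_eq_intros simp: p1)
      then have "((\<lambda>s. (Fx s - Fx 1) / (s - 1)) \<longlongrightarrow> real ?d * h x + Dh x (x - a)) (at 1)"
        by (simp add: has_field_derivative_iff)
      moreover have "filterlim r (at 1) sequentially"
        unfolding filterlim_at using rlim r by (auto simp: less_imp_neq intro!: always_eventually)
      ultimately have "(\<lambda>n. (Fx (r n) - Fx 1) / (r n - 1)) \<longlonglongrightarrow> real ?d * h x + Dh x (x - a)"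
        by (rule filterlim_compose)
      moreover have "(Fx (r n) - Fx 1) / (r n - 1) = q n x" for n
        using r[of n] by (simp add: Fx_def q_def p1 divide_simps) (simp add: algebra_simps)
      ultimately show ?thesis by simp
    qed
  qed
  moreover have "(\<lambda>n. integral ?T (q n)) \<longlonglongrightarrow> 0"
  proof (rule Lim_null_comparison[OF always_eventually])
    show "(\<lambda>n. B * (2 * D) * (real ?d * V) * (1 - r n)) \<longlonglongrightarrow> 0"
      using tendsto_mult_right[OF tendsto_diff[OF tendsto_const[of 1] rlim], of "B * (2 * D) * (real ?d * V)"] by (simp add: mult.commute)
    show "\<forall>n. norm (integral ?T (q n)) \<le> B * (2 * D) * (real ?d * V) * (1 - r n)"
    proof
      fix n
      have "integral ?T (q n) = (integral ?T h - G (r n)) / (1 - r n)"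
        unfolding q_def G_def using cT hc c\<phi>
        by (subst integral_divide, subst integral_diff) (auto intro!: integrable_on_compact(1) continuous_intros)
      then show "norm (integral ?T (q n)) \<le> B * (2 * D) * (real ?d * V) * (1 - r n)"
        using cut[OF r, of n] r[of n] by (simp add: divide_le_eq mult_ac)
    qed
  qed
  ultimately show ?thesis unfolding cone_int_def by (rule LIMSEQ_unique)
qed

text \<open>For \<open>\<gamma> = g k\<close> this is the flux of \<open>v\<close> out of
  \<open>T\<close> through the face opposite to \<open>k\<close>: \<open>g k\<close> points inwards,
  whence the sign, and its norm is the reciprocal of the height \<open>d |T| / |F|\<close> that the
  cone integral contains.\<close>

definition flux :: "'a::euclidean_space set \<Rightarrow> 'a \<Rightarrow> 'a \<Rightarrow> ('a \<Rightarrow> 'a) \<Rightarrow> ('a \<Rightarrow> 'a \<Rightarrow> 'a) \<Rightarrow> real" where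
  "flux T k \<gamma> v Dv = - cone_int T k (\<lambda>x. v x \<bullet> \<gamma>) (\<lambda>x w. Dv x w \<bullet> \<gamma>)"

definition facet_centroid :: "'a::euclidean_space set \<Rightarrow> 'a \<Rightarrow> 'a" where
  "facet_centroid S k = (\<Sum>v\<in>S - {k}. v) /\<^sub>R real DIM('a)"

lemma C1_Basis_continuous: "C1 v Dv \<Longrightarrow> continuous_on A (\<lambda>x. Dv x b)"
  unfolding C1_def by (meson continuous_on_subset subset_UNIV)

lemma vsize_continuous: "C1 v Dv \<Longrightarrow> continuous_on A (vsize v Dv)"
  unfolding vsize_def using C1_Basis_continuous[of v Dv A] C1_continuous[of v Dv A]
  by (auto intro!: continuous_intros)

lemma divg_continuous: "C1 v Dv \<Longrightarrow> continuous_on A (divg Dv)"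
  unfolding divg_def using C1_Basis_continuous[of v Dv A] by (auto intro!: continuous_intros)

lemma vsize_nonneg: "vsize v Dv x \<ge> 0"
  by (auto simp: vsize_def intro!: add_nonneg_nonneg sum_nonneg)

lemma norm_le_vsize: "C1 v Dv \<Longrightarrow> norm (Dv x w) \<le> vsize v Dv x * norm w"
  unfolding vsize_def distrib_right by (rule order_trans[OF C1_norm_le]) auto

lemma divg_le_vsize: "\<bar>divg Dv x\<bar> \<le> vsize v Dv x"
proof -
  have "\<bar>divg Dv x\<bar> \<le> (\<Sum>b\<in>Basis. \<bar>Dv x b \<bullet> b\<bar>)" unfolding divg_def by (rule sum_abs)
  also have "\<dots> \<le> (\<Sum>b\<in>Basis. norm (Dv x b))" by (intro sum_mono Basis_le_norm)
  finally show ?thesis using norm_ge_zero[of "v x"] unfolding vsize_def by linarith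
qed

section \<open>Algebra and estimates of cone integrals and fluxes\<close>

lemma integral_scaled_bound:
  fixes f :: "'a::euclidean_space \<Rightarrow> real"
  assumes "f integrable_on T" "w integrable_on T" "\<And>x. x \<in> T \<Longrightarrow> \<bar>f x\<bar> \<le> c * w x"
  shows "\<bar>integral T f\<bar> \<le> c * integral T w"
proof -
  have "(\<lambda>x. c * w x) integrable_on T" using integrable_cmul[OF assms(2), of c] by simp
  then have "norm (integral T f) \<le> integral T (\<lambda>x. c * w x)"
    using assms by (intro Henstock_Kurzweil_Integration.integral_norm_bound_integral) auto
  then show ?thesis by simp
qed

lemma cone_int_lincomb:
  assumes T: "compact T" and v: "C1 v Dv" and I: "finite I"
  shows "cone_int T k (\<lambda>x. v x \<bullet> (\<Sum>i\<in>I. c i *\<^sub>R \<gamma> i)) (\<lambda>x w. Dv x w \<bullet> (\<Sum>i\<in>I. c i *\<^sub>R \<gamma> i))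
    = (\<Sum>i\<in>I. c i * cone_int T k (\<lambda>x. v x \<bullet> \<gamma> i) (\<lambda>x w. Dv x w \<bullet> \<gamma> i))"
proof -
  have "cone_int T k (\<lambda>x. v x \<bullet> (\<Sum>i\<in>I. c i *\<^sub>R \<gamma> i)) (\<lambda>x w. Dv x w \<bullet> (\<Sum>i\<in>I. c i *\<^sub>R \<gamma> i))
    = integral T (\<lambda>x. \<Sum>i\<in>I. c i * (real DIM('a) * (v x \<bullet> \<gamma> i) + Dv x (x - k) \<bullet> \<gamma> i))"
    unfolding cone_int_def by (simp add: inner_sum_right sum_distrib_left sum.distrib algebra_simps)
  also have "\<dots> = (\<Sum>i\<in>I. integral T (\<lambda>x. c i * (real DIM('a) * (v x \<bullet> \<gamma> i) + Dv x (x - k) \<bullet> \<gamma> i)))"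
    using integrable_cmul[OF cone_integrable[OF T C1_inner[OF v]]]
    by (intro integral_sum I) auto
  finally show ?thesis by (simp add: cone_int_def)
qed

lemma cone_int_scale:
  assumes "compact T" "C1 v Dv"
  shows "cone_int T k (\<lambda>x. v x \<bullet> (c *\<^sub>R \<gamma>)) (\<lambda>x w. Dv x w \<bullet> (c *\<^sub>R \<gamma>)) = c * cone_int T k (\<lambda>x. v x \<bullet> \<gamma>) (\<lambda>x w. Dv x w \<bullet> \<gamma>)"
  using cone_int_lincomb[OF assms, of "{()}" k "\<lambda>_. c" "\<lambda>_. \<gamma>"] by simp

text \<open>Moving the apex changes only the derivative term, by a constant direction; for two
  apices joined by an edge the difference contains a derivative along that edge only.\<close>

lemma cone_int_apex:
  assumes T: "compact T" and f: "C1 f Df"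
  shows "cone_int T b f Df - cone_int T a f Df = integral T (\<lambda>x. Df x (a - b))"
proof -
  have "cone_int T b f Df - cone_int T a f Df = integral T (\<lambda>x. (real DIM('a) * f x + Df x (x - b)) - (real DIM('a) * f x + Df x (x - a)))"
    unfolding cone_int_def by (rule integral_diff[symmetric]) (intro cone_integrable T f)+
  also have "\<dots> = integral T (\<lambda>x. Df x (a - b))"
    by (rule integral_cong) (simp add: linear_diff[OF C1_linear[OF f]])
  finally show ?thesis .
qed

text \<open>A use of the bound 1 on the diameters: it puts the derivative term, which carries the
  factor \<open>norm (x - k)\<close>, on a level with the field itself.\<close>

lemma cone_int_bound:
  assumes T: "compact T" and v: "C1 v Dv" and k: "\<And>x. x \<in> T \<Longrightarrow> norm (x - k) \<le> 1"
  shows "\<bar>cone_int T k (\<lambda>x. v x \<bullet> \<gamma>) (\<lambda>x w. Dv x w \<bullet> \<gamma>)\<bar> \<le> (norm \<gamma> * real DIM('a)) * integral T (vsize v (Dv :: 'a::euclidean_space \<Rightarrow> _))"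
  unfolding cone_int_def
proof (rule integral_scaled_bound)
  show "(\<lambda>x. real DIM('a) * (v x \<bullet> \<gamma>) + Dv x (x - k) \<bullet> \<gamma>) integrable_on T"
    by (rule cone_integrable[OF T C1_inner[OF v]])
  show "vsize v Dv integrable_on T" by (rule integrable_on_compact(1)[OF T vsize_continuous[OF v]])
  fix x assume x: "x \<in> T"
  have "\<bar>Dv x (x - k) \<bullet> \<gamma>\<bar> \<le> norm (Dv x (x - k)) * norm \<gamma>" by (rule Cauchy_Schwarz_ineq2)
  also have "\<dots> \<le> (\<Sum>b\<in>Basis. norm (Dv x b)) * norm \<gamma>"
  proof (rule mult_right_mono[OF order_trans[OF C1_norm_le[OF v]]])
    show "(\<Sum>b\<in>Basis. norm (Dv x b)) * norm (x - k) \<le> (\<Sum>b\<in>Basis. norm (Dv x b))"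
      using k[OF x] by (intro mult_left_le) (auto intro!: sum_nonneg)
  qed simp
  also have "\<dots> \<le> real DIM('a) * ((\<Sum>b\<in>Basis. norm (Dv x b)) * norm \<gamma>)"
    by (intro mult_right_mono[of 1 "real DIM('a)", simplified]) (auto intro!: mult_nonneg_nonneg sum_nonneg simp: Suc_leI)
  finally have 1: "\<bar>Dv x (x - k) \<bullet> \<gamma>\<bar> \<le> real DIM('a) * ((\<Sum>b\<in>Basis. norm (Dv x b)) * norm \<gamma>)" .
  have "\<bar>real DIM('a) * (v x \<bullet> \<gamma>)\<bar> \<le> real DIM('a) * (norm (v x) * norm \<gamma>)"
    unfolding abs_mult by (intro mult_mono Cauchy_Schwarz_ineq2) auto
  with 1 show "\<bar>real DIM('a) * (v x \<bullet> \<gamma>) + Dv x (x - k) \<bullet> \<gamma>\<bar> \<le> (norm \<gamma> * real DIM('a)) * vsize v Dv x"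
    unfolding vsize_def by (simp add: algebra_simps)
qed

lemma flux_bound:
  assumes "compact T" "C1 v Dv" "\<And>x. x \<in> T \<Longrightarrow> norm (x - k) \<le> 1"
  shows "\<bar>flux T k \<gamma> v Dv\<bar> \<le> (norm \<gamma> * real DIM('a)) * integral T (vsize v (Dv :: 'a::euclidean_space \<Rightarrow> _))"
  using cone_int_bound[OF assms] by (simp add: flux_def)

text \<open>The divergence theorem as an identity of integrands: the gradients \<open>g k\<close>
  sum to 0, which removes the terms with \<open>v x\<close> and \<open>Dv x x\<close>, and the sum
  of \<open>(g k \<bullet> w) *\<^sub>R k\<close> reproduces \<open>w\<close>, which leaves the
  trace of \<open>Dv x\<close>.\<close>

lemma flux_sum:
  fixes S :: "'a::euclidean_space set"
  assumes fs: "full_simplex S" and ba: "barycentric S g \<beta>" and v: "C1 v Dv"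
  shows "(\<Sum>k\<in>S. flux (convex hull S) k (g k) v Dv) = integral (convex hull S) (divg Dv)"
proof -
  let ?T = "convex hull S" and ?d = "real DIM('a)"
  have fin: "finite S" using fs by (simp add: full_simplex_def)
  have cT: "compact ?T" by (rule finite_imp_compact_convex_hull[OF fin])
  have lin: "linear (Dv x)" for x by (rule C1_linear[OF v])
  have g0: "(\<Sum>k\<in>S. g k) = 0" using bary_grad(1)[OF fs ba] by (metis inner_eq_zero_iff inner_sum_left)
  have tr: "(\<Sum>k\<in>S. Dv x k \<bullet> g k) = divg Dv x" for x
  proof -
    have "Dv x b \<bullet> b = (\<Sum>k\<in>S. (g k \<bullet> b) * (Dv x k \<bullet> b))" for b
    proof -
      have "Dv x b = Dv x (\<Sum>k\<in>S. (g k \<bullet> b) *\<^sub>R k)" using bary_grad(2)[OF fs ba, of b] by simp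
      then show ?thesis by (simp add: linear_sum[OF lin] linear_scale[OF lin] inner_sum_left)
    qed
    then have "divg Dv x = (\<Sum>b\<in>Basis. \<Sum>k\<in>S. (Dv x k \<bullet> b) * (g k \<bullet> b))" by (simp add: divg_def mult.commute)
    also have "\<dots> = (\<Sum>k\<in>S. \<Sum>b\<in>Basis. (Dv x k \<bullet> b) * (g k \<bullet> b))" by (rule sum.swap)
    finally show ?thesis by (simp add: euclidean_inner[symmetric])
  qed
  have "(\<Sum>k\<in>S. cone_int ?T k (\<lambda>x. v x \<bullet> g k) (\<lambda>x w. Dv x w \<bullet> g k)) = integral ?T (\<lambda>x. \<Sum>k\<in>S. ?d * (v x \<bullet> g k) + Dv x (x - k) \<bullet> g k)"
    unfolding cone_int_def using cone_integrable[OF cT C1_inner[OF v]] by (intro integral_sum[OF fin, symmetric]) auto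
  also have "\<dots> = integral ?T (\<lambda>x. - divg Dv x)"
  proof (rule integral_cong)
    fix x
    have "(\<Sum>k\<in>S. ?d * (v x \<bullet> g k) + Dv x (x - k) \<bullet> g k)
        = ?d * (v x \<bullet> (\<Sum>k\<in>S. g k)) + Dv x x \<bullet> (\<Sum>k\<in>S. g k) - (\<Sum>k\<in>S. Dv x k \<bullet> g k)"
      by (simp add: linear_diff[OF lin] inner_diff_left inner_sum_right sum_distrib_left sum.distrib sum_subtractf)
    then show "(\<Sum>k\<in>S. ?d * (v x \<bullet> g k) + Dv x (x - k) \<bullet> g k) = - divg Dv x" by (simp add: g0 tr)
  qed
  finally show ?thesis by (simp add: flux_def sum_negf)
qed

text \<open>The piecewise affine bijection \<open>x \<mapsto> x + \<lambda>\<^sub>a(x) (b - a)\<close> of the two neighbours fixes their common face.\<close>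

lemma flux_face_consistent:
  fixes R :: "(real^'n) set"
  assumes d2: "CARD('n) \<ge> 2"
    and fa: "full_simplex (insert a R)" and fb: "full_simplex (insert b R)"
    and aR: "a \<notin> R" and bR: "b \<notin> R"
    and ba: "barycentric (insert a R) g \<beta>" and bb: "barycentric (insert b R) g' \<beta>'"
    and side: "g a \<bullet> b + \<beta> a < 0" and v: "C1 v Dv"
  shows "flux (convex hull (insert b R)) b (g' b) v Dv = - flux (convex hull (insert a R)) a (g a) v Dv"
proof -
  let ?A = "convex hull (insert a R)" and ?B = "convex hull (insert b R)"
  define t where "t = - (g a \<bullet> b + \<beta> a)"
  have t: "t > 0" using side by (simp add: t_def)
  have finR: "finite R" using fa by (simp add: full_simplex_def)
  have cA: "compact ?A" and cB: "compact ?B" using finR by (auto intro: finite_imp_compact_convex_hull)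
  have lamR: "g a \<bullet> w + \<beta> a = 0" if "w \<in> R" for w using ba that aR by (auto simp: barycentric_def)
  have lama: "g a \<bullet> a + \<beta> a = 1" using ba by (auto simp: barycentric_def)
  \<comment> \<open>Both barycentric coordinates vanish on the common face, so their gradients are
    parallel; they point in opposite directions as the apices lie on opposite sides.\<close>
  have ga: "g a = (- t) *\<^sub>R g' b"
  proof -
    have "g a \<bullet> w = ((- t) *\<^sub>R g' b) \<bullet> w" for w
    proof -
      have "g a \<bullet> w = g a \<bullet> (\<Sum>k\<in>insert b R. (g' k \<bullet> w) *\<^sub>R k)" using bary_grad(2)[OF fb bb, of w] by simp
      also have "\<dots> = (\<Sum>k\<in>insert b R. (g' k \<bullet> w) * (g a \<bullet> k + \<beta> a)) - \<beta> a * (\<Sum>k\<in>insert b R. g' k \<bullet> w)"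
        by (simp add: inner_sum_right sum_distrib_left sum.distrib algebra_simps)
      also have "\<dots> = (g' b \<bullet> w) * (g a \<bullet> b + \<beta> a)"
        unfolding bary_grad(1)[OF fb bb] using finR bR lamR by (subst sum.insert) auto
      finally show ?thesis by (simp add: t_def)
    qed
    then show ?thesis by (metis vector_eq_rdot)
  qed
  define A where "A x = x + (g a \<bullet> x) *\<^sub>R (b - a)" for x
  define p where "p = \<beta> a *\<^sub>R (b - a)"
  have linA: "linear A" unfolding A_def by (intro linearI) (auto simp: algebra_simps inner_add_right)
  have gba: "g a \<bullet> (b - a) = - t - 1" using lama by (simp add: t_def inner_diff_right)
  have injA: "inj A"
    unfolding linear_injective_0[OF linA]
  proof (intro allI impI)
    fix x assume "A x = 0"
    then have x: "x = - ((g a \<bullet> x) *\<^sub>R (b - a))" by (simp add: A_def eq_neg_iff_add_eq_0)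
    then have "g a \<bullet> x = - ((g a \<bullet> x) * (g a \<bullet> (b - a)))" by (metis inner_minus_right inner_scaleR_right)
    then have "(g a \<bullet> x) * t = 0" unfolding gba by (simp add: algebra_simps)
    then show "x = 0" using x t by simp
  qed
  have \<Psi>: "p + A x = x + (g a \<bullet> x + \<beta> a) *\<^sub>R (b - a)" for x by (simp add: p_def A_def algebra_simps)
  have "(\<lambda>x. p + A x) ` insert a R = insert b R"
    unfolding \<Psi> using lamR lama by (auto simp: image_iff)
  then have im: "(\<lambda>x. p + A x) ` ?A = ?B" using convex_hull_affine_image[OF linA, of p "insert a R"] by simp
  \<comment> \<open>The quotient of the two volumes follows from the face volume law, applied to the
    same face from either side.\<close>
  have lsA: "lscale A = t"
  proof -
    obtain c where c: "c > 0" and cc: "\<And>S g \<beta> k. full_simplex (S :: (real^'n) set) \<Longrightarrow> barycentric S g \<beta> \<Longrightarrow> k \<in> S \<Longrightarrow>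
     measure lborel (convex hull S) > 0 \<and>
     measure (hausdorff_measure (CARD('n) - 1)) (convex hull (S - {k})) = c * norm (g k) * measure lborel (convex hull S)"
      using simplex_face_volume[OF d2] by blast
    have "measure (hausdorff_measure (CARD('n) - 1)) (convex hull R) = c * norm (g a) * measure lborel ?A"
      using cc[OF fa ba, of a] aR by simp
    moreover have "measure (hausdorff_measure (CARD('n) - 1)) (convex hull R) = c * norm (g' b) * measure lborel ?B"
      using cc[OF fb bb, of b] bR by simp
    moreover have "norm (g a) = t * norm (g' b)" unfolding ga using t by simp
    moreover have "norm (g' b) > 0" using bary_grad_nonzero[OF fb bb, of b] by simp
    ultimately have mB: "measure lborel ?B = t * measure lborel ?A" using c by simp
    have "measure lborel ?B = lscale A * measure lborel ?A"
      using lborel_affine_image(2)[OF linA injA borel_compact[OF cA], of p] im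
      by (simp add: measure_def enn2real_mult lscale_nonneg)
    moreover have "measure lborel ?A > 0" using cc[OF fa ba, of a] by simp
    ultimately show ?thesis using mB by simp
  qed
  define f where "f x = v x \<bullet> g a" for x
  define Df where "Df x w = Dv x w \<bullet> g a" for x w
  have Cf: "C1 f Df" unfolding f_def[abs_def] Df_def[abs_def] by (rule C1_inner[OF v])
  have Cf': "C1 (\<lambda>x. f (p + A x)) (\<lambda>x w. Df (p + A x) (A w))" by (rule C1_affine[OF Cf linA])
  \<comment> \<open>The map fixes the common face, so \<open>f\<close> and its composition with the
    map agree there and \<open>cone_int_vanish\<close> applies to the difference.\<close>
  have "cone_int ?A a (\<lambda>x. f (p + A x) - f x) (\<lambda>x w. Df (p + A x) (A w) - Df x w) = 0"
  proof (rule cone_int_vanish[OF fa ba _ C1_diff[OF Cf' Cf]])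
    fix x assume "x \<in> convex hull (insert a R - {a})"
    then have "g a \<bullet> x + \<beta> a = 0" by (rule bary_face_0[OF fa ba insertI1])
    then show "f (p + A x) - f x = 0" unfolding \<Psi> by simp
  qed simp
  moreover have "cone_int ?A a (\<lambda>x. f (p + A x) - f x) (\<lambda>x w. Df (p + A x) (A w) - Df x w)
      = cone_int ?A a (\<lambda>x. f (p + A x)) (\<lambda>x w. Df (p + A x) (A w)) - cone_int ?A a f Df"
    unfolding cone_int_def
    by (subst integral_diff[OF cone_integrable[OF cA Cf'] cone_integrable[OF cA Cf], symmetric])
      (auto intro!: integral_cong simp: algebra_simps)
  moreover have "cone_int ?B b f Df = t * cone_int ?A a (\<lambda>x. f (p + A x)) (\<lambda>x w. Df (p + A x) (A w))"
  proof -
    have "continuous_on UNIV (\<lambda>x. Df x (x - b))" by (rule C1_continuous_dir[OF Cf]) (intro continuous_intros)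
    then have "continuous_on UNIV (\<lambda>x. real DIM(real^'n) * f x + Df x (x - b))"
      using C1_continuous[OF Cf] by (intro continuous_intros)
    from integral_affine_image[OF linA injA cA this, of p]
    have "cone_int ?B b f Df = t * integral ?A (\<lambda>x. real DIM(real^'n) * f (p + A x) + Df (p + A x) (p + A x - b))"
      unfolding im lsA cone_int_def .
    moreover have "p + A x - b = A (x - a)" for x
    proof -
      have "p + A a = b" unfolding \<Psi> lama by simp
      then have "p + A x - b = A x - A a" by (metis add_diff_cancel_left)
      then show ?thesis by (simp add: linear_diff[OF linA])
    qed
    ultimately show ?thesis by (simp add: cone_int_def)
  qed
  ultimately have N: "cone_int ?B b f Df = t * cone_int ?A a f Df" by simp
  have N': "cone_int ?B b f Df = (- t) * cone_int ?B b (\<lambda>x. v x \<bullet> g' b) (\<lambda>x w. Dv x w \<bullet> g' b)"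
    unfolding f_def[abs_def] Df_def[abs_def] ga by (rule cone_int_scale[OF cB v])
  then have "cone_int ?B b (\<lambda>x. v x \<bullet> g' b) (\<lambda>x w. Dv x w \<bullet> g' b) = - cone_int ?A a f Df"
  proof -
    have "t * (cone_int ?B b (\<lambda>x. v x \<bullet> g' b) (\<lambda>x w. Dv x w \<bullet> g' b) + cone_int ?A a f Df) = 0"
      using N N' by (simp add: algebra_simps)
    then show ?thesis using t by simp
  qed
  then show ?thesis by (simp add: flux_def f_def[abs_def] Df_def[abs_def])
qed

text \<open>For an edge direction only the cone integrals at the two endpoints of the edge enter, and their
  difference is the integral of a tangential derivative; this is why no angle condition is needed.\<close>

lemma element_residual:
  fixes S :: "'a::euclidean_space set"
  assumes fs: "full_simplex S" and ba: "barycentric S g \<beta>" and v: "C1 v Dv"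
    and diam: "\<And>x y. x \<in> convex hull S \<Longrightarrow> y \<in> convex hull S \<Longrightarrow> norm (x - y) \<le> 1"
    and I: "finite I" and ab: "\<And>i. i \<in> I \<Longrightarrow> a i \<in> S \<and> b i \<in> S"
    and rep: "\<And>w. w = (\<Sum>i\<in>I. (\<xi> i \<bullet> w) *\<^sub>R (b i - a i))"
    and K: "\<And>i. i \<in> I \<Longrightarrow> norm (\<xi> i) * norm (b i - a i) \<le> K"
  shows "\<bar>integral (convex hull S) (\<lambda>x. (c \<bullet> x + e) * divg Dv x)
      - (\<Sum>k\<in>S. (c \<bullet> facet_centroid S k + e) * flux (convex hull S) k (g k) v Dv)\<bar>
    \<le> (norm c * (1 + 2 * K * card I)) * integral (convex hull S) (vsize v Dv)"
proof -
  let ?T = "convex hull S" and ?d = "real DIM('a)"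
  have fin: "finite S" and card: "card S = Suc DIM('a)" using fs by (auto simp: full_simplex_def)
  have cT: "compact ?T" by (rule finite_imp_compact_convex_hull[OF fin])
  have ST: "k \<in> ?T" if "k \<in> S" for k using that by (rule hull_inc)
  have d1: "?d \<ge> 1" by (simp add: Suc_leI)
  define W where "W = integral ?T (vsize v Dv)"
  have wint: "vsize v Dv integrable_on ?T" by (rule integrable_on_compact(1)[OF cT vsize_continuous[OF v]])
  have W0: "W \<ge> 0" unfolding W_def by (intro integral_nonneg wint vsize_nonneg)
  \<comment> \<open>\<open>m\<close> is the barycentre of the simplex. The centroid of the facet
    opposite to \<open>k\<close> lies beyond \<open>m\<close> as seen from \<open>k\<close>, at
    \<open>1 / d\<close> of the distance; this links values at facet centroids with values at
    vertices.\<close>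
  define m where "m = (\<Sum>v\<in>S. v) /\<^sub>R (?d + 1)"
  have mT: "m \<in> ?T"
  proof -
    have "m = (\<Sum>v\<in>S. (1 / (?d + 1)) *\<^sub>R v)" by (simp add: m_def scaleR_sum_right divide_inverse)
    moreover have "(\<Sum>v\<in>S. 1 / (?d + 1)) = 1" by (simp add: card field_simps)
    ultimately show ?thesis using fin
      by (auto simp: convex_hull_finite intro!: exI[of _ "\<lambda>_. 1 / (?d + 1)"])
  qed
  have mk: "facet_centroid S k - m = (m - k) /\<^sub>R ?d" if k: "k \<in> S" for k
  proof -
    have "(\<Sum>v\<in>S - {k}. v) = (?d + 1) *\<^sub>R m - k" using sum.remove[OF fin k, of "\<lambda>v. v"] d1 by (simp add: m_def)
    then have "facet_centroid S k - m = (1 / ?d) *\<^sub>R ((?d + 1) *\<^sub>R m - k) - m" by (simp add: facet_centroid_def divide_inverse)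
    also have "\<dots> = (1 / ?d) *\<^sub>R (((?d + 1) *\<^sub>R m - k) - ?d *\<^sub>R m)"
      using d1 by (simp add: scaleR_diff_right del: scaleR_diff_left)
    also have "((?d + 1) *\<^sub>R m - k) - ?d *\<^sub>R m = m - k" by (simp add: scaleR_left_distrib)
    finally show ?thesis by (simp add: divide_inverse)
  qed
  define u where "u k = c \<bullet> (facet_centroid S k - m)" for k
  define Q where "Q k = flux ?T k (g k) v Dv" for k
  define M where "M k i = cone_int ?T k (\<lambda>x. v x \<bullet> \<xi> i) (\<lambda>x w. Dv x w \<bullet> \<xi> i)" for k i
  \<comment> \<open>Expanding vectors along the edges dually expands each \<open>g k\<close> in the
    vectors \<open>\<xi> i\<close>, with the coefficients \<open>g k \<bullet> (b i - a i)\<close>;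
    for a vertex \<open>k\<close> these vanish unless \<open>k\<close> is an endpoint of the
    edge.\<close>
  have Qk: "Q k = - (\<Sum>i\<in>I. (g k \<bullet> (b i - a i)) * M k i)" for k
  proof -
    have "g k = (\<Sum>i\<in>I. (g k \<bullet> (b i - a i)) *\<^sub>R \<xi> i)"
    proof -
      have "w \<bullet> g k = w \<bullet> (\<Sum>i\<in>I. (g k \<bullet> (b i - a i)) *\<^sub>R \<xi> i)" for w
      proof -
        have "w \<bullet> g k = (\<Sum>i\<in>I. (\<xi> i \<bullet> w) *\<^sub>R (b i - a i)) \<bullet> g k" using rep[of w] by simp
        then show ?thesis by (simp add: inner_sum_left inner_sum_right inner_commute mult.commute)
      qed
      then show ?thesis by (metis vector_eq_ldot)
    qed
    then have "Q k = flux ?T k (\<Sum>i\<in>I. (g k \<bullet> (b i - a i)) *\<^sub>R \<xi> i) v Dv" by (simp add: Q_def)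
    then show ?thesis unfolding flux_def cone_int_lincomb[OF cT v I] M_def .
  qed
  have edge: "(\<Sum>k\<in>S. u k * ((g k \<bullet> (b i - a i)) * M k i)) = u (b i) * M (b i) i - u (a i) * M (a i) i" if i: "i \<in> I" for i
  proof -
    have "u k * ((g k \<bullet> (b i - a i)) * M k i) = (if k = b i then u k * M k i else 0) - (if k = a i then u k * M k i else 0)" if "k \<in> S" for k
      using bary_edge[OF fs ba that, of "a i" "b i"] ab[OF i] by (auto simp del: inner_diff_right)
    then have "(\<Sum>k\<in>S. u k * ((g k \<bullet> (b i - a i)) * M k i)) = (\<Sum>k\<in>S. (if k = b i then u k * M k i else 0) - (if k = a i then u k * M k i else 0))"
      by (rule sum.cong[OF refl])
    then show ?thesis unfolding sum_subtractf using ab[OF i] fin by simp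
  qed
  have sumQ: "(\<Sum>k\<in>S. u k * Q k) = - (\<Sum>i\<in>I. u (b i) * M (b i) i - u (a i) * M (a i) i)"
  proof -
    have "(\<Sum>k\<in>S. u k * Q k) = - (\<Sum>k\<in>S. \<Sum>i\<in>I. u k * ((g k \<bullet> (b i - a i)) * M k i))"
      by (simp add: Qk sum_distrib_left sum_negf)
    also have "\<dots> = - (\<Sum>i\<in>I. \<Sum>k\<in>S. u k * ((g k \<bullet> (b i - a i)) * M k i))" by (subst sum.swap) simp
    also have "\<dots> = - (\<Sum>i\<in>I. u (b i) * M (b i) i - u (a i) * M (a i) i)"
      using edge by (simp cong: sum.cong)
    finally show ?thesis .
  qed
  \<comment> \<open>A discrete product rule. The difference of the cone integrals is a derivative
    along the edge paired with \<open>\<xi> i\<close>, and the difference of the values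
    \<open>u\<close> is bounded by the edge length. Either way the product
    \<open>norm (\<xi> i) * norm (b i - a i)\<close> appears, and no bare norm of
    \<open>\<xi> i\<close> remains.\<close>
  have edge_bound: "\<bar>u (b i) * M (b i) i - u (a i) * M (a i) i\<bar> \<le> norm c * (2 * K) * W" if i: "i \<in> I" for i
  proof -
    note abS = ab[OF i]
    have "\<bar>u (b i)\<bar> \<le> norm c * norm ((m - b i) /\<^sub>R ?d)" unfolding u_def mk[OF conjunct2[OF abS]] by (rule Cauchy_Schwarz_ineq2)
    also have "\<dots> \<le> norm c * 1"
      using order_trans[OF diam[OF mT ST[OF conjunct2[OF abS]]] d1] by (intro mult_left_mono) (auto simp: divide_inverse[symmetric] divide_le_eq mult.commute[of "inverse _"] simp del: scaleR_diff_right)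
    finally have u1: "\<bar>u (b i)\<bar> \<le> norm c" by simp
    have "u (b i) - u (a i) = - (c \<bullet> (b i - a i)) / ?d"
      using abS by (simp add: u_def mk inner_diff_right field_simps)
    then have u2: "\<bar>u (b i) - u (a i)\<bar> \<le> norm c * norm (b i - a i) / ?d"
      using Cauchy_Schwarz_ineq2[of c "b i - a i"] by (simp add: abs_mult divide_right_mono)
    have M1: "\<bar>M (b i) i - M (a i) i\<bar> \<le> K * W"
      unfolding M_def cone_int_apex[OF cT C1_inner[OF v]] W_def
    proof (rule integral_scaled_bound[OF _ wint])
      show "(\<lambda>x. Dv x (a i - b i) \<bullet> \<xi> i) integrable_on ?T"
        using C1_Basis_continuous[OF v] by (intro integrable_on_compact(1)[OF cT] continuous_intros)
      fix x
      have "\<bar>Dv x (a i - b i) \<bullet> \<xi> i\<bar> \<le> norm (Dv x (a i - b i)) * norm (\<xi> i)" by (rule Cauchy_Schwarz_ineq2)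
      also have "\<dots> \<le> (vsize v Dv x * norm (a i - b i)) * norm (\<xi> i)"
        by (intro mult_right_mono norm_le_vsize[OF v]) simp
      also have "\<dots> = (norm (\<xi> i) * norm (b i - a i)) * vsize v Dv x" by (simp add: norm_minus_commute)
      also have "\<dots> \<le> K * vsize v Dv x" by (intro mult_right_mono K[OF i] vsize_nonneg)
      finally show "\<bar>Dv x (a i - b i) \<bullet> \<xi> i\<bar> \<le> K * vsize v Dv x" .
    qed
    have M2: "\<bar>M (a i) i\<bar> \<le> (norm (\<xi> i) * ?d) * W"
      unfolding M_def W_def using diam ST abS by (intro cone_int_bound[OF cT v]) auto
    have "u (b i) * M (b i) i - u (a i) * M (a i) i = u (b i) * (M (b i) i - M (a i) i) + (u (b i) - u (a i)) * M (a i) i"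
      by (simp add: algebra_simps)
    also have "\<bar>\<dots>\<bar> \<le> \<bar>u (b i)\<bar> * \<bar>M (b i) i - M (a i) i\<bar> + \<bar>u (b i) - u (a i)\<bar> * \<bar>M (a i) i\<bar>"
      by (metis abs_mult abs_triangle_ineq)
    also have "\<dots> \<le> norm c * (K * W) + (norm c * norm (b i - a i) / ?d) * ((norm (\<xi> i) * ?d) * W)"
      using u1 u2 M1 M2 d1 by (intro add_mono mult_mono) auto
    also have "\<dots> = norm c * (K * W) + norm c * (norm (\<xi> i) * norm (b i - a i)) * W" using d1 by simp
    also have "\<dots> \<le> norm c * (K * W) + norm c * K * W"
      using K[OF i] W0 by (intro add_left_mono mult_right_mono mult_left_mono) auto
    finally show ?thesis by (simp add: algebra_simps)
  qed
  have uQ: "\<bar>\<Sum>k\<in>S. u k * Q k\<bar> \<le> card I * (norm c * (2 * K) * W)"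
    unfolding sumQ abs_minus_cancel by (rule order_trans[OF sum_abs sum_bounded_above[OF edge_bound]])
  have cdiv: "continuous_on ?T (divg Dv)" by (rule divg_continuous[OF v])
  have "\<bar>integral ?T (\<lambda>x. (c \<bullet> (x - m)) * divg Dv x)\<bar> \<le> norm c * W"
    unfolding W_def
  proof (rule integral_scaled_bound[OF _ wint])
    show "(\<lambda>x. (c \<bullet> (x - m)) * divg Dv x) integrable_on ?T"
      using cdiv by (intro integrable_on_compact(1)[OF cT] continuous_intros)
    fix x assume x: "x \<in> ?T"
    have "\<bar>c \<bullet> (x - m)\<bar> \<le> norm c * 1"
      by (rule order_trans[OF Cauchy_Schwarz_ineq2 mult_left_mono[OF diam[OF x mT]]]) simp
    then show "\<bar>(c \<bullet> (x - m)) * divg Dv x\<bar> \<le> norm c * vsize v Dv x"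
      unfolding abs_mult using divg_le_vsize[of Dv x v] by (intro mult_mono) auto
  qed
  \<comment> \<open>The value at \<open>m\<close> is split off the affine function: for constants
    the identity is exact by \<open>flux_sum\<close>.\<close>
  moreover have "integral ?T (\<lambda>x. (c \<bullet> x + e) * divg Dv x) - (\<Sum>k\<in>S. (c \<bullet> facet_centroid S k + e) * Q k)
     = integral ?T (\<lambda>x. (c \<bullet> (x - m)) * divg Dv x) - (\<Sum>k\<in>S. u k * Q k)"
  proof -
    have "integral ?T (\<lambda>x. (c \<bullet> x + e) * divg Dv x) = integral ?T (\<lambda>x. (c \<bullet> (x - m)) * divg Dv x + (c \<bullet> m + e) * divg Dv x)"
      by (rule integral_cong) (simp add: algebra_simps inner_diff_right)
    also have "\<dots> = integral ?T (\<lambda>x. (c \<bullet> (x - m)) * divg Dv x) + (c \<bullet> m + e) * integral ?T (divg Dv)"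
      using cdiv by (subst integral_add) (auto intro!: integrable_on_compact(1)[OF cT] continuous_intros)
    also have "integral ?T (divg Dv) = (\<Sum>k\<in>S. Q k)" using flux_sum[OF fs ba v] by (simp add: Q_def)
    finally have 1: "integral ?T (\<lambda>x. (c \<bullet> x + e) * divg Dv x) = integral ?T (\<lambda>x. (c \<bullet> (x - m)) * divg Dv x) + (c \<bullet> m + e) * (\<Sum>k\<in>S. Q k)" .
    have "(\<Sum>k\<in>S. (c \<bullet> facet_centroid S k + e) * Q k) = (\<Sum>k\<in>S. u k * Q k + (c \<bullet> m + e) * Q k)"
      by (intro sum.cong) (auto simp: u_def inner_diff_right algebra_simps)
    then show ?thesis unfolding 1 by (simp add: sum.distrib sum_distrib_left)
  qed
  ultimately show ?thesis using uQ unfolding Q_def[symmetric] W_def[symmetric] by (simp add: algebra_simps)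
qed

section \<open>Semi-regular simplices\<close>

lemma simplex_volume_det:
  fixes S :: "(real^'n) set"
  assumes fs: "full_simplex S" and p0: "p0 \<in> S" and b: "bij_betw b UNIV (S - {p0})"
  shows "det (\<chi> i. b i - p0) \<noteq> 0" "measure lborel (convex hull S) = \<bar>det (\<chi> i. b i - p0)\<bar> / fact CARD('n)"
proof -
  obtain g \<beta> where ba: "barycentric S g \<beta>" using barycentric_exists fs unfolding full_simplex_def by blast
  obtain \<Theta> where T: "linear \<Theta>" "inj \<Theta>" "\<And>j. \<Theta> (axis j 1) = b j - p0"
    "measure lborel (convex hull S) = lscale \<Theta> / fact CARD('n)"
    by (rule simplex_chart[OF fs ba p0 b]) (rule that; simp)
  have "transpose (matrix \<Theta>) = (\<chi> i. b i - p0)"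
    by (simp add: transpose_def matrix_def T(3) vec_eq_iff)
  then have det: "det (matrix \<Theta>) = det (\<chi> i. b i - p0)" by (metis det_transpose)
  then show "det (\<chi> i. b i - p0) \<noteq> 0" using det_nz_iff_inj[OF T(1)] T(2) by simp
  show "measure lborel (convex hull S) = \<bar>det (\<chi> i. b i - p0)\<bar> / fact CARD('n)"
    using lscale_eq_det[OF T(1,2)] det T(4) by simp
qed

text \<open>Hadamard's inequality up to the factor \<open>fact CARD('n)\<close>, which the Leibniz
  formula gives at once.\<close>

lemma abs_det_le_prod_norm:
  fixes A :: "real^'n^'n"
  shows "\<bar>det A\<bar> \<le> fact CARD('n) * (\<Prod>i\<in>UNIV. norm (A $ i))"
proof -
  have "\<bar>det A\<bar> \<le> (\<Sum>q\<in>{q. q permutes UNIV}. \<bar>of_int (sign q) * (\<Prod>i\<in>UNIV. A $ i $ q i)\<bar>)"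
    unfolding det_def by (rule sum_abs)
  also have "\<dots> \<le> (\<Sum>q\<in>{q. q permutes (UNIV::'n set)}. \<Prod>i\<in>UNIV. norm (A $ i))"
  proof (rule sum_mono)
    fix q
    have "\<bar>of_int (sign q) * (\<Prod>i\<in>UNIV. A $ i $ q i)\<bar> = (\<Prod>i\<in>UNIV. \<bar>A $ i $ q i\<bar>)"
      by (simp add: abs_mult sign_def abs_prod)
    also have "\<dots> \<le> (\<Prod>i\<in>UNIV. norm (A $ i))" by (intro prod_mono) (auto intro: component_le_norm_cart)
    finally show "\<bar>of_int (sign q) * (\<Prod>i\<in>UNIV. A $ i $ q i)\<bar> \<le> (\<Prod>i\<in>UNIV. norm (A $ i))" .
  qed
  finally show ?thesis by (simp add: card_permutations[of "UNIV :: 'n set"])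
qed

text \<open>A dual vector is put in place of the edge with the same index; by Cramer's rule this
  multiplies the determinant by the squared norm of the dual vector. The product bound for the new
  determinant contains that norm once, so one factor cancels.\<close>

lemma dual_edges:
  fixes E :: "'n::finite \<Rightarrow> real^'n"
  assumes det: "det (\<chi> i. E i) \<noteq> 0"
  shows "\<exists>\<xi>. (\<forall>w. w = (\<Sum>i\<in>UNIV. (\<xi> i \<bullet> w) *\<^sub>R E i)) \<and>
    (\<forall>i. norm (\<xi> i) * norm (E i) \<le> fact CARD('n) * (\<Prod>j\<in>UNIV. norm (E j)) / \<bar>det (\<chi> i. E i)\<bar>)"
proof -
  define R where "R = (\<chi> i. E i)"
  have "invertible (transpose R)" using det by (simp add: invertible_det_nz R_def)
  then obtain M where M: "transpose R ** M = mat 1" by (auto simp: invertible_def)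
  have rep: "w = (\<Sum>i\<in>UNIV. (row i M \<bullet> w) *\<^sub>R E i)" for w
  proof -
    have "w = transpose R *v (M *v w)" by (simp add: matrix_vector_mul_assoc M)
    also have "\<dots> = (\<Sum>i\<in>UNIV. (M *v w) $ i *s column i (transpose R))" by (simp add: matrix_mult_sum)
    finally show ?thesis
      by (simp add: column_transpose R_def row_def matrix_vector_mul_component scalar_mult_eq_scaleR inner_commute)
  qed
  have bound: "norm (row k M) * norm (E k) \<le> fact CARD('n) * (\<Prod>j\<in>UNIV. norm (E j)) / \<bar>det R\<bar>" for k
  proof -
    let ?w = "row k M"
    define x where "x = (\<chi> i. row i M \<bullet> ?w)"
    have "det (\<chi> i. if i = k then ?w else E i) = x $ k * det R"
    proof -
      have rowR: "row i R = E i" for i by (simp add: R_def row_def)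
      have "(\<Sum>i\<in>UNIV. x $ i *s E i) = ?w"
        using rep[of ?w] by (simp add: x_def scalar_mult_eq_scaleR)
      then show ?thesis using cramer_lemma_transpose[where x=x and A=R and k=k] unfolding rowR by (simp cong: if_cong)
    qed
    moreover have "\<bar>det (\<chi> i. if i = k then ?w else E i)\<bar> \<le> fact CARD('n) * (\<Prod>i\<in>UNIV. norm (if i = k then ?w else E i))"
      using abs_det_le_prod_norm[of "\<chi> i. if i = k then ?w else E i"] by simp
    moreover have "(\<Prod>i\<in>UNIV. norm (if i = k then ?w else E i)) = norm ?w * (\<Prod>i\<in>UNIV - {k}. norm (E i))"
      by (subst prod.remove[of UNIV k]) (auto intro!: prod.cong)
    moreover have "x $ k = norm ?w * norm ?w" by (simp add: x_def power2_norm_eq_inner[symmetric] power2_eq_square)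
    ultimately have "norm ?w * (norm ?w * \<bar>det R\<bar>) \<le> norm ?w * (fact CARD('n) * (\<Prod>i\<in>UNIV - {k}. norm (E i)))"
      by (simp add: abs_mult algebra_simps)
    moreover have "(\<Prod>i\<in>UNIV - {k}. norm (E i)) \<ge> 0" by (intro prod_nonneg) auto
    ultimately have "norm ?w * \<bar>det R\<bar> \<le> fact CARD('n) * (\<Prod>i\<in>UNIV - {k}. norm (E i))"
      by (cases "norm ?w = 0") auto
    then have "(norm ?w * \<bar>det R\<bar>) * norm (E k) \<le> (fact CARD('n) * (\<Prod>i\<in>UNIV - {k}. norm (E i))) * norm (E k)"
      by (rule mult_right_mono) simp
    moreover have "(\<Prod>j\<in>UNIV. norm (E j)) = norm (E k) * (\<Prod>i\<in>UNIV - {k}. norm (E i))"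
      by (rule prod.remove) auto
    ultimately show ?thesis using det by (simp add: R_def pos_le_divide_eq algebra_simps)
  qed
  show ?thesis
  proof (rule exI[of _ "\<lambda>i. row i M"], intro conjI allI)
    show "w = (\<Sum>i\<in>UNIV. (row i M \<bullet> w) *\<^sub>R E i)" for w by (rule rep)
    show "norm (row i M) * norm (E i) \<le> fact CARD('n) * (\<Prod>j\<in>UNIV. norm (E j)) / \<bar>det (\<chi> i. E i)\<bar>" for i
      using bound[of i] by (simp add: R_def)
  qed
qed

text \<open>Vectors decompose along \<open>d\<close> edges of the simplex with a constant that does not see the angles.\<close>

abbreviation edge_frame :: "(real^'n) set \<Rightarrow> real \<Rightarrow> bool" where
  "edge_frame S K \<equiv> \<exists>a b \<xi>. (\<forall>i::'n. a i \<in> S \<and> b i \<in> S) \<and>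
     (\<forall>w. w = (\<Sum>i\<in>UNIV. (\<xi> i \<bullet> w) *\<^sub>R (b i - a i))) \<and> (\<forall>i. norm (\<xi> i) * norm (b i - a i) \<le> K)"

text \<open>\<open>H_param\<close> divided by the diameter is the product of the edge parameters
  over the volume. These parameters are the lengths of \<open>d\<close> edges that span the simplex,
  so this quotient is the bound of \<open>dual_edges\<close> up to the normalisation
  \<open>\<kappa>\<close>.\<close>

lemma semi_regular_edges:
  fixes S :: "(real^'n) set"
  assumes d: "CARD('n) = 2 \<or> CARD('n) = 3" and fs: "full_simplex S" and vS: "vertices (convex hull S) = S"
    and lab: "vertex_labelling (convex hull S) p"
    and reg: "H_param (convex hull S) p / diameter (convex hull S) \<le> \<gamma>0" and diam: "diameter (convex hull S) > 0"
    and vol: "vol CARD('n) (convex hull S) = \<kappa> * measure lborel (convex hull S)" and \<kappa>: "\<kappa> > 0"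
  shows "edge_frame S (\<kappa> * \<gamma>0)"
proof -
  let ?T = "convex hull S" and ?d = "CARD('n)"
  have bij: "bij_betw p {1..Suc ?d} S"
    using lab d vS by (auto simp: vertex_labelling_def labelling_2d_def labelling_3d_def numeral_eq_Suc)
  have pS: "p i \<in> S" if "i \<in> {1..Suc ?d}" for i using bij that by (auto simp: bij_betw_def)
  obtain \<sigma> where \<sigma>: "bij_betw \<sigma> (UNIV :: 'n set) {1..?d}"
    using finite_same_card_bij[of "UNIV :: 'n set" "{1..?d}"] by auto
  have \<sigma>r: "\<sigma> i \<in> {1..?d}" for i using \<sigma> by (auto simp: bij_betw_def)
  have bijb: "bij_betw (\<lambda>i. p (Suc (\<sigma> i))) UNIV (S - {p 1})"
  proof -
    have "bij_betw Suc {1..?d} {2..Suc ?d}" by (auto simp: bij_betw_def image_Suc_atLeastAtMost numeral_2_eq_2)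
    moreover have "bij_betw p {2..Suc ?d} (S - {p 1})"
    proof -
      have "{1..Suc ?d} - {1} = {2..Suc ?d}" by auto
      then show ?thesis using bij_betw_DiffI[OF bij, of "{1}" "{p 1}"] pS[of 1] by (simp add: bij_betw_def)
    qed
    ultimately have "bij_betw (p \<circ> (Suc \<circ> \<sigma>)) UNIV (S - {p 1})" using \<sigma> by (meson bij_betw_trans)
    then show ?thesis by (simp add: comp_def)
  qed
  have p1: "p 1 \<in> S" by (rule pS) simp
  define R where "R = (\<chi> i::'n. p (Suc (\<sigma> i)) - p 1)"
  note vd = simplex_volume_det[OF fs p1 bijb, folded R_def]
  have sel: "shortest_edge_length ?T = dist x y" if "shortest_edge ?T x y" for x y
    unfolding shortest_edge_length_def
  proof (rule Min_eqI)
    have "{dist x y |x y. x \<in> vertices ?T \<and> y \<in> vertices ?T \<and> x \<noteq> y} \<subseteq> (\<lambda>(x, y). dist x y) ` (S \<times> S)"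
      using vS by auto
    then show "finite {dist x y |x y. x \<in> vertices ?T \<and> y \<in> vertices ?T \<and> x \<noteq> y}"
      using fs finite_subset by (fastforce simp: full_simplex_def)
    show "dist x y \<le> z" if "z \<in> {dist x y |x y. x \<in> vertices ?T \<and> y \<in> vertices ?T \<and> x \<noteq> y}" for z
      using that \<open>shortest_edge ?T x y\<close> by (auto simp: shortest_edge_def)
    show "dist x y \<in> {dist x y |x y. x \<in> vertices ?T \<and> y \<in> vertices ?T \<and> x \<noteq> y}"
      using that by (auto simp: shortest_edge_def)
  qed
  \<comment> \<open>In Type ii the shortest edge starts at \<open>p 2\<close> instead of
    \<open>p 1\<close>. The edge vector changes by a row operation, so the determinant is
    unaffected.\<close>
  obtain A B where AB: "\<And>j. j \<in> {1..?d} \<Longrightarrow> A j \<in> S \<and> B j \<in> S \<and> dist (A j) (B j) = edge_parameter ?T p j"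
    and detAB: "det (\<chi> i::'n. B (\<sigma> i) - A (\<sigma> i)) = det R"
  proof (cases "?d = 3 \<and> \<not> type_i ?T p")
    case False
    show ?thesis
    proof (rule that[of "\<lambda>_. p 1" "\<lambda>j. p (Suc j)"])
      show "det (\<chi> i::'n. p (Suc (\<sigma> i)) - p 1) = det R" by (simp add: R_def)
      fix j assume j: "j \<in> {1..?d}"
      have "dist (p 1) (p (Suc j)) = edge_parameter ?T p j"
      proof (cases "?d = 2")
        case True
        then show ?thesis using j by (cases "j = 1") (auto simp: edge_parameter_def numeral_eq_Suc le_Suc_eq)
      next
        case d: False
        then have "type_i ?T p" "?d = 3" using False assms(1) by auto
        moreover have "j = 1 \<or> j = 2 \<or> j = 3" using j \<open>?d = 3\<close> by auto
        ultimately show ?thesis using sel[of "p 1" "p 3"]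
          by (auto simp: edge_parameter_def numeral_eq_Suc type_i_def)
      qed
      then show "p 1 \<in> S \<and> p (Suc j) \<in> S \<and> dist (p 1) (p (Suc j)) = edge_parameter ?T p j"
        using p1 pS j by auto
    qed
  next
    case True
    then have d3: "?d = 3" and ii: "type_ii ?T p"
      using lab by (auto simp: vertex_labelling_def labelling_3d_def)
    have "1 \<in> range \<sigma>" "2 \<in> range \<sigma>" using \<sigma> d3 by (auto simp: bij_betw_def)
    then obtain i1 i2 where i12: "\<sigma> i1 = 1" "\<sigma> i2 = 2" by (metis imageE)
    have inj\<sigma>: "\<sigma> i = \<sigma> j \<longleftrightarrow> i = j" for i j using \<sigma> by (auto simp: bij_betw_def inj_def)
    show ?thesis
    proof (rule that[of "\<lambda>j. if j = 2 then p 2 else p 1" "\<lambda>j. p (Suc j)"])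
      have "(\<chi> i. p (Suc (\<sigma> i)) - (if \<sigma> i = 2 then p 2 else p 1)) = (\<chi> k. if k = i2 then row i2 R + (- 1) *s row i1 R else row k R)"
        using inj\<sigma>[of _ i2] i12
        by (auto simp: vec_eq_iff R_def row_def numeral_eq_Suc)
      moreover have "i2 \<noteq> i1" using i12 by auto
      ultimately show "det (\<chi> i. p (Suc (\<sigma> i)) - (if \<sigma> i = 2 then p 2 else p 1)) = det R"
        using det_row_operation[of i2 i1 R "- 1"] by simp
      fix j assume j: "j \<in> {1..?d}"
      then have "j = 1 \<or> j = 2 \<or> j = 3" using d3 by auto
      then have "dist (if j = 2 then p 2 else p 1) (p (Suc j)) = edge_parameter ?T p j"
        using sel[of "p 2" "p 3"] ii d3
        by (auto simp: edge_parameter_def numeral_eq_Suc type_ii_def)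
      then show "(if j = 2 then p 2 else p 1) \<in> S \<and> p (Suc j) \<in> S \<and> dist (if j = 2 then p 2 else p 1) (p (Suc j)) = edge_parameter ?T p j"
        using pS[of 1] pS[of 2] pS[of "Suc j"] j d3 by auto
    qed
  qed
  define E where "E i = B (\<sigma> i) - A (\<sigma> i)" for i
  have "(\<Prod>i\<in>UNIV. norm (E i)) = (\<Prod>i\<in>UNIV. edge_parameter ?T p (\<sigma> i))"
    using AB[OF \<sigma>r] by (intro prod.cong) (auto simp: E_def dist_norm norm_minus_commute)
  also have "\<dots> = (\<Prod>j=1..?d. edge_parameter ?T p j)" by (rule prod.reindex_bij_betw[OF \<sigma>])
  finally have prodE: "(\<Prod>i\<in>UNIV. norm (E i)) = (\<Prod>j=1..?d. edge_parameter ?T p j)" .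
  have detE: "det (\<chi> i. E i) = det R" using detAB by (simp add: E_def)
  have mpos: "measure lborel ?T > 0" using vd by simp
  have "(\<Prod>j=1..?d. edge_parameter ?T p j) / (\<kappa> * measure lborel ?T) \<le> \<gamma>0"
    using reg diam vol by (simp add: H_param_def)
  then have "(\<Prod>i\<in>UNIV. norm (E i)) \<le> \<gamma>0 * \<kappa> * measure lborel ?T"
    unfolding prodE using \<kappa> mpos by (simp add: divide_le_eq algebra_simps)
  \<comment> \<open>\<open>fact ?d\<close> cancels against the one in the volume formula.\<close>
  then have K: "fact ?d * (\<Prod>j\<in>UNIV. norm (E j)) / \<bar>det (\<chi> i. E i)\<bar> \<le> \<kappa> * \<gamma>0"
    unfolding detE using vd by (simp add: divide_le_eq field_simps)
  obtain \<xi> where \<xi>: "\<And>w. w = (\<Sum>i\<in>UNIV. (\<xi> i \<bullet> w) *\<^sub>R E i)"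
    "\<And>i. norm (\<xi> i) * norm (E i) \<le> fact ?d * (\<Prod>j\<in>UNIV. norm (E j)) / \<bar>det (\<chi> i. E i)\<bar>"
    using dual_edges[of E] detE vd(1) by auto
  show ?thesis
  proof (rule exI[of _ "\<lambda>i. A (\<sigma> i)"], rule exI[of _ "\<lambda>i. B (\<sigma> i)"], rule exI[of _ \<xi>], intro conjI allI)
    show "norm (\<xi> i) * norm (B (\<sigma> i) - A (\<sigma> i)) \<le> \<kappa> * \<gamma>0" for i
      using order_trans[OF \<xi>(2) K] by (simp add: E_def)
    show "w = (\<Sum>i\<in>UNIV. (\<xi> i \<bullet> w) *\<^sub>R (B (\<sigma> i) - A (\<sigma> i)))" for w using \<xi>(1) by (simp add: E_def)
  qed (use AB[OF \<sigma>r] in auto)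
qed

section \<open>Conforming meshes\<close>

lemma bary_interior:
  assumes fs: "full_simplex S" and ba: "barycentric S g \<beta>" and x: "\<And>v. v \<in> S \<Longrightarrow> g v \<bullet> x + \<beta> v > 0"
  shows "x \<in> interior (convex hull S)"
proof (rule interiorI)
  have "finite S" using fs by (simp add: full_simplex_def)
  moreover have "open {x. 0 < g v \<bullet> x + \<beta> v}" for v by (intro open_Collect_less continuous_intros)
  ultimately show "open (\<Inter>v\<in>S. {x. g v \<bullet> x + \<beta> v > 0})" by (intro open_INT) auto
  show "x \<in> (\<Inter>v\<in>S. {x. g v \<bullet> x + \<beta> v > 0})" using x by blast
  show "(\<Inter>v\<in>S. {x. g v \<bullet> x + \<beta> v > 0}) \<subseteq> convex hull S"
    using bary_hull[OF fs ba] by (auto simp: less_imp_le)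
qed

text \<open>Both coordinates vanish on the common face, so one is a multiple of the other;
  evaluation at \<open>b\<close> gives the factor.\<close>

lemma bary_shared_face:
  assumes fb: "full_simplex (insert b R)" and bR: "b \<notin> R" and aR: "a \<notin> R"
    and ba: "barycentric (insert a R) g \<beta>" and bb: "barycentric (insert b R) g' \<beta>'"
  shows "g a \<bullet> x + \<beta> a = (g a \<bullet> b + \<beta> a) * (g' b \<bullet> x + \<beta>' b)"
proof -
  have lamR: "g a \<bullet> w + \<beta> a = 0" if "w \<in> R" for w using ba that aR by (auto simp: barycentric_def)
  have finR: "finite R" using fb by (simp add: full_simplex_def)
  have A: "(\<Sum>k\<in>insert b R. (g' k \<bullet> x + \<beta>' k) * (g a \<bullet> k)) = g a \<bullet> x"
    using arg_cong[OF bary_repr(2)[OF fb bb, of x], of "\<lambda>y. g a \<bullet> y"] by (simp only: inner_sum_right inner_scaleR_right)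
  have "(\<Sum>k\<in>insert b R. (g' k \<bullet> x + \<beta>' k) * (g a \<bullet> k + \<beta> a)) = (\<Sum>k\<in>insert b R. (g' k \<bullet> x + \<beta>' k) * (g a \<bullet> k)) + (\<Sum>k\<in>insert b R. g' k \<bullet> x + \<beta>' k) * \<beta> a"
    unfolding sum_distrib_right sum.distrib[symmetric] distrib_left ..
  then have "g a \<bullet> x + \<beta> a = (\<Sum>k\<in>insert b R. (g' k \<bullet> x + \<beta>' k) * (g a \<bullet> k + \<beta> a))"
    unfolding A bary_repr(1)[OF fb bb] by simp
  then show ?thesis using finR bR lamR by (simp add: mult.commute)
qed

context
  fixes \<Omega> :: "'a::euclidean_space set" and \<T>
  assumes cm: "conforming_mesh \<Omega> \<T>"
begin

lemma mesh_finite: "finite \<T>" using cm by (simp add: conforming_mesh_def triangulation_def)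

lemma mesh_simplex:
  assumes "T \<in> \<T>"
  shows "full_simplex (vertices T)" "convex hull (vertices T) = T"
proof -
  have "int DIM('a) simplex T" using cm assms by (simp add: conforming_mesh_def)
  then obtain C where C: "\<not> affine_dependent C" "int (card C) = int DIM('a) + 1" "T = convex hull C"
    by (auto simp: simplex_def)
  have v: "vertices T = C" by (auto simp: vertices_def C(3) extreme_point_of_convex_hull_affine_independent[OF C(1)])
  show "full_simplex (vertices T)" unfolding v full_simplex_def using C aff_independent_finite by auto
  show "convex hull (vertices T) = T" unfolding v by (simp add: C)
qed

lemma mesh_barycentric: "T \<in> \<T> \<Longrightarrow> \<exists>g \<beta>. barycentric (vertices T) g \<beta>"
  using barycentric_exists mesh_simplex(1) unfolding full_simplex_def by blast

lemma mesh_compact: "T \<in> \<T> \<Longrightarrow> compact T"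
  using mesh_simplex[of T] finite_imp_compact_convex_hull[of "vertices T"] by (simp add: full_simplex_def)

lemma mesh_convex: "T \<in> \<T> \<Longrightarrow> convex T"
  using mesh_simplex[of T] convex_convex_hull by metis

lemma mesh_negligible_frontier: "T \<in> \<T> \<Longrightarrow> negligible (frontier T)"
  by (rule negligible_convex_frontier[OF mesh_convex])

lemma mesh_interior_nonempty:
  assumes T: "T \<in> \<T>"
  shows "interior T \<noteq> {}"
proof -
  note fs = mesh_simplex(1)[OF T]
  obtain g \<beta> where ba: "barycentric (vertices T) g \<beta>" using mesh_barycentric[OF T] by blast
  have card: "card (vertices T) = Suc DIM('a)" using fs by (simp add: full_simplex_def)
  have 1: "(\<Sum>v\<in>vertices T. 1 / (real DIM('a) + 1)) = 1" by (simp add: card field_simps)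
  have "(\<Sum>w\<in>vertices T. (1 / (real DIM('a) + 1)) *\<^sub>R w) \<in> interior (convex hull (vertices T))"
    using bary_coord[OF fs ba 1] by (intro bary_interior[OF fs ba]) simp
  then show ?thesis using mesh_simplex(2)[OF T] by auto
qed

lemma mesh_aff_dim: "T \<in> \<T> \<Longrightarrow> aff_dim T = int DIM('a)"
  by (rule aff_dim_nonempty_interior[OF mesh_interior_nonempty])

lemma mesh_face: "T \<in> \<T> \<Longrightarrow> T' \<in> \<T> \<Longrightarrow> T \<inter> T' face_of T"
  using cm unfolding conforming_mesh_def triangulation_def by blast

lemma mesh_not_face: "T \<in> \<T> \<Longrightarrow> T' \<in> \<T> \<Longrightarrow> T \<noteq> T' \<Longrightarrow> T \<inter> T' \<noteq> T"
  using mesh_face[of T' T] face_of_aff_dim_lt[OF mesh_convex, of T' T] mesh_aff_dim[of T] mesh_aff_dim[of T']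
  by (metis inf_commute less_irrefl)

lemma mesh_interior_disjoint:
  assumes "T \<in> \<T>" "T' \<in> \<T>" "T \<noteq> T'"
  shows "interior T \<inter> T' = {}"
  using face_of_disjoint_interior[OF mesh_face[OF assms(1,2)] mesh_not_face[OF assms]] interior_subset by blast

lemma mesh_overlap_negligible:
  assumes "T \<in> \<T>" "T' \<in> \<T>" "T \<noteq> T'"
  shows "negligible (T \<inter> T')"
proof (rule negligible_subset[OF mesh_negligible_frontier[OF assms(1)]])
  show "T \<inter> T' \<subseteq> frontier T"
    using mesh_interior_disjoint[OF assms] closure_subset[of T] by (auto simp: frontier_def)
qed

lemma mesh_facet_iff:
  assumes "T \<in> \<T>"
  shows "F facet_of T \<longleftrightarrow> (\<exists>k\<in>vertices T. F = convex hull (vertices T - {k}))"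
proof -
  have fs: "\<not> affine_dependent (vertices T)" "2 \<le> card (vertices T)"
    using mesh_simplex(1)[OF assms] by (auto simp: full_simplex_def Suc_leI)
  show ?thesis
    using facet_of_convex_hull_affine_independent_alt[OF fs(1), of F] fs(2) mesh_simplex(2)[OF assms] by auto
qed

lemma mesh_facet_inj:
  assumes T: "T \<in> \<T>" and k: "k \<in> vertices T" "l \<in> vertices T"
    and eq: "convex hull (vertices T - {k}) = convex hull (vertices T - {l})"
  shows "k = l"
proof (rule ccontr)
  assume "k \<noteq> l"
  note fs = mesh_simplex(1)[OF T]
  obtain g \<beta> where ba: "barycentric (vertices T) g \<beta>" using mesh_barycentric[OF T] by blast
  have "k \<in> convex hull (vertices T - {l})" using k \<open>k \<noteq> l\<close> by (intro hull_inc) auto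
  then have "g k \<bullet> k + \<beta> k = 0" using bary_face_0[OF fs ba k(1)] eq by simp
  then show False using ba k by (auto simp: barycentric_def)
qed

section \<open>Facets and the elements that share them\<close>

definition opposite :: "'a set \<Rightarrow> 'a set \<Rightarrow> 'a" where
  "opposite T F = (THE k. k \<in> vertices T \<and> F = convex hull (vertices T - {k}))"

lemma opposite_eq: "T \<in> \<T> \<Longrightarrow> k \<in> vertices T \<Longrightarrow> opposite T (convex hull (vertices T - {k})) = k"
  unfolding opposite_def using mesh_facet_inj by (intro the_equality) auto

lemma opposite:
  assumes "T \<in> \<T>" "F facet_of T"
  shows "opposite T F \<in> vertices T" "F = convex hull (vertices T - {opposite T F})"
proof -
  obtain k where k: "k \<in> vertices T" "F = convex hull (vertices T - {k})" using mesh_facet_iff assms by blast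
  then have "opposite T F = k" using opposite_eq assms by blast
  with k show "opposite T F \<in> vertices T" "F = convex hull (vertices T - {opposite T F})" by auto
qed

lemma sum_vertices_facets:
  assumes T: "T \<in> \<T>"
  shows "(\<Sum>k\<in>vertices T. h k) = (\<Sum>F\<in>{F. F facet_of T}. h (opposite T F))"
  by (rule sum.reindex_bij_witness[of _ "opposite T" "\<lambda>k. convex hull (vertices T - {k})"])
    (use T opposite opposite_eq mesh_facet_iff in auto)

text \<open>If the apices were on the same side, a point slightly off the centroid of the common
  face towards \<open>b\<close> would lie in the interior of both elements. The coordinate of
  \<open>b\<close> cannot be 0 either, as the coordinate function would then vanish
  identically.\<close>

lemma mesh_shared_facet:
  assumes T: "T \<in> \<T>" "T' \<in> \<T>" "T \<noteq> T'" and F: "F facet_of T" "F facet_of T'"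
  obtains R where "vertices T = insert (opposite T F) R" "vertices T' = insert (opposite T' F) R"
    "opposite T F \<notin> R" "opposite T' F \<notin> R" "F = convex hull R"
    "\<And>g \<beta>. barycentric (vertices T) g \<beta> \<Longrightarrow> g (opposite T F) \<bullet> opposite T' F + \<beta> (opposite T F) < 0"
proof -
  define a where "a = opposite T F"
  define b where "b = opposite T' F"
  define R where "R = vertices T - {a}"
  note oa = opposite[OF T(1) F(1), folded a_def] and ob = opposite[OF T(2) F(2), folded b_def]
  note fT = mesh_simplex(1)[OF T(1)] and fT' = mesh_simplex(1)[OF T(2)]
  have ind: "\<not> affine_dependent (vertices T - {a})" "\<not> affine_dependent (vertices T' - {b})"
    using fT fT' unfolding full_simplex_def by (meson Diff_subset affine_independent_subset)+
  have "vertices T - {a} = {x. x extreme_point_of F}"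
    unfolding oa(2) using extreme_point_of_convex_hull_affine_independent[OF ind(1)] by blast
  moreover have "vertices T' - {b} = {x. x extreme_point_of F}"
    using extreme_point_of_convex_hull_affine_independent[OF ind(2)] ob(2) by auto
  ultimately have R': "R = vertices T' - {b}" by (simp add: R_def)
  have vT: "vertices T = insert a R" "a \<notin> R" using oa by (auto simp: R_def)
  have vT': "vertices T' = insert b R" "b \<notin> R" using ob by (auto simp: R')
  have finR: "finite R" and cR: "card R = DIM('a)" using fT vT by (auto simp: full_simplex_def)
  have neg: "g a \<bullet> b + \<beta> a < 0" if ba: "barycentric (vertices T) g \<beta>" for g \<beta>
  proof (rule ccontr)
    assume nn: "\<not> g a \<bullet> b + \<beta> a < 0"
    obtain g' \<beta>' where bb: "barycentric (vertices T') g' \<beta>'" using mesh_barycentric[OF T(2)] by blast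
    have "g a \<bullet> a + \<beta> a = 1" using ba oa by (auto simp: barycentric_def)
    then have "g a \<bullet> b + \<beta> a \<noteq> 0"
      using bary_shared_face[OF _ vT'(2) vT(2) ba[unfolded vT] bb[unfolded vT'], of a] fT' vT' by auto
    with nn have pos: "g a \<bullet> b + \<beta> a > 0" by simp
    define d where "d = real DIM('a)"
    have d: "d > 0" by (simp add: d_def)
    define m where "m = (\<Sum>v\<in>R. (1 / d) *\<^sub>R v)"
    have lm: "h v \<bullet> m + \<gamma> v = (if v \<in> R then 1 / d else 0)" if h: "barycentric (insert k R) h \<gamma>" and v: "v \<in> insert k R" and k: "k \<notin> R" for h \<gamma> v k
    proof -
      have "h v \<bullet> m + \<gamma> v = (\<Sum>w\<in>R. (1 / d) * (h v \<bullet> w + \<gamma> v))"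
        using d by (simp add: m_def inner_sum_right distrib_left sum.distrib cR d_def)
      also have "\<dots> = (\<Sum>w\<in>R. if v = w then 1 / d else 0)"
        using h v by (intro sum.cong) (auto simp: barycentric_def)
      finally show ?thesis using finR by simp
    qed
    define x where "x \<epsilon> = m + \<epsilon> *\<^sub>R (b - m)" for \<epsilon>
    have lx: "h v \<bullet> x \<epsilon> + c = (1 - \<epsilon>) * (h v \<bullet> m + c) + \<epsilon> * (h v \<bullet> b + c)" for h :: "'a \<Rightarrow> 'a" and v c \<epsilon>
      by (simp add: x_def inner_add_right inner_diff_right algebra_simps)
    have ev: "\<forall>\<^sub>F \<epsilon> in at_right 0. g v \<bullet> x \<epsilon> + \<beta> v > 0" if v: "v \<in> insert a R" for v
    proof (cases "v = a")
      case True
      have "g a \<bullet> m + \<beta> a = 0" using lm[OF ba[unfolded vT] _ vT(2), of a] vT(2) by simp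
      moreover have "\<forall>\<^sub>F \<epsilon> in at_right (0::real). \<epsilon> > 0" by (simp add: eventually_at_right_less)
      ultimately show ?thesis unfolding True lx using pos by (auto elim!: eventually_mono)
    next
      case False
      then have 1: "g v \<bullet> m + \<beta> v = 1 / d" using lm[OF ba[unfolded vT] v vT(2)] v by simp
      have "((\<lambda>\<epsilon>. g v \<bullet> x \<epsilon> + \<beta> v) \<longlongrightarrow> (1 - 0) * (1 / d) + 0 * (g v \<bullet> b + \<beta> v)) (at_right 0)"
        unfolding lx 1 by (intro tendsto_intros)
      from order_tendstoD(1)[OF this, of 0] show ?thesis using d by simp
    qed
    have "\<forall>\<^sub>F \<epsilon> in at_right 0. \<forall>v\<in>insert a R. g v \<bullet> x \<epsilon> + \<beta> v > 0"
      using ev finR by (intro eventually_ball_finite) auto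
    moreover have "\<forall>\<^sub>F \<epsilon> in at_right (0::real). 0 < \<epsilon> \<and> \<epsilon> < 1"
      using eventually_at_right_real[of 0 1] by (auto elim!: eventually_mono)
    ultimately have "\<forall>\<^sub>F \<epsilon> in at_right (0::real). (\<forall>v\<in>insert a R. g v \<bullet> x \<epsilon> + \<beta> v > 0) \<and> 0 < \<epsilon> \<and> \<epsilon> < 1"
      by eventually_elim auto
    then obtain \<epsilon> where \<epsilon>: "\<And>v. v \<in> insert a R \<Longrightarrow> g v \<bullet> x \<epsilon> + \<beta> v > 0" "0 < \<epsilon>" "\<epsilon> < 1"
      using eventually_happens'[OF trivial_limit_at_right_real] by blast
    have "x \<epsilon> \<in> interior T"
      using bary_interior[OF fT ba] \<epsilon>(1) vT(1) mesh_simplex(2)[OF T(1)] by auto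
    moreover have "x \<epsilon> \<in> interior T'"
    proof -
      have "g' v \<bullet> x \<epsilon> + \<beta>' v > 0" if v: "v \<in> insert b R" for v
      proof -
        have "g' v \<bullet> b + \<beta>' v = (if v = b then 1 else 0)" using bb v by (auto simp: barycentric_def vT')
        then show ?thesis using lm[OF bb[unfolded vT'] v vT'(2)] v vT'(2) d \<epsilon>(2,3) unfolding lx by (auto simp: divide_simps)
      qed
      then show ?thesis using bary_interior[OF fT' bb] vT'(1) mesh_simplex(2)[OF T(2)] by auto
    qed
    ultimately show False using mesh_interior_disjoint[OF T] interior_subset by blast
  qed
  show ?thesis
  proof (rule that[of R])
    show "F = convex hull R" using oa by (simp add: R_def)
  qed (use vT vT' neg in \<open>auto simp: a_def b_def\<close>)
qed

text \<open>Three elements with a common facet would have apices pairwise on opposite sides. But the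
  coordinate for the pair 1, 3 is the product of those for 1, 2 and 2, 3, and a product of two
  negative numbers is positive.\<close>

lemma mesh_facet_at_most_two:
  assumes T: "T1 \<in> \<T>" "T2 \<in> \<T>" "T3 \<in> \<T>" and F: "F facet_of T1" "F facet_of T2" "F facet_of T3"
    and ne: "T1 \<noteq> T2" "T1 \<noteq> T3"
  shows "T2 = T3"
proof (rule ccontr)
  assume ne': "T2 \<noteq> T3"
  obtain g \<beta> where ba: "barycentric (vertices T1) g \<beta>" using mesh_barycentric[OF T(1)] by blast
  obtain g' \<beta>' where bb: "barycentric (vertices T2) g' \<beta>'" using mesh_barycentric[OF T(2)] by blast
  obtain R where R: "vertices T1 = insert (opposite T1 F) R" "vertices T2 = insert (opposite T2 F) R"
    "opposite T1 F \<notin> R" "opposite T2 F \<notin> R"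
    and neg: "\<And>g \<beta>. barycentric (vertices T1) g \<beta> \<Longrightarrow> g (opposite T1 F) \<bullet> opposite T2 F + \<beta> (opposite T1 F) < 0"
    by (rule mesh_shared_facet[OF T(1,2) ne(1) F(1,2)]) blast
  have neg13: "g (opposite T1 F) \<bullet> opposite T3 F + \<beta> (opposite T1 F) < 0"
    by (rule mesh_shared_facet[OF T(1,3) ne(2) F(1,3)]) (use ba in blast)
  have neg23: "g' (opposite T2 F) \<bullet> opposite T3 F + \<beta>' (opposite T2 F) < 0"
    by (rule mesh_shared_facet[OF T(2,3) ne' F(2,3)]) (use bb in blast)
  have "g (opposite T1 F) \<bullet> opposite T3 F + \<beta> (opposite T1 F) =
    (g (opposite T1 F) \<bullet> opposite T2 F + \<beta> (opposite T1 F)) * (g' (opposite T2 F) \<bullet> opposite T3 F + \<beta>' (opposite T2 F))"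
    using mesh_simplex(1)[OF T(2)] ba bb R by (intro bary_shared_face[of _ R]) auto
  then show False using neg[OF ba] neg13 neg23 by (smt (verit) mult_neg_neg)
qed

text \<open>Guarantees that \<open>faces\<close> misses no facet. Were a relative interior point of
  \<open>F\<close> inside \<open>\<Omega>\<close>, points approaching it from outside
  \<open>T\<close> would lie in other elements; one of these contains the point in the limit and, by
  conformity, shares the facet.\<close>

lemma mesh_boundary_facet:
  assumes op: "open \<Omega>" and T: "T \<in> \<T>" and F: "F facet_of T" and ni: "F \<notin> interior_faces \<T>"
  shows "F \<subseteq> frontier \<Omega>"
proof -
  have un: "\<Union>\<T> = closure \<Omega>" using cm by (simp add: conforming_mesh_def)
  note fs = mesh_simplex(1)[OF T]
  define k where "k = opposite T F"
  note k = opposite[OF T F, folded k_def]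
  obtain g \<beta> where ba: "barycentric (vertices T) g \<beta>" using mesh_barycentric[OF T] by blast
  have FT: "F \<subseteq> T" using F by (rule facet_of_imp_subset)
  have cF: "convex F" "closed F"
    using F mesh_convex[OF T] face_of_imp_convex facet_of_imp_face_of
      face_of_imp_closed mesh_compact[OF T] compact_imp_closed by blast+
  have rel: "x \<in> frontier \<Omega>" if x: "x \<in> rel_interior F" for x
  proof (rule ccontr)
    assume nf: "x \<notin> frontier \<Omega>"
    have xF: "x \<in> F" using x rel_interior_subset by blast
    have lx: "g k \<bullet> x + \<beta> k = 0" using bary_face_0[OF fs ba k(1)] xF k(2) by simp
    have "x \<in> closure \<Omega>" using xF FT T un by blast
    then have "x \<in> \<Omega>" using nf op by (simp add: frontier_def interior_open)
    then obtain e where e: "e > 0" "ball x e \<subseteq> \<Omega>" using op open_contains_ball by blast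
    define y where "y n = x - (e / (2 * real (Suc n) * norm (g k))) *\<^sub>R g k" for n
    have gk: "norm (g k) > 0" using bary_grad_nonzero[OF fs ba k(1)] by simp
    have ydist: "dist x (y n) = e / (2 * real (Suc n))" for n
      using e gk by (simp add: y_def dist_norm)
    have yb: "y n \<in> ball x e" for n
    proof -
      have "e / (2 * real (Suc n)) < e" using e by (simp add: divide_less_eq)
      then show ?thesis by (simp add: ydist)
    qed
    have ylim: "y \<longlonglongrightarrow> x"
    proof (rule iffD2[OF tendsto_dist_iff])
      have "(\<lambda>n. e / (2 * real (Suc n))) \<longlonglongrightarrow> 0" by real_asymp
      then show "(\<lambda>n. dist (y n) x) \<longlonglongrightarrow> 0" by (simp add: dist_commute[of _ x] ydist)
    qed
    have yT: "y n \<notin> T" for n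
    proof
      assume "y n \<in> T"
      then have "g k \<bullet> y n + \<beta> k \<ge> 0" using bary_hull[OF fs ba] mesh_simplex(2)[OF T] k(1) by blast
      moreover have "g k \<bullet> y n + \<beta> k = (g k \<bullet> x + \<beta> k) - (e / (2 * real (Suc n) * norm (g k))) * (g k \<bullet> g k)"
        by (simp add: y_def inner_diff_right)
      moreover have "(e / (2 * real (Suc n) * norm (g k))) * (g k \<bullet> g k) > 0" using e gk by (intro mult_pos_pos) auto
      ultimately show False using lx by simp
    qed
    have "y n \<in> \<Union>\<T>" for n using yb e(2) closure_subset un by blast
    then have "\<forall>n. \<exists>t. t \<in> \<T> \<and> y n \<in> t" by blast
    then obtain \<tau> where \<tau>: "\<And>n. \<tau> n \<in> \<T> \<and> y n \<in> \<tau> n" by metis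
    have "finite (range \<tau>)" by (rule finite_subset[OF _ mesh_finite]) (use \<tau> in blast)
    then obtain n0 where inf: "infinite {n. \<tau> n = \<tau> n0}" using pigeonhole_infinite[of UNIV \<tau>] by auto
    define T' where "T' = \<tau> n0"
    have T'in: "T' \<in> \<T>" and "T' \<noteq> T" using \<tau>[of n0] yT[of n0] by (auto simp: T'_def)
    define r where "r = enumerate {n. \<tau> n = T'}"
    have r: "strict_mono r" "\<And>n. \<tau> (r n) = T'"
      using strict_mono_enumerate[OF inf] enumerate_in_set[OF inf] by (auto simp: r_def T'_def)
    have "x \<in> T'"
    proof (rule closed_sequentially[OF compact_imp_closed[OF mesh_compact[OF T'in]]])
      show "(y \<circ> r) n \<in> T'" for n using \<tau>[of "r n"] r(2)[of n] by simp
      show "(y \<circ> r) \<longlonglongrightarrow> x" by (rule LIMSEQ_subseq_LIMSEQ[OF ylim r(1)])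
    qed
    have sub: "F \<subseteq> T \<inter> T'"
      using \<open>x \<in> T'\<close> xF x FT by (intro subset_of_face_of[OF mesh_face[OF T T'in]]) auto
    have "T \<inter> T' face_of T'" using mesh_face[OF T'in T] by (simp add: Int_commute)
    have "F face_of T \<inter> T'" by (rule face_of_subset[OF facet_of_imp_face_of[OF F] sub]) simp
    \<comment> \<open>\<open>F\<close> has codimension 1 in \<open>T\<close>, so no face of
      \<open>T\<close> lies strictly between them in dimension.\<close>
    have "T \<inter> T' = F"
    proof (rule ccontr)
      assume "T \<inter> T' \<noteq> F"
      then have "aff_dim F < aff_dim (T \<inter> T')"
        using face_of_aff_dim_lt[OF _ \<open>F face_of T \<inter> T'\<close>] convex_Int[OF mesh_convex[OF T] mesh_convex[OF T'in]] by auto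
      moreover have "aff_dim (T \<inter> T') < aff_dim T"
        using mesh_not_face[OF T T'in] \<open>T' \<noteq> T\<close> by (intro face_of_aff_dim_lt[OF mesh_convex[OF T] mesh_face[OF T T'in]]) auto
      ultimately show False using F by (simp add: facet_of_def)
    qed
    then have "F facet_of T'"
      using \<open>T \<inter> T' face_of T'\<close> F mesh_aff_dim[OF T] mesh_aff_dim[OF T'in] by (simp add: facet_of_def)
    then have "F \<in> interior_faces \<T>" using T T'in F \<open>T' \<noteq> T\<close> by (auto simp: interior_faces_def)
    then show False using ni by blast
  qed
  have "F = closure (rel_interior F)" using convex_closure_rel_interior[OF cF(1)] cF(2) by simp
  also have "\<dots> \<subseteq> frontier \<Omega>" using rel by (intro closure_minimal) auto
  finally show ?thesis .
qed

lemma mesh_facet_elements: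
  assumes fo: "face_ordering \<T> Tp Tm" and T: "T \<in> \<T>" and F: "F facet_of T"
  shows "{T' \<in> \<T>. F facet_of T'} = (if F \<in> interior_faces \<T> then {Tp F, Tm F} else {boundary_element \<T> F})"
    "F \<notin> interior_faces \<T> \<Longrightarrow> boundary_element \<T> F = T"
proof -
  show be: "boundary_element \<T> F = T" if "F \<notin> interior_faces \<T>"
    unfolding boundary_element_def using that T F by (intro the_equality) (auto simp: interior_faces_def)
  show "{T' \<in> \<T>. F facet_of T'} = (if F \<in> interior_faces \<T> then {Tp F, Tm F} else {boundary_element \<T> F})"
  proof (cases "F \<in> interior_faces \<T>")
    case True
    then have o: "Tp F \<in> \<T>" "Tm F \<in> \<T>" "Tp F \<noteq> Tm F" "F facet_of Tp F" "F facet_of Tm F"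
      using fo by (auto simp: face_ordering_def)
    have "T' = Tp F \<or> T' = Tm F" if "T' \<in> \<T>" "F facet_of T'" for T'
      using mesh_facet_at_most_two[of "Tp F" T' "Tm F" F] o that by metis
    then show ?thesis using True o by auto
  next
    case False
    then show ?thesis using be[OF False] T F by (auto simp: interior_faces_def)
  qed
qed

text \<open>The sum over elements and their facets is reordered by faces; an interior face collects
  exactly two terms.\<close>

lemma sum_facets:
  assumes op: "open \<Omega>" and fo: "face_ordering \<T> Tp Tm"
  shows "(\<Sum>T\<in>\<T>. \<Sum>F\<in>{F. F facet_of T}. a T F) =
    (\<Sum>F\<in>faces \<Omega> \<T>. if F \<in> interior_faces \<T> then a (Tp F) F + a (Tm F) F else a (boundary_element \<T> F) F)"
    "finite (faces \<Omega> \<T>)"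
    "F \<in> faces \<Omega> \<T> \<longleftrightarrow> (\<exists>T\<in>\<T>. F facet_of T)"
proof -
  show fac: "F \<in> faces \<Omega> \<T> \<longleftrightarrow> (\<exists>T\<in>\<T>. F facet_of T)" for F
    using mesh_boundary_facet[OF op, of _ F]
    by (auto simp: faces_def interior_faces_def boundary_faces_def)
  have "finite {F. F facet_of T}" if "T \<in> \<T>" for T
  proof (rule finite_polytope_facets)
    show "polytope T" using mesh_simplex[OF that] unfolding polytope_def full_simplex_def by metis
  qed
  moreover have eq: "faces \<Omega> \<T> = (\<Union>T\<in>\<T>. {F. F facet_of T})" using fac by blast
  ultimately show fin: "finite (faces \<Omega> \<T>)" using mesh_finite by simp
  have "(\<Sum>T\<in>\<T>. \<Sum>F\<in>{F. F facet_of T}. a T F) = (\<Sum>T\<in>\<T>. \<Sum>F\<in>{F\<in>faces \<Omega> \<T>. F facet_of T}. a T F)"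
    by (intro sum.cong) (use fac in auto)
  also have "\<dots> = (\<Sum>F\<in>faces \<Omega> \<T>. \<Sum>T\<in>{T\<in>\<T>. F facet_of T}. a T F)"
    by (rule sum.swap_restrict[OF mesh_finite fin])
  also have "\<dots> = (\<Sum>F\<in>faces \<Omega> \<T>. if F \<in> interior_faces \<T> then a (Tp F) F + a (Tm F) F else a (boundary_element \<T> F) F)"
  proof (intro sum.cong refl)
    fix F assume "F \<in> faces \<Omega> \<T>"
    then obtain T where T: "T \<in> \<T>" "F facet_of T" using fac by blast
    show "(\<Sum>T\<in>{T\<in>\<T>. F facet_of T}. a T F) = (if F \<in> interior_faces \<T> then a (Tp F) F + a (Tm F) F else a (boundary_element \<T> F) F)"
      unfolding mesh_facet_elements(1)[OF fo T] using fo by (auto simp: face_ordering_def)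
  qed
  finally show "(\<Sum>T\<in>\<T>. \<Sum>F\<in>{F. F facet_of T}. a T F) =
    (\<Sum>F\<in>faces \<Omega> \<T>. if F \<in> interior_faces \<T> then a (Tp F) F + a (Tm F) F else a (boundary_element \<T> F) F)" .
qed

end

section \<open>Duality with trigonometric polynomials\<close>

text \<open>The cube \<open>[-M, 3 M]^d\<close>. The elements will lie in \<open>[-M, M]^d\<close>;
  the period is twice that side, so that a function given there can be continued continuously to a
  periodic one by reflection.\<close>

definition shifted_cube :: "real \<Rightarrow> 'a::euclidean_space set" where
  "shifted_cube M = (\<lambda>x. - (M *\<^sub>R One) + x) ` pbox (4 * M)"

abbreviation cube_tev :: "real \<Rightarrow> real \<Rightarrow> 'a::euclidean_space trig \<Rightarrow> real" where
  "cube_tev M r xs \<equiv> integral (shifted_cube M) (\<lambda>x. \<bar>tev xs (x + M *\<^sub>R One)\<bar> powr r)"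

lemma mem_shifted_cube: "x \<in> shifted_cube M \<longleftrightarrow> (\<forall>b\<in>Basis. - M \<le> x \<bullet> b \<and> x \<bullet> b \<le> 3 * M)"
proof -
  have "x \<in> shifted_cube M \<longleftrightarrow> x + M *\<^sub>R One \<in> pbox (4 * M)"
    unfolding shifted_cube_def by (auto simp: image_iff intro!: bexI[of _ "x + M *\<^sub>R One"])
  moreover have "(x + M *\<^sub>R One) \<bullet> b = x \<bullet> b + M" "(4 * M) *\<^sub>R One \<bullet> b = 4 * M" if "b \<in> Basis" for b
    using that by (simp_all add: inner_add_left inner_sum_left inner_Basis if_distrib cong: if_cong)
  moreover have "0 \<le> x \<bullet> b + M \<and> x \<bullet> b + M \<le> 4 * M \<longleftrightarrow> - M \<le> x \<bullet> b \<and> x \<bullet> b \<le> 3 * M" for b by linarith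
  ultimately show ?thesis by (simp add: pbox_def mem_box)
qed

lemma compact_shifted_cube: "compact (shifted_cube M)"
  unfolding shifted_cube_def pbox_def by (intro compact_continuous_image continuous_intros compact_cbox)

lemma integral_shifted_cube:
  fixes f :: "'a::euclidean_space \<Rightarrow> real"
  assumes "continuous_on UNIV f"
  shows "integral (shifted_cube M) f = integral (pbox (4 * M)) (\<lambda>x. f (x - M *\<^sub>R One))"
proof -
  have "compact (pbox (4 * M) :: 'a set)" by (simp add: pbox_def)
  from integral_affine_image[of id, OF _ _ this assms, of "- (M *\<^sub>R One)"]
  show ?thesis by (simp add: shifted_cube_def linear_id)
qed

abbreviation divergence_solvable :: "real \<Rightarrow> real \<Rightarrow> real \<Rightarrow> 'a::euclidean_space trig \<Rightarrow> bool" where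
  "divergence_solvable M r C xs \<equiv> \<exists>v Dv. C1 v Dv \<and> (\<forall>x. divg Dv x = tev xs (x + M *\<^sub>R One)) \<and>
     vpow v Dv r (shifted_cube M) \<le> C * cube_tev M r xs"

lemma divergence_right_inverse_cube:
  assumes r: "r > 1" and M: "M > 0"
  shows "\<exists>C>0. \<forall>xs :: 'a::euclidean_space trig. trig_freq (4 * M) xs \<longrightarrow> divergence_solvable M r C xs"
proof -
  let ?z = "M *\<^sub>R One :: 'a"
  have "4 * M > 0" using M by simp
  from divergence_right_inverse[OF r this, where 'a='a] obtain C where C: "C > 0"
    and inv: "\<And>xs :: 'a trig. trig_freq (4 * M) xs \<Longrightarrow> \<exists>v Dv. C1 v Dv \<and> (\<forall>x. divg Dv x = tev xs x) \<and>
       vpow v Dv r (pbox (4 * M)) \<le> C * lpow (4 * M) r (tev xs)" by blast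
  show ?thesis
  proof (intro exI[of _ C] conjI allI impI C)
    fix xs :: "'a trig" assume "trig_freq (4 * M) xs"
    from inv[OF this] obtain v Dv where C1v: "C1 v Dv" and dv: "\<And>x. divg Dv x = tev xs x"
      and le: "vpow v Dv r (pbox (4 * M)) \<le> C * lpow (4 * M) r (tev xs)" by blast
    define u where "u x = v (?z + id x)" for x
    define Du where "Du x w = Dv (?z + id x) (id w)" for x w
    have C1u: "C1 u Du" unfolding u_def[abs_def] Du_def[abs_def] by (rule C1_affine[OF C1v linear_id])
    show "\<exists>v Dv. C1 v Dv \<and> (\<forall>x. divg Dv x = tev xs (x + ?z)) \<and>
     vpow v Dv r (shifted_cube M)
       \<le> C * cube_tev M r xs"
    proof (intro exI conjI allI)
      show "C1 u Du" by (rule C1u)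
      show "divg Du x = tev xs (x + ?z)" for x
        using dv[of "x + ?z"] by (simp add: divg_def Du_def add.commute)
      have c1: "continuous_on UNIV (\<lambda>x. vsize u Du x powr r)"
        using vsize_continuous[OF C1u, of UNIV] r by (intro continuous_on_powr') (auto simp: vsize_nonneg)
      have c2: "continuous_on UNIV (\<lambda>x. \<bar>tev xs (x + ?z)\<bar> powr r)"
        using r by (intro continuous_on_powr' continuous_intros) auto
      show "vpow u Du r (shifted_cube M)
       \<le> C * cube_tev M r xs"
        unfolding integral_shifted_cube[OF c1] integral_shifted_cube[OF c2]
        using le by (simp add: vsize_def u_def Du_def)
    qed
  qed
qed

lemma LIMSEQ_min_1:
  assumes "c > (0::real)"
  shows "(\<lambda>n. min 1 (real n * c)) \<longlonglongrightarrow> 1"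
proof (rule tendsto_eventually)
  obtain N where N: "1 / c < real N" using reals_Archimedean2 by blast
  show "\<forall>\<^sub>F n in sequentially. min 1 (real n * c) = 1"
  proof (rule eventually_sequentiallyI[of N])
    fix n assume "N \<le> n"
    then have "1 / c \<le> real n" using N by linarith
    then show "min 1 (real n * c) = 1" using assms by (simp add: divide_le_eq)
  qed
qed

text \<open>The function that realises the norm of \<open>h\<close> is \<open>G\<close>: it equals
  \<open>spow (p - 1) (h T)\<close> inside each element and 0 elsewhere, so it may jump between
  elements. It is the pointwise limit of uniformly bounded trigonometric polynomials, which suffices
  for dominated convergence on both sides of \<open>bound\<close>; the limit reads
  \<open>A \<le> K * A powr (1 / r)\<close>.\<close>

lemma trig_duality:
  fixes h :: "'a::euclidean_space set \<Rightarrow> 'a \<Rightarrow> real"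
  assumes p: "p > 1" and r: "r = p / (p - 1)" and M: "M > 0" and fin: "finite \<T>"
    and T: "\<And>T. T \<in> \<T> \<Longrightarrow> compact T" "\<And>T. T \<in> \<T> \<Longrightarrow> negligible (frontier T)" "\<And>T x. T \<in> \<T> \<Longrightarrow> x \<in> T \<Longrightarrow> norm x < M"
    and disj: "\<And>T T'. T \<in> \<T> \<Longrightarrow> T' \<in> \<T> \<Longrightarrow> T \<noteq> T' \<Longrightarrow> interior T \<inter> interior T' = {}"
    and h: "\<And>T. continuous_on UNIV (h T)" and K: "K \<ge> 0"
    and bound: "\<And>xs. trig_freq (4 * M) xs \<Longrightarrow> \<bar>\<Sum>T\<in>\<T>. integral T (\<lambda>x. h T x * tev xs (x + M *\<^sub>R One))\<bar>
      \<le> K * (cube_tev M r xs) powr (1 / r)"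
  shows "(\<Sum>T\<in>\<T>. integral T (\<lambda>x. \<bar>h T x\<bar> powr p)) \<le> K powr p"
proof -
  let ?z = "M *\<^sub>R One :: 'a" and ?Q = "shifted_cube M :: 'a set"
  have r1: "r > 1" using p by (simp add: r field_simps)
  define \<omega> where "\<omega> = pi / (2 * M)"
  have \<omega>: "\<omega> > 0" "\<omega> * M = pi / 2" "\<omega> * (4 * M) = 2 * pi" using M by (auto simp: \<omega>_def)
  \<comment> \<open>\<open>tri\<close> folds space periodically onto the subcube \<open>[-M, M]\<close>, being the identity there; \<open>Z n\<close>
    removes the mirror images, and \<open>cut n\<close> the jumps between elements.\<close>
  define tri where "tri x = (\<Sum>b\<in>Basis. (arccos (cos (\<omega> * (x \<bullet> b + M))) / \<omega> - M) *\<^sub>R b)" for x :: 'a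
  define Z where "Z n x = (\<Prod>b\<in>Basis. min 1 (real n * max 0 (sin (\<omega> * (x \<bullet> b + M)))))" for n and x :: 'a
  define cut where "cut n T x = min 1 (real n * infdist x (- interior T))" for n T and x :: 'a
  define s where "s T x = spow (p - 1) (h T x)" for T x
  define f where "f n x = Z n x * (\<Sum>T\<in>\<T>. cut n T (tri x) * s T (tri x))" for n x
  define U where "U = {x :: 'a. \<forall>b\<in>Basis. - M < x \<bullet> b \<and> x \<bullet> b < M}"
  define G where "G x = (if x \<in> U then \<Sum>T\<in>\<T>. if x \<in> interior T then s T x else 0 else 0)" for x
  have cs: "continuous_on UNIV (s T)" for T
    unfolding s_def using p h by (intro continuous_on_compose2[OF continuous_on_spow, of _ UNIV]) auto
  have ctri: "continuous_on UNIV tri"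
    unfolding tri_def by (intro continuous_intros) (use \<omega> in \<open>auto simp: cos_ge_minus_one\<close>)
  have tri_in: "tri x \<bullet> b \<in> {- M..M}" if "b \<in> Basis" for x b
  proof -
    have "tri x \<bullet> b = arccos (cos (\<omega> * (x \<bullet> b + M))) / \<omega> - M"
      using that by (simp add: tri_def inner_sum_left inner_Basis if_distrib cong: if_cong)
    moreover have "0 \<le> arccos (cos (\<omega> * (x \<bullet> b + M)))" "arccos (cos (\<omega> * (x \<bullet> b + M))) \<le> pi"
      by (auto intro: arccos_lbound arccos_ubound simp: cos_ge_minus_one)
    moreover have "pi / \<omega> = 2 * M" using M by (simp add: \<omega>_def)
    moreover have "0 \<le> arccos (cos (\<omega> * (x \<bullet> b + M))) / \<omega>" "arccos (cos (\<omega> * (x \<bullet> b + M))) / \<omega> \<le> pi / \<omega>"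
      using \<omega>(1) calculation(2,3) by (auto intro!: divide_right_mono)
    ultimately show ?thesis by simp
  qed
  have tri_id: "tri x = x" if "x \<in> U" for x
  proof (rule euclidean_eqI)
    fix b :: 'a assume b: "b \<in> Basis"
    have "0 \<le> \<omega> * (x \<bullet> b + M)" using that b \<omega>(1) by (auto simp: U_def intro!: mult_nonneg_nonneg)
    moreover have "\<omega> * (x \<bullet> b + M) \<le> \<omega> * (2 * M)" using that b \<omega>(1) by (intro mult_left_mono) (auto simp: U_def)
    ultimately have "arccos (cos (\<omega> * (x \<bullet> b + M))) = \<omega> * (x \<bullet> b + M)" using \<omega>(2) by (intro arccos_cos) auto
    then show "tri x \<bullet> b = x \<bullet> b" using b \<omega>(1) by (simp add: tri_def inner_sum_left inner_Basis if_distrib cong: if_cong)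
  qed
  have cZ: "continuous_on UNIV (Z n)" for n unfolding Z_def by (intro continuous_intros)
  have ccut: "continuous_on UNIV (cut n T)" for n T unfolding cut_def by (intro continuous_intros)
  have cf: "continuous_on UNIV (f n)" for n
  proof -
    have "continuous_on UNIV (\<lambda>x. cut n T (tri x))" "continuous_on UNIV (\<lambda>x. s T (tri x))" for T
      by (rule continuous_on_compose2[OF ccut ctri] continuous_on_compose2[OF cs ctri]; simp)+
    then show ?thesis unfolding f_def using cZ by (intro continuous_intros)
  qed
  have per: "f n (x + (4 * M) *\<^sub>R i) = f n x" if i: "i \<in> Basis" for n x i
  proof -
    have a: "\<omega> * ((x + (4 * M) *\<^sub>R i) \<bullet> b + M) = \<omega> * (x \<bullet> b + M) + (if i = b then 2 * pi else 0)" if "b \<in> Basis" for b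
      using \<omega>(3) i that by (simp add: inner_add_left inner_Basis distrib_left)
    have c: "cos (\<omega> * ((x + (4 * M) *\<^sub>R i) \<bullet> b + M)) = cos (\<omega> * (x \<bullet> b + M))"
      "sin (\<omega> * ((x + (4 * M) *\<^sub>R i) \<bullet> b + M)) = sin (\<omega> * (x \<bullet> b + M))" if "b \<in> Basis" for b
      unfolding a[OF that] by simp_all
    have "tri (x + (4 * M) *\<^sub>R i) = tri x" unfolding tri_def by (intro sum.cong) (simp_all add: c)
    moreover have "Z n (x + (4 * M) *\<^sub>R i) = Z n x" unfolding Z_def by (intro prod.cong) (simp_all add: c)
    ultimately show ?thesis by (simp add: f_def)
  qed
  have "\<exists>B. \<forall>x. \<bar>s T (tri x)\<bar> \<le> B" for T
  proof -
    have "compact (cbox (- ?z) ?z)" by (rule compact_cbox)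
    from compact_imp_bounded[OF compact_continuous_image[OF continuous_on_subset[OF cs] this]]
    obtain B where "\<And>x. x \<in> cbox (- ?z) ?z \<Longrightarrow> \<bar>s T x\<bar> \<le> B" by (auto simp: bounded_iff) (meson subset_UNIV)
    moreover have "tri x \<in> cbox (- ?z) ?z" for x
      using tri_in by (auto simp: mem_box inner_sum_left inner_Basis if_distrib cong: if_cong)
    ultimately show ?thesis by blast
  qed
  then obtain B where B: "\<And>T x. \<bar>s T (tri x)\<bar> \<le> B T" by metis
  define Bd where "Bd = (\<Sum>T\<in>\<T>. B T)"
  have Z01: "0 \<le> Z n x" "Z n x \<le> 1" for n x
    unfolding Z_def by (auto intro!: prod_nonneg prod_le_1)
  have cut01: "0 \<le> cut n T x" "cut n T x \<le> 1" for n T x unfolding cut_def by (auto simp: infdist_nonneg)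
  have fB: "\<bar>f n x\<bar> \<le> Bd" for n x
  proof -
    have "\<bar>f n x\<bar> \<le> 1 * (\<Sum>T\<in>\<T>. \<bar>cut n T (tri x) * s T (tri x)\<bar>)"
      unfolding f_def abs_mult[of "Z n x"] using Z01[of n x] by (intro mult_mono sum_abs) auto
    also have "\<dots> \<le> 1 * Bd"
      unfolding Bd_def mult_1
    proof (rule sum_mono)
      fix T show "\<bar>cut n T (tri x) * s T (tri x)\<bar> \<le> B T"
        using mult_mono[of "\<bar>cut n T (tri x)\<bar>" 1 "\<bar>s T (tri x)\<bar>" "B T"] cut01[of n T "tri x"] B[of T x]
        by (simp add: abs_mult)
    qed
    finally show ?thesis by simp
  qed
  have "\<exists>xs. trig_freq (4 * M) xs \<and> (\<forall>x. \<bar>f n x - tev xs (x + ?z)\<bar> < 1 / (real n + 1))" for n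
  proof -
    have "continuous_on UNIV (\<lambda>x. f n (x - ?z))" by (intro continuous_on_compose2[OF cf] continuous_intros) auto
    moreover have "f n (x + (4 * M) *\<^sub>R i - ?z) = f n (x - ?z)" if "i \<in> Basis" for x i
      using per[OF that, of n "x - ?z"] by (simp add: algebra_simps)
    ultimately obtain xs where "trig_freq (4 * M) xs" "\<And>x. \<bar>f n (x - ?z) - tev xs x\<bar> < 1 / (real n + 1)"
      using trig_dense[of "4 * M" "\<lambda>x. f n (x - ?z)" "1 / (real n + 1)"] M by auto
    then show ?thesis by (metis add_diff_cancel)
  qed
  then obtain xs where xs: "\<And>n. trig_freq (4 * M) (xs n)" "\<And>n x. \<bar>f n x - tev (xs n) (x + ?z)\<bar> < 1 / (real n + 1)"
    by metis
  define t where "t n x = tev (xs n) (x + ?z)" for n x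
  have ct: "continuous_on X (t n)" for n X unfolding t_def by (intro continuous_intros)
  have tB: "\<bar>t n x\<bar> \<le> Bd + 1" for n x
  proof -
    have "1 / (real n + 1) \<le> 1" by (simp add: field_simps)
    then show ?thesis using xs(2)[of n x] fB[of n x] unfolding t_def by linarith
  qed
  have flim: "(\<lambda>n. f n x) \<longlonglongrightarrow> G x" if x: "x \<in> ?Q" for x
  proof (cases "x \<in> U")
    case True
    have "(\<lambda>n. Z n x) \<longlonglongrightarrow> (\<Prod>b\<in>(Basis::'a set). 1)"
      unfolding Z_def
    proof (rule tendsto_prod)
      fix b :: 'a assume b: "b \<in> Basis"
      have "\<omega> * (x \<bullet> b + M) < \<omega> * (2 * M)" using True b \<omega>(1) by (intro mult_strict_left_mono) (auto simp: U_def)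
      moreover have "0 < \<omega> * (x \<bullet> b + M)" using True b \<omega>(1) by (auto simp: U_def intro!: mult_pos_pos)
      ultimately have "sin (\<omega> * (x \<bullet> b + M)) > 0" using \<omega>(2) by (intro sin_gt_zero) auto
      then show "(\<lambda>n. min 1 (real n * max 0 (sin (\<omega> * (x \<bullet> b + M))))) \<longlonglongrightarrow> 1"
        by (intro LIMSEQ_min_1) simp
    qed
    moreover have "(\<lambda>n. \<Sum>T\<in>\<T>. cut n T (tri x) * s T (tri x)) \<longlonglongrightarrow> (\<Sum>T\<in>\<T>. if x \<in> interior T then s T x else 0)"
    proof (rule tendsto_sum)
      fix T assume TT: "T \<in> \<T>"
      have ne: "- interior T \<noteq> {}"
      proof
        assume "- interior T = {}"
        then have "UNIV = T" using interior_subset by blast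
        then show False using compact_imp_bounded[OF T(1)[OF TT]] not_bounded_UNIV by metis
      qed
      have cl: "closed (- interior T)" by (simp add: closed_Compl)
      show "(\<lambda>n. cut n T (tri x) * s T (tri x)) \<longlonglongrightarrow> (if x \<in> interior T then s T x else 0)"
      proof (cases "x \<in> interior T")
        case i: True
        then have "infdist x (- interior T) > 0"
          using in_closed_iff_infdist_zero[OF cl ne, of x] infdist_nonneg[of x "- interior T"] by auto
        then have "(\<lambda>n. cut n T x) \<longlonglongrightarrow> 1" unfolding cut_def by (rule LIMSEQ_min_1)
        from tendsto_mult_right[OF this, of "s T x"] show ?thesis using i by (simp add: tri_id[OF True])
      next
        case False
        then have "infdist x (- interior T) = 0" by simp
        then show ?thesis using False by (simp add: tri_id[OF True] cut_def)
      qed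
    qed
    ultimately show ?thesis using tendsto_mult True unfolding f_def G_def by fastforce
  next
    case False
    then obtain b where b: "b \<in> Basis" "\<not> (- M < x \<bullet> b \<and> x \<bullet> b < M)" by (auto simp: U_def)
    moreover have "- M \<le> x \<bullet> b" "x \<bullet> b \<le> 3 * M" using x b by (auto simp: mem_shifted_cube)
    ultimately have "x \<bullet> b = - M \<or> (M \<le> x \<bullet> b \<and> x \<bullet> b \<le> 3 * M)" by auto
    \<comment> \<open>Within one period the sine is positive exactly for
      \<open>-M < x \<bullet> b < M\<close>, so the cut-off \<open>Z n\<close> vanishes on the
      mirror images.\<close>
    then have "sin (\<omega> * (x \<bullet> b + M)) \<le> 0"
    proof
      assume "M \<le> x \<bullet> b \<and> x \<bullet> b \<le> 3 * M"
      then have "\<omega> * (2 * M) \<le> \<omega> * (x \<bullet> b + M)" "\<omega> * (x \<bullet> b + M) \<le> \<omega> * (4 * M)"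
        using \<omega>(1) by (auto intro!: mult_left_mono simp del: mult_le_cancel_left_pos)
      then have "0 \<le> \<omega> * (x \<bullet> b + M) - pi" "\<omega> * (x \<bullet> b + M) - pi \<le> pi" using \<omega>(2,3) by (simp_all only: mult.left_commute[of \<omega> 2 M])
      then have "sin (\<omega> * (x \<bullet> b + M) - pi) \<ge> 0" by (rule sin_ge_zero)
      then show ?thesis by (simp add: sin_diff)
    qed simp
    then have "Z n x = 0" for n unfolding Z_def using b(1) by (intro prod_zero) (auto intro!: bexI[of _ b])
    then show ?thesis using False by (simp add: f_def G_def)
  qed
  have tlim: "(\<lambda>n. t n x) \<longlonglongrightarrow> G x" if x: "x \<in> ?Q" for x
  proof -
    have "(\<lambda>n. 1 / (real n + 1)) \<longlonglongrightarrow> 0" by real_asymp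
    then have "(\<lambda>n. f n x - t n x) \<longlonglongrightarrow> 0"
      by (rule Lim_null_comparison[rotated]) (use xs(2) in \<open>auto simp: t_def less_imp_le\<close>)
    from tendsto_diff[OF flim[OF x] this] show ?thesis by simp
  qed
  have TU: "x \<in> U" "x \<in> ?Q" if "T \<in> \<T>" "x \<in> T" for T x
  proof -
    have "\<bar>x \<bullet> b\<bar> < M" if "b \<in> Basis" for b
      using T(3)[OF \<open>T \<in> \<T>\<close> \<open>x \<in> T\<close>] Basis_le_norm[OF that, of x] by linarith
    then show "x \<in> U" "x \<in> ?Q" using M by (fastforce simp: U_def mem_shifted_cube abs_less_iff)+
  qed
  have Gs: "G x = s T x" if "T \<in> \<T>" "x \<in> interior T" for T x
  proof -
    have "(\<Sum>T'\<in>\<T>. if x \<in> interior T' then s T' x else 0) = (\<Sum>T'\<in>\<T>. if T' = T then s T' x else 0)"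
      using disj that by (intro sum.cong) auto
    moreover have "x \<in> U" using TU(1)[OF that(1)] that(2) interior_subset by blast
    ultimately show ?thesis using that fin by (simp add: G_def)
  qed
  have Gr: "\<bar>G x\<bar> powr r = (\<Sum>T\<in>\<T>. if x \<in> interior T then \<bar>h T x\<bar> powr p else 0)" for x
  proof (cases "\<exists>T\<in>\<T>. x \<in> interior T")
    case True
    then obtain T where TT: "T \<in> \<T>" "x \<in> interior T" by blast
    have "\<bar>G x\<bar> powr r = \<bar>h T x\<bar> powr ((p - 1) * r)"
      unfolding Gs[OF TT] s_def abs_spow powr_powr ..
    also have "(p - 1) * r = p" using p by (simp add: r)
    finally have 1: "\<bar>G x\<bar> powr r = \<bar>h T x\<bar> powr p" .
    have "(\<Sum>T'\<in>\<T>. if x \<in> interior T' then \<bar>h T' x\<bar> powr p else 0) = (\<Sum>T'\<in>\<T>. if T' = T then \<bar>h T' x\<bar> powr p else 0)"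
      using disj TT by (intro sum.cong) auto
    then show ?thesis using TT fin by (simp add: 1)
  next
    case False
    then have "(\<Sum>T\<in>\<T>. if x \<in> interior T then s T x else 0) = 0" "(\<Sum>T\<in>\<T>. if x \<in> interior T then \<bar>h T x\<bar> powr p else 0) = 0"
      by (auto intro!: sum.neutral)
    then show ?thesis by (simp add: G_def)
  qed
  \<comment> \<open>The limit is identified in the interiors of the elements, so the integrals are
    taken there; the frontiers are negligible.\<close>
  have neg: "negligible (sym_diff (interior T) T)" "negligible (sym_diff T (interior T))" if "T \<in> \<T>" for T
  proof -
    have "T - interior T \<subseteq> frontier T" using closure_subset by (auto simp: frontier_def)
    moreover have "interior T - T = {}" using interior_subset by blast
    ultimately show "negligible (sym_diff (interior T) T)" "negligible (sym_diff T (interior T))"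
      using T(2)[OF that] negligible_subset by auto
  qed
  have inti: "g integrable_on interior T" "integral (interior T) g = integral T g" if "T \<in> \<T>" "continuous_on T g" for g :: "'a \<Rightarrow> real" and T
  proof -
    have "g integrable_on T" by (rule integrable_on_compact(1)[OF T(1)[OF that(1)] that(2)])
    moreover have "negligible {x \<in> T - interior T. g x \<noteq> 0}" "negligible {x \<in> interior T - T. g x \<noteq> 0}"
      using neg[OF that(1)] negligible_subset by (smt (verit) Un_iff mem_Collect_eq subsetI)+
    ultimately show "g integrable_on interior T" "integral (interior T) g = integral T g"
      using integrable_spike_set[of g T "interior T"] integral_spike_set[of "interior T" T g] by auto
  qed
  have ch: "continuous_on X (h T)" for X T using h by (meson continuous_on_subset subset_UNIV)
  have chp: "continuous_on X (\<lambda>x. \<bar>h T x\<bar> powr p)" for X T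
    using p ch by (intro continuous_on_powr' continuous_intros) auto
  define A where "A = (\<Sum>T\<in>\<T>. integral T (\<lambda>x. \<bar>h T x\<bar> powr p))"
  have A0: "A \<ge> 0" unfolding A_def
    using integrable_on_compact(1)[OF T(1) chp] by (intro sum_nonneg integral_nonneg) auto
  have "(\<lambda>n. \<Sum>T\<in>\<T>. integral T (\<lambda>x. h T x * t n x)) \<longlonglongrightarrow> A"
    unfolding A_def
  proof (rule tendsto_sum)
    fix T assume TT: "T \<in> \<T>"
    have cab: "continuous_on T (\<lambda>x. \<bar>h T x\<bar> * (Bd + 1))" using ch by (intro continuous_intros)
    have "(\<lambda>n. integral (interior T) (\<lambda>x. h T x * t n x)) \<longlonglongrightarrow> integral (interior T) (\<lambda>x. \<bar>h T x\<bar> powr p)"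
    proof (rule dominated_convergence(2)[where h="\<lambda>x. \<bar>h T x\<bar> * (Bd + 1)"])
      show "(\<lambda>x. h T x * t n x) integrable_on interior T" for n
        by (rule inti(1)[OF TT]) (intro continuous_intros ch ct)
      show "(\<lambda>x. \<bar>h T x\<bar> * (Bd + 1)) integrable_on interior T" by (rule inti(1)[OF TT cab])
      show "norm (h T x * t n x) \<le> \<bar>h T x\<bar> * (Bd + 1)" for n x
        using tB by (simp add: abs_mult mult_left_mono)
      fix x assume x: "x \<in> interior T"
      then have "x \<in> ?Q" using TU(2)[OF TT] interior_subset by blast
      from tendsto_mult_left[OF tlim[OF this], of "h T x"]
      show "(\<lambda>n. h T x * t n x) \<longlonglongrightarrow> \<bar>h T x\<bar> powr p"
        unfolding Gs[OF TT x] s_def mult_spow .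
    qed
    then show "(\<lambda>n. integral T (\<lambda>x. h T x * t n x)) \<longlonglongrightarrow> integral T (\<lambda>x. \<bar>h T x\<bar> powr p)"
      unfolding inti(2)[OF TT chp] by (subst (asm) inti(2)[OF TT]) (auto intro!: continuous_intros ch ct)
  qed
  then have lim1: "(\<lambda>n. \<bar>\<Sum>T\<in>\<T>. integral T (\<lambda>x. h T x * t n x)\<bar>) \<longlonglongrightarrow> A"
    using tendsto_rabs A0 by fastforce
  have ctr: "continuous_on X (\<lambda>x. \<bar>t n x\<bar> powr r)" for n X
    using r1 ct by (intro continuous_on_powr' continuous_intros) auto
  have "(\<lambda>n. integral ?Q (\<lambda>x. \<bar>t n x\<bar> powr r)) \<longlonglongrightarrow> integral ?Q (\<lambda>x. \<bar>G x\<bar> powr r)"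
  proof (rule dominated_convergence(2)[where h="\<lambda>x. (Bd + 1) powr r"])
    show "(\<lambda>x. \<bar>t n x\<bar> powr r) integrable_on ?Q" for n by (rule integrable_on_compact(1)[OF compact_shifted_cube ctr])
    show "(\<lambda>x. (Bd + 1) powr r) integrable_on ?Q" by (rule integrable_on_compact(1)[OF compact_shifted_cube]) simp
    show "norm (\<bar>t n x\<bar> powr r) \<le> (Bd + 1) powr r" for n x
      using tB[of n x] r1 by (simp add: powr_mono2)
    fix x assume "x \<in> ?Q"
    from tendsto_rabs[OF tlim[OF this]] show "(\<lambda>n. \<bar>t n x\<bar> powr r) \<longlonglongrightarrow> \<bar>G x\<bar> powr r"
      using r1 by (intro tendsto_powr' tendsto_const) auto
  qed
  also have "integral ?Q (\<lambda>x. \<bar>G x\<bar> powr r) = A"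
  proof -
    have sub: "interior T \<subseteq> ?Q" if "T \<in> \<T>" for T using TU(2)[OF that] interior_subset by blast
    have "integral ?Q (\<lambda>x. \<bar>G x\<bar> powr r) = (\<Sum>T\<in>\<T>. integral ?Q (\<lambda>x. if x \<in> interior T then \<bar>h T x\<bar> powr p else 0))"
      unfolding Gr
      by (intro integral_sum fin) (use sub inti(1)[OF _ chp] in \<open>auto simp: integrable_restrict_Int Int_absorb1 Int_absorb2\<close>)
    also have "\<dots> = A" unfolding A_def
    proof (rule sum.cong[OF refl])
      fix T assume TT: "T \<in> \<T>"
      show "integral ?Q (\<lambda>x. if x \<in> interior T then \<bar>h T x\<bar> powr p else 0) = integral T (\<lambda>x. \<bar>h T x\<bar> powr p)"
        using Henstock_Kurzweil_Integration.integral_restrict_Int[of ?Q "interior T" "\<lambda>x. \<bar>h T x\<bar> powr p"] Int_absorb2[OF sub[OF TT]] inti(2)[OF TT chp] by simp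
    qed
    finally show ?thesis .
  qed
  finally have "(\<lambda>n. integral ?Q (\<lambda>x. \<bar>t n x\<bar> powr r)) \<longlonglongrightarrow> A" .
  then have "(\<lambda>n. (integral ?Q (\<lambda>x. \<bar>t n x\<bar> powr r)) powr (1 / r)) \<longlonglongrightarrow> A powr (1 / r)"
    using r1 integrable_on_compact(1)[OF compact_shifted_cube ctr]
    by (intro tendsto_powr' tendsto_const) (auto intro!: always_eventually integral_nonneg)
  from tendsto_mult_left[OF this, of K]
  have "A \<le> K * A powr (1 / r)"
    by (rule LIMSEQ_le[OF lim1]) (use bound[OF xs(1)] in \<open>auto simp: t_def\<close>)
  moreover have "A \<le> K powr p" if "A > 0" "A \<le> K * A powr (1 / r)"
  proof -
    have "1 / r = 1 - 1 / p" using p by (simp add: r field_simps)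
    then have "A powr (1 / p) * A powr (1 / r) = A" using that(1) by (simp add: powr_add[symmetric])
    then have "A powr (1 / p) * A powr (1 / r) \<le> K * A powr (1 / r)" using that(2) by simp
    then have "A powr (1 / p) \<le> K" using that(1) by simp
    then have "(A powr (1 / p)) powr p \<le> K powr p" using p by (intro powr_mono2) auto
    then show ?thesis using that(1) p by (simp add: powr_powr)
  qed
  ultimately show ?thesis using A0 unfolding A_def[symmetric] by (cases "A = 0") auto
qed

section \<open>The discrete Sobolev inequality\<close>

lemma Holder_sum:
  fixes a b :: "'i \<Rightarrow> real"
  assumes p: "p > 1" and r: "r = p / (p - 1)" and fin: "finite I"
    and nn: "\<And>i. i \<in> I \<Longrightarrow> a i \<ge> 0" "\<And>i. i \<in> I \<Longrightarrow> b i \<ge> 0"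
  shows "(\<Sum>i\<in>I. a i * b i) \<le> (\<Sum>i\<in>I. a i powr p) powr (1 / p) * (\<Sum>i\<in>I. b i powr r) powr (1 / r)"
proof -
  have r1: "r > 1" and pr: "1 / p + 1 / r = 1" using p by (simp_all add: r field_simps)
  define X where "X = (\<Sum>i\<in>I. a i powr p)"
  define Y where "Y = (\<Sum>i\<in>I. b i powr r)"
  have XY: "X \<ge> 0" "Y \<ge> 0" by (auto simp: X_def Y_def intro!: sum_nonneg)
  show ?thesis
  proof (cases "X = 0 \<or> Y = 0")
    case True
    have "a i * b i = 0" if "i \<in> I" for i
    proof -
      have "a i powr p = 0 \<or> b i powr r = 0"
        using True that fin by (auto simp: X_def Y_def sum_nonneg_eq_0_iff)
      then show ?thesis by auto
    qed
    then have "(\<Sum>i\<in>I. a i * b i) = 0" by (rule sum.neutral[OF ballI])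
    then show ?thesis by simp
  next
    case False
    then have pos: "X > 0" "Y > 0" using XY by auto
    define x where "x = X powr (1 / p)"
    define y where "y = Y powr (1 / r)"
    have xy: "x > 0" "y > 0" "x powr p = X" "y powr r = Y"
      using pos p r1 by (auto simp: x_def y_def powr_powr)
    have "(\<Sum>i\<in>I. (a i / x) * (b i / y)) \<le> (\<Sum>i\<in>I. (a i / x) powr p / p + (b i / y) powr r / r)"
      using nn xy by (intro sum_mono Youngs_inequality p r1 pr) auto
    also have "\<dots> = (\<Sum>i\<in>I. (a i powr p) / X) / p + (\<Sum>i\<in>I. (b i powr r) / Y) / r"
      using nn xy by (simp add: sum.distrib sum_divide_distrib powr_divide)
    also have "\<dots> = X / X / p + Y / Y / r"
      unfolding sum_divide_distrib[symmetric] X_def[symmetric] Y_def[symmetric] ..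
    also have "\<dots> = 1" using pos pr by simp
    finally have "(\<Sum>i\<in>I. a i * b i) / (x * y) \<le> 1" by (simp add: sum_divide_distrib)
    then show ?thesis using xy by (simp add: divide_le_eq X_def Y_def x_def y_def)
  qed
qed

lemma affine_eq_on_open:
  fixes a c :: "'a::euclidean_space"
  assumes "open U" "x0 \<in> U" and eq: "\<And>x. x \<in> U \<Longrightarrow> a \<bullet> x + b = c \<bullet> x + e"
  shows "a = c" "b = e"
proof -
  obtain \<epsilon> where \<epsilon>: "\<epsilon> > 0" "ball x0 \<epsilon> \<subseteq> U" using assms(1,2) open_contains_ball by blast
  define t where "t = \<epsilon> / (2 * (norm (a - c) + 1))"
  have t: "t > 0" using \<epsilon>(1) by (auto simp: t_def intro!: divide_pos_pos add_nonneg_pos)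
  have "t * norm (a - c) < \<epsilon>"
  proof -
    have "t * norm (a - c) = (\<epsilon> / 2) * (norm (a - c) / (norm (a - c) + 1))" by (simp add: t_def)
    also have "\<dots> \<le> (\<epsilon> / 2) * 1" using \<epsilon>(1) by (intro mult_left_mono) (auto simp: divide_le_eq add_nonneg_pos)
    finally show ?thesis using \<epsilon>(1) by simp
  qed
  then have "x0 + t *\<^sub>R (a - c) \<in> U" using \<epsilon>(2) t by (intro subsetD[OF \<epsilon>(2)]) (simp add: dist_norm)
  from eq[OF this] eq[OF assms(2)] have "t * ((a - c) \<bullet> (a - c)) = 0"
    by (simp add: inner_add_right inner_diff_left algebra_simps)
  then show "a = c" using t by simp
  then show "b = e" using eq[OF assms(2)] by simp
qed

text \<open>The definite description in \<open>elem_restrict\<close> is justified: two affine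
  functions that agree on the nonempty interior of an element are equal.\<close>

lemma elem_restrict_affine:
  assumes cm: "conforming_mesh \<Omega> \<T>" and phi: "\<phi> \<in> V_DCCR \<T>" and T: "T \<in> \<T>"
  shows "\<exists>c e. elem_restrict \<phi> T = (\<lambda>x. c \<bullet> x + e) \<and> (\<forall>x\<in>interior T. \<phi> x = c \<bullet> x + e)"
proof -
  obtain g where g: "g \<in> P1" "\<forall>x\<in>interior T. \<phi> x = g x" using phi T by (auto simp: V_DCCR_def)
  obtain c e where ce: "g = (\<lambda>x. c \<bullet> x + e)" using g(1) by (auto simp: P1_def)
  obtain x0 where x0: "x0 \<in> interior T" using mesh_interior_nonempty[OF cm T] by blast
  have "elem_restrict \<phi> T = g"
    unfolding elem_restrict_def
  proof (rule the_equality)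
    show "g \<in> P1 \<and> (\<forall>x\<in>interior T. \<phi> x = g x)" using g by blast
    fix f assume f: "f \<in> P1 \<and> (\<forall>x\<in>interior T. \<phi> x = f x)"
    then obtain a b where ab: "f = (\<lambda>x. a \<bullet> x + b)" by (auto simp: P1_def)
    have "a = c" "b = e" using affine_eq_on_open[OF open_interior x0, of a b c e] f g(2) ab ce by auto
    then show "f = g" by (simp add: ab ce)
  qed
  then show ?thesis using g(2) ce by auto
qed

lemma Lp_norm_const:
  assumes A: "A \<in> sets M" "emeasure M A < \<infinity>" and p: "p > 0"
  shows "Lp_norm M A p (\<lambda>x. a) powr p = measure M A * \<bar>a\<bar> powr p"
proof -
  have "(LINT x:A|M. \<bar>a\<bar> powr p) = measure M A * \<bar>a\<bar> powr p"
    using A by (simp add: set_lebesgue_integral_def less_top)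
  moreover have "measure M A * \<bar>a\<bar> powr p \<ge> 0" by simp
  ultimately show ?thesis using p by (simp add: Lp_norm_def powr_powr)
qed

lemma W1p_seminorm_affine:
  fixes c :: "'a::euclidean_space"
  assumes T: "compact T" and p: "p > 0"
  shows "W1p_seminorm p T (\<lambda>x. c \<bullet> x + e) powr p = measure lborel T * (\<Sum>b\<in>Basis. \<bar>c \<bullet> b\<bar> powr p)"
proof -
  have "frechet_derivative (\<lambda>x. c \<bullet> x + e) (at x) = (\<lambda>w. c \<bullet> w)" for x
    by (rule frechet_derivative_at[symmetric]) (auto intro!: derivative_eq_intros)
  then have "Lp_norm lebesgue T p (\<lambda>x. frechet_derivative (\<lambda>x. c \<bullet> x + e) (at x) b) powr p = measure lborel T * \<bar>c \<bullet> b\<bar> powr p" for b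
    using Lp_norm_const[of T lebesgue p "c \<bullet> b"] lmeasurable_compact[OF T] borel_compact[OF T] p
    by (simp add: fmeasurable_def)
  moreover have "(\<Sum>b\<in>Basis. measure lborel T * \<bar>c \<bullet> b\<bar> powr p) \<ge> 0" by (intro sum_nonneg) auto
  ultimately show ?thesis using p by (simp add: W1p_seminorm_def powr_powr sum_distrib_left)
qed

lemma norm_powr_le_sum:
  fixes c :: "'a::euclidean_space"
  assumes "p > 0"
  shows "norm c powr p \<le> real DIM('a) powr p * (\<Sum>b\<in>Basis. \<bar>c \<bullet> b\<bar> powr p)"
proof -
  have "norm c powr p \<le> (\<Sum>b\<in>Basis. \<bar>c \<bullet> b\<bar>) powr p"
    using assms by (intro powr_mono2 norm_le_l1) auto
  also have "\<dots> \<le> real DIM('a) powr p * (\<Sum>b\<in>Basis. \<bar>c \<bullet> b\<bar> powr p)"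
    using assms by (intro powr_sum_le) auto
  finally show ?thesis .
qed

section \<open>The estimate on one mesh, for a fixed piecewise affine function\<close>

context
  fixes \<Omega> :: "(real^'n) set" and \<T> Tp Tm and c :: "(real^'n) set \<Rightarrow> real^'n" and e :: "(real^'n) set \<Rightarrow> real"
    and p r K cF \<kappa> :: real
  assumes d2: "CARD('n) \<ge> 2" and op: "open \<Omega>" and cm: "conforming_mesh \<Omega> \<T>" and fo: "face_ordering \<T> Tp Tm"
    and diam: "\<And>T. T \<in> \<T> \<Longrightarrow> diameter T \<le> 1"
    and edges: "\<And>T. T \<in> \<T> \<Longrightarrow> edge_frame (vertices T) K"
    and K: "K \<ge> 0" and p: "p > 1" and r: "r = p / (p - 1)" and cF: "cF > 0"
    and face_vol: "\<And>S g \<beta> k. full_simplex (S :: (real^'n) set) \<Longrightarrow> barycentric S g \<beta> \<Longrightarrow> k \<in> S \<Longrightarrow>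
     face_volume_law cF S g k"
    and \<kappa>: "\<kappa> > 0" and vol: "\<And>A. A \<in> sets borel \<Longrightarrow> vol CARD('n) (A :: (real^'n) set) = \<kappa> * measure lborel A"
begin

lemma r_facts: "r > 1" "1 / r = 1 - 1 / p" "1 / r = (p - 1) / p" "(r - 1) / r = 1 / p"
  using p by (simp_all add: r field_simps)

lemma mesh_volume_pos: "T \<in> \<T> \<Longrightarrow> measure lborel T > 0"
proof -
  assume T: "T \<in> \<T>"
  obtain k where "k \<in> vertices T"
    using mesh_simplex(1)[OF cm T] unfolding full_simplex_def by (metis card.empty ex_in_conv nat.distinct(1))
  moreover obtain g \<beta> where "barycentric (vertices T) g \<beta>"
    using mesh_barycentric[OF cm T] by blast
  ultimately show ?thesis using face_vol mesh_simplex[OF cm T] by metis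
qed

definition first_element :: "(real^'n) set \<Rightarrow> (real^'n) set" where
  "first_element F = (if F \<in> interior_faces \<T> then Tp F else boundary_element \<T> F)"

text \<open>The jump is affine on the face, so its mean is its value at the centroid of the face.
  Both neighbours yield the same centroid; the one computed from \<open>first_element\<close> is
  taken.\<close>

definition jump_value :: "(real^'n) set \<Rightarrow> real" where
  "jump_value F = (let m = facet_centroid (vertices (first_element F)) (opposite (first_element F) F) in
     if F \<in> interior_faces \<T> then (c (Tp F) \<bullet> m + e (Tp F)) - (c (Tm F) \<bullet> m + e (Tm F))
     else c (first_element F) \<bullet> m + e (first_element F))"

abbreviation gradient_energy :: real where
  "gradient_energy \<equiv> \<Sum>T\<in>\<T>. measure lborel T * (\<Sum>b\<in>Basis. \<bar>c T \<bullet> b\<bar> powr p)"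

abbreviation jump_energy :: real where
  "jump_energy \<equiv> \<Sum>F\<in>faces \<Omega> \<T>. kappa p \<T> Tp Tm F * (vol (CARD('n) - 1) F * \<bar>jump_value F\<bar> powr p)"

definition dg_energy :: real where "dg_energy = gradient_energy + jump_energy"

lemma facet_facts:
  assumes T: "T \<in> \<T>" and F: "F facet_of T" and ba: "barycentric (vertices T) g \<beta>"
  shows "vol (CARD('n) - 1) F = cF * norm (g (opposite T F)) * measure lborel T"
    "vol (CARD('n) - 1) F > 0" "emeasure (hausdorff_measure (CARD('n) - 1)) F < \<infinity>" "F \<in> sets borel"
    "face_height T F = CARD('n) * \<kappa> * measure lborel T / vol (CARD('n) - 1) F" "face_height T F > 0"
proof -
  note o = opposite[OF cm T F]
  note fs = mesh_simplex[OF cm T]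
  show 1: "vol (CARD('n) - 1) F = cF * norm (g (opposite T F)) * measure lborel T"
    using face_vol[OF fs(1) ba o(1)] unfolding fs(2) o(2)[symmetric] by (simp add: vol_def)
  show 2: "vol (CARD('n) - 1) F > 0"
    unfolding 1 using cF bary_grad_nonzero[OF fs(1) ba o(1)] mesh_volume_pos[OF T] by simp
  show "emeasure (hausdorff_measure (CARD('n) - 1)) F < \<infinity>"
    using face_vol[OF fs(1) ba o(1)] unfolding o(2)[symmetric] by simp
  show "F \<in> sets borel"
    by (subst o(2)) (use fs(1) in \<open>auto simp: full_simplex_def intro!: borel_compact finite_imp_compact_convex_hull\<close>)
  show 3: "face_height T F = CARD('n) * \<kappa> * measure lborel T / vol (CARD('n) - 1) F"
    using vol[OF borel_compact[OF mesh_compact[OF cm T]]] by (simp add: face_height_def)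
  show "face_height T F > 0" unfolding 3 using 2 \<kappa> mesh_volume_pos[OF T] by simp
qed

lemma first_element:
  assumes "F \<in> faces \<Omega> \<T>"
  shows "first_element F \<in> \<T>" "F facet_of first_element F" "F \<notin> interior_faces \<T> \<Longrightarrow> first_element F = boundary_element \<T> F"
proof -
  obtain T where T: "T \<in> \<T>" "F facet_of T" using assms sum_facets(3)[OF cm op fo] by blast
  show "first_element F \<in> \<T>" "F facet_of first_element F"
    using fo mesh_facet_elements(2)[OF cm fo T] T by (auto simp: first_element_def face_ordering_def)
  show "F \<notin> interior_faces \<T> \<Longrightarrow> first_element F = boundary_element \<T> F" by (simp add: first_element_def)
qed

lemma interior_face:
  assumes "F \<in> interior_faces \<T>"
  shows "Tp F \<in> \<T>" "Tm F \<in> \<T>" "Tp F \<noteq> Tm F" "F facet_of Tp F" "F facet_of Tm F" "first_element F = Tp F"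
  using assms fo by (auto simp: face_ordering_def first_element_def)

lemma kappa_pos:
  assumes F: "F \<in> faces \<Omega> \<T>"
  shows "kappa p \<T> Tp Tm F > 0"
proof -
  have h: "face_height T F > 0" if "T \<in> \<T>" "F facet_of T" for T
    using facet_facts(6)[OF that] mesh_barycentric[OF cm that(1)] by blast
  show ?thesis
  proof (cases "F \<in> interior_faces \<T>")
    case True
    note i = interior_face[OF True]
    have "face_height (Tp F) F powr ((p - 1) / p) + face_height (Tm F) F powr ((p - 1) / p) > 0"
      using h[OF i(1,4)] h[OF i(2,5)] by (intro add_pos_pos) auto
    then show ?thesis using True by (simp add: kappa_def)
  next
    case False
    then show ?thesis using h[OF first_element(1,2)[OF F]] first_element(3)[OF F] by (simp add: kappa_def)
  qed
qed

lemma dg_energy_parts: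
  "gradient_energy \<le> dg_energy"
  "jump_energy \<le> dg_energy"
  "0 \<le> dg_energy"
proof -
  have 1: "gradient_energy \<ge> 0"
    by (intro sum_nonneg mult_nonneg_nonneg) auto
  have 2: "jump_energy \<ge> 0"
    using kappa_pos by (intro sum_nonneg mult_nonneg_nonneg) (auto simp: vol_def less_imp_le)
  show "gradient_energy \<le> dg_energy"
    "jump_energy \<le> dg_energy"
    "0 \<le> dg_energy"
    using 1 2 by (auto simp: dg_energy_def)
qed

lemma face_projection_jump:
  assumes phi: "\<And>T. T \<in> \<T> \<Longrightarrow> elem_restrict \<phi> T = (\<lambda>x. c T \<bullet> x + e T)" and F: "F \<in> faces \<Omega> \<T>"
  shows "face_projection F (jump \<T> Tp Tm \<phi> F) = (\<lambda>x. jump_value F)"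
proof -
  define T where "T = first_element F"
  note T = first_element(1,2)[OF F, folded T_def]
  define a where "a = (if F \<in> interior_faces \<T> then c (Tp F) - c (Tm F) else c T)"
  define b where "b = (if F \<in> interior_faces \<T> then e (Tp F) - e (Tm F) else e T)"
  obtain g \<beta> where ba: "barycentric (vertices T) g \<beta>"
    using mesh_barycentric[OF cm T(1)] by blast
  note o = opposite[OF cm T]
  have "jump \<T> Tp Tm \<phi> F = (\<lambda>x. a \<bullet> x + b)"
    using phi interior_face[of F] T first_element(3)[OF F]
    by (auto simp: jump_def fun_eq_iff a_def b_def T_def inner_diff_left)
  moreover have "face_integral F (\<lambda>x. a \<bullet> x + b) = vol (CARD('n) - 1) F * jump_value F"
  proof -
    have "face_integral F (\<lambda>x. a \<bullet> x + b) = vol (CARD('n) - 1) F * (a \<bullet> facet_centroid (vertices T) (opposite T F) + b)"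
      unfolding face_integral_def vol_def facet_centroid_def
      using simplex_face_centroid[OF d2 mesh_simplex(1)[OF cm T(1)] o(1), of a b] unfolding o(2)[symmetric] by simp
    also have "a \<bullet> facet_centroid (vertices T) (opposite T F) + b = jump_value F"
      by (simp add: jump_value_def a_def b_def T_def[symmetric] Let_def inner_diff_left)
    finally show ?thesis .
  qed
  ultimately show ?thesis using facet_facts(2)[OF T ba] by (simp add: face_projection_def)
qed

lemma Vh_norm_eq:
  assumes phi: "\<And>T. T \<in> \<T> \<Longrightarrow> elem_restrict \<phi> T = (\<lambda>x. c T \<bullet> x + e T)"
  shows "Vh_norm p \<Omega> \<T> Tp Tm \<phi> = dg_energy powr (1 / p)"
proof -
  have W: "W1p_seminorm p T (elem_restrict \<phi> T) powr p = measure lborel T * (\<Sum>b\<in>Basis. \<bar>c T \<bullet> b\<bar> powr p)" if "T \<in> \<T>" for T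
    unfolding phi[OF that] using p by (intro W1p_seminorm_affine mesh_compact[OF cm that]) auto
  have "(\<Sum>T\<in>\<T>. W1p_seminorm p T (elem_restrict \<phi> T) powr p) = gradient_energy"
    using W by (rule sum.cong[OF refl])
  moreover have "0 \<le> (\<Sum>T\<in>\<T>. W1p_seminorm p T (elem_restrict \<phi> T) powr p)" by (intro sum_nonneg) auto
  ultimately have 1: "broken_W1p_seminorm p \<T> \<phi> powr p = gradient_energy"
    using p by (simp add: broken_W1p_seminorm_def powr_powr)
  have L: "kappa p \<T> Tp Tm F * Lp_norm (hausdorff_measure (DIM(real^'n) - 1)) F p (face_projection F (jump \<T> Tp Tm \<phi> F)) powr p
    = kappa p \<T> Tp Tm F * (vol (CARD('n) - 1) F * \<bar>jump_value F\<bar> powr p)" if F: "F \<in> faces \<Omega> \<T>" for F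
  proof -
    obtain g \<beta> where ba: "barycentric (vertices (first_element F)) g \<beta>"
      using mesh_barycentric[OF cm first_element(1)[OF F]] by blast
    have eq: "face_projection F (jump \<T> Tp Tm \<phi> F) = (\<lambda>x. jump_value F)"
      by (rule face_projection_jump) (use phi F in auto)
    show ?thesis unfolding eq
      using Lp_norm_const[of F "hausdorff_measure (CARD('n) - 1)" p "jump_value F"] p
        facet_facts(3,4)[OF first_element(1,2)[OF F] ba] by (simp add: vol_def)
  qed
  have "(\<Sum>F\<in>faces \<Omega> \<T>. kappa p \<T> Tp Tm F * Lp_norm (hausdorff_measure (DIM(real^'n) - 1)) F p (face_projection F (jump \<T> Tp Tm \<phi> F)) powr p)
    = jump_energy"
    using L by (rule sum.cong[OF refl])
  moreover have "0 \<le> jump_energy"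
    using kappa_pos by (intro sum_nonneg mult_nonneg_nonneg) (auto simp: vol_def less_imp_le)
  ultimately have 2: "jump_seminorm p \<Omega> \<T> Tp Tm \<phi> powr p = jump_energy"
    using p by (simp add: jump_seminorm_def powr_powr)
  show ?thesis unfolding Vh_norm_def 1 2 dg_energy_def ..
qed

section \<open>Pairing a piecewise affine function with a divergence\<close>

lemma element_Jensen:
  assumes v: "C1 v Dv" and T: "T \<in> \<T>"
  shows "integral T (vsize v Dv) \<le> measure lborel T powr (1 / p) * vpow v Dv r T powr (1 / r)"
    "0 \<le> integral T (vsize v Dv)" "0 \<le> vpow v Dv r T"
proof -
  note cT = mesh_compact[OF cm T]
  have w: "vsize v Dv integrable_on T" by (rule integrable_on_compact(1)[OF cT vsize_continuous[OF v]])
  have wr: "(\<lambda>x. vsize v Dv x powr r) integrable_on T"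
    using vsize_continuous[OF v, of T] r_facts(1)
    by (intro integrable_on_compact(1)[OF cT] continuous_on_powr') (auto simp: vsize_nonneg)
  show W0: "0 \<le> integral T (vsize v Dv)" by (intro integral_nonneg w vsize_nonneg)
  show w0: "0 \<le> vpow v Dv r T" by (intro integral_nonneg wr) simp
  have "((\<lambda>_. 1::real) has_integral measure lborel T) T"
    using has_integral_measure_lborel[OF borel_compact[OF cT] emeasure_bounded_finite[OF compact_imp_bounded[OF cT]]] .
  from integral_powr_jensen[OF w wr vsize_nonneg this mesh_volume_pos[OF T] r_facts(1)]
  have "(integral T (vsize v Dv) powr r) powr (1 / r) \<le> (measure lborel T powr (r - 1) * vpow v Dv r T) powr (1 / r)"
    using r_facts(1) by (intro powr_mono2) auto
  also have "\<dots> = measure lborel T powr ((r - 1) / r) * vpow v Dv r T powr (1 / r)"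
    using w0 by (simp add: powr_mult powr_powr)
  finally show "integral T (vsize v Dv) \<le> measure lborel T powr (1 / p) * vpow v Dv r T powr (1 / r)"
    using W0 r_facts(1,4) by (simp add: powr_powr)
qed

lemma mesh_diam: "T \<in> \<T> \<Longrightarrow> x \<in> T \<Longrightarrow> y \<in> T \<Longrightarrow> norm (x - y) \<le> 1"
  using diameter_bounded_bound[OF compact_imp_bounded[OF mesh_compact[OF cm]], of T x y] diam[of T]
  by (simp add: dist_norm)

definition flux_const :: real where
  "flux_const = CARD('n) / cF * (CARD('n) * \<kappa>) powr (1 / r)"

lemma flux_const_pos: "flux_const > 0"
  using cF \<kappa> by (simp add: flux_const_def)

text \<open>The height carries \<open>|T| / |F|\<close> and \<open>norm (g k)\<close> carries
  \<open>|F| / |T|\<close>. Together with the \<open>|T| powr (1 / p)\<close> of Jensen's inequality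
  all powers of \<open>|T|\<close> cancel, and of \<open>|F|\<close> the power \<open>1 / p\<close>
  remains that the jump seminorm provides. This explains the exponent
  \<open>(p - 1) / p = 1 / r\<close> of the heights in \<open>kappa\<close>.\<close>

lemma facet_flux_bound:
  assumes v: "C1 v Dv" and T: "T \<in> \<T>" and F: "F facet_of T" and ba: "barycentric (vertices T) g \<beta>"
  shows "face_height T F powr (1 / r) * \<bar>flux T (opposite T F) (g (opposite T F)) v Dv\<bar>
    \<le> flux_const * vol (CARD('n) - 1) F powr (1 / p) * vpow v Dv r T powr (1 / r)"
proof -
  define k where "k = opposite T F"
  define vF where "vF = vol (CARD('n) - 1) F"
  define \<mu> where "\<mu> = measure lborel T"
  define \<omega> where "\<omega> = vpow v Dv r T powr (1 / r)"
  note ff = facet_facts[OF T F ba, folded vF_def \<mu>_def k_def]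
  have \<mu>: "\<mu> > 0" using mesh_volume_pos[OF T] by (simp add: \<mu>_def)
  have kT: "k \<in> T" using opposite(1)[OF cm T F] mesh_simplex(2)[OF cm T] hull_inc by (metis k_def)
  have d: "real CARD('n) > 0" by simp
  have "\<bar>flux T k (g k) v Dv\<bar> \<le> (norm (g k) * real DIM(real^'n)) * integral T (vsize v Dv)"
    using mesh_diam[OF T _ kT] by (intro flux_bound[OF mesh_compact[OF cm T] v])
  also have "\<dots> \<le> (norm (g k) * real DIM(real^'n)) * (\<mu> powr (1 / p) * \<omega>)"
    using element_Jensen(1)[OF v T] by (intro mult_left_mono) (auto simp: \<mu>_def \<omega>_def)
  also have "norm (g k) = vF / (cF * \<mu>)" using ff(1) cF \<mu> by (simp add: field_simps)
  finally have 1: "\<bar>flux T k (g k) v Dv\<bar> \<le> (vF / (cF * \<mu>) * CARD('n)) * (\<mu> powr (1 / p) * \<omega>)" by simp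
  have "face_height T F powr (1 / r) = (CARD('n) * \<kappa>) powr (1 / r) * \<mu> powr (1 / r) / vF powr (1 / r)"
    unfolding ff(5) using \<kappa> \<mu> ff(2) by (simp add: powr_divide powr_mult)
  moreover have "((CARD('n) * \<kappa>) powr (1 / r) * \<mu> powr (1 / r) / vF powr (1 / r)) * ((vF / (cF * \<mu>) * CARD('n)) * (\<mu> powr (1 / p) * \<omega>))
    = flux_const * vF powr (1 / p) * \<omega>"
  proof -
    have a: "x powr (1 / r) * x powr (1 / p) = x" if "x > 0" for x :: real
      using that r_facts(2) by (simp add: powr_add[symmetric])
    have "((CARD('n) * \<kappa>) powr (1 / r) * \<mu> powr (1 / r) / vF powr (1 / r)) * ((vF / (cF * \<mu>) * CARD('n)) * (\<mu> powr (1 / p) * \<omega>))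
      = flux_const * (vF / vF powr (1 / r)) * ((\<mu> powr (1 / r) * \<mu> powr (1 / p)) / \<mu>) * \<omega>"
      using cF by (simp add: flux_const_def field_simps)
    also have "vF / vF powr (1 / r) = vF powr (1 / p)"
      using a[OF ff(2)] ff(2) by (simp add: field_simps)
    finally show ?thesis using a[OF \<mu>] \<mu> by simp
  qed
  ultimately show ?thesis
    using mult_left_mono[OF 1, of "face_height T F powr (1 / r)"] unfolding k_def[symmetric] vF_def[symmetric] \<omega>_def[symmetric]
    by simp
qed

text \<open>The first summand accounts for the element residuals, the second for the faces:
  \<open>2 powr (1 / p)\<close> because a face is counted from at most two elements, and
  \<open>(real CARD('n) + 1) powr (1 / r)\<close> because an element has \<open>CARD('n) + 1\<close>
  facets.\<close>

definition pairing_const :: real where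
  "pairing_const = (1 + 2 * K * CARD('n)) * CARD('n) + flux_const * 2 powr (1 / p) * (real CARD('n) + 1) powr (1 / r)"

lemma pairing_const_pos: "pairing_const > 0"
proof -
  have "1 + 2 * K * CARD('n) > 0" using K by (simp add: add_pos_nonneg)
  then have "(1 + 2 * K * CARD('n)) * CARD('n) > 0" by simp
  moreover have "flux_const * 2 powr (1 / p) * (real CARD('n) + 1) powr (1 / r) > 0"
    using flux_const_pos by (intro mult_pos_pos) auto
  ultimately show ?thesis unfolding pairing_const_def by linarith
qed

abbreviation face_terms where
  "face_terms G v Dv T \<equiv> \<Sum>k\<in>vertices T. (c T \<bullet> facet_centroid (vertices T) k + e T) * flux T k (G T k) v Dv"

lemma mesh_element_sum_bound:
  assumes v: "C1 v Dv" and ba: "\<And>T. T \<in> \<T> \<Longrightarrow> barycentric (vertices T) (G T) (B T)"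
  shows "\<bar>(\<Sum>T\<in>\<T>. integral T (\<lambda>x. (c T \<bullet> x + e T) * divg Dv x)
      - face_terms G v Dv T)\<bar>
    \<le> (1 + 2 * K * CARD('n)) * CARD('n) * dg_energy powr (1 / p) * (\<Sum>T\<in>\<T>. vpow v Dv r T) powr (1 / r)"
proof -
  define w where "w T = vpow v Dv r T" for T
  have w0: "w T \<ge> 0" if "T \<in> \<T>" for T using element_Jensen(3)[OF v that] by (simp add: w_def)
  define \<mu> where "\<mu> T = measure lborel T" for T :: "(real^'n) set"
  define A where "A = 1 + 2 * K * CARD('n)"
  have A: "A \<ge> 0" using K by (simp add: A_def)
  have el: "\<bar>integral T (\<lambda>x. (c T \<bullet> x + e T) * divg Dv x)
      - face_terms G v Dv T\<bar>
    \<le> A * ((norm (c T) * \<mu> T powr (1 / p)) * w T powr (1 / r))" if T: "T \<in> \<T>" for T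
  proof -
    note fs = mesh_simplex[OF cm T]
    obtain a b \<xi> where ab: "\<And>i::'n. a i \<in> vertices T \<and> b i \<in> vertices T"
      "\<And>w. w = (\<Sum>i\<in>UNIV. (\<xi> i \<bullet> w) *\<^sub>R (b i - a i))" "\<And>i. norm (\<xi> i) * norm (b i - a i) \<le> K"
      using edges[OF T] by blast
    have "\<bar>integral (convex hull (vertices T)) (\<lambda>x. (c T \<bullet> x + e T) * divg Dv x)
      - (\<Sum>k\<in>vertices T. (c T \<bullet> facet_centroid (vertices T) k + e T) * flux (convex hull (vertices T)) k (G T k) v Dv)\<bar>
    \<le> (norm (c T) * (1 + 2 * K * card (UNIV :: 'n set))) * integral (convex hull (vertices T)) (vsize v Dv)"
      proof (rule element_residual[OF fs(1) ba[OF T] v])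
      show "norm (x - y) \<le> 1" if "x \<in> convex hull vertices T" "y \<in> convex hull vertices T" for x y
        using mesh_diam[OF T] that unfolding fs(2) by blast
      show "w = (\<Sum>i\<in>UNIV. (\<xi> i \<bullet> w) *\<^sub>R (b i - a i))" for w by (rule ab(2))
    qed (use ab in auto)
    then have "\<bar>integral T (\<lambda>x. (c T \<bullet> x + e T) * divg Dv x)
      - face_terms G v Dv T\<bar>
    \<le> (norm (c T) * A) * integral T (vsize v Dv)" unfolding fs(2) A_def .
    also have "\<dots> \<le> (norm (c T) * A) * (\<mu> T powr (1 / p) * w T powr (1 / r))"
      unfolding \<mu>_def w_def using A by (intro mult_left_mono element_Jensen(1)[OF v T]) auto
    finally show ?thesis by (simp add: mult_ac)
  qed
  have "\<bar>(\<Sum>T\<in>\<T>. integral T (\<lambda>x. (c T \<bullet> x + e T) * divg Dv x)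
      - face_terms G v Dv T)\<bar>
    \<le> (\<Sum>T\<in>\<T>. A * ((norm (c T) * \<mu> T powr (1 / p)) * w T powr (1 / r)))"
    by (rule order_trans[OF sum_abs sum_mono]) (rule el)
  also have "\<dots> = A * (\<Sum>T\<in>\<T>. (norm (c T) * \<mu> T powr (1 / p)) * w T powr (1 / r))" by (simp add: sum_distrib_left)
  also have "\<dots> \<le> A * ((\<Sum>T\<in>\<T>. (norm (c T) * \<mu> T powr (1 / p)) powr p) powr (1 / p) * (\<Sum>T\<in>\<T>. (w T powr (1 / r)) powr r) powr (1 / r))"
    by (intro mult_left_mono Holder_sum p r mesh_finite[OF cm] A) auto
  also have "(\<Sum>T\<in>\<T>. (w T powr (1 / r)) powr r) = (\<Sum>T\<in>\<T>. w T)"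
    using w0 r_facts(1) by (intro sum.cong) (auto simp: powr_powr)
  also have "A * ((\<Sum>T\<in>\<T>. (norm (c T) * \<mu> T powr (1 / p)) powr p) powr (1 / p) * (\<Sum>T\<in>\<T>. w T) powr (1 / r))
    \<le> A * ((CARD('n) * dg_energy powr (1 / p)) * (\<Sum>T\<in>\<T>. w T) powr (1 / r))"
  proof (intro mult_left_mono mult_right_mono A)
    have "(\<Sum>T\<in>\<T>. (norm (c T) * \<mu> T powr (1 / p)) powr p) \<le> real CARD('n) powr p * dg_energy"
    proof -
      have "(\<Sum>T\<in>\<T>. (norm (c T) * \<mu> T powr (1 / p)) powr p) \<le> (\<Sum>T\<in>\<T>. real CARD('n) powr p * (\<mu> T * (\<Sum>b\<in>Basis. \<bar>c T \<bullet> b\<bar> powr p)))"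
      proof (rule sum_mono)
        fix T
        have "(norm (c T) * \<mu> T powr (1 / p)) powr p = norm (c T) powr p * \<mu> T"
          using p by (simp add: powr_mult powr_powr \<mu>_def)
        also have "\<dots> \<le> (real DIM(real^'n) powr p * (\<Sum>b\<in>Basis. \<bar>c T \<bullet> b\<bar> powr p)) * \<mu> T"
          using p by (intro mult_right_mono norm_powr_le_sum) (auto simp: \<mu>_def)
        finally show "(norm (c T) * \<mu> T powr (1 / p)) powr p \<le> real CARD('n) powr p * (\<mu> T * (\<Sum>b\<in>Basis. \<bar>c T \<bullet> b\<bar> powr p))"
          by (simp add: mult_ac)
      qed
      also have "\<dots> = real CARD('n) powr p * (\<Sum>T\<in>\<T>. \<mu> T * (\<Sum>b\<in>Basis. \<bar>c T \<bullet> b\<bar> powr p))"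
        by (rule sum_distrib_left[symmetric])
      also have "\<dots> \<le> real CARD('n) powr p * dg_energy"
        using dg_energy_parts(1) by (intro mult_left_mono) (auto simp: \<mu>_def)
      finally show ?thesis .
    qed
    then have "(\<Sum>T\<in>\<T>. (norm (c T) * \<mu> T powr (1 / p)) powr p) powr (1 / p) \<le> (real CARD('n) powr p * dg_energy) powr (1 / p)"
      using p by (intro powr_mono2) (auto intro!: sum_nonneg)
    also have "\<dots> = CARD('n) * dg_energy powr (1 / p)" using p dg_energy_parts(3) by (simp add: powr_mult powr_powr)
    finally show "(\<Sum>T\<in>\<T>. (norm (c T) * \<mu> T powr (1 / p)) powr p) powr (1 / p) \<le> CARD('n) * dg_energy powr (1 / p)" .
  qed auto
  finally show ?thesis by (simp add: A_def w_def mult_ac)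
qed

abbreviation face_sum where
  "face_sum a F \<equiv> if F \<in> interior_faces \<T> then a (Tp F) F + a (Tm F) F else a (boundary_element \<T> F) F"

lemma mesh_face_sum_bound:
  assumes v: "C1 v Dv" and ba: "\<And>T. T \<in> \<T> \<Longrightarrow> barycentric (vertices T) (G T) (B T)"
  shows "\<bar>\<Sum>T\<in>\<T>. face_terms G v Dv T\<bar>
    \<le> flux_const * 2 powr (1 / p) * (real CARD('n) + 1) powr (1 / r) * dg_energy powr (1 / p)
      * (\<Sum>T\<in>\<T>. vpow v Dv r T) powr (1 / r)"
proof -
  define w where "w T = vpow v Dv r T" for T
  have w0: "w T \<ge> 0" if "T \<in> \<T>" for T using element_Jensen(3)[OF v that] by (simp add: w_def)
  define q where "q T F = flux T (opposite T F) (G T (opposite T F)) v Dv" for T F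
  define m where "m T F = facet_centroid (vertices T) (opposite T F)" for T F :: "(real^'n) set"
  define \<nu> where "\<nu> F = vol (CARD('n) - 1) F" for F :: "(real^'n) set"
  \<comment> \<open>\<open>j F\<close> is the \<open>p\<close>-th root of the contribution of
    \<open>F\<close> to the jump energy.\<close>
  define j where "j F = (kappa p \<T> Tp Tm F * (\<nu> F * \<bar>jump_value F\<bar> powr p)) powr (1 / p)" for F
  note sf = sum_facets[OF cm op fo]
  have j_eq: "j F = kappa p \<T> Tp Tm F powr (1 / p) * \<nu> F powr (1 / p) * \<bar>jump_value F\<bar>" for F
    using p by (simp add: j_def powr_mult powr_powr \<nu>_def vol_def kappa_def)
  have "(\<Sum>T\<in>\<T>. face_terms G v Dv T)
     = (\<Sum>T\<in>\<T>. \<Sum>F\<in>{F. F facet_of T}. (c T \<bullet> m T F + e T) * q T F)"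
    unfolding m_def q_def by (intro sum.cong refl sum_vertices_facets[OF cm])
  also have "\<dots> = (\<Sum>F\<in>faces \<Omega> \<T>. face_sum (\<lambda>T F. (c T \<bullet> m T F + e T) * q T F) F)"
    by (rule sf(1))
  finally have sum_eq: "(\<Sum>T\<in>\<T>. face_terms G v Dv T) = \<dots>" .
  have qb: "face_height T F powr (1 / r) * \<bar>q T F\<bar> \<le> flux_const * \<nu> F powr (1 / p) * w T powr (1 / r)" if "T \<in> \<T>" "F facet_of T" for T F
    using facet_flux_bound[OF v that ba[OF that(1)]] by (simp add: q_def \<nu>_def w_def)
  have face: "\<bar>face_sum (\<lambda>T F. (c T \<bullet> m T F + e T) * q T F) F\<bar>
    \<le> flux_const * (face_sum (\<lambda>T F. j F * w T powr (1 / r)) F)"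
    if F: "F \<in> faces \<Omega> \<T>" for F
  proof (cases "F \<in> interior_faces \<T>")
    case True
    note i = interior_face[OF True]
    have vF: "\<nu> F > 0" unfolding \<nu>_def by (rule facet_facts(2)[OF i(1,4) ba[OF i(1)]])
    have eqs: "m (Tm F) F = m (Tp F) F \<and> q (Tm F) F = - q (Tp F) F"
    proof (rule mesh_shared_facet[OF cm i(1-5)])
      fix R assume R: "vertices (Tp F) = insert (opposite (Tp F) F) R" "vertices (Tm F) = insert (opposite (Tm F) F) R"
        "opposite (Tp F) F \<notin> R" "opposite (Tm F) F \<notin> R" "F = convex hull R"
        and neg: "\<And>g \<beta>. barycentric (vertices (Tp F)) g \<beta> \<Longrightarrow> g (opposite (Tp F) F) \<bullet> opposite (Tm F) F + \<beta> (opposite (Tp F) F) < 0"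
      have "vertices (Tp F) - {opposite (Tp F) F} = R" "vertices (Tm F) - {opposite (Tm F) F} = R" using R(1-4) by auto
      then have "m (Tm F) F = m (Tp F) F" by (simp add: m_def facet_centroid_def)
      moreover have "q (Tm F) F = - q (Tp F) F"
      proof -
        have h: "convex hull (insert (opposite (Tp F) F) R) = Tp F" "convex hull (insert (opposite (Tm F) F) R) = Tm F"
          using mesh_simplex(2)[OF cm i(1)] mesh_simplex(2)[OF cm i(2)] unfolding R(1,2) .
        show ?thesis
          using flux_face_consistent[OF d2 _ _ R(3,4) ba[OF i(1), unfolded R(1)] ba[OF i(2), unfolded R(2)] neg[OF ba[OF i(1)]] v]
            mesh_simplex(1)[OF cm i(1), unfolded R(1)] mesh_simplex(1)[OF cm i(2), unfolded R(2)]
          unfolding h q_def by blast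
      qed
      ultimately show ?thesis by blast
    qed
    define a where "a = face_height (Tp F) F powr (1 / r)"
    define b where "b = face_height (Tm F) F powr (1 / r)"
    have ab: "a > 0" "b > 0" unfolding a_def b_def
      using facet_facts(6)[OF i(1,4) ba[OF i(1)]] facet_facts(6)[OF i(2,5) ba[OF i(2)]] by auto
    have "kappa p \<T> Tp Tm F = (a + b) powr (- p)" using True by (simp add: kappa_def a_def b_def r_facts(3))
    then have kp: "kappa p \<T> Tp Tm F powr (1 / p) = 1 / (a + b)"
    proof -
      have "- p * (1 / p) = - 1" using p by simp
      then have "kappa p \<T> Tp Tm F powr (1 / p) = (a + b) powr (- 1)"
        unfolding \<open>kappa p \<T> Tp Tm F = _\<close> powr_powr by simp
      then show ?thesis using ab by (simp add: powr_minus_divide)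
    qed
    \<comment> \<open>The flux bounds from the two sides are added with the weights \<open>a\<close>
      and \<open>b\<close>. The sum of heights in \<open>kappa\<close> matches this, since the
      \<open>p\<close>-th root of \<open>kappa\<close> is \<open>1 / (a + b)\<close>.\<close>
    have "(a + b) * \<bar>q (Tp F) F\<bar> \<le> flux_const * \<nu> F powr (1 / p) * (w (Tp F) powr (1 / r) + w (Tm F) powr (1 / r))"
      using qb[OF i(1,4)] qb[OF i(2,5)] eqs unfolding a_def b_def by (simp add: algebra_simps)
    then have "(\<bar>jump_value F\<bar> / (a + b)) * ((a + b) * \<bar>q (Tp F) F\<bar>) \<le> (\<bar>jump_value F\<bar> / (a + b)) * (flux_const * \<nu> F powr (1 / p) * (w (Tp F) powr (1 / r) + w (Tm F) powr (1 / r)))"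
      using ab by (intro mult_left_mono) auto
    moreover have "(\<bar>jump_value F\<bar> / (a + b)) * ((a + b) * \<bar>q (Tp F) F\<bar>) = \<bar>jump_value F\<bar> * \<bar>q (Tp F) F\<bar>"
      using ab by simp
    moreover have "(\<bar>jump_value F\<bar> / (a + b)) * (flux_const * \<nu> F powr (1 / p) * (w (Tp F) powr (1 / r) + w (Tm F) powr (1 / r)))
      = flux_const * (j F * w (Tp F) powr (1 / r) + j F * w (Tm F) powr (1 / r))"
      unfolding j_eq kp by (simp add: distrib_left mult_ac)
    ultimately have 1: "\<bar>jump_value F\<bar> * \<bar>q (Tp F) F\<bar> \<le> flux_const * (j F * w (Tp F) powr (1 / r) + j F * w (Tm F) powr (1 / r))"
      by simp
    have "(c (Tp F) \<bullet> m (Tp F) F + e (Tp F)) * q (Tp F) F + (c (Tm F) \<bullet> m (Tm F) F + e (Tm F)) * q (Tm F) F = jump_value F * q (Tp F) F"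
      using eqs True i(6) by (simp add: jump_value_def m_def[symmetric] Let_def algebra_simps)
    then show ?thesis using True 1 by (simp add: abs_mult)
  next
    case False
    note T = first_element[OF F, unfolded first_element(3)[OF F False]]
    define T where "T = boundary_element \<T> F"
    note T = first_element(1,2)[OF F, unfolded first_element(3)[OF F False], folded T_def]
    define a where "a = face_height T F powr (1 / r)"
    have hp: "face_height T F > 0" by (rule facet_facts(6)[OF T ba[OF T(1)]])
    then have a: "a > 0" by (simp add: a_def)
    have "kappa p \<T> Tp Tm F powr (1 / p) = 1 / a"
    proof -
      have "kappa p \<T> Tp Tm F powr (1 / p) = face_height T F powr ((1 - p) / p)"
        using False p by (simp add: kappa_def T_def powr_powr)
      also have "(1 - p) / p = - (1 / r)" unfolding r_facts(3) by (simp add: minus_divide_left)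
      finally show ?thesis using hp by (simp add: a_def powr_minus_divide)
    qed
    moreover have "(\<bar>jump_value F\<bar> / a) * (a * \<bar>q T F\<bar>) \<le> (\<bar>jump_value F\<bar> / a) * (flux_const * \<nu> F powr (1 / p) * w T powr (1 / r))"
      using qb[OF T] a by (intro mult_left_mono) (auto simp: a_def)
    moreover have "(\<bar>jump_value F\<bar> / a) * (a * \<bar>q T F\<bar>) = \<bar>jump_value F\<bar> * \<bar>q T F\<bar>" using a by simp
    ultimately have 1: "\<bar>jump_value F\<bar> * \<bar>q T F\<bar> \<le> flux_const * (j F * w T powr (1 / r))"
      unfolding j_eq by (simp add: mult_ac)
    have "c T \<bullet> m T F + e T = jump_value F"
      using False first_element(3)[OF F False] by (simp add: jump_value_def m_def[symmetric] T_def Let_def)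
    then show ?thesis using False 1 by (simp add: abs_mult T_def)
  qed
  have "\<bar>\<Sum>T\<in>\<T>. face_terms G v Dv T\<bar>
    \<le> (\<Sum>F\<in>faces \<Omega> \<T>. flux_const * (face_sum (\<lambda>T F. j F * w T powr (1 / r)) F))"
    unfolding sum_eq by (rule order_trans[OF sum_abs sum_mono]) (rule face)
  also have "\<dots> = flux_const * (\<Sum>T\<in>\<T>. \<Sum>F\<in>{F. F facet_of T}. j F * w T powr (1 / r))"
    unfolding sf(1)[of "\<lambda>T F. j F * w T powr (1 / r)"] by (rule sum_distrib_left[symmetric])
  also have "(\<Sum>T\<in>\<T>. \<Sum>F\<in>{F. F facet_of T}. j F * w T powr (1 / r)) = (\<Sum>(T, F)\<in>Sigma \<T> (\<lambda>T. {F. F facet_of T}). j F * w T powr (1 / r))"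
  proof (rule sum.Sigma[OF mesh_finite[OF cm]], intro ballI)
    fix T assume "T \<in> \<T>"
    then show "finite {F. F facet_of T}"
      by (intro finite_subset[OF _ sf(2)]) (use sf(3) in auto)
  qed
  also have "\<dots> \<le> 2 powr (1 / p) * (real CARD('n) + 1) powr (1 / r) * dg_energy powr (1 / p) * (\<Sum>T\<in>\<T>. w T) powr (1 / r)"
  proof -
    \<comment> \<open>Holder's inequality is applied over all pairs of an element and one of its
      facets.\<close>
    let ?I = "Sigma \<T> (\<lambda>T. {F. F facet_of T})"
    have finT: "finite {F. F facet_of T}" if "T \<in> \<T>" for T
      using that by (intro finite_subset[OF _ sf(2)]) (use sf(3) in auto)
    have finI: "finite ?I" using finT mesh_finite[OF cm] by (intro finite_SigmaI) auto
    have "(\<Sum>(T, F)\<in>?I. j F * w T powr (1 / r)) = (\<Sum>i\<in>?I. j (snd i) * w (fst i) powr (1 / r))"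
      by (simp add: split_def)
    also have "\<dots> \<le> (\<Sum>i\<in>?I. j (snd i) powr p) powr (1 / p) * (\<Sum>i\<in>?I. (w (fst i) powr (1 / r)) powr r) powr (1 / r)"
      by (rule Holder_sum[OF p r finI]) (auto simp: j_def)
    also have "(\<Sum>i\<in>?I. (w (fst i) powr (1 / r)) powr r) = (real CARD('n) + 1) * (\<Sum>T\<in>\<T>. w T)"
    proof -
      have "(\<Sum>i\<in>?I. (w (fst i) powr (1 / r)) powr r) = (\<Sum>(T, F)\<in>?I. w T)"
        using w0 r_facts(1) by (intro sum.cong) (auto simp: powr_powr)
      also have "\<dots> = (\<Sum>T\<in>\<T>. \<Sum>F\<in>{F. F facet_of T}. w T)"
        using finT by (intro sum.Sigma[symmetric] mesh_finite[OF cm]) auto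
      also have "\<dots> = (\<Sum>T\<in>\<T>. (real CARD('n) + 1) * w T)"
      proof (rule sum.cong[OF refl])
        fix T assume T: "T \<in> \<T>"
        have "(\<Sum>F\<in>{F. F facet_of T}. w T) = (\<Sum>k\<in>vertices T. w T)" by (rule sum_vertices_facets[OF cm T, symmetric])
        then show "(\<Sum>F\<in>{F. F facet_of T}. w T) = (real CARD('n) + 1) * w T"
          using mesh_simplex(1)[OF cm T] by (simp only: sum_constant full_simplex_def) (simp add: algebra_simps)
      qed
      finally show ?thesis by (simp add: sum_distrib_left)
    qed
    also have "(\<Sum>i\<in>?I. j (snd i) powr p) powr (1 / p) * ((real CARD('n) + 1) * (\<Sum>T\<in>\<T>. w T)) powr (1 / r)
      \<le> (2 * dg_energy) powr (1 / p) * ((real CARD('n) + 1) * (\<Sum>T\<in>\<T>. w T)) powr (1 / r)"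
    proof (rule mult_right_mono[OF powr_mono2])
      define Jp where "Jp F = kappa p \<T> Tp Tm F * (\<nu> F * \<bar>jump_value F\<bar> powr p)" for F
      have Jp0: "Jp F \<ge> 0" if "F \<in> faces \<Omega> \<T>" for F
        using kappa_pos[OF that] by (auto simp: Jp_def \<nu>_def vol_def intro!: mult_nonneg_nonneg)
      have "(\<Sum>i\<in>?I. j (snd i) powr p) = (\<Sum>(T, F)\<in>?I. j F powr p)" by (simp add: split_def)
      also have "\<dots> = (\<Sum>T\<in>\<T>. \<Sum>F\<in>{F. F facet_of T}. j F powr p)"
        using finT by (intro sum.Sigma[symmetric] mesh_finite[OF cm]) auto
      also have "\<dots> = (\<Sum>F\<in>faces \<Omega> \<T>. if F \<in> interior_faces \<T> then j F powr p + j F powr p else j F powr p)"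
        by (rule sf(1))
      also have "\<dots> \<le> (\<Sum>F\<in>faces \<Omega> \<T>. 2 * Jp F)"
      proof (rule sum_mono)
        fix F assume "F \<in> faces \<Omega> \<T>"
        then have "j F powr p = Jp F" using Jp0[of F] p by (simp add: j_def Jp_def[symmetric] powr_powr)
        then show "(if F \<in> interior_faces \<T> then j F powr p + j F powr p else j F powr p) \<le> 2 * Jp F"
          using Jp0[of F] \<open>F \<in> faces \<Omega> \<T>\<close> by simp
      qed
      also have "\<dots> = 2 * (\<Sum>F\<in>faces \<Omega> \<T>. Jp F)" by (rule sum_distrib_left[symmetric])
      also have "\<dots> \<le> 2 * dg_energy" using dg_energy_parts(2) by (simp add: Jp_def \<nu>_def)
      finally show "(\<Sum>i\<in>?I. j (snd i) powr p) \<le> 2 * dg_energy" .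
    qed (use p in \<open>auto intro!: sum_nonneg\<close>)
    also have "\<dots> = 2 powr (1 / p) * (real CARD('n) + 1) powr (1 / r) * dg_energy powr (1 / p) * (\<Sum>T\<in>\<T>. w T) powr (1 / r)"
      using dg_energy_parts(3) sum_nonneg[of \<T> w] w0 by (simp add: powr_mult)
    finally show ?thesis .
  qed
  finally show ?thesis using flux_const_pos by (simp add: w_def mult_ac mult_left_mono)
qed

lemma mesh_pairing_bound:
  assumes v: "C1 v Dv"
  shows "\<bar>\<Sum>T\<in>\<T>. integral T (\<lambda>x. (c T \<bullet> x + e T) * divg Dv x)\<bar>
    \<le> pairing_const * dg_energy powr (1 / p) * (\<Sum>T\<in>\<T>. vpow v Dv r T) powr (1 / r)"
proof -
  obtain G B where ba: "\<And>T. T \<in> \<T> \<Longrightarrow> barycentric (vertices T) (G T) (B T)"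
    using mesh_barycentric[OF cm] by metis
  show ?thesis
    using mesh_element_sum_bound[OF v ba] mesh_face_sum_bound[OF v ba]
    unfolding sum_subtractf pairing_const_def by (simp add: algebra_simps)
qed

section \<open>From the pairing bound to Lebesgue norms\<close>

lemma mesh_in_cube:
  assumes bd: "\<And>x. x \<in> closure \<Omega> \<Longrightarrow> norm x < M" and M: "M > 0"
  shows "\<Union>\<T> \<subseteq> shifted_cube M"
proof
  fix x assume "x \<in> \<Union>\<T>"
  then have "norm x < M" using bd cm by (auto simp: conforming_mesh_def)
  then have "\<bar>x \<bullet> b\<bar> < M" if "b \<in> Basis" for b using Basis_le_norm[OF that, of x] by linarith
  then show "x \<in> shifted_cube M" using M by (fastforce simp: mem_shifted_cube abs_less_iff)
qed

abbreviation elem_power :: "real \<Rightarrow> (real^'n) set \<Rightarrow> real" where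
  "elem_power s T \<equiv> integral T (\<lambda>x. \<bar>c T \<bullet> x + e T\<bar> powr s)"

lemma mesh_Lp_bound:
  assumes M: "M > 0" and bd: "\<And>x. x \<in> closure \<Omega> \<Longrightarrow> norm x < M" and C0: "C0 > 0"
    and inv: "\<And>xs :: (real^'n) trig. trig_freq (4 * M) xs \<Longrightarrow> divergence_solvable M r C0 xs"
  shows "(\<Sum>T\<in>\<T>. elem_power p T) \<le> (pairing_const * C0 powr (1 / r) * dg_energy powr (1 / p)) powr p"
proof (rule trig_duality[OF p r M mesh_finite[OF cm]])
  have un: "\<Union>\<T> = closure \<Omega>" using cm by (simp add: conforming_mesh_def)
  show "norm x < M" if "T \<in> \<T>" "x \<in> T" for T x using that un bd by blast
  show "interior T \<inter> interior T' = {}" if "T \<in> \<T>" "T' \<in> \<T>" "T \<noteq> T'" for T T'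
    using mesh_interior_disjoint[OF cm that] interior_subset by blast
  show "continuous_on UNIV (\<lambda>x. c T \<bullet> x + e T)" for T by (intro continuous_intros)
  show "0 \<le> pairing_const * C0 powr (1 / r) * dg_energy powr (1 / p)" using pairing_const_pos by simp
  fix xs :: "(real^'n) trig" assume "trig_freq (4 * M) xs"
  then obtain v Dv where v: "C1 v Dv" and dv: "\<And>x. divg Dv x = tev xs (x + M *\<^sub>R One)"
    and le: "vpow v Dv r (shifted_cube M) \<le> C0 * cube_tev M r xs"
    using inv by blast
  define I where "I = cube_tev M r xs"
  define w where "w T = vpow v Dv r T" for T
  have cw: "continuous_on A (\<lambda>x. vsize v Dv x powr r)" for A
    using vsize_continuous[OF v, of A] r_facts(1) by (intro continuous_on_powr') (auto simp: vsize_nonneg)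
  have "continuous_on A (\<lambda>x. \<bar>tev xs (x + M *\<^sub>R One)\<bar> powr r)" for A
    using r_facts(1) by (intro continuous_on_powr' continuous_intros) auto
  then have I0: "I \<ge> 0" unfolding I_def by (intro integral_nonneg integrable_on_compact(1)[OF compact_shifted_cube]) auto
  have hU: "((\<lambda>x. vsize v Dv x powr r) has_integral (\<Sum>T\<in>\<T>. w T)) (\<Union>\<T>)"
  proof (rule has_integral_Union[OF mesh_finite[OF cm]])
    show "((\<lambda>x. vsize v Dv x powr r) has_integral w T) T" if "T \<in> \<T>" for T
      unfolding w_def using integrable_on_compact(1)[OF mesh_compact[OF cm that] cw] by (rule integrable_integral)
    show "pairwise (\<lambda>S S'. negligible (S \<inter> S')) \<T>"
      using mesh_overlap_negligible[OF cm] by (auto simp: pairwise_def)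
  qed
  have "(\<Sum>T\<in>\<T>. w T) = vpow v Dv r (\<Union>\<T>)" using hU by (simp add: integral_unique)
  also have "\<dots> \<le> vpow v Dv r (shifted_cube M)"
  proof (rule integral_subset_le)
    show "\<Union>\<T> \<subseteq> shifted_cube M" by (rule mesh_in_cube[OF bd M])
    show "(\<lambda>x. vsize v Dv x powr r) integrable_on \<Union>\<T>" using hU by blast
  qed (auto intro!: integrable_on_compact(1)[OF compact_shifted_cube] cw)
  finally have wI: "(\<Sum>T\<in>\<T>. w T) \<le> C0 * I" using le by (simp add: I_def)
  have w0: "0 \<le> (\<Sum>T\<in>\<T>. w T)" unfolding w_def using element_Jensen(3)[OF v] by (intro sum_nonneg)
  have "\<bar>\<Sum>T\<in>\<T>. integral T (\<lambda>x. (c T \<bullet> x + e T) * tev xs (x + M *\<^sub>R One))\<bar>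
    \<le> pairing_const * dg_energy powr (1 / p) * (\<Sum>T\<in>\<T>. w T) powr (1 / r)"
    using mesh_pairing_bound[OF v] by (simp add: dv w_def)
  also have "\<dots> \<le> pairing_const * dg_energy powr (1 / p) * (C0 * I) powr (1 / r)"
    using pairing_const_pos r_facts(1) w0 wI by (intro mult_left_mono powr_mono2) auto
  also have "\<dots> = pairing_const * C0 powr (1 / r) * dg_energy powr (1 / p) * I powr (1 / r)"
    using C0 I0 by (simp add: powr_mult)
  finally show "\<bar>\<Sum>T\<in>\<T>. integral T (\<lambda>x. (c T \<bullet> x + e T) * tev xs (x + M *\<^sub>R One))\<bar>
    \<le> pairing_const * C0 powr (1 / r) * dg_energy powr (1 / p) *
      (cube_tev M r xs) powr (1 / r)"
    by (simp add: I_def)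
qed (use mesh_compact[OF cm] mesh_negligible_frontier[OF cm] in auto)

text \<open>The values of \<open>\<phi>\<close> on the mesh skeleton are arbitrary, but the skeleton
  is negligible. Every other point of \<open>\<Omega>\<close> is interior to an element, whose term
  bounds the integrand within a sum of nonnegative terms.\<close>

lemma mesh_lebesgue_integral_le:
  assumes phi: "\<And>T x. T \<in> \<T> \<Longrightarrow> x \<in> interior T \<Longrightarrow> \<phi> x = c T \<bullet> x + e T" and q: "q > 0"
  shows "(LINT x:\<Omega>|lebesgue. \<bar>\<phi> x\<bar> powr q) \<le> (\<Sum>T\<in>\<T>. elem_power q T)"
proof -
  have un: "\<Union>\<T> = closure \<Omega>" using cm by (simp add: conforming_mesh_def)
  define f where "f T x = indicator T x *\<^sub>R \<bar>c T \<bullet> x + e T\<bar> powr q" for T x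
  have cont: "continuous_on A (\<lambda>x. \<bar>c T \<bullet> x + e T\<bar> powr q)" for A T
    using q by (intro continuous_on_powr' continuous_intros) auto
  have si: "set_integrable lebesgue T (\<lambda>x. \<bar>c T \<bullet> x + e T\<bar> powr q)" if "T \<in> \<T>" for T
  proof -
    have i: "integrable lborel (\<lambda>x. indicat_real T x *\<^sub>R \<bar>c T \<bullet> x + e T\<bar> powr q)"
      using integrable_on_compact(2)[OF mesh_compact[OF cm that] cont[of T T]] unfolding set_integrable_def .
    show ?thesis
      unfolding set_integrable_def using integrable_completion[OF borel_measurable_integrable[OF i]] i by blast
  qed
  have fi: "integrable lebesgue (f T)" if "T \<in> \<T>" for T
    using si[OF that] unfolding f_def set_integrable_def .
  have "(LINT x:\<Omega>|lebesgue. \<bar>\<phi> x\<bar> powr q) \<le> (LINT x|lebesgue. (\<Sum>T\<in>\<T>. f T x))"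
    unfolding set_lebesgue_integral_def
  proof (rule integral_mono_AE')
    show "integrable lebesgue (\<lambda>x. \<Sum>T\<in>\<T>. f T x)" by (intro Bochner_Integration.integrable_sum fi)
    have "negligible (\<Union>T\<in>\<T>. frontier T)"
      using mesh_finite[OF cm] mesh_negligible_frontier[OF cm] by (intro negligible_Union) auto
    then have ae: "AE x in lebesgue. x \<notin> (\<Union>T\<in>\<T>. frontier T)"
      unfolding negligible_iff_null_sets by (rule AE_not_in)
    show "AE x in lebesgue. indicat_real \<Omega> x *\<^sub>R \<bar>\<phi> x\<bar> powr q \<le> (\<Sum>T\<in>\<T>. f T x)"
      using ae
    proof (eventually_elim)
      case (elim x)
      show ?case
      proof (cases "x \<in> \<Omega>")
        case True
        then obtain T where T: "T \<in> \<T>" "x \<in> T" using un closure_subset by blast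
        then have xi: "x \<in> interior T" using elim closure_subset[of T] by (auto simp: frontier_def)
        have "indicat_real \<Omega> x *\<^sub>R \<bar>\<phi> x\<bar> powr q = f T x" using phi[OF T(1) xi] True T by (simp add: f_def)
        also have "\<dots> \<le> (\<Sum>T\<in>\<T>. f T x)" using mesh_finite[OF cm] T by (intro member_le_sum) (auto simp: f_def)
        finally show ?thesis .
      qed (auto simp: f_def intro!: sum_nonneg)
    qed
  qed (auto simp: f_def intro!: sum_nonneg)
  also have "\<dots> = (\<Sum>T\<in>\<T>. LINT x|lebesgue. f T x)" by (intro Bochner_Integration.integral_sum fi)
  also have "\<dots> = (\<Sum>T\<in>\<T>. elem_power q T)"
    using set_lebesgue_integral_eq_integral(2)[OF si]
    by (intro sum.cong) (auto simp: f_def set_lebesgue_integral_def)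
  finally show ?thesis .
qed

text \<open>The exponent is lowered by a pointwise inequality with a threshold \<open>l\<close>:
  small values are bounded by \<open>l\<close>, large ones through the \<open>p\<close>-th power.
  With \<open>l\<close> just above the bound for the L^p norm both parts scale like
  \<open>l powr q\<close>.\<close>

lemma mesh_discrete_Sobolev:
  assumes M: "M > 0" and bd: "\<And>x. x \<in> closure \<Omega> \<Longrightarrow> norm x < M" and C0: "C0 > 0"
    and inv: "\<And>xs :: (real^'n) trig. trig_freq (4 * M) xs \<Longrightarrow> divergence_solvable M r C0 xs"
    and phi: "\<And>T. T \<in> \<T> \<Longrightarrow> elem_restrict \<phi> T = (\<lambda>x. c T \<bullet> x + e T)"
      "\<And>T x. T \<in> \<T> \<Longrightarrow> x \<in> interior T \<Longrightarrow> \<phi> x = c T \<bullet> x + e T"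
    and q: "q > 0" "q \<le> p"
  shows "Lp_norm lebesgue \<Omega> q \<phi> \<le> ((measure lborel (shifted_cube M :: (real^'n) set) + 1) powr (1 / q)
    * (((1 + 2 * K * CARD('n)) * CARD('n) + CARD('n) / cF * (CARD('n) * \<kappa>) powr (1 / r) * 2 powr (1 / p) * (real CARD('n) + 1) powr (1 / r))
      * C0 powr (1 / r))) * Vh_norm p \<Omega> \<T> Tp Tm \<phi>"
proof -
  define V where "V = measure lborel (shifted_cube M :: (real^'n) set)"
  define D where "D = pairing_const * C0 powr (1 / r)"
  define N where "N = dg_energy powr (1 / p)"
  have D: "D > 0" using pairing_const_pos C0 by (simp add: D_def)
  have V0: "V \<ge> 0" by (simp add: V_def)
  have N0: "N \<ge> 0" by (simp add: N_def)
  have NV: "Vh_norm p \<Omega> \<T> Tp Tm \<phi> = N" unfolding N_def by (rule Vh_norm_eq) (use phi in auto)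
  have un: "\<Union>\<T> = closure \<Omega>" using cm by (simp add: conforming_mesh_def)
  have hc: "continuous_on A (\<lambda>x. \<bar>c T \<bullet> x + e T\<bar> powr s)" if "s > 0" for A T s
    using that by (intro continuous_on_powr' continuous_intros) auto
  have one: "((\<lambda>_. 1::real) has_integral measure lborel A) A" if "compact A" for A :: "(real^'n) set"
    using has_integral_measure_lborel[OF borel_compact[OF that] emeasure_bounded_finite[OF compact_imp_bounded[OF that]]] .
  have sumV: "(\<Sum>T\<in>\<T>. measure lborel T) \<le> V"
  proof -
    have "((\<lambda>_. 1::real) has_integral (\<Sum>T\<in>\<T>. measure lborel T)) (\<Union>\<T>)"
      using one[OF mesh_compact[OF cm]] mesh_overlap_negligible[OF cm]
      by (intro has_integral_Union[OF mesh_finite[OF cm]]) (auto simp: pairwise_def)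
    then show ?thesis unfolding V_def
    proof (rule has_integral_subset_le[OF _ _ one[OF compact_shifted_cube], rotated])
      show "\<Union>\<T> \<subseteq> shifted_cube M" by (rule mesh_in_cube[OF bd M])
    qed auto
  qed
  have X: "(\<Sum>T\<in>\<T>. elem_power p T) \<le> (D * N) powr p"
    unfolding D_def N_def by (rule mesh_Lp_bound[OF M bd C0 inv])
  have main: "Lp_norm lebesgue \<Omega> q \<phi> \<le> (V + 1) powr (1 / q) * D * (N + \<epsilon>)" if \<epsilon>: "\<epsilon> > 0" for \<epsilon>
  proof -
    \<comment> \<open>\<open>\<epsilon>\<close> keeps the threshold positive when the energy
      vanishes, since the power \<open>l powr (q - p)\<close> occurs.\<close>
    define l where "l = D * (N + \<epsilon>)"
    have l: "l > 0" using D N0 \<epsilon> by (simp add: l_def add_nonneg_pos)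
    have pt: "\<bar>t\<bar> powr q \<le> l powr q + l powr (q - p) * \<bar>t\<bar> powr p" for t :: real
    proof (cases "\<bar>t\<bar> \<le> l")
      case True
      then have "\<bar>t\<bar> powr q \<le> l powr q" using q by (intro powr_mono2) auto
      then show ?thesis by (simp add: add_increasing2)
    next
      case False
      then have "\<bar>t\<bar> powr q = \<bar>t\<bar> powr (q - p) * \<bar>t\<bar> powr p" by (simp add: powr_add[symmetric])
      also have "\<dots> \<le> l powr (q - p) * \<bar>t\<bar> powr p"
        using False l q by (intro mult_right_mono powr_mono2') auto
      finally show ?thesis by (simp add: add_increasing)
    qed
    have "(LINT x:\<Omega>|lebesgue. \<bar>\<phi> x\<bar> powr q) \<le> (\<Sum>T\<in>\<T>. elem_power q T)"
      by (rule mesh_lebesgue_integral_le) (use phi(2) q in auto)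
    also have "\<dots> \<le> (\<Sum>T\<in>\<T>. l powr q * measure lborel T + l powr (q - p) * elem_power p T)"
    proof (rule sum_mono)
      fix T assume "T \<in> \<T>"
      then have cT: "compact T" by (rule mesh_compact[OF cm])
      have h1: "((\<lambda>x. l powr q * 1 + l powr (q - p) * \<bar>c T \<bullet> x + e T\<bar> powr p) has_integral
        l powr q * measure lborel T + l powr (q - p) * elem_power p T) T"
        using p by (intro has_integral_add has_integral_mult_right one cT integrable_integral integrable_on_compact(1)[OF cT] hc) auto
      have h2: "((\<lambda>x. \<bar>c T \<bullet> x + e T\<bar> powr q) has_integral elem_power q T) T"
        using q by (intro integrable_integral integrable_on_compact(1)[OF cT] hc) auto
      show "elem_power q T \<le> l powr q * measure lborel T + l powr (q - p) * elem_power p T"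
        by (rule has_integral_le[OF h2 h1]) (simp only: mult_1_right pt)
    qed
    also have "\<dots> = l powr q * (\<Sum>T\<in>\<T>. measure lborel T) + l powr (q - p) * (\<Sum>T\<in>\<T>. elem_power p T)"
      unfolding sum.distrib sum_distrib_left[symmetric] ..
    also have "\<dots> \<le> l powr q * V + l powr (q - p) * l powr p"
    proof (intro add_mono mult_left_mono sumV)
      have "(D * N) powr p \<le> l powr p" using D N0 \<epsilon> p unfolding l_def by (intro powr_mono2 mult_left_mono) auto
      with X show "(\<Sum>T\<in>\<T>. elem_power p T) \<le> l powr p" by linarith
    qed auto
    also have "\<dots> = (V + 1) * l powr q" by (simp add: powr_add[symmetric] algebra_simps)
    finally have "(LINT x:\<Omega>|lebesgue. \<bar>\<phi> x\<bar> powr q) powr (1 / q) \<le> ((V + 1) * l powr q) powr (1 / q)"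
    proof (rule powr_mono2[rotated 2])
      show "0 \<le> (LINT x:\<Omega>|lebesgue. \<bar>\<phi> x\<bar> powr q)"
        unfolding set_lebesgue_integral_def by (intro Bochner_Integration.integral_nonneg) auto
    qed (use q in auto)
    also have "\<dots> = (V + 1) powr (1 / q) * l" using V0 l q by (simp add: powr_mult powr_powr)
    finally show ?thesis by (simp add: Lp_norm_def l_def mult_ac)
  qed
  define Bc where "Bc = (V + 1) powr (1 / q) * D"
  have Bc: "Bc > 0" using D V0 by (simp add: Bc_def)
  have "Lp_norm lebesgue \<Omega> q \<phi> \<le> Bc * N"
  proof (rule field_le_epsilon)
    fix \<delta> :: real assume "\<delta> > 0"
    then show "Lp_norm lebesgue \<Omega> q \<phi> \<le> Bc * N + \<delta>"
      using main[of "\<delta> / Bc"] Bc by (simp add: Bc_def[symmetric] distrib_left)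
  qed
  then show ?thesis unfolding NV Bc_def V_def D_def pairing_const_def flux_const_def .
qed

end

section \<open>Choice of the constants\<close>

theorem theorem5p1:
  fixes \<Omega> :: "(real ^ 'n::finite) set" and p q \<gamma>0 :: real
  assumes "CARD('n) = 2 \<or> CARD('n) = 3"
    and "lipschitz_polyhedral_domain \<Omega>"
    and "\<gamma>0 > 0"
    and "p > 1" and "q > 1"
    and "1 - real CARD('n) / p \<ge> - (real CARD('n) / q)"
    and "q \<le> p"
  shows "\<exists>C>0. \<forall>\<T> Tp Tm P.
           conforming_mesh \<Omega> \<T> \<and> face_ordering \<T> Tp Tm \<and>
           (\<forall>T\<in>\<T>. vertex_labelling T (P T)) \<and>
           0 < mesh_size \<T> \<and> mesh_size \<T> \<le> 1 \<and> semi_regular \<gamma>0 \<T> P \<longrightarrow>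
           (\<forall>V\<in>{V_DCCR \<T>, V_CR \<T> Tp Tm, V_CR0 \<Omega> \<T> Tp Tm}. \<forall>\<phi>\<in>V.
              Lp_norm lebesgue \<Omega> q \<phi> \<le> C * Vh_norm p \<Omega> \<T> Tp Tm \<phi>)"
proof -
  have d2: "CARD('n) \<ge> 2" using assms(1) by auto
  have op: "open \<Omega>" and bo: "bounded \<Omega>" using assms(2) by (auto simp: lipschitz_polyhedral_domain_def)
  define r where "r = p / (p - 1)"
  have r1: "r > 1" using assms(4) by (simp add: r_def field_simps)
  obtain M0 where M0: "\<And>x. x \<in> closure \<Omega> \<Longrightarrow> norm x \<le> M0" using bounded_closure[OF bo] by (auto simp: bounded_iff)
  \<comment> \<open>The 1 makes the norm bound strict and \<open>M\<close> positive.\<close>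
  define M where "M = \<bar>M0\<bar> + 1"
  have M: "M > 0" and bd: "\<And>x. x \<in> closure \<Omega> \<Longrightarrow> norm x < M" using M0 by (fastforce simp: M_def)+
  obtain C0 where C0: "C0 > 0" and inv: "\<And>xs :: (real^'n) trig. trig_freq (4 * M) xs \<Longrightarrow>
     divergence_solvable M r C0 xs"
    using divergence_right_inverse_cube[OF r1 M, where 'a="real^'n"] by blast
  obtain cF where cF: "cF > 0" and face_vol: "\<And>S g \<beta> k. full_simplex (S :: (real^'n) set) \<Longrightarrow> barycentric S g \<beta> \<Longrightarrow> k \<in> S \<Longrightarrow>
     face_volume_law cF S g k"
    using simplex_face_volume[OF d2] by blast
  obtain \<kappa> where \<kappa>: "\<kappa> > 0" and full: "\<And>A. A \<in> sets borel \<Longrightarrow> emeasure (hausdorff_measure CARD('n)) A = ennreal \<kappa> * emeasure lborel (A :: (real^'n) set)"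
    using hausdorff_full_dim by blast
  have vol: "vol CARD('n) A = \<kappa> * measure lborel A" if "A \<in> sets borel" for A :: "(real^'n) set"
    using full[OF that] \<kappa> by (simp add: vol_def measure_def enn2real_mult)
  define K where "K = \<kappa> * \<gamma>0"
  have K: "K > 0" using \<kappa> assms(3) by (simp add: K_def)
  \<comment> \<open>\<open>A\<close> is the value of \<open>pairing_const\<close>; it involves only
    \<open>p\<close>, \<open>\<gamma>0\<close>, the dimension and the normalisation constants, and
    is fixed before any mesh is given.\<close>
  define A where "A = (1 + 2 * K * CARD('n)) * CARD('n) + CARD('n) / cF * (CARD('n) * \<kappa>) powr (1 / r) * 2 powr (1 / p) * (real CARD('n) + 1) powr (1 / r)"
  have A: "A > 0" unfolding A_def using K cF \<kappa> by (intro add_pos_nonneg mult_pos_pos) (auto intro!: add_pos_nonneg)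
  define C where "C = (measure lborel (shifted_cube M :: (real^'n) set) + 1) powr (1 / q) * (A * C0 powr (1 / r))"
  have C: "C > 0"
  proof -
    have "measure lborel (shifted_cube M :: (real^'n) set) + 1 > 0" by (simp add: add_nonneg_pos)
    then show ?thesis unfolding C_def using A C0 by (intro mult_pos_pos) auto
  qed
  show ?thesis
  proof (intro exI[of _ C] conjI C allI impI ballI)
    fix \<T> Tp Tm P V \<phi>
    assume H: "conforming_mesh \<Omega> \<T> \<and> face_ordering \<T> Tp Tm \<and> (\<forall>T\<in>\<T>. vertex_labelling T (P T)) \<and>
           0 < mesh_size \<T> \<and> mesh_size \<T> \<le> 1 \<and> semi_regular \<gamma>0 \<T> P"
      and V: "V \<in> {V_DCCR \<T>, V_CR \<T> Tp Tm, V_CR0 \<Omega> \<T> Tp Tm}" "\<phi> \<in> V"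
    have cm: "conforming_mesh \<Omega> \<T>" and fo: "face_ordering \<T> Tp Tm" using H by auto
    \<comment> \<open>The three spaces are nested, so each \<open>\<phi>\<close> is treated as an
      element of the largest one.\<close>
    have phi: "\<phi> \<in> V_DCCR \<T>" using V by (auto simp: V_CR_def V_CR0_def)
    have diam: "diameter T \<le> 1" if "T \<in> \<T>" for T
    proof -
      have "diameter T \<le> mesh_size \<T>" unfolding mesh_size_def using that mesh_finite[OF cm] by (intro Max_ge) auto
      then show ?thesis using H by linarith
    qed
    have edges: "edge_frame (vertices T) K" if T: "T \<in> \<T>" for T
    proof -
      note fs = mesh_simplex[OF cm T]
      \<comment> \<open>Semi-regularity is stated with a division by the diameter, so two distinct
        vertices are produced to see that the diameter is positive.\<close>
      have "card (vertices T) \<ge> 2" using fs(1) d2 by (simp add: full_simplex_def)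
      then obtain x y where xy: "x \<in> vertices T" "y \<in> vertices T" "x \<noteq> y"
        using card_le_Suc0_iff_eq[of "vertices T"] fs(1) unfolding full_simplex_def by fastforce
      have "dist x y \<le> diameter T"
        using diameter_bounded_bound[OF compact_imp_bounded[OF mesh_compact[OF cm T]]] xy hull_inc[of _ "vertices T" convex] fs(2) by simp
      then have dpos: "diameter T > 0" using xy(3) by (smt (verit) zero_less_dist_iff)
      have "H_param T (P T) / diameter T \<le> \<gamma>0" "vertex_labelling T (P T)" using H T by (auto simp: semi_regular_def)
      then show ?thesis
        using semi_regular_edges[OF assms(1) fs(1), unfolded fs(2), OF refl _ _ dpos vol \<kappa>] borel_compact[OF mesh_compact[OF cm T]]
        unfolding K_def by blast
    qed
    have "\<forall>T\<in>\<T>. \<exists>c e. elem_restrict \<phi> T = (\<lambda>x. c \<bullet> x + e) \<and> (\<forall>x\<in>interior T. \<phi> x = c \<bullet> x + e)"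
      using elem_restrict_affine[OF cm phi] by blast
    then obtain c e where ce: "\<And>T. T \<in> \<T> \<Longrightarrow> elem_restrict \<phi> T = (\<lambda>x. c T \<bullet> x + e T)"
      "\<And>T x. T \<in> \<T> \<Longrightarrow> x \<in> interior T \<Longrightarrow> \<phi> x = c T \<bullet> x + e T" by metis
    have q: "q > 0" using assms(5) by simp
    show "Lp_norm lebesgue \<Omega> q \<phi> \<le> C * Vh_norm p \<Omega> \<T> Tp Tm \<phi>"
      unfolding C_def A_def
      by (rule mesh_discrete_Sobolev[where c=c and e=e and \<T>=\<T> and Tp=Tp and Tm=Tm and \<Omega>=\<Omega> and K=K
            and cF=cF and \<kappa>=\<kappa> and p=p and r=r and M=M and \<phi>=\<phi> and q=q and ?C0.0=C0];
          fact d2 op cm fo diam edges less_imp_le[OF K] assms(4) r_def cF face_vol \<kappa> vol M bd C0 inv ce q assms(7))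
  qed
qed

end
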